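(* Let $E$ be a finite dimensional Hopf algebra over a field $k$, $A$ an $E$-module algebra and $B=A\ast E$. The cohomology $HH^\bullet(A,B)$ is braided commutative in $\mathrm{dg}YD^E_E$. For any invertible dual cocycle $J\in E^*\otimes E^*$, the cohomology $HH^\bullet(A,B_J)$ is braided commutative in $\mathrm{dg}D^J\mathrm{mod}$.
   Context: $k$ is a field, Sweedler notation. $B=A\ast E$ is the smash product, an algebra in the category $YD^E_E$ of right Yetter-Drinfeld modules via $b\cdot w=S(w_1)bw_2$ and coaction $aw\mapsto aw_1\otimes w_2$. $YD^E_E=D\mathrm{mod}$, $D$ the Drinfeld double, a quasitriangular Hopf algebra containing $E^{op}$ and $E^*$ as Hopf subalgebras, with $R=r_j\otimes r^j$ (sum suppressed), $\{r_j\}$ a basis of $E$ and $\{r^j\}$ the dual basis; $w\in E^{op}$ acts by $w\cdot m=m\cdot w$ and $\xi\in E^*$ by $\xi\cdot m=m_0\xi(m_1)$. For a quasitriangular Hopf algebra with $R$-matrix $r_j\otimes r^j$, a graded algebra $\Omega$ in its category of modules is braided commutative if $\omega\omega'=(-1)^{|\omega||\omega'|}(r^j\cdot\omega')(r_j\cdot\omega)$ for homogeneous $\omega,\omega'$. $HH^\bullet(A,B)$ is the usual Hochschild cohomology with the usual cup product, and is an algebra in $YD^E_E$ by transport along the restriction isomorphism $C^\bullet_{c,E}(B)\cong C^\bullet(A,B)$, where $C^n_{c,E}(B)$ is the space of right $E$-linear maps $B^{\otimes_En}\to B$ ($B^{\otimes_E 0}=E$) with $D$-action $(h\cdot f)(x)=h_1\cdot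 f(S(h_2)\cdot x)$, and restriction is along $A^{\otimes n}\to B^{\otimes_En}$. An invertible dual cocycle (twist) is an invertible $J=J_l\otimes J^l\in E^*\otimes E^*\subset D\otimes D$ (sum suppressed) with $(\Delta\otimes id)(J)(J\otimes1)=(id\otimes\Delta)(J)(1\otimes J)$ and $(\epsilon\otimes id)(J)=(id\otimes\epsilon)(J)=1$. For a (dg) algebra $\Omega$ in $D\mathrm{mod}$, $\Omega_J$ is $\Omega$ with product $\omega\cdot_J\omega'=(J_l\cdot\omega)(J^l\cdot\omega')$, an algebra in modules over $D^J$, the Hopf algebra $D$ with coproduct $J^{-1}\Delta(h)J$ and $R$-matrix $J_{21}^{-1}RJ$. $HH^\bullet(A,B_J)$ has the usual cup product and the $D^J$-module structure coming from the equality of rings $HH^\bullet(A,B_J)=HH^\bullet(A,B)_J$. *)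

theory Defs
  imports Complex_Main "HOL-Library.Function_Algebras" "HOL-Algebra.Coset" "HOL-Algebra.FiniteProduct"
begin

section \<open>Algebras over a field, tensor products with a based space\<close>

text \<open>
  A unital associative algebra carries its operations in a record; the zero algebra is allowed,
  and one vector space may carry several products (as \<open>B\<close> and \<open>B\<^sub>J\<close> below do).
\<close>

record ('k, 'v) kalg =
  scl :: "'k \<Rightarrow> 'v \<Rightarrow> 'v"  (infixr \<open>\<star>\<index>\<close> 75)
  mul :: "'v \<Rightarrow> 'v \<Rightarrow> 'v"  (infixl \<open>\<bullet>\<index>\<close> 70)
  unt :: "'v"  (\<open>\<u>\<index>\<close>)

definition k_algebra :: "('k::field, 'v::ab_group_add, 'z) kalg_scheme \<Rightarrow> bool" where
  "k_algebra A \<longleftrightarrow>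
     (\<forall>x. Vector_Spaces.linear (scl A) (scl A) (\<lambda>y. x \<bullet>\<^bsub>A\<^esub> y)) \<and>
     (\<forall>y. Vector_Spaces.linear (scl A) (scl A) (\<lambda>x. x \<bullet>\<^bsub>A\<^esub> y)) \<and>
     (\<forall>x y z. (x \<bullet>\<^bsub>A\<^esub> y) \<bullet>\<^bsub>A\<^esub> z = x \<bullet>\<^bsub>A\<^esub> (y \<bullet>\<^bsub>A\<^esub> z)) \<and>
     (\<forall>x. \<u>\<^bsub>A\<^esub> \<bullet>\<^bsub>A\<^esub> x = x \<and> x \<bullet>\<^bsub>A\<^esub> \<u>\<^bsub>A\<^esub> = x)"

record ('k, 'v, 'i) based_alg = "('k, 'v) kalg" +
  bas :: "'i \<Rightarrow> 'v"

definition is_based :: "('k::field, 'v::ab_group_add, 'i::finite, 'z) based_alg_scheme \<Rightarrow> bool" where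
  "is_based H \<longleftrightarrow> vector_space (scl H) \<and> inj (bas H) \<and>
     \<not> module.dependent (scl H) (range (bas H)) \<and> module.span (scl H) (range (bas H)) = UNIV"

definition coord :: "('k::field, 'v::ab_group_add, 'i, 'z) based_alg_scheme \<Rightarrow> 'v \<Rightarrow> 'i \<Rightarrow> 'k" where
  "coord H h i = module.representation (scl H) (range (bas H)) h (bas H i)"

text \<open>
  For a space \<open>H\<close> with finite basis \<open>(b\<^sub>i)\<close>, the tensor product \<open>V \<otimes> H\<close> is the function space
  \<^typ>\<open>'i \<Rightarrow> 'v\<close>: the function \<open>t\<close> stands for \<open>\<Sum>\<^sub>i t(i) \<otimes> b\<^sub>i\<close>. \<open>tens V H v h\<close> is the pure tensor
  \<open>v \<otimes> h\<close>, and \<open>tsum H \<phi> t\<close> is the value at \<open>t\<close> of the linear map induced by a bilinear \<open>\<phi>\<close>; so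
  \<open>tsum H (\<lambda>x y. \<phi> x y) t\<close> is Sweedler-style notation, \<open>\<Sum> \<phi>(x, y)\<close> for \<open>t = \<Sum> x \<otimes> y\<close>.
  The lemmas \<open>tsum_tens\<close> and \<open>tensor_expansion\<close> give the universal property.
\<close>

definition tens :: "('k, 'v, 'y) kalg_scheme \<Rightarrow> ('k::field, 'h::ab_group_add, 'i, 'z) based_alg_scheme
    \<Rightarrow> 'v \<Rightarrow> 'h \<Rightarrow> 'i \<Rightarrow> 'v" where
  "tens V H v h = (\<lambda>i. coord H h i \<star>\<^bsub>V\<^esub> v)"

definition tsum :: "('k, 'h, 'i::finite, 'z) based_alg_scheme
    \<Rightarrow> ('v \<Rightarrow> 'h \<Rightarrow> 'w::comm_monoid_add) \<Rightarrow> ('i \<Rightarrow> 'v) \<Rightarrow> 'w" where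
  "tsum H \<phi> t = (\<Sum>i\<in>UNIV. \<phi> (t i) (bas H i))"

definition fscl :: "('k \<Rightarrow> 'v \<Rightarrow> 'v) \<Rightarrow> 'k \<Rightarrow> ('i \<Rightarrow> 'v) \<Rightarrow> 'i \<Rightarrow> 'v" where
  "fscl s c t = (\<lambda>i. s c (t i))"

definition talg :: "('k, 'v, 'y) kalg_scheme
    \<Rightarrow> ('k::field, 'h::ab_group_add, 'i::finite, 'z) based_alg_scheme \<Rightarrow> ('k, 'i \<Rightarrow> 'v::ab_group_add) kalg" where
  "talg V H = \<lparr>scl = fscl (scl V),
     mul = (\<lambda>s t. tsum H (\<lambda>v h. tsum H (\<lambda>v' h'. tens V H (v \<bullet>\<^bsub>V\<^esub> v') (h \<bullet>\<^bsub>H\<^esub> h')) t) s),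
     unt = tens V H \<u>\<^bsub>V\<^esub> \<u>\<^bsub>H\<^esub>\<rparr>"

lemma coord_expansion:
  assumes "is_based (H :: ('k::field, 'v::ab_group_add, 'i::finite, 'z) based_alg_scheme)"
  shows "(\<Sum>i\<in>UNIV. coord H h i \<star>\<^bsub>H\<^esub> bas H i) = h"
proof -
  interpret vector_space "scl H" using assms by (simp add: is_based_def)
  have ind: "independent (range (bas H))" and sp: "span (range (bas H)) = UNIV" and inj: "inj (bas H)"
    using assms by (auto simp: is_based_def)
  have "(\<Sum>b\<in>range (bas H). scl H (representation (range (bas H)) h b) b) = h"
    by (rule sum_representation_eq[OF ind]) (auto simp: sp)
  then show ?thesis by (simp add: coord_def sum.reindex[OF inj])
qed

lemma coord_bas:
  assumes "is_based (H :: ('k::field, 'v::ab_group_add, 'i::finite, 'z) based_alg_scheme)"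
  shows "coord H (bas H j) i = (if i = j then 1 else 0)"
proof -
  interpret vector_space "scl H" using assms by (simp add: is_based_def)
  have ind: "independent (range (bas H))" and inj: "inj (bas H)"
    using assms by (auto simp: is_based_def)
  show ?thesis using representation_basis[OF ind, of "bas H j"] inj
    by (auto simp: coord_def inj_def)
qed

lemma tsum_tens:
  assumes "is_based (H :: ('k::field, 'h::ab_group_add, 'i::finite, 'z) based_alg_scheme)"
    and l: "\<And>h. Vector_Spaces.linear (scl V) sW (\<lambda>v. \<phi> v h)"
    and r: "\<And>v. Vector_Spaces.linear (scl H) sW (\<phi> v)"
  shows "tsum H \<phi> (tens V H v h) = \<phi> v h"
proof -
  have "\<phi> v h = \<phi> v (\<Sum>i\<in>UNIV. coord H h i \<star>\<^bsub>H\<^esub> bas H i)"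
    by (simp add: coord_expansion[OF assms(1)])
  also have "\<dots> = (\<Sum>i\<in>UNIV. sW (coord H h i) (\<phi> v (bas H i)))"
  proof -
    interpret Vector_Spaces.linear "scl H" sW "\<phi> v" by (rule r)
    show ?thesis by (simp add: sum scale)
  qed
  also have "\<dots> = tsum H \<phi> (tens V H v h)"
    unfolding tsum_def tens_def
  proof (rule sum.cong)
    fix i
    interpret Vector_Spaces.linear "scl V" sW "\<lambda>v. \<phi> v (bas H i)" by (rule l)
    show "sW (coord H h i) (\<phi> v (bas H i)) = \<phi> (coord H h i \<star>\<^bsub>V\<^esub> v) (bas H i)" by (simp add: scale)
  qed simp
  finally show ?thesis by simp
qed

lemma tensor_expansion:
  fixes V :: "('k::field, 'v::ab_group_add, 'y) kalg_scheme"
  assumes "is_based (H :: ('k, 'h::ab_group_add, 'i::finite, 'z) based_alg_scheme)" "vector_space (scl V)"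
  shows "tsum H (tens V H) t = t"
proof
  fix j
  interpret vector_space "scl V" by fact
  have "tsum H (tens V H) t j = (\<Sum>i\<in>UNIV. tens V H (t i) (bas H i) j)"
    unfolding tsum_def by (induction rule: finite_induct[OF finite]) auto
  also have "\<dots> = (\<Sum>i\<in>UNIV. if j = i then t i else 0)"
    by (rule sum.cong) (auto simp: tens_def coord_bas[OF assms(1)])
  finally show "tsum H (tens V H) t j = t j" by simp
qed


section \<open>Hopf algebras, duals, Drinfeld doubles, twists\<close>

record ('k, 'v, 'i) bialg = "('k, 'v, 'i) based_alg" +
  cop :: "'v \<Rightarrow> 'i \<Rightarrow> 'v"
  cou :: "'v \<Rightarrow> 'k"

record ('k, 'v, 'i) hopf = "('k, 'v, 'i) bialg" +
  anti :: "'v \<Rightarrow> 'v"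

text \<open>On \<open>H \<otimes> H\<close>, the maps \<open>\<Delta> \<otimes> id\<close> and \<open>id \<otimes> \<Delta>\<close> into \<open>(H \<otimes> H) \<otimes> H\<close>.\<close>

definition cop_l :: "('k::field, 'v::ab_group_add, 'i::finite, 'z) bialg_scheme \<Rightarrow> ('i \<Rightarrow> 'v) \<Rightarrow> 'i \<Rightarrow> 'i \<Rightarrow> 'v" where
  "cop_l H = tsum H (\<lambda>x y. tens (talg H H) H (cop H x) y)"

definition cop_r :: "('k::field, 'v::ab_group_add, 'i::finite, 'z) bialg_scheme \<Rightarrow> ('i \<Rightarrow> 'v) \<Rightarrow> 'i \<Rightarrow> 'i \<Rightarrow> 'v" where
  "cop_r H = tsum H (\<lambda>x y. tsum H (\<lambda>y1 y2. tens (talg H H) H (tens H H x y1) y2) (cop H y))"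

text \<open>
  Finite dimensionality is expressed by the finite basis that is part of the record; its choice is arbitrary.
\<close>

definition hopf_algebra :: "('k::field, 'v::ab_group_add, 'i::finite, 'z) hopf_scheme \<Rightarrow> bool" where
  "hopf_algebra H \<longleftrightarrow> k_algebra H \<and> is_based H \<and>
     Vector_Spaces.linear (scl H) (fscl (scl H)) (cop H) \<and>
     Vector_Spaces.linear (scl H) (*) (cou H) \<and>
     Vector_Spaces.linear (scl H) (scl H) (anti H) \<and>
     (\<forall>h. cop_l H (cop H h) = cop_r H (cop H h)) \<and>
     (\<forall>h. tsum H (\<lambda>h1 h2. cou H h1 \<star>\<^bsub>H\<^esub> h2) (cop H h) = h) \<and>
     (\<forall>h. tsum H (\<lambda>h1 h2. cou H h2 \<star>\<^bsub>H\<^esub> h1) (cop H h) = h) \<and>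
     (\<forall>x y. cop H (x \<bullet>\<^bsub>H\<^esub> y) = cop H x \<bullet>\<^bsub>talg H H\<^esub> cop H y) \<and> cop H \<u>\<^bsub>H\<^esub> = \<u>\<^bsub>talg H H\<^esub> \<and>
     (\<forall>x y. cou H (x \<bullet>\<^bsub>H\<^esub> y) = cou H x * cou H y) \<and> cou H \<u>\<^bsub>H\<^esub> = 1 \<and>
     (\<forall>h. tsum H (\<lambda>h1 h2. anti H h1 \<bullet>\<^bsub>H\<^esub> h2) (cop H h) = cou H h \<star>\<^bsub>H\<^esub> \<u>\<^bsub>H\<^esub>) \<and>
     (\<forall>h. tsum H (\<lambda>h1 h2. h1 \<bullet>\<^bsub>H\<^esub> anti H h2) (cop H h) = cou H h \<star>\<^bsub>H\<^esub> \<u>\<^bsub>H\<^esub>)"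

text \<open>
  A linear functional is recorded by its values on the basis, so \<open>E\<^sup>*\<close> is \<^typ>\<open>'i \<Rightarrow> 'k\<close>; \<open>ev\<close> and
  \<open>to_dual\<close> pass between the two descriptions. \<open>dual E\<close> has the convolution product and
  \<open>\<Delta>(\<xi>)(v, w) = \<xi>(v w)\<close>.
\<close>

definition ev :: "('k::field, 'e::ab_group_add, 'i::finite, 'z) based_alg_scheme \<Rightarrow> ('i \<Rightarrow> 'k) \<Rightarrow> 'e \<Rightarrow> 'k" where
  "ev E \<xi> w = (\<Sum>i\<in>UNIV. \<xi> i * coord E w i)"

definition to_dual :: "('k::field, 'e::ab_group_add, 'i::finite, 'z) based_alg_scheme \<Rightarrow> ('e \<Rightarrow> 'k) \<Rightarrow> 'i \<Rightarrow> 'k" where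
  "to_dual E \<phi> = (\<lambda>i. \<phi> (bas E i))"

definition dual :: "('k::field, 'e::ab_group_add, 'i::finite, 'z) hopf_scheme \<Rightarrow> ('k, 'i \<Rightarrow> 'k, 'i) hopf" where
  "dual E = \<lparr>scl = fscl (*),
     mul = (\<lambda>\<xi> \<eta>. to_dual E (\<lambda>w. tsum E (\<lambda>w1 w2. ev E \<xi> w1 * ev E \<eta> w2) (cop E w))),
     unt = to_dual E (cou E),
     bas = (\<lambda>i j. if j = i then 1 else 0),
     cop = (\<lambda>\<xi> j. to_dual E (\<lambda>v. ev E \<xi> (v \<bullet>\<^bsub>E\<^esub> bas E j))),
     cou = (\<lambda>\<xi>. ev E \<xi> \<u>\<^bsub>E\<^esub>),
     anti = (\<lambda>\<xi>. to_dual E (\<lambda>w. ev E \<xi> (anti E w)))\<rparr>"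

text \<open>
  The Drinfeld double is \<open>E\<^sup>o\<^sup>p \<otimes> E\<^sup>*\<close> as a coalgebra; \<open>dpure E w \<xi>\<close> is the product \<open>w \<xi>\<close> in \<open>D\<close>, which
  acts on a Yetter-Drinfeld module by \<open>m \<mapsto> w \<cdot> (\<xi> \<cdot> m)\<close>. The compatibility
  \<open>\<rho>(m \<cdot> v) = m\<^sub>0 \<cdot> v\<^sub>2 \<otimes> S(v\<^sub>1) m\<^sub>1 v\<^sub>3\<close> of a right-right Yetter-Drinfeld module is the relation
  \<open>\<xi> v = v\<^sub>2 \<xi>(S(v\<^sub>1) - v\<^sub>3)\<close>, whence \<open>(w \<xi>)(v \<eta>) = (v\<^sub>2 w) (\<xi>(S(v\<^sub>1) - v\<^sub>3) \<eta>)\<close>, where \<open>v\<^sub>2 w\<close> is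
  formed in \<open>E\<close>. The antipode of \<open>E\<^sup>o\<^sup>p\<close> is \<open>S\<^sup>-\<^sup>1\<close> (\<open>S\<close> is bijective as \<open>E\<close> is finite dimensional).
\<close>

definition dpure :: "('k::field, 'e::ab_group_add, 'i::finite, 'z) hopf_scheme \<Rightarrow> 'e \<Rightarrow> ('i \<Rightarrow> 'k) \<Rightarrow> 'i \<Rightarrow> 'e" where
  "dpure E = tens E (dual E)"

definition double_alg :: "('k::field, 'e::ab_group_add, 'i::finite, 'z) hopf_scheme \<Rightarrow> ('k, 'i \<Rightarrow> 'e, 'i \<times> 'i) based_alg" where
  "double_alg E = \<lparr>scl = fscl (scl E),
     mul = (\<lambda>d d'. tsum (dual E) (\<lambda>w \<xi>. tsum (dual E) (\<lambda>v \<eta>.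
        tsum E (\<lambda>u v3. tsum E (\<lambda>v1 v2.
            dpure E (v2 \<bullet>\<^bsub>E\<^esub> w) (to_dual E (\<lambda>x. ev E \<xi> (anti E v1 \<bullet>\<^bsub>E\<^esub> x \<bullet>\<^bsub>E\<^esub> v3)) \<bullet>\<^bsub>dual E\<^esub> \<eta>))
          (cop E u)) (cop E v)) d') d),
     unt = dpure E \<u>\<^bsub>E\<^esub> \<u>\<^bsub>dual E\<^esub>,
     bas = (\<lambda>(j, i). dpure E (bas E j) (bas (dual E) i))\<rparr>"

definition double :: "('k::field, 'e::ab_group_add, 'i::finite, 'z) hopf_scheme \<Rightarrow> ('k, 'i \<Rightarrow> 'e, 'i \<times> 'i) hopf" where
  "double E = (let D = double_alg E in
     \<lparr>scl = scl D, mul = mul D, unt = unt D, bas = bas D,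
      cop = tsum (dual E) (\<lambda>w \<xi>. tsum E (\<lambda>w1 w2. tsum (dual E) (\<lambda>\<xi>1 \<xi>2.
              tens D D (dpure E w1 \<xi>1) (dpure E w2 \<xi>2)) (cop (dual E) \<xi>)) (cop E w)),
      cou = tsum (dual E) (\<lambda>w \<xi>. cou E w * cou (dual E) \<xi>),
      anti = tsum (dual E) (\<lambda>w \<xi>. dpure E \<u>\<^bsub>E\<^esub> (anti (dual E) \<xi>) \<bullet>\<^bsub>D\<^esub> dpure E (the_inv (anti E) w) \<u>\<^bsub>dual E\<^esub>)\<rparr>)"

definition double_R :: "('k::field, 'e::ab_group_add, 'i::finite, 'z) hopf_scheme \<Rightarrow> 'i \<times> 'i \<Rightarrow> 'i \<Rightarrow> 'e" where
  "double_R E = (\<Sum>j\<in>UNIV. tens (double E) (double E)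
     (dpure E (bas E j) \<u>\<^bsub>dual E\<^esub>) (dpure E \<u>\<^bsub>E\<^esub> (bas (dual E) j)))"

definition dual2_to_double2 :: "('k::field, 'e::ab_group_add, 'i::finite, 'z) hopf_scheme
    \<Rightarrow> ('i \<Rightarrow> 'i \<Rightarrow> 'k) \<Rightarrow> 'i \<times> 'i \<Rightarrow> 'i \<Rightarrow> 'e" where
  "dual2_to_double2 E = tsum (dual E) (\<lambda>\<xi> \<eta>. tens (double E) (double E) (dpure E \<u>\<^bsub>E\<^esub> \<xi>) (dpure E \<u>\<^bsub>E\<^esub> \<eta>))"

definition is_inverse :: "('k, 'v, 'z) kalg_scheme \<Rightarrow> 'v \<Rightarrow> 'v \<Rightarrow> bool" where
  "is_inverse A x y \<longleftrightarrow> x \<bullet>\<^bsub>A\<^esub> y = \<u>\<^bsub>A\<^esub> \<and> y \<bullet>\<^bsub>A\<^esub> x = \<u>\<^bsub>A\<^esub>"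

definition inverse_in :: "('k, 'v, 'z) kalg_scheme \<Rightarrow> 'v \<Rightarrow> 'v" where
  "inverse_in A x = (THE y. is_inverse A x y)"

definition invertible_twist :: "('k::field, 'v::ab_group_add, 'i::finite, 'z) bialg_scheme \<Rightarrow> ('i \<Rightarrow> 'v) \<Rightarrow> bool" where
  "invertible_twist H J \<longleftrightarrow> (\<exists>K. is_inverse (talg H H) J K) \<and>
     cop_l H J \<bullet>\<^bsub>talg (talg H H) H\<^esub> tens (talg H H) H J \<u>\<^bsub>H\<^esub> =
     cop_r H J \<bullet>\<^bsub>talg (talg H H) H\<^esub> tsum H (\<lambda>x y. tens (talg H H) H (tens H H \<u>\<^bsub>H\<^esub> x) y) J \<and>
     tsum H (\<lambda>x y. cou H x \<star>\<^bsub>H\<^esub> y) J = \<u>\<^bsub>H\<^esub> \<and> tsum H (\<lambda>x y. cou H y \<star>\<^bsub>H\<^esub> x) J = \<u>\<^bsub>H\<^esub>"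

definition flip :: "('k::field, 'v::ab_group_add, 'i::finite, 'z) based_alg_scheme \<Rightarrow> ('i \<Rightarrow> 'v) \<Rightarrow> 'i \<Rightarrow> 'v" where
  "flip H = tsum H (\<lambda>x y. tens H H y x)"

text \<open>\<open>H\<^sup>J\<close> as a bialgebra; its antipode, which is then determined, plays no role for its modules.\<close>

definition twist_bialg :: "('k::field, 'v::ab_group_add, 'i::finite, 'z) bialg_scheme \<Rightarrow> ('i \<Rightarrow> 'v) \<Rightarrow> ('k, 'v, 'i) bialg" where
  "twist_bialg H J = \<lparr>scl = scl H, mul = mul H, unt = unt H, bas = bas H,
     cop = (\<lambda>h. inverse_in (talg H H) J \<bullet>\<^bsub>talg H H\<^esub> cop H h \<bullet>\<^bsub>talg H H\<^esub> J), cou = cou H\<rparr>"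

definition twist_R :: "('k::field, 'v::ab_group_add, 'i::finite, 'z) bialg_scheme \<Rightarrow> ('i \<Rightarrow> 'v) \<Rightarrow> ('i \<Rightarrow> 'v) \<Rightarrow> 'i \<Rightarrow> 'v" where
  "twist_R H J R = inverse_in (talg H H) (flip H J) \<bullet>\<^bsub>talg H H\<^esub> R \<bullet>\<^bsub>talg H H\<^esub> J"


section \<open>The smash product as an algebra in Yetter-Drinfeld modules\<close>

definition module_algebra :: "('k::field, 'e::ab_group_add, 'i::finite, 'z) bialg_scheme
    \<Rightarrow> ('k, 'a::ab_group_add, 'y) kalg_scheme \<Rightarrow> ('e \<Rightarrow> 'a \<Rightarrow> 'a) \<Rightarrow> bool" where
  "module_algebra E A act \<longleftrightarrow> k_algebra A \<and>
     (\<forall>w. Vector_Spaces.linear (scl A) (scl A) (act w)) \<and>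
     (\<forall>a. Vector_Spaces.linear (scl E) (scl A) (\<lambda>w. act w a)) \<and>
     (\<forall>w v a. act (w \<bullet>\<^bsub>E\<^esub> v) a = act w (act v a)) \<and> (\<forall>a. act \<u>\<^bsub>E\<^esub> a = a) \<and>
     (\<forall>w a b. act w (a \<bullet>\<^bsub>A\<^esub> b) = tsum E (\<lambda>w1 w2. act w1 a \<bullet>\<^bsub>A\<^esub> act w2 b) (cop E w)) \<and>
     (\<forall>w. act w \<u>\<^bsub>A\<^esub> = cou E w \<star>\<^bsub>A\<^esub> \<u>\<^bsub>A\<^esub>)"

definition smash :: "('k::field, 'e::ab_group_add, 'i::finite, 'z) bialg_scheme
    \<Rightarrow> ('k, 'a::ab_group_add, 'y) kalg_scheme \<Rightarrow> ('e \<Rightarrow> 'a \<Rightarrow> 'a) \<Rightarrow> ('k, 'i \<Rightarrow> 'a) kalg" where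
  "smash E A act = \<lparr>scl = fscl (scl A),
     mul = (\<lambda>s t. tsum E (\<lambda>a w. tsum E (\<lambda>b v.
        tsum E (\<lambda>w1 w2. tens A E (a \<bullet>\<^bsub>A\<^esub> act w1 b) (w2 \<bullet>\<^bsub>E\<^esub> v)) (cop E w)) t) s),
     unt = tens A E \<u>\<^bsub>A\<^esub> \<u>\<^bsub>E\<^esub>\<rparr>"

text \<open>
  The action of the double on a right-right Yetter-Drinfeld module \<open>M\<close> with action \<open>ract\<close> and
  coaction \<open>coact\<close> into \<open>M \<otimes> E\<close>: \<open>w \<cdot> m = m \<cdot> w\<close> and \<open>\<xi> \<cdot> m = m\<^sub>0 \<xi>(m\<^sub>1)\<close>.
\<close>

definition yd_act :: "('k::field, 'e::ab_group_add, 'i::finite, 'z) hopf_scheme \<Rightarrow> ('k \<Rightarrow> 'm \<Rightarrow> 'm)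
    \<Rightarrow> ('m \<Rightarrow> 'e \<Rightarrow> 'm) \<Rightarrow> ('m \<Rightarrow> 'i \<Rightarrow> 'm) \<Rightarrow> ('i \<Rightarrow> 'e) \<Rightarrow> 'm \<Rightarrow> 'm::ab_group_add" where
  "yd_act E s ract coact d m =
     tsum (dual E) (\<lambda>w \<xi>. ract (tsum E (\<lambda>m0 m1. s (ev E \<xi> m1) m0) (coact m)) w) d"

definition dact_E :: "('k::field, 'e::ab_group_add, 'i::finite, 'z) hopf_scheme \<Rightarrow> ('i \<Rightarrow> 'e) \<Rightarrow> 'e \<Rightarrow> 'e" where
  "dact_E E = yd_act E (scl E)
     (\<lambda>v w. tsum E (\<lambda>w1 w2. anti E w1 \<bullet>\<^bsub>E\<^esub> v \<bullet>\<^bsub>E\<^esub> w2) (cop E w)) (cop E)"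

definition dact_B :: "('k::field, 'e::ab_group_add, 'i::finite, 'z) hopf_scheme
    \<Rightarrow> ('k, 'a::ab_group_add, 'y) kalg_scheme \<Rightarrow> ('e \<Rightarrow> 'a \<Rightarrow> 'a) \<Rightarrow> ('i \<Rightarrow> 'e) \<Rightarrow> ('i \<Rightarrow> 'a) \<Rightarrow> 'i \<Rightarrow> 'a" where
  "dact_B E A act = (let B = smash E A act; \<iota> = tens A E \<u>\<^bsub>A\<^esub> in yd_act E (scl B)
     (\<lambda>b w. tsum E (\<lambda>w1 w2. \<iota> (anti E w1) \<bullet>\<^bsub>B\<^esub> b \<bullet>\<^bsub>B\<^esub> \<iota> w2) (cop E w))
     (tsum E (\<lambda>a w. tsum E (\<lambda>w1 w2. tens B E (tens A E a w1) w2) (cop E w))))"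

text \<open>\<open>\<Omega>\<^sub>J\<close> for an ungraded algebra \<open>\<Omega>\<close> in \<open>H\<close>-modules with action \<open>act\<close>.\<close>

definition twist_alg :: "('k, 'h, 'i::finite, 'z) based_alg_scheme \<Rightarrow> ('i \<Rightarrow> 'h) \<Rightarrow> ('h \<Rightarrow> 'b \<Rightarrow> 'b)
    \<Rightarrow> ('k, 'b::ab_group_add) kalg \<Rightarrow> ('k, 'b) kalg" where
  "twist_alg H J act B = B\<lparr>mul := (\<lambda>b b'. tsum H (\<lambda>x y. act x b \<bullet>\<^bsub>B\<^esub> act y b') J)\<rparr>"


section \<open>Graded algebras in module categories, braided commutativity\<close>

text \<open>
  \<open>gr \<Omega> n\<close> is the additive group of degree \<open>n\<close> elements, in the multiplicative notation of
  HOL-Algebra, so that \<^const>\<open>finprod\<close> is a sum of vectors. The algebras here carry the zero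
  differential.
\<close>

record ('k, 'h, 'c) gr_alg =
  gr :: "nat \<Rightarrow> 'c monoid"
  gscl :: "nat \<Rightarrow> 'k \<Rightarrow> 'c \<Rightarrow> 'c"
  gmul :: "nat \<Rightarrow> nat \<Rightarrow> 'c \<Rightarrow> 'c \<Rightarrow> 'c"
  gunt :: "'c"
  gact :: "nat \<Rightarrow> 'h \<Rightarrow> 'c \<Rightarrow> 'c"

definition gr_space :: "('k::field, 'h, 'c) gr_alg \<Rightarrow> bool" where
  "gr_space \<Omega> \<longleftrightarrow> (\<forall>n. comm_group (gr \<Omega> n) \<and>
     (\<forall>c. gscl \<Omega> n c \<in> hom (gr \<Omega> n) (gr \<Omega> n)) \<and>
     (\<forall>x\<in>carrier (gr \<Omega> n). gscl \<Omega> n 1 x = x \<and>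
        (\<forall>c d. gscl \<Omega> n (c * d) x = gscl \<Omega> n c (gscl \<Omega> n d x) \<and>
               gscl \<Omega> n (c + d) x = gscl \<Omega> n c x \<otimes>\<^bsub>gr \<Omega> n\<^esub> gscl \<Omega> n d x)))"

definition gr_linear :: "('k, 'h, 'c) gr_alg \<Rightarrow> nat \<Rightarrow> nat \<Rightarrow> ('c \<Rightarrow> 'c) \<Rightarrow> bool" where
  "gr_linear \<Omega> m n f \<longleftrightarrow> f \<in> hom (gr \<Omega> m) (gr \<Omega> n) \<and>
     (\<forall>c. \<forall>x\<in>carrier (gr \<Omega> m). f (gscl \<Omega> m c x) = gscl \<Omega> n c (f x))"

definition gr_algebra :: "('k::field, 'h, 'c) gr_alg \<Rightarrow> bool" where
  "gr_algebra \<Omega> \<longleftrightarrow> gr_space \<Omega> \<and>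
     (\<forall>m n. \<forall>x\<in>carrier (gr \<Omega> m). gr_linear \<Omega> n (m + n) (gmul \<Omega> m n x)) \<and>
     (\<forall>m n. \<forall>y\<in>carrier (gr \<Omega> n). gr_linear \<Omega> m (m + n) (\<lambda>x. gmul \<Omega> m n x y)) \<and>
     (\<forall>l m n. \<forall>x\<in>carrier (gr \<Omega> l). \<forall>y\<in>carrier (gr \<Omega> m). \<forall>z\<in>carrier (gr \<Omega> n).
        gmul \<Omega> (l + m) n (gmul \<Omega> l m x y) z = gmul \<Omega> l (m + n) x (gmul \<Omega> m n y z)) \<and>
     gunt \<Omega> \<in> carrier (gr \<Omega> 0) \<and>
     (\<forall>n. \<forall>x\<in>carrier (gr \<Omega> n). gmul \<Omega> 0 n (gunt \<Omega>) x = x \<and> gmul \<Omega> n 0 x (gunt \<Omega>) = x)"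

definition gr_tsum :: "('k, 'h, 'j::finite, 'z) based_alg_scheme \<Rightarrow> ('k, 'h, 'c) gr_alg \<Rightarrow> nat
    \<Rightarrow> ('h \<Rightarrow> 'h \<Rightarrow> 'c) \<Rightarrow> ('j \<Rightarrow> 'h) \<Rightarrow> 'c" where
  "gr_tsum H \<Omega> n \<phi> t = finprod (gr \<Omega> n) (\<lambda>i. \<phi> (t i) (bas H i)) UNIV"

definition gr_module_algebra :: "('k::field, 'h::ab_group_add, 'j::finite, 'z) bialg_scheme
    \<Rightarrow> ('k, 'h, 'c) gr_alg \<Rightarrow> bool" where
  "gr_module_algebra H \<Omega> \<longleftrightarrow> gr_algebra \<Omega> \<and>
     (\<forall>n h. gr_linear \<Omega> n n (gact \<Omega> n h)) \<and>
     (\<forall>n. \<forall>x\<in>carrier (gr \<Omega> n).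
        (\<forall>h h'. gact \<Omega> n (h + h') x = gact \<Omega> n h x \<otimes>\<^bsub>gr \<Omega> n\<^esub> gact \<Omega> n h' x) \<and>
        (\<forall>c h. gact \<Omega> n (c \<star>\<^bsub>H\<^esub> h) x = gscl \<Omega> n c (gact \<Omega> n h x)) \<and>
        (\<forall>h h'. gact \<Omega> n (h \<bullet>\<^bsub>H\<^esub> h') x = gact \<Omega> n h (gact \<Omega> n h' x)) \<and>
        gact \<Omega> n \<u>\<^bsub>H\<^esub> x = x) \<and>
     (\<forall>h m n. \<forall>x\<in>carrier (gr \<Omega> m). \<forall>y\<in>carrier (gr \<Omega> n).
        gact \<Omega> (m + n) h (gmul \<Omega> m n x y) =
        gr_tsum H \<Omega> (m + n) (\<lambda>h1 h2. gmul \<Omega> m n (gact \<Omega> m h1 x) (gact \<Omega> n h2 y)) (cop H h)) \<and>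
     (\<forall>h. gact \<Omega> 0 h (gunt \<Omega>) = gscl \<Omega> 0 (cou H h) (gunt \<Omega>))"

definition braided_commutative :: "('k::field, 'h::ab_group_add, 'j::finite, 'z) bialg_scheme
    \<Rightarrow> ('j \<Rightarrow> 'h) \<Rightarrow> ('k, 'h, 'c) gr_alg \<Rightarrow> bool" where
  "braided_commutative H R \<Omega> \<longleftrightarrow> gr_module_algebra H \<Omega> \<and>
     (\<forall>m n. \<forall>x\<in>carrier (gr \<Omega> m). \<forall>y\<in>carrier (gr \<Omega> n).
        gmul \<Omega> m n x y = gscl \<Omega> (m + n) ((- 1) ^ (m * n))
          (gr_tsum H \<Omega> (m + n) (\<lambda>r r'. gmul \<Omega> n m (gact \<Omega> n r' y) (gact \<Omega> m r x)) R))"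


section \<open>Hochschild cohomology with coefficients in an algebra\<close>

text \<open>
  Multilinear maps of \<open>n\<close> arguments are functions on lists, with value \<open>0\<close> off lists of length \<open>n\<close>.
  The coefficients are an algebra \<open>M\<close>, an \<open>A\<close>-bimodule along an algebra map \<open>\<iota>\<close> from \<open>A\<close> to \<open>M\<close>.
\<close>

definition multilinear :: "('k::field \<Rightarrow> 'a::ab_group_add \<Rightarrow> 'a) \<Rightarrow> ('k \<Rightarrow> 'm::ab_group_add \<Rightarrow> 'm) \<Rightarrow> nat
    \<Rightarrow> ('a list \<Rightarrow> 'm) \<Rightarrow> bool" where
  "multilinear sA sM n f \<longleftrightarrow>
     (\<forall>xs i. length xs = n \<longrightarrow> i < n \<longrightarrow> Vector_Spaces.linear sA sM (\<lambda>x. f (xs[i := x])))"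

definition cochains :: "('k::field, 'a::ab_group_add, 'y) kalg_scheme \<Rightarrow> ('k, 'm::ab_group_add, 'z) kalg_scheme
    \<Rightarrow> nat \<Rightarrow> ('a list \<Rightarrow> 'm) set" where
  "cochains A M n = {f. multilinear (scl A) (scl M) n f \<and> (\<forall>xs. length xs \<noteq> n \<longrightarrow> f xs = 0)}"

definition hoch_diff :: "('k::field, 'a::ab_group_add, 'y) kalg_scheme \<Rightarrow> ('k, 'm::ab_group_add, 'z) kalg_scheme
    \<Rightarrow> ('a \<Rightarrow> 'm) \<Rightarrow> nat \<Rightarrow> ('a list \<Rightarrow> 'm) \<Rightarrow> 'a list \<Rightarrow> 'm" where
  "hoch_diff A M \<iota> n f = (\<lambda>xs. if length xs = Suc n then
       \<iota> (hd xs) \<bullet>\<^bsub>M\<^esub> f (tl xs)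
       + (\<Sum>i<n. (- 1) ^ Suc i \<star>\<^bsub>M\<^esub> f (take i xs @ [xs ! i \<bullet>\<^bsub>A\<^esub> xs ! Suc i] @ drop (i + 2) xs))
       + (- 1) ^ Suc n \<star>\<^bsub>M\<^esub> (f (butlast xs) \<bullet>\<^bsub>M\<^esub> \<iota> (last xs))
     else 0)"

definition cup :: "('k, 'm, 'z) kalg_scheme \<Rightarrow> nat \<Rightarrow> nat \<Rightarrow> ('a list \<Rightarrow> 'm) \<Rightarrow> ('a list \<Rightarrow> 'm)
    \<Rightarrow> 'a list \<Rightarrow> 'm::ab_group_add" where
  "cup M m n f g = (\<lambda>xs. if length xs = m + n then f (take m xs) \<bullet>\<^bsub>M\<^esub> g (drop m xs) else 0)"

definition cocycles :: "('k::field, 'a::ab_group_add, 'y) kalg_scheme \<Rightarrow> ('k, 'm::ab_group_add, 'z) kalg_scheme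
    \<Rightarrow> ('a \<Rightarrow> 'm) \<Rightarrow> nat \<Rightarrow> ('a list \<Rightarrow> 'm) monoid" where
  "cocycles A M \<iota> n = \<lparr>carrier = {f \<in> cochains A M n. hoch_diff A M \<iota> n f = 0}, mult = (+), one = 0\<rparr>"

fun coboundaries :: "('k::field, 'a::ab_group_add, 'y) kalg_scheme \<Rightarrow> ('k, 'm::ab_group_add, 'z) kalg_scheme
    \<Rightarrow> ('a \<Rightarrow> 'm) \<Rightarrow> nat \<Rightarrow> ('a list \<Rightarrow> 'm) set" where
  "coboundaries A M \<iota> 0 = {0}"
| "coboundaries A M \<iota> (Suc n) = hoch_diff A M \<iota> n ` cochains A M n"

definition hoch_class :: "('k::field, 'a::ab_group_add, 'y) kalg_scheme \<Rightarrow> ('k, 'm::ab_group_add, 'z) kalg_scheme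
    \<Rightarrow> ('a \<Rightarrow> 'm) \<Rightarrow> nat \<Rightarrow> ('a list \<Rightarrow> 'm) \<Rightarrow> ('a list \<Rightarrow> 'm) set" where
  "hoch_class A M \<iota> n f = coboundaries A M \<iota> n #>\<^bsub>cocycles A M \<iota> n\<^esub> f"

text \<open>
  Operations on classes are unions over representatives, as usual for maps on quotients: they return
  a single class exactly when the result does not depend on the representatives. \<open>cact\<close> is an
  action on cochains that descends to cohomology.
\<close>

definition HH :: "('k::field, 'a::ab_group_add, 'y) kalg_scheme \<Rightarrow> ('k, 'm::ab_group_add, 'z) kalg_scheme
    \<Rightarrow> ('a \<Rightarrow> 'm) \<Rightarrow> (nat \<Rightarrow> 'h \<Rightarrow> ('a list \<Rightarrow> 'm) \<Rightarrow> 'a list \<Rightarrow> 'm)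
    \<Rightarrow> ('k, 'h, ('a list \<Rightarrow> 'm) set) gr_alg" where
  "HH A M \<iota> cact = (let cls = hoch_class A M \<iota> in
     \<lparr>gr = (\<lambda>n. cocycles A M \<iota> n Mod coboundaries A M \<iota> n),
      gscl = (\<lambda>n c X. \<Union>f\<in>X. cls n (\<lambda>xs. c \<star>\<^bsub>M\<^esub> f xs)),
      gmul = (\<lambda>m n X Y. \<Union>f\<in>X. \<Union>g\<in>Y. cls (m + n) (cup M m n f g)),
      gunt = cls 0 (\<lambda>xs. if xs = [] then \<u>\<^bsub>M\<^esub> else 0),
      gact = (\<lambda>n h X. \<Union>f\<in>X. cls n (cact n h f))\<rparr>)"


section \<open>The action of the double on Hochschild cochains\<close>

text \<open>
  \<open>rel_cochains E A act n\<close> are the right \<open>E\<close>-linear maps from the \<open>n\<close>-fold tensor power of \<open>B\<close> over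
  \<open>E\<close> to \<open>B\<close>. That tensor power is written as \<open>B \<otimes>\<^sub>E \<dots> \<otimes>\<^sub>E B \<otimes>\<^sub>E E\<close>, which is \<open>E\<close> when \<open>n = 0\<close>: a map is
  a function of a list of \<open>n\<close> elements of \<open>B\<close> and of one element of \<open>E\<close>, multilinear and balanced over
  \<open>E\<close> at each tensor sign.
\<close>

definition rel_cochains :: "('k::field, 'e::ab_group_add, 'i::finite, 'z) bialg_scheme
    \<Rightarrow> ('k, 'a::ab_group_add, 'y) kalg_scheme \<Rightarrow> ('e \<Rightarrow> 'a \<Rightarrow> 'a) \<Rightarrow> nat
    \<Rightarrow> (('i \<Rightarrow> 'a) list \<Rightarrow> 'e \<Rightarrow> 'i \<Rightarrow> 'a) set" where
  "rel_cochains E A act n = (let B = smash E A act; \<iota> = tens A E \<u>\<^bsub>A\<^esub> in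
     {F. (\<forall>w. multilinear (scl B) (scl B) n (\<lambda>bs. F bs w)) \<and>
         (\<forall>bs. length bs = n \<longrightarrow> Vector_Spaces.linear (scl E) (scl B) (F bs)) \<and>
         (\<forall>bs w. length bs \<noteq> n \<longrightarrow> F bs w = 0) \<and>
         (\<forall>bs i v w. length bs = n \<longrightarrow> Suc i < n \<longrightarrow>
            F (bs[i := bs ! i \<bullet>\<^bsub>B\<^esub> \<iota> v]) w = F (bs[Suc i := \<iota> v \<bullet>\<^bsub>B\<^esub> bs ! Suc i]) w) \<and>
         (\<forall>bs b v w. Suc (length bs) = n \<longrightarrow> F (bs @ [b \<bullet>\<^bsub>B\<^esub> \<iota> v]) w = F (bs @ [b]) (v \<bullet>\<^bsub>E\<^esub> w)) \<and>
         (\<forall>bs v w. length bs = n \<longrightarrow> F bs (w \<bullet>\<^bsub>E\<^esub> v) = F bs w \<bullet>\<^bsub>B\<^esub> \<iota> v)})"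

definition restrict_cochain :: "('k::field, 'e::ab_group_add, 'i::finite, 'z) bialg_scheme
    \<Rightarrow> ('k, 'a::ab_group_add, 'y) kalg_scheme \<Rightarrow> (('i \<Rightarrow> 'a) list \<Rightarrow> 'e \<Rightarrow> 'i \<Rightarrow> 'a) \<Rightarrow> 'a list \<Rightarrow> 'i \<Rightarrow> 'a" where
  "restrict_cochain E A F = (\<lambda>as. F (map (\<lambda>a. tens A E a \<u>\<^bsub>E\<^esub>) as) \<u>\<^bsub>E\<^esub>)"

text \<open>\<open>diag_eval H aB aE F h [b\<^sub>1, \<dots>, b\<^sub>n] w\<close> is \<open>F(h\<^sub>1 \<cdot> b\<^sub>1, \<dots>, h\<^sub>n \<cdot> b\<^sub>n, h\<^sub>n\<^sub>+\<^sub>1 \<cdot> w)\<close>.\<close>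

primrec diag_eval :: "('k, 'h, 'j::finite, 'z) bialg_scheme \<Rightarrow> ('h \<Rightarrow> 'b \<Rightarrow> 'b) \<Rightarrow> ('h \<Rightarrow> 'e \<Rightarrow> 'e)
    \<Rightarrow> ('b list \<Rightarrow> 'e \<Rightarrow> 'm::ab_group_add) \<Rightarrow> 'h \<Rightarrow> 'b list \<Rightarrow> 'e \<Rightarrow> 'm" where
  "diag_eval H aB aE F h [] w = F [] (aE h w)"
| "diag_eval H aB aE F h (b # bs) w =
     tsum H (\<lambda>h1 h2. diag_eval H aB aE (\<lambda>bs'. F (aB h1 b # bs')) h2 bs w) (cop H h)"

definition rel_act :: "('k::field, 'e::ab_group_add, 'i::finite, 'z) hopf_scheme
    \<Rightarrow> ('k, 'a::ab_group_add, 'y) kalg_scheme \<Rightarrow> ('e \<Rightarrow> 'a \<Rightarrow> 'a) \<Rightarrow> ('i \<Rightarrow> 'e)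
    \<Rightarrow> (('i \<Rightarrow> 'a) list \<Rightarrow> 'e \<Rightarrow> 'i \<Rightarrow> 'a) \<Rightarrow> ('i \<Rightarrow> 'a) list \<Rightarrow> 'e \<Rightarrow> 'i \<Rightarrow> 'a" where
  "rel_act E A act h F = (\<lambda>bs w. tsum (double E) (\<lambda>h1 h2. dact_B E A act h1
     (diag_eval (double E) (dact_B E A act) (dact_E E) F (anti (double E) h2) bs w)) (cop (double E) h))"

definition cochain_act :: "('k::field, 'e::ab_group_add, 'i::finite, 'z) hopf_scheme
    \<Rightarrow> ('k, 'a::ab_group_add, 'y) kalg_scheme \<Rightarrow> ('e \<Rightarrow> 'a \<Rightarrow> 'a) \<Rightarrow> nat \<Rightarrow> ('i \<Rightarrow> 'e)
    \<Rightarrow> ('a list \<Rightarrow> 'i \<Rightarrow> 'a) \<Rightarrow> 'a list \<Rightarrow> 'i \<Rightarrow> 'a" where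
  "cochain_act E A act n h f = restrict_cochain E A
     (rel_act E A act h (the_inv_into (rel_cochains E A act n) (restrict_cochain E A) f))"

definition HH_smash :: "('k::field, 'e::ab_group_add, 'i::finite, 'z) hopf_scheme
    \<Rightarrow> ('k, 'a::ab_group_add, 'y) kalg_scheme \<Rightarrow> ('e \<Rightarrow> 'a \<Rightarrow> 'a)
    \<Rightarrow> ('k, 'i \<Rightarrow> 'e, ('a list \<Rightarrow> 'i \<Rightarrow> 'a) set) gr_alg" where
  "HH_smash E A act = HH A (smash E A act) (\<lambda>a. tens A E a \<u>\<^bsub>E\<^esub>) (cochain_act E A act)"

text \<open>
  \<open>B\<^sub>J\<close> and \<open>B\<close> have the same underlying space, hence \<open>A\<close> has the same cochains in both, and the
  double acts on them as before; the differential and the cup product are formed in \<open>B\<^sub>J\<close>.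
\<close>

definition HH_twisted_smash :: "('k::field, 'e::ab_group_add, 'i::finite, 'z) hopf_scheme
    \<Rightarrow> ('k, 'a::ab_group_add, 'y) kalg_scheme \<Rightarrow> ('e \<Rightarrow> 'a \<Rightarrow> 'a) \<Rightarrow> ('i \<Rightarrow> 'i \<Rightarrow> 'k)
    \<Rightarrow> ('k, 'i \<Rightarrow> 'e, ('a list \<Rightarrow> 'i \<Rightarrow> 'a) set) gr_alg" where
  "HH_twisted_smash E A act J =
     HH A (twist_alg (double E) (dual2_to_double2 E J) (dact_B E A act) (smash E A act))
       (\<lambda>a. tens A E a \<u>\<^bsub>E\<^esub>) (cochain_act E A act)"

end

theory Submission
  imports Defs
begin

text \<open>
  A cochain \<open>f\<close> on \<open>A\<close> has an explicit right \<open>E\<close>-linear extension \<open>F\<close> to the tensor powers of \<open>B\<close> over \<open>E\<close>,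
  obtained by moving all factors from \<open>E\<close> to the right. This turns the action of the double into a formula on
  cochains of \<open>A\<close>: \<open>\<xi> \<in> E\<^sup>*\<close> acts through the values of \<open>f\<close>, and \<open>w \<in> E\<close> by
  \<open>(w \<cdot> f)(x\<^sub>1, x\<^sub>2, \<dots>) = S(w\<^sub>1) F(w\<^sub>2 x\<^sub>1, x\<^sub>2, \<dots>)\<close>. If \<open>f\<close> is a cocycle, the extension is a relative cocycle on \<open>B\<close>, so
  inserting a second cocycle \<open>g\<close>, whose values lie in \<open>B\<close>, at all places of \<open>F\<close> is possible, and Gerstenhaber's
  homotopy shows that \<open>f \<union> g\<close> is cohomologous to \<open>\<plusminus> F'(g(x\<^sub>1, \<dots>, x\<^sub>n), x\<^sub>n\<^sub>+\<^sub>1, \<dots>)\<close>, where \<open>F'(a w, x\<^sub>1, \<dots>) = a F(w x\<^sub>1, \<dots>)\<close>.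
  As \<open>F'(b, x) = \<Sum> (r\<^sup>j \<cdot> b) (r\<^sub>j \<cdot> f)(x)\<close>, this is the braiding.

  For a twist \<open>J\<close>, the images of \<open>A\<close> in \<open>B\<close> are \<open>E\<^sup>*\<close>-invariant, so \<open>B\<^sub>J\<close> and \<open>B\<close> have the same differential, while
  \<open>f \<union>\<^sub>J g = (J\<^sub>l \<cdot> f) \<union> (J\<^sup>l \<cdot> g)\<close> on cochains. The twisted relation is then the untwisted one applied to
  \<open>J\<^sub>l \<cdot> f\<close> and \<open>J\<^sup>l \<cdot> g\<close>, because \<open>J\<^sub>2\<^sub>1 R\<^sup>J = R J\<close>.
\<close>

section \<open>Linear maps and tensors\<close>

text \<open>Two obstacles shape the proof. The antipode of the double contains
  \<open>the_inv S\<close>, which is an inverse only if S is bijective; so bijectivity for a finite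
  dimensional Hopf algebra is derived from the axioms, by means of a nonzero integral obtained as a
  trace. And the action on cochains is defined by extending to B, conjugating by the double and
  restricting: nothing can be computed until the extension is explicit and the antipodes of the
  conjugation have cancelled. Much of the rest comes from the image of A in B being coinvariant:
  functionals act on values only, commute with the differential, and a twist does not see A. In the
  homotopy only the extended cochain F has to accept arguments from B; g is applied to elements of A
  and merely takes values in B. The map F' is not a choice either. It is the extension of the first
  face of f, and the cocycle condition, once extended, says that F' is minus the sum of the
  remaining faces of F. This is what identifies one end of the telescoping sum with the braided
  product, while the other end is the cup product.\<close>

abbreviation lin where "lin \<equiv> Vector_Spaces.linear"

lemma lin_def: "lin s t f \<longleftrightarrow> vector_space s \<and> vector_space t \<and>
   (\<forall>x y. f (x + y) = f x + f y) \<and> (\<forall>c x. f (s c x) = t c (f x))"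
  by (simp add: Vector_Spaces.linear_iff)

lemma lin_plus: "lin s t f \<Longrightarrow> f (x + y) = f x + f y"
  and lin_scl: "lin s t f \<Longrightarrow> f (s c x) = t c (f x)"
  and lin_vs1: "lin s t f \<Longrightarrow> vector_space s"
  and lin_vs2: "lin s t f \<Longrightarrow> vector_space t"
  by (simp_all add: lin_def)

lemma lin_zero: "lin s t f \<Longrightarrow> f 0 = 0"
  using lin_plus[of s t f 0 0] by simp

lemma lin_uminus: "lin s t f \<Longrightarrow> f (- x) = - f x"
  using lin_plus[of s t f x "- x"] lin_zero[of s t f] by (simp add: eq_neg_iff_add_eq_0 add.commute)

lemma lin_minus: "lin s t f \<Longrightarrow> f (x - y) = f x - f y"
  using lin_plus[of s t f x "- y"] lin_uminus[of s t f y] by simp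

lemma lin_setsum: "lin s t f \<Longrightarrow> f (sum g I) = (\<Sum>i\<in>I. f (g i))"
  by (induction I rule: infinite_finite_induct) (auto simp: lin_zero lin_plus)

lemma vs_fscl: "vector_space s \<Longrightarrow> vector_space (fscl s)"
  by (auto simp: vector_space_def fscl_def fun_eq_iff)

lemma vs_field: "vector_space ((*) :: 'k::field \<Rightarrow> 'k \<Rightarrow> 'k)"
  by (auto simp: vector_space_def algebra_simps)

lemma vs_scale_add: "vector_space s \<Longrightarrow> s c (x + y) = s c x + s c y"
  and vs_add_scale: "vector_space s \<Longrightarrow> s (c + d) x = s c x + s d x"
  and vs_scale_scale: "vector_space s \<Longrightarrow> s c (s d x) = s (c * d) x"
  and vs_scale_one: "vector_space s \<Longrightarrow> s 1 x = x"
  by (simp_all add: vector_space_def)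

lemma vs_zero: "vector_space s \<Longrightarrow> s 0 x = 0" "vector_space s \<Longrightarrow> s c 0 = 0"
  using vs_add_scale[of s 0 0 x] vs_scale_add[of s c 0 0] by auto

lemma vs_neg: "vector_space s \<Longrightarrow> s (- c) x = - s c x"
  using vs_add_scale[of s c "- c" x] vs_zero(1)[of s x]
  by (simp add: eq_neg_iff_add_eq_0 add.commute)

lemma vs_neg_right: "vector_space s \<Longrightarrow> s c (- x) = - s c x"
  using vs_scale_add[of s c x "- x"] vs_zero(2)[of s c]
  by (simp add: eq_neg_iff_add_eq_0 add.commute)

lemma vs_scale_sum: "vector_space s \<Longrightarrow> s c (sum g I) = (\<Sum>i\<in>I. s c (g i))"
  by (induction I rule: infinite_finite_induct) (auto simp: vs_zero vs_scale_add)

lemma vs_sum_scale: "vector_space s \<Longrightarrow> s (sum g I) x = (\<Sum>i\<in>I. s (g i) x)"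
  by (induction I rule: infinite_finite_induct) (auto simp: vs_zero vs_add_scale)

lemma lin_ident: "vector_space s \<Longrightarrow> lin s s (\<lambda>x. x)"
  by (simp add: lin_def)

lemma lin_comp: "lin s t g \<Longrightarrow> lin r s f \<Longrightarrow> lin r t (\<lambda>x. g (f x))"
  by (simp add: lin_def)

lemma lin_add: "lin s t f \<Longrightarrow> lin s t g \<Longrightarrow> lin s t (\<lambda>x. f x + g x)"
  by (simp add: lin_def vs_scale_add)

lemma lin_neg: "lin s t f \<Longrightarrow> lin s t (\<lambda>x. - f x)"
  by (simp add: lin_def vs_neg_right)

lemma lin_diff: "lin s t f \<Longrightarrow> lin s t g \<Longrightarrow> lin s t (\<lambda>x. f x - g x)"
  using lin_add[OF _ lin_neg] by fastforce

lemma lin_const_zero: "vector_space s \<Longrightarrow> vector_space t \<Longrightarrow> lin s t (\<lambda>x. 0)"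
  by (simp add: lin_def vs_zero)

lemma lin_sum: "(\<And>i. lin s t (f i)) \<Longrightarrow> lin s t (\<lambda>x. \<Sum>i\<in>I. f i x)"
proof -
  assume f: "\<And>i. lin s t (f i)"
  note vs = lin_vs1[OF f] lin_vs2[OF f]
  show ?thesis
    by (induction I rule: infinite_finite_induct) (simp_all add: lin_const_zero[OF vs] lin_add[OF f])
qed

lemma lin_scale: "lin s t f \<Longrightarrow> lin s t (\<lambda>x. t c (f x))"
  by (simp add: lin_def vs_scale_add vs_scale_scale mult.commute)

lemma lin_scale_vec: "vector_space t \<Longrightarrow> lin s (*) f \<Longrightarrow> lin s t (\<lambda>x. t (f x) v)"
  by (simp add: lin_def vs_add_scale vs_scale_scale)

lemma lin_mult_left: "lin s (*) f \<Longrightarrow> lin s (*) (\<lambda>x. c * f x)"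
  and lin_mult_right: "lin s (*) f \<Longrightarrow> lin s (*) (\<lambda>x. f x * c)"
  by (auto simp: lin_def algebra_simps)

lemma lin_fun: "vector_space s \<Longrightarrow> vector_space t \<Longrightarrow> (\<And>i. lin s t (\<lambda>x. f x i)) \<Longrightarrow> lin s (fscl t) f"
  by (auto simp: lin_def vs_fscl fun_eq_iff) (auto simp: fscl_def)

lemma lin_fun_apply: "vector_space t \<Longrightarrow> lin s (fscl t) f \<Longrightarrow> lin s t (\<lambda>x. f x i)"
  by (auto simp: lin_def fscl_def)

lemma lin_tsum_fun: "(\<And>x y. lin s t (\<lambda>z. \<phi> z x y)) \<Longrightarrow> lin s t (\<lambda>z. tsum H (\<phi> z) T)"
  unfolding tsum_def by (rule lin_sum) auto

text \<open>A tensor is stored as the family of its first factors over the basis of the second, so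
  the sum feeds the tensor into the first slot of \<open>\<phi>\<close> alone. Linearity in that
  slot makes the whole Sweedler sum linear in the tensor.\<close>

lemma lin_tsum_arg:
  assumes f: "lin s (fscl r) f" and "vector_space r" and "\<And>y. lin r t (\<lambda>x. \<phi> x y)"
  shows "lin s t (\<lambda>z. tsum H \<phi> (f z))"
  unfolding tsum_def by (rule lin_sum) (rule lin_comp[OF assms(3) lin_fun_apply[OF assms(2) f]])

lemma lin_tsum: "lin s t L \<Longrightarrow> L (tsum H \<psi> T) = tsum H (\<lambda>x y. L (\<psi> x y)) T"
  unfolding tsum_def by (rule lin_setsum)

lemma tsum_swap: "tsum H (\<lambda>x y. tsum H' (\<lambda>x' y'. \<phi> x y x' y') T') T
    = tsum H' (\<lambda>x' y'. tsum H (\<lambda>x y. \<phi> x y x' y') T) T'"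
  unfolding tsum_def by (rule sum.swap)

lemma tsum_add: "tsum H (\<lambda>x y. f x y + g x y) T = tsum H f T + tsum H g T"
  unfolding tsum_def by (rule sum.distrib)

lemma tsum_sum: "tsum H (\<lambda>x y. \<Sum>i\<in>I. f i x y) T = (\<Sum>i\<in>I. tsum H (f i) T)"
  unfolding tsum_def by (rule sum.swap)

lemma tsum_scale: "vector_space s \<Longrightarrow> tsum H (\<lambda>x y. s c (f x y)) T = s c (tsum H f T)"
  unfolding tsum_def by (simp add: vs_scale_sum)

lemma tsum_neg: "tsum H (\<lambda>x y. - f x y) T = - tsum H (f :: _ \<Rightarrow> _ \<Rightarrow> 'a::ab_group_add) T"
  unfolding tsum_def by (simp add: sum_negf)

lemma tsum_cong: "(\<And>x y. f x y = g x y) \<Longrightarrow> tsum H f T = tsum H g T"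
  by presburger

section \<open>Coordinates, bases, and the algebra structure on a tensor product\<close>

lemma coord_lin: assumes "is_based H" shows "lin (scl H) (*) (\<lambda>h. coord H h i)"
proof -
  interpret vector_space "scl H" using assms by (simp add: is_based_def)
  have ind: "independent (range (bas H))" and sp: "span (range (bas H)) = UNIV"
    using assms by (auto simp: is_based_def)
  show ?thesis
    by (auto simp: lin_def coord_def vs_field representation_add[OF ind] representation_scale[OF ind] sp
        intro: vector_space_axioms)
qed

lemma sum_mult_unit:
  "(\<Sum>i\<in>UNIV. f i * (if j = i then 1 else 0)) = (f j :: 'k::semiring_1)"
  "(\<Sum>i\<in>UNIV. f i * (if i = j then 1 else 0)) = (f j :: 'k::semiring_1)"
  for j :: "'i::finite"
proof -
  have "f i * (if j = i then 1 else 0) = (if j = i then f i else 0)" for i by simp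
  then show "(\<Sum>i\<in>UNIV. f i * (if j = i then 1 else 0)) = f j" by simp
  then show "(\<Sum>i\<in>UNIV. f i * (if i = j then 1 else 0)) = f j" by (simp add: eq_commute)
qed

text \<open>Linear coordinates that rebuild every vector and are dual to the family force it to be a
  basis: applying them to a vanishing combination kills its coefficients. This is how the dual and
  the double receive their bases together with an explicit formula for \<open>coord\<close>.\<close>

lemma is_basedI:
  fixes H :: "('k::field, 'v::ab_group_add, 'i::finite, 'z) based_alg_scheme"
  assumes vs: "vector_space (scl H)" and c: "\<And>i. lin (scl H) (*) (\<lambda>v. c v i)"
    and e: "\<And>v. (\<Sum>i\<in>UNIV. scl H (c v i) (bas H i)) = v"
    and d: "\<And>i j. c (bas H j) i = (if i = j then 1 else 0)"
  shows "is_based H" and "coord H v i = c v i"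
proof -
  interpret vector_space "scl H" by fact
  have inj: "inj (bas H)"
  proof (rule injI)
    fix x y assume "bas H x = bas H y"
    then have "(if x = y then 1 else 0 :: 'k) = 1" using d[of y x] d[of x x] by presburger
    then show "x = y" by (rule contrapos_pp) simp
  qed
  have ind: "independent (range (bas H))"
  proof (rule independent_if_scalars_zero)
    fix f x assume s: "(\<Sum>x\<in>range (bas H). scl H (f x) x) = 0" and x: "x \<in> range (bas H)"
    from x obtain j where j: "x = bas H j" by blast
    have "0 = c (\<Sum>i\<in>UNIV. scl H (f (bas H i)) (bas H i)) j"
      using s lin_zero[OF c] by (simp add: sum.reindex[OF inj])
    also have "\<dots> = (\<Sum>i\<in>UNIV. f (bas H i) * c (bas H i) j)"
      by (simp add: lin_setsum[OF c] lin_scl[OF c])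
    also have "\<dots> = f (bas H j)" by (simp add: d sum_mult_unit)
    finally show "f x = 0" using j by simp
  qed simp
  have "v \<in> span (range (bas H))" for v
    by (subst e[of v, symmetric]) (intro span_sum span_scale span_base rangeI)
  then show b: "is_based H" using vs inj ind by (auto simp: is_based_def)
  have "coord H v i = coord H (\<Sum>i\<in>UNIV. scl H (c v i) (bas H i)) i" by (simp add: e)
  also have "\<dots> = c v i"
    by (simp add: lin_setsum[OF coord_lin[OF b]] lin_scl[OF coord_lin[OF b]] coord_bas[OF b] sum_mult_unit)
  finally show "coord H v i = c v i" .
qed

lemma lin_tens_left: "vector_space (scl V) \<Longrightarrow> lin s (scl V) f \<Longrightarrow> lin s (fscl (scl V)) (\<lambda>x. tens V H (f x) h)"
  unfolding tens_def by (rule lin_fun) (auto intro: lin_scale lin_vs1)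

lemma lin_tens_right:
  assumes "is_based H" "vector_space (scl V)" "lin s (scl H) f"
  shows "lin s (fscl (scl V)) (\<lambda>x. tens V H v (f x))"
  unfolding tens_def
  by (rule lin_fun) (auto intro!: lin_scale_vec lin_comp[OF coord_lin] assms intro: lin_vs1[OF assms(3)])

lemma tensor_ext:
  fixes V :: "('k::field, 'v::ab_group_add, 'y) kalg_scheme"
    and H :: "('k, 'h::ab_group_add, 'i::finite, 'z) based_alg_scheme"
  assumes "is_based H" "vector_space (scl V)" "lin (fscl (scl V)) s F" "lin (fscl (scl V)) s G"
    and "\<And>v h. F (tens V H v h) = G (tens V H v h)"
  shows "F t = G t"
  by (subst (1 2) tensor_expansion[OF assms(1,2), of t, symmetric])
     (simp add: lin_tsum[OF assms(3)] lin_tsum[OF assms(4)] assms(5))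

lemma k_algebraD:
  assumes "k_algebra A"
  shows "vector_space (scl A)" and "(x \<bullet>\<^bsub>A\<^esub> y) \<bullet>\<^bsub>A\<^esub> z = x \<bullet>\<^bsub>A\<^esub> (y \<bullet>\<^bsub>A\<^esub> z)"
    and "\<u>\<^bsub>A\<^esub> \<bullet>\<^bsub>A\<^esub> x = x" and "x \<bullet>\<^bsub>A\<^esub> \<u>\<^bsub>A\<^esub> = x"
    and "lin s (scl A) f \<Longrightarrow> lin s (scl A) (\<lambda>v. f v \<bullet>\<^bsub>A\<^esub> y)"
    and "lin s (scl A) f \<Longrightarrow> lin s (scl A) (\<lambda>v. y \<bullet>\<^bsub>A\<^esub> f v)"
  using assms lin_vs1 unfolding k_algebra_def
  by (blast, simp_all add: lin_comp[of "scl A" "scl A" "\<lambda>x. x \<bullet>\<^bsub>A\<^esub> y"] lin_comp[of "scl A" "scl A" "\<lambda>x. y \<bullet>\<^bsub>A\<^esub> x"])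

lemma k_algebraI:
  assumes "\<And>y. lin (scl A) (scl A) (\<lambda>x. x \<bullet>\<^bsub>A\<^esub> y)" "\<And>x. lin (scl A) (scl A) (\<lambda>y. x \<bullet>\<^bsub>A\<^esub> y)"
    and "\<And>x y z. (x \<bullet>\<^bsub>A\<^esub> y) \<bullet>\<^bsub>A\<^esub> z = x \<bullet>\<^bsub>A\<^esub> (y \<bullet>\<^bsub>A\<^esub> z)"
    and "\<And>x. \<u>\<^bsub>A\<^esub> \<bullet>\<^bsub>A\<^esub> x = x" and "\<And>x. x \<bullet>\<^bsub>A\<^esub> \<u>\<^bsub>A\<^esub> = x"
  shows "k_algebra A"
  using assms by (simp add: k_algebra_def)

lemma tsum_tens':
  assumes "is_based H" "\<And>h. lin (scl V) t (\<lambda>v. \<phi> v h)" "\<And>v. lin (scl H) t (\<phi> v)"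
  shows "tsum H \<phi> (tens V H v h) = \<phi> v h"
  using tsum_tens[of H V t \<phi>] assms by blast

text \<open>The product of two tensors is a sum of pure tensors, and on these the map induced by a
  bilinear \<open>\<Phi>\<close> is \<open>\<Phi>\<close> itself. In this form the multiplicativity
  of a coproduct enters Sweedler computations.\<close>

lemma tsum_talg_mult:
  assumes H: "is_based H" and "\<And>h. lin (scl V) t (\<lambda>v. \<Phi> v h)" and "\<And>v. lin (scl H) t (\<Phi> v)"
  shows "tsum H \<Phi> (x \<bullet>\<^bsub>talg V H\<^esub> y) = tsum H (\<lambda>v h. tsum H (\<lambda>v' h'. \<Phi> (v \<bullet>\<^bsub>V\<^esub> v') (h \<bullet>\<^bsub>H\<^esub> h')) y) x"
proof -
  have vs: "vector_space (scl V)" using assms(2) lin_vs1 by blast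
  have L: "lin (fscl (scl V)) t (tsum H \<Phi>)"
    by (rule lin_tsum_arg[OF lin_ident[OF vs_fscl[OF vs]] vs assms(2)])
  show ?thesis
    by (simp add: talg_def lin_tsum[OF L] tsum_tens'[of H V t \<Phi>, OF assms])
qed

lemma talg_scl [simp]: "scl (talg V H) = fscl (scl V)"
  and talg_unt [simp]: "\<u>\<^bsub>talg V H\<^esub> = tens V H \<u>\<^bsub>V\<^esub> \<u>\<^bsub>H\<^esub>"
  by (simp_all add: talg_def)

lemma talg_lin:
  assumes H: "is_based H" "k_algebra H" and V: "k_algebra V"
  shows "lin s (fscl (scl V)) f \<Longrightarrow> lin s (fscl (scl V)) (\<lambda>z. f z \<bullet>\<^bsub>talg V H\<^esub> y)"
    and "lin s (fscl (scl V)) f \<Longrightarrow> lin s (fscl (scl V)) (\<lambda>z. x \<bullet>\<^bsub>talg V H\<^esub> f z)"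
proof -
  note vs = k_algebraD(1)[OF V]
  assume f: "lin s (fscl (scl V)) f"
  show "lin s (fscl (scl V)) (\<lambda>z. f z \<bullet>\<^bsub>talg V H\<^esub> y)"
    unfolding talg_def kalg.simps
    by (rule lin_tsum_arg[OF f vs]) (intro lin_tsum_fun lin_tens_left vs k_algebraD(5)[OF V] lin_ident)
  show "lin s (fscl (scl V)) (\<lambda>z. x \<bullet>\<^bsub>talg V H\<^esub> f z)"
    unfolding talg_def kalg.simps
    by (rule lin_tsum_fun, rule lin_tsum_arg[OF f vs]) (intro lin_tens_left vs k_algebraD(6)[OF V] lin_ident)
qed

lemma talg_pure:
  assumes H: "is_based H" "k_algebra H" and V: "k_algebra V"
  shows "tens V H v h \<bullet>\<^bsub>talg V H\<^esub> tens V H v' h' = tens V H (v \<bullet>\<^bsub>V\<^esub> v') (h \<bullet>\<^bsub>H\<^esub> h')"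
proof -
  note vs = k_algebraD(1)[OF V]
  note vsH = k_algebraD(1)[OF H(2)]
  have "tsum H (\<lambda>v' h'. tens V H (x \<bullet>\<^bsub>V\<^esub> v') (y \<bullet>\<^bsub>H\<^esub> h')) (tens V H v' h') = tens V H (x \<bullet>\<^bsub>V\<^esub> v') (y \<bullet>\<^bsub>H\<^esub> h')" for x y
    by (rule tsum_tens'[OF H(1), where t = "fscl (scl V)"]) (intro lin_tens_left lin_tens_right vs vsH k_algebraD(6)[OF V] k_algebraD(6)[OF H(2)] lin_ident H)+
  then show ?thesis
    by (simp add: talg_def)
       (rule tsum_tens'[OF H(1), where t = "fscl (scl V)"], (intro lin_tens_left lin_tens_right vs vsH k_algebraD(5)[OF V] k_algebraD(5)[OF H(2)] lin_ident H)+)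
qed

lemma k_algebra_talg:
  assumes H: "is_based H" "k_algebra H" and V: "k_algebra V"
  shows "k_algebra (talg V H)"
proof -
  note vs = k_algebraD(1)[OF V]
  note rules = talg_lin[OF assms] vs_fscl[OF vs] lin_ident
  note ext = tensor_ext[OF H(1) vs, where s = "fscl (scl V)"]
  note pure = talg_pure[OF assms]
  show ?thesis
  proof (rule k_algebraI)
    fix x y z
    show "(x \<bullet>\<^bsub>talg V H\<^esub> y) \<bullet>\<^bsub>talg V H\<^esub> z = x \<bullet>\<^bsub>talg V H\<^esub> (y \<bullet>\<^bsub>talg V H\<^esub> z)"
    proof (rule ext[where t = x], (intro rules)+)
      fix v h show "(tens V H v h \<bullet>\<^bsub>talg V H\<^esub> y) \<bullet>\<^bsub>talg V H\<^esub> z = tens V H v h \<bullet>\<^bsub>talg V H\<^esub> (y \<bullet>\<^bsub>talg V H\<^esub> z)"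
      proof (rule ext[where t = y], (intro rules)+)
        fix v' h' show "(tens V H v h \<bullet>\<^bsub>talg V H\<^esub> tens V H v' h') \<bullet>\<^bsub>talg V H\<^esub> z = tens V H v h \<bullet>\<^bsub>talg V H\<^esub> (tens V H v' h' \<bullet>\<^bsub>talg V H\<^esub> z)"
          by (rule ext[where t = z], (intro rules)+)
             (simp add: pure k_algebraD(2)[OF H(2)] k_algebraD(2)[OF V])
      qed
    qed
    show "\<u>\<^bsub>talg V H\<^esub> \<bullet>\<^bsub>talg V H\<^esub> x = x"
      by (rule ext[where t = x], (intro rules)+) (simp add: pure k_algebraD(3)[OF H(2)] k_algebraD(3)[OF V])
    show "x \<bullet>\<^bsub>talg V H\<^esub> \<u>\<^bsub>talg V H\<^esub> = x"
      by (rule ext[where t = x], (intro rules)+) (simp add: pure k_algebraD(4)[OF H(2)] k_algebraD(4)[OF V])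
  qed (simp_all, (intro rules)+)
qed

lemma inverse_in_unique:
  assumes "k_algebra A" "is_inverse A x y"
  shows "inverse_in A x = y"
  unfolding inverse_in_def
proof (rule the_equality)
  fix z assume z: "is_inverse A x z"
  then show "z = y" using assms unfolding is_inverse_def by (metis k_algebraD(2-4))
qed fact

text \<open>An element of the triple tensor product is a nested family, which no Sweedler sum
  matches directly. Pairing it with a trilinear \<open>\<phi>\<close> gives iterated sums, here for
  \<open>cop_l\<close> and in \<open>tsum_cop_r\<close> for \<open>cop_r\<close>; comparing the two
  is coassociativity.\<close>

lemma tsum_cop_l:
  assumes H: "is_based H" and "\<And>y z. lin (scl H) t (\<lambda>x. \<phi> x y z)" "\<And>x y. lin (scl H) t (\<lambda>z. \<phi> x y z)"
  shows "tsum H (\<lambda>u z. tsum H (\<lambda>x y. \<phi> x y z) u) (cop_l H T)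
     = tsum H (\<lambda>u z. tsum H (\<lambda>x y. \<phi> x y z) (cop H u)) T"
proof -
  have vs: "vector_space (scl H)" using H by (simp add: is_based_def)
  have l: "lin (fscl (scl H)) t (\<lambda>u. tsum H (\<lambda>x y. \<phi> x y z) u)" for z
    by (rule lin_tsum_arg[OF lin_ident[OF vs_fscl[OF vs]] vs]) (rule assms)
  have L: "lin (fscl (fscl (scl H))) t (tsum H (\<lambda>u z. tsum H (\<lambda>x y. \<phi> x y z) u))"
    by (rule lin_tsum_arg[OF lin_ident vs_fscl[OF vs] l]) (intro vs_fscl vs)
  show ?thesis unfolding cop_l_def lin_tsum[OF L]
    by (intro tsum_cong, subst tsum_tens'[OF H, where t = t])
       (auto intro!: l lin_tsum_fun assms)
qed

lemma tsum_cop_r: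
  assumes H: "is_based H" and "\<And>y z. lin (scl H) t (\<lambda>x. \<phi> x y z)" "\<And>x y. lin (scl H) t (\<lambda>z. \<phi> x y z)"
     "\<And>x z. lin (scl H) t (\<lambda>y. \<phi> x y z)"
  shows "tsum H (\<lambda>u z. tsum H (\<lambda>x y. \<phi> x y z) u) (cop_r H T)
     = tsum H (\<lambda>x u. tsum H (\<lambda>y z. \<phi> x y z) (cop H u)) T"
proof -
  have vs: "vector_space (scl H)" using H by (simp add: is_based_def)
  have l: "lin (fscl (scl H)) t (\<lambda>u. tsum H (\<lambda>x y. \<phi> x y z) u)" for z
    by (rule lin_tsum_arg[OF lin_ident[OF vs_fscl[OF vs]] vs]) (rule assms)
  have L: "lin (fscl (fscl (scl H))) t (tsum H (\<lambda>u z. tsum H (\<lambda>x y. \<phi> x y z) u))"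
    by (rule lin_tsum_arg[OF lin_ident vs_fscl[OF vs] l]) (intro vs_fscl vs)
  show ?thesis unfolding cop_r_def lin_tsum[OF L]
    by (intro tsum_cong, subst tsum_tens'[OF H, where t = t])
       (auto intro!: l lin_tsum_fun assms tsum_cong tsum_tens'[OF H, where t = t])
qed

section \<open>Hopf algebras\<close>

locale hopf_alg =
  fixes E :: "('k::field, 'e::ab_group_add, 'i::finite) hopf"
  assumes hopf: "hopf_algebra E"
begin

abbreviation sE where "sE \<equiv> scl E"
abbreviation mE (infixl "\<diamondop>" 70) where "x \<diamondop> y \<equiv> x \<bullet>\<^bsub>E\<^esub> y"
abbreviation oE where "oE \<equiv> \<u>\<^bsub>E\<^esub>"
abbreviation S where "S \<equiv> anti E"
abbreviation eps where "eps \<equiv> cou E"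
abbreviation cf where "cf k x \<equiv> coord E x k"
abbreviation sw where "sw \<phi> w \<equiv> tsum E \<phi> (cop E w)"

lemma based: "is_based E" and algE: "k_algebra E"
  and cop_lin: "lin sE (fscl sE) (cop E)" and eps_lin: "lin sE (*) eps" and S_lin: "lin sE sE S"
  and eps_mult: "eps (x \<diamondop> y) = eps x * eps y" and eps_one: "eps oE = 1"
  using hopf by (auto simp: hopf_algebra_def)

lemma vsE: "vector_space sE" using k_algebraD(1)[OF algE] .

lemmas mE_assoc = k_algebraD(2)[OF algE] and one_mE = k_algebraD(3)[OF algE] and mE_one = k_algebraD(4)[OF algE]

lemma lin_sw: "lin s sE f \<Longrightarrow> (\<And>y. lin sE t (\<lambda>x. \<phi> x y)) \<Longrightarrow> lin s t (\<lambda>z. sw \<phi> (f z))"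
  by (rule lin_tsum_arg[OF lin_comp[OF cop_lin] vsE])

text \<open>Linearity rules for \<open>intro\<close>. A tensor identity can be used only under
  multilinear maps, so every appeal to coassociativity or to a cancellation rule leaves one
  linearity goal per slot; larger collections of the same kind follow as new operations
  appear.\<close>

lemmas lins = lin_ident[OF vsE] k_algebraD(5)[OF algE] k_algebraD(6)[OF algE] lin_comp[OF S_lin] lin_comp[OF eps_lin]
  lin_comp[OF coord_lin[OF based]] lin_scale[where t = sE] lin_scale_vec[OF vsE] lin_mult_left lin_mult_right
  lin_tsum_fun lin_sw

text \<open>Coassociativity as a change of nesting: the three legs stay in their order, and only the
  split that is made first changes.\<close>

lemma sw_assoc:
  assumes "\<And>y z. lin sE t (\<lambda>x. \<phi> x y z)" "\<And>x z. lin sE t (\<lambda>y. \<phi> x y z)" "\<And>x y. lin sE t (\<lambda>z. \<phi> x y z)"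
  shows "sw (\<lambda>u z. sw (\<lambda>x y. \<phi> x y z) u) w = sw (\<lambda>x u. sw (\<lambda>y z. \<phi> x y z) u) w"
proof -
  have "cop_l E (cop E w) = cop_r E (cop E w)" using hopf by (simp add: hopf_algebra_def)
  then show ?thesis
    using tsum_cop_l[OF based, of t \<phi> "cop E w"] tsum_cop_r[OF based, of t \<phi> "cop E w"] assms by simp
qed

lemma sw_eps_left: "lin sE t \<phi> \<Longrightarrow> sw (\<lambda>x y. t (eps x) (\<phi> y)) w = \<phi> w"
proof -
  assume l: "lin sE t \<phi>"
  have "tsum E (\<lambda>h1 h2. sE (eps h1) h2) (cop E w) = w" using hopf by (simp add: hopf_algebra_def)
  then show ?thesis using lin_tsum[OF l, of E "\<lambda>h1 h2. sE (eps h1) h2" "cop E w"] by (simp add: lin_scl[OF l])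
qed

lemma sw_eps_right: "lin sE t \<phi> \<Longrightarrow> sw (\<lambda>x y. t (eps y) (\<phi> x)) w = \<phi> w"
proof -
  assume l: "lin sE t \<phi>"
  have "tsum E (\<lambda>h1 h2. sE (eps h2) h1) (cop E w) = w" using hopf by (simp add: hopf_algebra_def)
  then show ?thesis using lin_tsum[OF l, of E "\<lambda>h1 h2. sE (eps h2) h1" "cop E w"] by (simp add: lin_scl[OF l])
qed

lemma sw_S_left: "lin sE t \<phi> \<Longrightarrow> sw (\<lambda>x y. \<phi> (S x \<diamondop> y)) w = t (eps w) (\<phi> oE)"
proof -
  assume l: "lin sE t \<phi>"
  have "tsum E (\<lambda>h1 h2. S h1 \<diamondop> h2) (cop E w) = sE (eps w) oE" using hopf by (simp add: hopf_algebra_def)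
  then show ?thesis using lin_tsum[OF l, of E "\<lambda>h1 h2. S h1 \<diamondop> h2" "cop E w"] by (simp add: lin_scl[OF l])
qed

lemma sw_S_right: "lin sE t \<phi> \<Longrightarrow> sw (\<lambda>x y. \<phi> (x \<diamondop> S y)) w = t (eps w) (\<phi> oE)"
proof -
  assume l: "lin sE t \<phi>"
  have "tsum E (\<lambda>h1 h2. h1 \<diamondop> S h2) (cop E w) = sE (eps w) oE" using hopf by (simp add: hopf_algebra_def)
  then show ?thesis using lin_tsum[OF l, of E "\<lambda>h1 h2. h1 \<diamondop> S h2" "cop E w"] by (simp add: lin_scl[OF l])
qed

lemma sw_mult:
  assumes "\<And>y. lin sE t (\<lambda>x. \<phi> x y)" "\<And>x. lin sE t (\<lambda>y. \<phi> x y)"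
  shows "sw \<phi> (x \<diamondop> y) = sw (\<lambda>x1 x2. sw (\<lambda>y1 y2. \<phi> (x1 \<diamondop> y1) (x2 \<diamondop> y2)) y) x"
  using hopf tsum_talg_mult[OF based, of E t \<phi> "cop E x" "cop E y"] assms by (simp add: hopf_algebra_def)

lemma sw_one:
  assumes "\<And>y. lin sE t (\<lambda>x. \<phi> x y)" "\<And>x. lin sE t (\<lambda>y. \<phi> x y)"
  shows "sw \<phi> oE = \<phi> oE oE"
  using hopf tsum_tens'[OF based, of E t \<phi>] assms by (simp add: hopf_algebra_def)

text \<open>This and the next three rules cancel an antipode next to one spare leg. In their names
  the first \<open>left\<close> or \<open>right\<close> tells which factor of the pair carries S,
  the second where the pair stands among the three legs. The pair is brought under one coproduct and
  becomes a counit, which the spare leg absorbs.\<close>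

lemma sw_S_left_left:
  assumes 1: "\<And>y. lin sE t (\<lambda>x. \<phi> x y)" and 2: "\<And>x. lin sE t (\<lambda>y. \<phi> x y)"
  shows "sw (\<lambda>x u. sw (\<lambda>y z. \<phi> (S x \<diamondop> y) z) u) w = \<phi> oE w"
  by (subst sw_assoc[where t = t, symmetric], (intro lins lin_comp[OF 1] lin_comp[OF 2])+,
      subst sw_S_left[OF 1], rule sw_eps_left[OF 2])

lemma sw_S_right_left:
  assumes 1: "\<And>y. lin sE t (\<lambda>x. \<phi> x y)" and 2: "\<And>x. lin sE t (\<lambda>y. \<phi> x y)"
  shows "sw (\<lambda>x u. sw (\<lambda>y z. \<phi> (x \<diamondop> S y) z) u) w = \<phi> oE w"
  by (subst sw_assoc[where t = t, symmetric], (intro lins lin_comp[OF 1] lin_comp[OF 2])+,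
      subst sw_S_right[OF 1], rule sw_eps_left[OF 2])

lemma sw_S_left_right:
  assumes 1: "\<And>y. lin sE t (\<lambda>x. \<phi> x y)" and 2: "\<And>x. lin sE t (\<lambda>y. \<phi> x y)"
  shows "sw (\<lambda>x u. sw (\<lambda>y z. \<phi> x (S y \<diamondop> z)) u) w = \<phi> w oE"
  by (subst sw_S_left[OF 2], rule sw_eps_right[OF 1])

lemma sw_S_right_right:
  assumes 1: "\<And>y. lin sE t (\<lambda>x. \<phi> x y)" and 2: "\<And>x. lin sE t (\<lambda>y. \<phi> x y)"
  shows "sw (\<lambda>x u. sw (\<lambda>y z. \<phi> x (y \<diamondop> S z)) u) w = \<phi> w oE"
  by (subst sw_S_right[OF 2], rule sw_eps_right[OF 1])

lemma S_one: "S oE = oE"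
proof -
  have "sw (\<lambda>x y. S x \<diamondop> y) oE = oE"
    using sw_S_left[OF lin_ident[OF vsE], of oE] by (simp add: eps_one vs_scale_one[OF vsE])
  moreover have "sw (\<lambda>x y. S x \<diamondop> y) oE = S oE \<diamondop> oE"
    by (rule sw_one[where t = sE]) (intro lins)+
  ultimately show ?thesis by (simp add: mE_one)
qed

lemma eps_S: "eps (S w) = eps w"
proof -
  have "eps (S w) = sw (\<lambda>x y. eps y * eps (S x)) w"
    by (rule sw_eps_right[symmetric]) (intro lins)
  also have "\<dots> = sw (\<lambda>x y. eps (S x \<diamondop> y)) w" by (simp add: eps_mult mult.commute)
  also have "\<dots> = eps w" using sw_S_left[OF eps_lin] by (simp add: eps_one)
  finally show ?thesis .
qed

text \<open>Both sides are convolution inverses of the multiplication. The element \<open>?Q\<close>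
  is S(x1 y1) x2 y2 S(y3) S(x3): cancelling from the right end leaves S(xy), cancelling from the
  left end leaves S(y) S(x).\<close>

lemma S_mult: "S (x \<diamondop> y) = S y \<diamondop> S x"
proof -
  let ?Q = "sw (\<lambda>x1 x'. sw (\<lambda>x2 x3. sw (\<lambda>y1 y'. sw (\<lambda>y2 y3. S (x1 \<diamondop> y1) \<diamondop> (x2 \<diamondop> (y2 \<diamondop> S y3) \<diamondop> S x3)) y') y) x') x"
  have "?Q = sw (\<lambda>x1 x'. sw (\<lambda>x2 x3. S (x1 \<diamondop> y) \<diamondop> (x2 \<diamondop> oE \<diamondop> S x3)) x') x"
    by (intro tsum_cong sw_S_right_right[where t = sE]) (intro lins)+
  also have "\<dots> = sw (\<lambda>x1 x'. sw (\<lambda>x2 x3. S (x1 \<diamondop> y) \<diamondop> (x2 \<diamondop> S x3)) x') x" by (simp add: mE_one)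
  also have "\<dots> = S (x \<diamondop> y) \<diamondop> oE"
    by (rule sw_S_right_right[where t = sE]) (intro lins)+
  finally have 1: "?Q = S (x \<diamondop> y)" by (simp add: mE_one)
  have "?Q = sw (\<lambda>x1 x'. sw (\<lambda>x2 x3. sw (\<lambda>v y3. sw (\<lambda>y1 y2. S (x1 \<diamondop> y1) \<diamondop> (x2 \<diamondop> (y2 \<diamondop> S y3) \<diamondop> S x3)) v) y) x') x"
    by (intro tsum_cong sw_assoc[where t = sE, symmetric]) (intro lins)+
  also have "\<dots> = sw (\<lambda>u x3. sw (\<lambda>x1 x2. sw (\<lambda>v y3. sw (\<lambda>y1 y2. S (x1 \<diamondop> y1) \<diamondop> (x2 \<diamondop> (y2 \<diamondop> S y3) \<diamondop> S x3)) v) y) u) x"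
    by (rule sw_assoc[where t = sE, symmetric]) (intro lins)+
  also have "\<dots> = sw (\<lambda>u x3. sw (\<lambda>v y3. sw (\<lambda>x1 x2. sw (\<lambda>y1 y2. S (x1 \<diamondop> y1) \<diamondop> (x2 \<diamondop> y2) \<diamondop> (S y3 \<diamondop> S x3)) v) u) y) x"
    by (subst tsum_swap) (simp add: mE_assoc)
  also have "\<dots> = sw (\<lambda>u x3. sw (\<lambda>v y3. sw (\<lambda>p q. S p \<diamondop> q \<diamondop> (S y3 \<diamondop> S x3)) (u \<diamondop> v)) y) x"
    by (intro tsum_cong sw_mult[where t = sE, symmetric]) (intro lins)+
  also have "\<dots> = sw (\<lambda>u x3. sw (\<lambda>v y3. sE (eps v) (sE (eps u) (S y3 \<diamondop> S x3))) y) x"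
    by (subst sw_S_left[where t = sE], intro lins)
       (simp add: eps_mult one_mE vs_scale_scale[OF vsE] mult.commute)
  also have "\<dots> = sw (\<lambda>u x3. sE (eps u) (S y \<diamondop> S x3)) x"
    by (intro tsum_cong sw_eps_left) (intro lins)
  also have "\<dots> = S y \<diamondop> S x"
    by (intro sw_eps_left) (intro lins)
  finally show ?thesis using 1 by simp
qed

text \<open>The same uniqueness of inverses, now for the coproduct and in the tensor square:
  \<open>?\<Phi> z a b\<close> is \<open>\<phi>\<close> evaluated at \<Delta>(z) (a \<otimes>
  b).\<close>

lemma sw_S:
  assumes 1: "\<And>y. lin sE t (\<lambda>x. \<phi> x y)" and 2: "\<And>x. lin sE t (\<lambda>y. \<phi> x y)"
  shows "sw \<phi> (S w) = sw (\<lambda>x y. \<phi> (S y) (S x)) w"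
proof -
  note lins' = lins lin_comp[OF 1] lin_comp[OF 2]
  let ?\<Phi> = "\<lambda>z a b. sw (\<lambda>p q. \<phi> (p \<diamondop> a) (q \<diamondop> b)) z"
  have vst: "vector_space t" using 1 lin_vs2 by blast
  have "sw (\<lambda>x y. \<phi> (S y) (S x)) w = sw (\<lambda>x y. ?\<Phi> oE (S y) (S x)) w"
    by (subst sw_one[where t = t], (intro lins')+) (simp add: one_mE)
  \<comment> \<open>The unit under \<Delta> is replaced by S(w1) w2. Multiplicativity then separates
    \<Delta>(S(w1)) from \<Delta>(w2), and the legs of w2 cancel against the two antipodes on the
    right.\<close>
  also have "\<dots> = sw (\<lambda>w1 r. sw (\<lambda>w2 r'. sw (\<lambda>x y. ?\<Phi> (S w1 \<diamondop> w2) (S y) (S x)) r') r) w"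
    by (rule sw_S_left_left[where t = t, symmetric]) (intro lins')+
  also have "\<dots> = sw (\<lambda>w1 r. sw (\<lambda>w2 r'. sw (\<lambda>x y. sw (\<lambda>p q. sw (\<lambda>c d. \<phi> (p \<diamondop> c \<diamondop> S y) (q \<diamondop> d \<diamondop> S x)) w2) (S w1)) r') r) w"
    by (intro tsum_cong sw_mult[where t = t]) (intro lins')+
  also have "\<dots> = sw (\<lambda>w1 r. sw (\<lambda>w2 r'. sw (\<lambda>p q. sw (\<lambda>x y. sw (\<lambda>c d. \<phi> (p \<diamondop> c \<diamondop> S y) (q \<diamondop> d \<diamondop> S x)) w2) r') (S w1)) r) w"
    by (intro tsum_cong tsum_swap)
  also have "\<dots> = sw (\<lambda>w1 r. sw (\<lambda>p q. sw (\<lambda>w2 r'. sw (\<lambda>x y. sw (\<lambda>c d. \<phi> (p \<diamondop> c \<diamondop> S y) (q \<diamondop> (d \<diamondop> S x))) w2) r') r) (S w1)) w"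
    unfolding mE_assoc by (intro tsum_cong tsum_swap)
  also have "\<dots> = sw (\<lambda>w1 r. sw (\<lambda>p q. sw (\<lambda>w2 r'. sw (\<lambda>c d. sw (\<lambda>x y. \<phi> (p \<diamondop> c \<diamondop> S y) (q \<diamondop> (d \<diamondop> S x))) r') w2) r) (S w1)) w"
    by (intro tsum_cong tsum_swap)
  also have "\<dots> = sw (\<lambda>w1 r. sw (\<lambda>p q. sw (\<lambda>c r'. sw (\<lambda>d r''. sw (\<lambda>x y. \<phi> (p \<diamondop> c \<diamondop> S y) (q \<diamondop> (d \<diamondop> S x))) r'') r') r) (S w1)) w"
    by (intro tsum_cong sw_assoc[where t = t]) (intro lins')+
  also have "\<dots> = sw (\<lambda>w1 r. sw (\<lambda>p q. sw (\<lambda>c r'. \<phi> (p \<diamondop> c \<diamondop> S r') (q \<diamondop> oE)) r) (S w1)) w"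
    by (intro tsum_cong sw_S_right_left[where t = t]) (intro lins')+
  also have "\<dots> = sw (\<lambda>w1 r. sw (\<lambda>p q. sw (\<lambda>c r'. \<phi> (p \<diamondop> (c \<diamondop> S r')) q) r) (S w1)) w"
    by (simp only: mE_assoc mE_one)
  also have "\<dots> = sw (\<lambda>w1 r. t (eps r) (sw \<phi> (S w1))) w"
    by (subst sw_S_right[where t = t], intro lins') (simp add: mE_one tsum_scale[OF vst])
  also have "\<dots> = sw \<phi> (S w)"
    by (rule sw_eps_right) (intro lins')
  finally show ?thesis ..
qed

section \<open>Injectivity of the antipode\<close>

definition tr :: "('e \<Rightarrow> 'e) \<Rightarrow> 'k" where "tr K = (\<Sum>k\<in>UNIV. cf k (K (bas E k)))"

lemma expand: "lin sE t G \<Longrightarrow> (\<Sum>k\<in>UNIV. t (cf k x) (G (bas E k))) = G x"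
proof -
  assume G: "lin sE t G"
  have "G x = G (\<Sum>k\<in>UNIV. sE (cf k x) (bas E k))" by (simp add: coord_expansion[OF based])
  also have "\<dots> = (\<Sum>k\<in>UNIV. t (cf k x) (G (bas E k)))" by (simp add: lin_setsum[OF G] lin_scl[OF G])
  finally show ?thesis ..
qed

text \<open>The hypothesis \<open>col\<close> says that K is colinear up to the square of the
  antipode, \<Delta>(K y) = S(S(y1)) \<otimes> K(y2). It makes x \<mapsto> tr(y \<mapsto> x K(y)) an
  invariant functional, that is, an integral on E.\<close>

lemma tr_coinvariant:
  assumes K: "lin sE sE K"
    and col: "\<And>F y. (\<And>y. lin sE sE (\<lambda>x. F x y)) \<Longrightarrow> (\<And>x. lin sE sE (\<lambda>y. F x y)) \<Longrightarrow>
      sw F (K y) = sw (\<lambda>y1 y2. F (S (S y1)) (K y2)) y"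
  shows "sw (\<lambda>x1 x2. sE (tr (\<lambda>y. x2 \<diamondop> K y)) x1) x = sE (tr (\<lambda>y. x \<diamondop> K y)) oE"
proof -
  note lins' = lins lin_comp[OF K]
  let ?M = "\<lambda>j. x \<diamondop> K (bas E j)"
  \<comment> \<open>By \<open>col\<close> the first leg of \<Delta>(x K(y2)) ends in S(S(y2));
    multiplied by S(y1) it contributes S(y1 S(y2)), which collapses. So x1 \<otimes> x2 K(y) is
    expressed through the coproduct of the single element x K(y2).\<close>
  have 1: "sw (\<lambda>x1 x2. sE (cf k (x2 \<diamondop> K y)) x1) x = sw (\<lambda>y1 y2. sw (\<lambda>p q. sE (cf k q) (p \<diamondop> S y1)) (x \<diamondop> K y2)) y" for k y
  proof -
    have "sw (\<lambda>y1 y2. sw (\<lambda>p q. sE (cf k q) (p \<diamondop> S y1)) (x \<diamondop> K y2)) y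
        = sw (\<lambda>y1 y2. sw (\<lambda>x1 x2. sw (\<lambda>p q. sE (cf k (x2 \<diamondop> q)) (x1 \<diamondop> p \<diamondop> S y1)) (K y2)) x) y"
      by (intro tsum_cong sw_mult[where t = sE]) (intro lins')+
    also have "\<dots> = sw (\<lambda>y1 y2. sw (\<lambda>x1 x2. sw (\<lambda>a b. sE (cf k (x2 \<diamondop> K b)) (x1 \<diamondop> S (S a) \<diamondop> S y1)) y2) x) y"
      by (intro tsum_cong col) (intro lins')+
    also have "\<dots> = sw (\<lambda>x1 x2. sw (\<lambda>y1 y2. sw (\<lambda>a b. sE (cf k (x2 \<diamondop> K b)) (x1 \<diamondop> S (S a) \<diamondop> S y1)) y2) y) x"
      by (rule tsum_swap)
    also have "\<dots> = sw (\<lambda>x1 x2. sw (\<lambda>y1 y2. sw (\<lambda>a b. sE (cf k (x2 \<diamondop> K b)) (x1 \<diamondop> S (y1 \<diamondop> S a))) y2) y) x"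
      by (simp add: S_mult mE_assoc)
    also have "\<dots> = sw (\<lambda>x1 x2. sE (cf k (x2 \<diamondop> K y)) (x1 \<diamondop> S oE)) x"
      by (intro tsum_cong sw_S_right_left[where t = sE]) (intro lins')+
    finally show ?thesis by (simp add: S_one mE_one)
  qed
  have "sw (\<lambda>x1 x2. sE (tr (\<lambda>y. x2 \<diamondop> K y)) x1) x = (\<Sum>k\<in>UNIV. sw (\<lambda>x1 x2. sE (cf k (x2 \<diamondop> K (bas E k))) x1) x)"
    by (simp add: tr_def vs_sum_scale[OF vsE] tsum_sum)
  also have "\<dots> = (\<Sum>k\<in>UNIV. sw (\<lambda>y1 y2. sw (\<lambda>p q. sE (cf k q) (p \<diamondop> S y1)) (x \<diamondop> K y2)) (bas E k))"
    by (simp add: 1)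
  also have "\<dots> = (\<Sum>k\<in>UNIV. sw (\<lambda>y1 y2. \<Sum>j\<in>UNIV. sE (cf j y2) (sw (\<lambda>p q. sE (cf k q) (p \<diamondop> S y1)) (?M j))) (bas E k))"
    by (intro sum.cong tsum_cong expand[symmetric] refl) (intro lins')
  also have "\<dots> = (\<Sum>k\<in>UNIV. \<Sum>j\<in>UNIV. sw (\<lambda>p q. sw (\<lambda>y1 y2. sE (cf k q) (sE (cf j y2) (p \<diamondop> S y1))) (bas E k)) (?M j))"
  proof -
    have "sw (\<lambda>y1 y2. sE (cf j y2) (sw (\<lambda>p q. sE (cf k q) (p \<diamondop> S y1)) m)) b
        = sw (\<lambda>y1 y2. sw (\<lambda>p q. sE (cf k q) (sE (cf j y2) (p \<diamondop> S y1))) m) b" for j k m b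
      by (simp add: vs_scale_scale[OF vsE] mult.commute flip: tsum_scale[OF vsE])
    also have "sw (\<lambda>y1 y2. sw (\<lambda>p q. sE (cf k q) (sE (cf j y2) (p \<diamondop> S y1))) m) b = sw (\<lambda>p q. sw (\<lambda>y1 y2. sE (cf k q) (sE (cf j y2) (p \<diamondop> S y1))) b) m" for j k m b
      by (rule tsum_swap)
    finally show ?thesis by (simp add: tsum_sum)
  qed
  \<comment> \<open>Exchanging the two basis sums is the cyclicity of the trace: the sum over k now
    reassembles q, whose first leg under S then cancels p.\<close>
  also have "\<dots> = (\<Sum>j\<in>UNIV. \<Sum>k\<in>UNIV. sw (\<lambda>p q. sE (cf k q) (sw (\<lambda>y1 y2. sE (cf j y2) (p \<diamondop> S y1)) (bas E k))) (?M j))"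
    by (subst sum.swap) (simp add: tsum_scale[OF vsE])
  also have "\<dots> = (\<Sum>j\<in>UNIV. sw (\<lambda>p q. sw (\<lambda>y1 y2. sE (cf j y2) (p \<diamondop> S y1)) q) (?M j))"
    by (simp flip: tsum_sum, subst expand, intro lins', rule refl)
  also have "\<dots> = (\<Sum>j\<in>UNIV. sE (cf j (?M j)) oE)"
    by (intro sum.cong sw_S_right_left[where t = sE] refl) (intro lins')+
  also have "\<dots> = sE (tr (\<lambda>y. x \<diamondop> K y)) oE"
    by (simp add: tr_def vs_sum_scale[OF vsE])
  finally show ?thesis .
qed

text \<open>
  Each functional \<open>x \<mapsto> tr(y \<mapsto> x S\<^sup>2(y\<^sub>1) e\<^sup>j(y\<^sub>2))\<close>, with \<open>(e\<^sub>j)\<close> the basis of \<open>E\<close>, is invariant; one of them is nonzero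
  because their values at \<open>S(e\<^sub>j)\<close> sum to the trace of \<open>y \<mapsto> \<epsilon>(y) 1\<close>, which is \<open>1\<close>.
\<close>

lemma integral_exists:
  "\<exists>L z. lin sE (*) L \<and> (\<forall>x. sw (\<lambda>x1 x2. sE (L x2) x1) x = sE (L x) oE) \<and> L z \<noteq> 0"
proof -
  let ?K = "\<lambda>j y. sw (\<lambda>y1 y2. sE (cf j y2) (S (S y1))) y"
  have K: "lin sE sE (?K j)" for j by (intro lins)
  have coinv: "sw (\<lambda>x1 x2. sE (tr (\<lambda>y. x2 \<diamondop> ?K j y)) x1) x = sE (tr (\<lambda>y. x \<diamondop> ?K j y)) oE" for j x
  proof (rule tr_coinvariant[OF K])
    fix F :: "'e \<Rightarrow> 'e \<Rightarrow> 'e" and y assume F: "\<And>y. lin sE sE (\<lambda>x. F x y)" "\<And>x. lin sE sE (\<lambda>y. F x y)"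
    note lins' = lins lin_comp[OF F(1)] lin_comp[OF F(2)]
    have l: "lin sE sE (\<lambda>z. sw F z)" by (intro lins')
    have "sw F (?K j y) = sw (\<lambda>y1 y2. sE (cf j y2) (sw F (S (S y1)))) y"
      by (simp add: lin_tsum[OF l] lin_scl[OF l])
    \<comment> \<open>The square of the antipode preserves the order of the legs, since each
      application of S reverses it.\<close>
    also have "\<dots> = sw (\<lambda>y1 y2. sE (cf j y2) (sw (\<lambda>a b. F (S (S a)) (S (S b))) y1)) y"
      by (subst sw_S[where t = sE], (intro lins')+, subst sw_S[where t = sE], (intro lins')+) (rule refl)
    also have "\<dots> = sw (\<lambda>y1 y2. sw (\<lambda>a b. sE (cf j y2) (F (S (S a)) (S (S b)))) y1) y"
      by (simp add: tsum_scale[OF vsE])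
    also have "\<dots> = sw (\<lambda>a r. sw (\<lambda>b y2. sE (cf j y2) (F (S (S a)) (S (S b)))) r) y"
      by (rule sw_assoc[where t = sE]) (intro lins')+
    also have "\<dots> = sw (\<lambda>y1 y2. F (S (S y1)) (?K j y2)) y"
      using F(2) by (simp add: lin_tsum[OF F(2)] lin_scl[OF F(2)])
    finally show "sw F (?K j y) = sw (\<lambda>y1 y2. F (S (S y1)) (?K j y2)) y" .
  qed
  have "(\<Sum>j\<in>UNIV. tr (\<lambda>y. S (bas E j) \<diamondop> ?K j y)) = tr (\<lambda>y. \<Sum>j\<in>UNIV. S (bas E j) \<diamondop> ?K j y)"
    unfolding tr_def by (subst sum.swap) (simp add: lin_setsum[OF coord_lin[OF based]])
  also have "\<dots> = tr (\<lambda>y. sE (eps y) oE)"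
  proof -
    have "(\<Sum>j\<in>UNIV. S (bas E j) \<diamondop> ?K j y) = sE (eps y) oE" for y
    proof -
      have l: "lin sE sE (\<lambda>z. S (bas E j) \<diamondop> z)" for j by (intro lins)
      have "(\<Sum>j\<in>UNIV. S (bas E j) \<diamondop> ?K j y) = sw (\<lambda>y1 y2. \<Sum>j\<in>UNIV. sE (cf j y2) (S (bas E j) \<diamondop> S (S y1))) y"
        by (simp add: lin_tsum[OF l] lin_scl[OF l] tsum_sum)
      also have "\<dots> = sw (\<lambda>y1 y2. S (S y1 \<diamondop> y2)) y"
        by (subst expand, intro lins) (simp add: S_mult)
      also have "\<dots> = sE (eps y) oE"
        using sw_S_left[OF S_lin] by (simp add: S_one)
      finally show ?thesis .
    qed
    then show ?thesis by simp
  qed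
  also have "\<dots> = 1"
  proof -
    have "tr (\<lambda>y. sE (eps y) oE) = (\<Sum>k\<in>UNIV. cf k oE * eps (bas E k))"
      by (simp add: tr_def lin_scl[OF coord_lin[OF based]] mult.commute)
    also have "\<dots> = eps oE" by (rule expand[OF eps_lin])
    finally show ?thesis by (simp add: eps_one)
  qed
  finally have "(\<Sum>j\<in>UNIV. tr (\<lambda>y. S (bas E j) \<diamondop> ?K j y)) \<noteq> 0" by simp
  then obtain j where j: "tr (\<lambda>y. S (bas E j) \<diamondop> ?K j y) \<noteq> 0"
    by (rule sum.not_neutral_contains_not_neutral)
  have "lin sE (*) (\<lambda>x. tr (\<lambda>y. x \<diamondop> ?K j y))"
    unfolding tr_def by (intro lin_sum lins)
  with coinv[of j] j show ?thesis by blast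
qed

text \<open>
  If \<open>S(h) = 0\<close>, invariance of \<open>L\<close> gives \<open>L(x S(h\<^sub>1)) h\<^sub>2 = 0\<close> for all \<open>x\<close>, whereas
  \<open>L(z) h = L(z S(h\<^sub>1 S(h\<^sub>2))) h\<^sub>3 = L(z S\<^sup>2(h\<^sub>2) S(h\<^sub>1)) h\<^sub>3\<close> is a combination of such terms.
\<close>

lemma S_inj: assumes h: "S h = 0" shows "h = 0"
proof -
  obtain L z where L: "lin sE (*) L" and co: "\<And>x. sw (\<lambda>x1 x2. sE (L x2) x1) x = sE (L x) oE" and z: "L z \<noteq> 0"
    using integral_exists by blast
  note lins' = lins lin_comp[OF L]
  have I: "sw (\<lambda>h1 h2. sE (L (x \<diamondop> S h1)) h2) h = 0" for x
  proof -
    have l: "lin sE sE (\<lambda>p. p \<diamondop> h2)" for h2 by (intro lins)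
    have "sw (\<lambda>h1 h2. sE (L (x \<diamondop> S h1)) h2) h = sw (\<lambda>h1 h2. sE (L (x \<diamondop> S h1)) oE \<diamondop> h2) h"
      by (simp add: lin_scl[OF l] one_mE)
    also have "\<dots> = sw (\<lambda>h1 h2. sw (\<lambda>x1 x2. sE (L x2) x1) (x \<diamondop> S h1) \<diamondop> h2) h"
      by (simp add: co)
    also have "\<dots> = sw (\<lambda>h1 h2. sw (\<lambda>x1 x2. sE (L x2) (x1 \<diamondop> h2)) (x \<diamondop> S h1)) h"
      by (simp add: lin_tsum[OF l] lin_scl[OF l])
    also have "\<dots> = sw (\<lambda>h1 h2. sw (\<lambda>x1 x2. sw (\<lambda>p q. sE (L (x2 \<diamondop> q)) (x1 \<diamondop> p \<diamondop> h2)) (S h1)) x) h"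
      by (intro tsum_cong sw_mult[where t = sE]) (intro lins')+
    also have "\<dots> = sw (\<lambda>h1 h2. sw (\<lambda>x1 x2. sw (\<lambda>a b. sE (L (x2 \<diamondop> S a)) (x1 \<diamondop> S b \<diamondop> h2)) h1) x) h"
      by (intro tsum_cong sw_S[where t = sE]) (intro lins')+
    also have "\<dots> = sw (\<lambda>x1 x2. sw (\<lambda>h1 h2. sw (\<lambda>a b. sE (L (x2 \<diamondop> S a)) (x1 \<diamondop> (S b \<diamondop> h2))) h1) h) x"
      unfolding mE_assoc by (rule tsum_swap)
    also have "\<dots> = sw (\<lambda>x1 x2. sw (\<lambda>a r. sw (\<lambda>b h2. sE (L (x2 \<diamondop> S a)) (x1 \<diamondop> (S b \<diamondop> h2))) r) h) x"
      by (intro tsum_cong sw_assoc[where t = sE]) (intro lins')+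
    \<comment> \<open>The antipode has reversed the legs of h1, so S(b) stands next to h2 and
      cancels with it. What remains under L contains S(h), which is zero.\<close>
    also have "\<dots> = sw (\<lambda>x1 x2. sE (L (x2 \<diamondop> S h)) (x1 \<diamondop> oE)) x"
      by (intro tsum_cong sw_S_left_right[where t = sE]) (intro lins')+
    also have "\<dots> = 0"
      using lin_zero[OF k_algebraD(6)[OF algE lin_ident[OF vsE]]] lin_zero[OF L]
      by (simp add: h vs_zero[OF vsE] tsum_def)
    finally show ?thesis .
  qed
  let ?G = "\<lambda>i r. sw (\<lambda>h2 h3. sE (cf i h2) h3) r"
  have G: "lin sE sE (?G i)" for i by (intro lins)
  have "sE (L z) h = sE (L (z \<diamondop> S oE)) h" by (simp add: S_one mE_one)
  also have "\<dots> = sw (\<lambda>h1 r. sw (\<lambda>h2 h3. sE (L (z \<diamondop> S (h1 \<diamondop> S h2))) h3) r) h"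
    by (rule sw_S_right_left[where t = sE, symmetric]) (intro lins')+
  also have "\<dots> = sw (\<lambda>h1 r. sw (\<lambda>h2 h3. \<Sum>i\<in>UNIV. sE (cf i h2) (sE (L (z \<diamondop> S (h1 \<diamondop> S (bas E i)))) h3)) r) h"
    by (intro tsum_cong expand[symmetric]) (intro lins')
  also have "\<dots> = (\<Sum>i\<in>UNIV. ?G i (sw (\<lambda>h1 r. sE (L (z \<diamondop> S (S (bas E i)) \<diamondop> S h1)) r) h))"
    by (simp add: lin_tsum[OF G] lin_scl[OF G] tsum_sum S_mult mE_assoc vs_scale_scale[OF vsE] mult.commute flip: tsum_scale[OF vsE])
  also have "\<dots> = 0" by (simp add: I lin_zero[OF G])
  finally have "sE (L z) h = 0" .
  then have "sE (inverse (L z)) (sE (L z) h) = 0" by (simp add: vs_zero[OF vsE])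
  then show "h = 0" using z by (simp add: vs_scale_scale[OF vsE] vs_scale_one[OF vsE])
qed

text \<open>An injective endomorphism of a finite dimensional space is onto. Injectivity gives
  \<open>the_inv S\<close> its meaning in the antipode of the double; surjectivity permits writing
  any element of E as S(t), which is how that inverse is eliminated.\<close>

lemma S_bij: "bij S"
proof -
  have inj: "inj S"
    by (rule injI) (metis S_inj lin_minus[OF S_lin] eq_iff_diff_eq_0)
  interpret finite_dimensional_vector_space sE "range (bas E)"
    using based unfolding finite_dimensional_vector_space_def finite_dimensional_vector_space_axioms_def is_based_def by simp
  have "surj S" using linear_inj_imp_surj[OF S_lin inj] .
  with inj show ?thesis by (simp add: bij_def)
qed

lemma the_inv_S [simp]: "the_inv S (S w) = w"
  using S_bij by (simp add: bij_def the_inv_f_f)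

section \<open>The dual and the Drinfeld double\<close>

abbreviation ED where "ED \<equiv> dual E"
abbreviation DD where "DD \<equiv> double E"
abbreviation ev' where "ev' \<equiv> ev E"
abbreviation dp where "dp \<equiv> dpure E"
abbreviation oED where "oED \<equiv> \<u>\<^bsub>ED\<^esub>"

lemma ev_lin: "lin sE (*) (ev' \<xi>)"
  unfolding ev_def by (intro lin_sum lins)

lemma ev_lin_left: "lin s (fscl (*)) f \<Longrightarrow> lin s (*) (\<lambda>z. ev' (f z) w)"
  unfolding ev_def by (intro lin_sum lin_mult_right lin_fun_apply[OF vs_field])

lemma to_dual_lin: "(\<And>x. lin s (*) (\<lambda>z. f z x)) \<Longrightarrow> lin s (fscl (*)) (\<lambda>z. to_dual E (f z))"
  unfolding to_dual_def by (rule lin_fun) (auto intro: lin_vs1 vs_field)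

lemma ev_to_dual: "lin sE (*) \<phi> \<Longrightarrow> ev' (to_dual E \<phi>) w = \<phi> w"
  unfolding ev_def to_dual_def using expand[of "(*)" \<phi> w] by (simp add: mult.commute)

lemma ev_bas: "ev' \<xi> (bas E i) = \<xi> i"
  by (simp add: ev_def coord_bas[OF based] sum_mult_unit)

lemma ev_ext: "(\<And>w. ev' \<xi> w = ev' \<eta> w) \<Longrightarrow> \<xi> = \<eta>"
  by (metis ev_bas ext)

lemma dual_scl [simp]: "scl ED = fscl (*)" by (simp add: dual_def)

lemma dual_bas: "bas ED j = (\<lambda>i. if i = j then 1 else 0)" by (simp add: dual_def)

lemma ev_dual_bas: "ev' (bas ED j) w = cf j w"
  using sum_mult_unit(2)[of "\<lambda>i. cf i w" j] by (simp add: ev_def dual_bas mult.commute)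

lemma ev_dual_mult: "ev' (\<xi> \<bullet>\<^bsub>ED\<^esub> \<eta>) w = sw (\<lambda>w1 w2. ev' \<xi> w1 * ev' \<eta> w2) w"
  by (simp add: dual_def ev_to_dual lins lin_comp[OF ev_lin])

lemma ev_dual_one: "ev' oED w = eps w"
  by (simp add: dual_def ev_to_dual eps_lin)

lemma ev_dual_cop: "ev' (cop ED \<xi> j) v = ev' \<xi> (v \<diamondop> bas E j)"
  by (simp add: dual_def ev_to_dual lins lin_comp[OF ev_lin])

lemma ev_dual_anti: "ev' (anti ED \<xi>) v = ev' \<xi> (S v)"
  by (simp add: dual_def ev_to_dual lins lin_comp[OF ev_lin] S_lin)

lemma dual_cou: "cou ED \<xi> = ev' \<xi> oE" by (simp add: dual_def)

text \<open>The second tensor factors in the encoding of \<open>cop ED \<xi>\<close> are dual basis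
  vectors, so the sum expands y in the basis. The rule trades a product in E for a coproduct in the
  dual, in both directions.\<close>

lemma tsum_dual_cop: "tsum ED (\<lambda>\<xi>1 \<xi>2. ev' \<xi>1 x * ev' \<xi>2 y) (cop ED \<xi>) = ev' \<xi> (x \<diamondop> y)"
  using expand[OF lin_comp[OF ev_lin], of "\<lambda>y. x \<diamondop> y" y \<xi>]
  by (simp add: tsum_def ev_dual_cop ev_dual_bas mult.commute lins)

lemma vs_dual: "vector_space (scl ED)" by (simp add: vs_fscl vs_field)

lemma sum_fun_apply: "(\<Sum>i\<in>I. f i) x = (\<Sum>i\<in>I. f i x :: 'x::comm_monoid_add)"
  by (induction I rule: infinite_finite_induct) auto

lemma dual_based: "is_based ED" and dual_coord: "coord ED \<xi> i = \<xi> i"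
proof -
  have 1: "lin (scl ED) (*) (\<lambda>v. v i)" for i
    using lin_fun_apply[OF vs_field lin_ident[OF vs_fscl[OF vs_field]]] by simp
  have 2: "(\<Sum>i\<in>UNIV. scl ED (v i) (bas ED i)) = v" for v
    using sum_mult_unit(1)[of v] by (auto simp: sum_fun_apply fscl_def dual_bas fun_eq_iff)
  show "is_based ED" "coord ED \<xi> i = \<xi> i"
    using is_basedI[where c = "\<lambda>v i. v i", OF vs_dual 1 2] by (auto simp: dual_bas)
qed

lemma dual_alg: "k_algebra ED"
proof (rule k_algebraI)
  note lins' = lins lin_comp[OF ev_lin]
  show "lin (scl ED) (scl ED) (\<lambda>x. x \<bullet>\<^bsub>ED\<^esub> y)" for y
    by (simp add: dual_def) (intro to_dual_lin lins' ev_lin_left lin_ident vs_fscl vs_field)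
  show "lin (scl ED) (scl ED) (\<lambda>y. x \<bullet>\<^bsub>ED\<^esub> y)" for x
    by (simp add: dual_def) (intro to_dual_lin lins' ev_lin_left lin_ident vs_fscl vs_field)
  fix x y z
  show "x \<bullet>\<^bsub>ED\<^esub> y \<bullet>\<^bsub>ED\<^esub> z = x \<bullet>\<^bsub>ED\<^esub> (y \<bullet>\<^bsub>ED\<^esub> z)"
  proof (rule ev_ext)
    fix w
    have "ev' (x \<bullet>\<^bsub>ED\<^esub> y \<bullet>\<^bsub>ED\<^esub> z) w = sw (\<lambda>u w3. sw (\<lambda>w1 w2. ev' x w1 * ev' y w2 * ev' z w3) u) w"
      by (simp add: ev_dual_mult tsum_def sum_distrib_right)
    also have "\<dots> = sw (\<lambda>w1 u. sw (\<lambda>w2 w3. ev' x w1 * ev' y w2 * ev' z w3) u) w"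
      by (rule sw_assoc[where t = "(*)"]) (intro lins')+
    also have "\<dots> = ev' (x \<bullet>\<^bsub>ED\<^esub> (y \<bullet>\<^bsub>ED\<^esub> z)) w"
      by (simp add: ev_dual_mult tsum_def sum_distrib_left mult.assoc)
    finally show "ev' (x \<bullet>\<^bsub>ED\<^esub> y \<bullet>\<^bsub>ED\<^esub> z) w = ev' (x \<bullet>\<^bsub>ED\<^esub> (y \<bullet>\<^bsub>ED\<^esub> z)) w" .
  qed
  show "oED \<bullet>\<^bsub>ED\<^esub> x = x"
    by (rule ev_ext) (simp add: ev_dual_mult ev_dual_one sw_eps_left[OF ev_lin])
  show "x \<bullet>\<^bsub>ED\<^esub> oED = x"
    by (rule ev_ext) (simp add: ev_dual_mult ev_dual_one sw_eps_right[OF ev_lin] mult.commute)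
qed

lemmas linsd = lins lin_comp[OF ev_lin] ev_lin_left to_dual_lin
  lin_ident[OF vs_dual, simplified] k_algebraD(5)[OF dual_alg, simplified] k_algebraD(6)[OF dual_alg, simplified]

section \<open>The double as an associative algebra\<close>

lemma dp_eq: "dp w \<xi> = (\<lambda>i. sE (\<xi> i) w)"
  by (simp add: dpure_def tens_def dual_coord)

lemma dp_lin_left: "lin s sE f \<Longrightarrow> lin s (fscl sE) (\<lambda>z. dp (f z) \<xi>)"
  unfolding dpure_def by (rule lin_tens_left[OF vsE])

lemma dp_lin_right: "lin s (fscl (*)) f \<Longrightarrow> lin s (fscl sE) (\<lambda>z. dp w (f z))"
  unfolding dpure_def by (rule lin_tens_right[OF dual_based vsE]) simp

lemma D_tsum_dp:
  assumes "\<And>\<xi>. lin sE t (\<lambda>w. \<phi> w \<xi>)" "\<And>w. lin (fscl (*)) t (\<phi> w)"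
  shows "tsum ED \<phi> (dp w \<xi>) = \<phi> w \<xi>"
  unfolding dpure_def by (rule tsum_tens'[OF dual_based]) (use assms in auto)

lemma D_ext:
  assumes "lin (fscl sE) t F" "lin (fscl sE) t G" "\<And>w \<xi>. F (dp w \<xi>) = G (dp w \<xi>)"
  shows "F d = G d"
  using tensor_ext[OF dual_based vsE assms(1,2)] assms(3) unfolding dpure_def by blast

lemma DD_simps [simp]: "scl DD = fscl sE" "\<u>\<^bsub>DD\<^esub> = dp oE oED"
  "bas DD = (\<lambda>(j, i). dp (bas E j) (bas ED i))"
  by (simp_all add: double_def double_alg_def Let_def)

lemma vs_DD: "vector_space (fscl sE)" by (rule vs_fscl[OF vsE])

text \<open>An element of the double is a family of vectors of E, so its coordinate at (j, i) is the
  j-th coordinate of the i-th vector.\<close>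

lemma DD_based: "is_based DD"
proof -
  let ?c = "\<lambda>d (j, i). cf j (d i)"
  have vs: "vector_space (scl DD)" by (simp add: vs_DD)
  have 1: "lin (scl DD) (*) (\<lambda>d. ?c d p)" for p
    using lin_comp[OF coord_lin[OF based] lin_fun_apply[OF vsE lin_ident[OF vs_DD]]]
    by (cases p) simp
  have 2: "(\<Sum>p\<in>UNIV. scl DD (?c d p) (bas DD p)) = d" for d
  proof
    fix k
    have "(\<Sum>p\<in>UNIV. scl DD (?c d p) (bas DD p)) k = (\<Sum>(j, i)\<in>UNIV. sE (if k = i then 1 else 0) (sE (cf j (d i)) (bas E j)))"
      by (simp add: sum_fun_apply fscl_def split_beta dp_eq dual_bas vs_scale_scale[OF vsE] mult.commute)
    also have "\<dots> = (\<Sum>j\<in>UNIV. \<Sum>i\<in>UNIV. sE (if k = i then 1 else 0) (sE (cf j (d i)) (bas E j)))"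
      by (simp add: sum.cartesian_product)
    also have "\<dots> = (\<Sum>i\<in>UNIV. sE (if k = i then 1 else 0) (d i))"
      by (subst sum.swap) (simp add: coord_expansion[OF based] flip: vs_scale_sum[OF vsE])
    also have "\<dots> = (\<Sum>i\<in>UNIV. if k = i then d i else 0)"
      by (intro sum.cong) (auto simp: vs_scale_one[OF vsE] vs_zero[OF vsE])
    finally show "(\<Sum>p\<in>UNIV. scl DD (?c d p) (bas DD p)) k = d k" by simp
  qed
  have 3: "?c (bas DD q) p = (if p = q then 1 else 0)" for p q
    by (cases p; cases q) (simp add: dp_eq dual_bas lin_scl[OF coord_lin[OF based]] coord_bas[OF based])
  show "is_based DD" by (rule is_basedI(1)[where c = ?c, OF vs 1 2 3])
qed

lemma DD_mult_def: "d \<bullet>\<^bsub>DD\<^esub> d' = tsum ED (\<lambda>w \<xi>. tsum ED (\<lambda>v \<eta>. sw (\<lambda>u v3. sw (\<lambda>v1 v2.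
   dp (v2 \<diamondop> w) (to_dual E (\<lambda>x. ev' \<xi> (S v1 \<diamondop> x \<diamondop> v3)) \<bullet>\<^bsub>ED\<^esub> \<eta>)) u) v) d') d"
  by (simp add: double_def Let_def double_alg_def)

lemma DD_mult_lin:
  shows "lin s (fscl sE) f \<Longrightarrow> lin s (fscl sE) (\<lambda>z. f z \<bullet>\<^bsub>DD\<^esub> d)"
    and "lin s (fscl sE) f \<Longrightarrow> lin s (fscl sE) (\<lambda>z. d \<bullet>\<^bsub>DD\<^esub> f z)"
  unfolding DD_mult_def
  by (rule lin_tsum_arg[OF _ vsE], assumption, intro lin_tsum_fun linsd dp_lin_left dp_lin_right)
     (rule lin_tsum_fun, rule lin_tsum_arg[OF _ vsE], assumption, intro lin_tsum_fun linsd dp_lin_left dp_lin_right)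

lemmas linsD = linsd dp_lin_left dp_lin_right DD_mult_lin lin_ident[OF vs_DD]

lemma DD_mult_dp: "dp w \<xi> \<bullet>\<^bsub>DD\<^esub> dp v \<eta> = sw (\<lambda>u v3. sw (\<lambda>v1 v2.
   dp (v2 \<diamondop> w) (to_dual E (\<lambda>x. ev' \<xi> (S v1 \<diamondop> x \<diamondop> v3)) \<bullet>\<^bsub>ED\<^esub> \<eta>)) u) v"
  unfolding DD_mult_def
  by (subst D_tsum_dp[where t = "fscl sE"], (intro linsD)+, subst D_tsum_dp[where t = "fscl sE"], (intro linsD)+) (rule refl)

text \<open>
  An element of the double, read as an endomorphism of \<open>E\<close>. The product becomes a convolution twisted by
  the adjoint operation below, which makes associativity accessible.
\<close>

definition td :: "('i \<Rightarrow> 'e) \<Rightarrow> 'e \<Rightarrow> 'e" where "td d x = (\<Sum>i\<in>UNIV. sE (cf i x) (d i))"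

lemma td_lin: "lin s sE f \<Longrightarrow> lin s sE (\<lambda>z. td d (f z))"
  and td_lin_left: "lin s (fscl sE) g \<Longrightarrow> lin s sE (\<lambda>z. td (g z) x)"
  unfolding td_def by (intro lin_sum lins, assumption) (intro lin_sum lins lin_fun_apply[OF vsE], assumption)

lemma td_dp: "td (dp w \<xi>) x = sE (ev' \<xi> x) w"
  by (simp add: td_def dp_eq ev_def vs_sum_scale[OF vsE] vs_scale_scale[OF vsE] mult.commute)

lemma td_bas: "td d (bas E i) = d i"
proof -
  have "td d (bas E i) = (\<Sum>j\<in>UNIV. if j = i then d j else 0)" unfolding td_def
    by (intro sum.cong) (auto simp: coord_bas[OF based] vs_zero[OF vsE] vs_scale_one[OF vsE])
  then show ?thesis by simp
qed

lemma td_ext: "(\<And>x. td d x = td d' x) \<Longrightarrow> d = d'"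
  by (metis td_bas ext)

abbreviation adj where "adj f v x \<equiv> sw (\<lambda>u v3. sw (\<lambda>v1 v2. v2 \<diamondop> f (S v1 \<diamondop> x \<diamondop> v3)) u) v"

lemmas linst = linsD td_lin td_lin_left

text \<open>Both sides are bilinear, so pure factors suffice. For d = w \<xi> and d' = v \<eta> the
  exchange relation contributes v2 w with weight \<xi>(S(v1) x1 v3), which is \<open>adj\<close> of
  the operator of d along v.\<close>

lemma td_mult: "td (d \<bullet>\<^bsub>DD\<^esub> d') x = sw (\<lambda>x1 x2. adj (td d) (td d' x2) x1) x"
proof (rule D_ext[where t = sE and d = d])
  show "lin (fscl sE) sE (\<lambda>d. td (d \<bullet>\<^bsub>DD\<^esub> d') x)" by (intro linst)
  show "lin (fscl sE) sE (\<lambda>d. sw (\<lambda>x1 x2. adj (td d) (td d' x2) x1) x)" by (intro linst)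
  fix w \<xi>
  show "td (dp w \<xi> \<bullet>\<^bsub>DD\<^esub> d') x = sw (\<lambda>x1 x2. adj (td (dp w \<xi>)) (td d' x2) x1) x"
  proof (rule D_ext[where t = sE and d = d'])
    show "lin (fscl sE) sE (\<lambda>d'. td (dp w \<xi> \<bullet>\<^bsub>DD\<^esub> d') x)" by (intro linst)
    show "lin (fscl sE) sE (\<lambda>d'. sw (\<lambda>x1 x2. adj (td (dp w \<xi>)) (td d' x2) x1) x)" by (intro linst)
    fix v \<eta>
    have l: "lin (fscl sE) sE (\<lambda>d. td d x)" by (intro linst)
    have "td (dp w \<xi> \<bullet>\<^bsub>DD\<^esub> dp v \<eta>) x = sw (\<lambda>u v3. sw (\<lambda>v1 v2. sw (\<lambda>x1 x2. sE (ev' \<eta> x2) (sE (ev' \<xi> (S v1 \<diamondop> x1 \<diamondop> v3)) (v2 \<diamondop> w))) x) u) v"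
      by (simp add: DD_mult_dp lin_tsum[OF l] td_dp ev_dual_mult ev_to_dual linsd vs_scale_scale[OF vsE] mult.commute)
         (simp add: tsum_def vs_sum_scale[OF vsE])
    also have "\<dots> = sw (\<lambda>u v3. sw (\<lambda>x1 x2. sw (\<lambda>v1 v2. sE (ev' \<eta> x2) (sE (ev' \<xi> (S v1 \<diamondop> x1 \<diamondop> v3)) (v2 \<diamondop> w))) u) x) v"
      by (intro tsum_cong tsum_swap)
    also have "\<dots> = sw (\<lambda>x1 x2. sw (\<lambda>u v3. sw (\<lambda>v1 v2. sE (ev' \<eta> x2) (sE (ev' \<xi> (S v1 \<diamondop> x1 \<diamondop> v3)) (v2 \<diamondop> w))) u) v) x"
      by (rule tsum_swap)
    also have "\<dots> = sw (\<lambda>x1 x2. sE (ev' \<eta> x2) (adj (td (dp w \<xi>)) v x1)) x"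
      by (simp add: tsum_scale[OF vsE] td_dp lin_scl[OF k_algebraD(6)[OF algE lin_ident[OF vsE]]])
    also have "\<dots> = sw (\<lambda>x1 x2. adj (td (dp w \<xi>)) (td (dp v \<eta>) x2) x1) x"
    proof (intro tsum_cong)
      fix x1 x2
      have "lin sE sE (\<lambda>v. adj (td (dp w \<xi>)) v x1)" by (intro linst)
      from lin_scl[OF this] show "sE (ev' \<eta> x2) (adj (td (dp w \<xi>)) v x1) = adj (td (dp w \<xi>)) (td (dp v \<eta>) x2) x1"
        by (simp add: td_dp)
    qed
    finally show "td (dp w \<xi> \<bullet>\<^bsub>DD\<^esub> dp v \<eta>) x = sw (\<lambda>x1 x2. adj (td (dp w \<xi>)) (td (dp v \<eta>) x2) x1) x" .
  qed
qed

lemma adj_one: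
  assumes f: "lin sE sE f" shows "adj f oE x = f x"
  by (subst sw_one[where t = sE], (intro lins lin_comp[OF f])+, subst sw_one[where t = sE], (intro lins lin_comp[OF f])+)
     (simp add: S_one mE_one one_mE)

text \<open>\<open>adj\<close> is an action of E on its linear endomorphisms, because \<Delta> is
  multiplicative and S reverses products.\<close>

lemma adj_mult:
  assumes f: "lin sE sE f"
  shows "adj f (v \<diamondop> q) x = adj (adj f q) v x"
proof -
  note lins' = lins lin_comp[OF f]
  have "adj f (v \<diamondop> q) x = sw (\<lambda>u v3. sw (\<lambda>p q3. sw (\<lambda>v1 v2. v2 \<diamondop> f (S v1 \<diamondop> x \<diamondop> (v3 \<diamondop> q3))) (u \<diamondop> p)) q) v"
    by (rule sw_mult[where t = sE]) (intro lins')+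
  also have "\<dots> = sw (\<lambda>u v3. sw (\<lambda>p q3. sw (\<lambda>v1 v2. sw (\<lambda>q1 q2. v2 \<diamondop> q2 \<diamondop> f (S (v1 \<diamondop> q1) \<diamondop> x \<diamondop> (v3 \<diamondop> q3))) p) u) q) v"
    by (intro tsum_cong sw_mult[where t = sE]) (intro lins')+
  also have "\<dots> = sw (\<lambda>u v3. sw (\<lambda>v1 v2. sw (\<lambda>p q3. sw (\<lambda>q1 q2. v2 \<diamondop> q2 \<diamondop> f (S (v1 \<diamondop> q1) \<diamondop> x \<diamondop> (v3 \<diamondop> q3))) p) q) u) v"
    by (intro tsum_cong tsum_swap)
  also have "\<dots> = adj (adj f q) v x"
    by (simp add: S_mult mE_assoc lin_tsum[OF k_algebraD(6)[OF algE lin_ident[OF vsE]]])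
  finally show ?thesis .
qed

text \<open>How the adjoint action meets a convolution of two operators: v is split for the second
  argument, and its middle leg is split again for the first. Both sides are reduced to one normal
  form in the five consecutive legs a, b, m, c, d of v, recorded by \<open>G\<close>.\<close>

lemma adj_sw:
  assumes F: "\<And>y. lin sE sE (\<lambda>x. F x y)" "\<And>x. lin sE sE (\<lambda>y. F x y)"
  shows "adj (sw F) v x = sw (\<lambda>x1 x2. sw (\<lambda>u v3. sw (\<lambda>v1 v2. sw (\<lambda>t r. sw (\<lambda>p q. q \<diamondop> F (S p \<diamondop> x1 \<diamondop> r) (S v1 \<diamondop> x2 \<diamondop> v3)) t) v2) u) v) x"
proof -
  note lins' = lins lin_comp[OF F(1)] lin_comp[OF F(2)]
  define G where "G x1 x2 a b m c d = m \<diamondop> F (S b \<diamondop> x1 \<diamondop> c) (S a \<diamondop> x2 \<diamondop> d)" for x1 x2 a b m c d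
  have G: "lin sE sE (\<lambda>z. G x1 x2 z b m c d)" "lin sE sE (\<lambda>z. G x1 x2 a z m c d)" "lin sE sE (\<lambda>z. G x1 x2 a b z c d)"
     "lin sE sE (\<lambda>z. G x1 x2 a b m z d)" "lin sE sE (\<lambda>z. G x1 x2 a b m c z)" for x1 x2 a b m c d
    unfolding G_def by (intro lins')+
  note linsG = lins G[THEN lin_comp]
  note asc = sw_assoc[where t = sE]
  have "adj (sw F) v x = sw (\<lambda>u v3. sw (\<lambda>v1 v2. v2 \<diamondop> sw (\<lambda>y1 y2. sw (\<lambda>c d. F (y1 \<diamondop> c) (y2 \<diamondop> d)) v3) (S v1 \<diamondop> x)) u) v"
    by (subst sw_mult[where t = sE and \<phi> = F], (intro lins')+) (rule refl)
  also have "\<dots> = sw (\<lambda>u v3. sw (\<lambda>v1 v2. v2 \<diamondop> sw (\<lambda>y1 y2. sw (\<lambda>x1 x2. sw (\<lambda>c d. F (y1 \<diamondop> x1 \<diamondop> c) (y2 \<diamondop> x2 \<diamondop> d)) v3) x) (S v1)) u) v"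
    by (subst sw_mult[where t = sE], (intro lins')+) (rule refl)
  also have "\<dots> = sw (\<lambda>u v3. sw (\<lambda>v1 v2. v2 \<diamondop> sw (\<lambda>a b. sw (\<lambda>x1 x2. sw (\<lambda>c d. F (S b \<diamondop> x1 \<diamondop> c) (S a \<diamondop> x2 \<diamondop> d)) v3) x) v1) u) v"
    by (subst sw_S[where t = sE], (intro lins')+) (rule refl)
  also have "\<dots> = sw (\<lambda>u v3. sw (\<lambda>v1 v2. sw (\<lambda>a b. sw (\<lambda>x1 x2. sw (\<lambda>c d. G x1 x2 a b v2 c d) v3) x) v1) u) v"
    unfolding G_def by (simp add: lin_tsum[OF k_algebraD(6)[OF algE lin_ident[OF vsE]]])
  also have "\<dots> = sw (\<lambda>u v3. sw (\<lambda>v1 v2. sw (\<lambda>x1 x2. sw (\<lambda>a b. sw (\<lambda>c d. G x1 x2 a b v2 c d) v3) v1) x) u) v"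
    by (intro tsum_cong tsum_swap)
  also have "\<dots> = sw (\<lambda>u v3. sw (\<lambda>x1 x2. sw (\<lambda>v1 v2. sw (\<lambda>a b. sw (\<lambda>c d. G x1 x2 a b v2 c d) v3) v1) u) x) v"
    by (intro tsum_cong tsum_swap)
  also have "\<dots> = sw (\<lambda>x1 x2. sw (\<lambda>u v3. sw (\<lambda>v1 v2. sw (\<lambda>a b. sw (\<lambda>c d. G x1 x2 a b v2 c d) v3) v1) u) v) x"
    by (rule tsum_swap)
  also have "\<dots> = sw (\<lambda>x1 x2. sw (\<lambda>u v3. sw (\<lambda>a r. sw (\<lambda>b m. sw (\<lambda>c d. G x1 x2 a b m c d) v3) r) u) v) x"
    by (intro tsum_cong asc) (intro linsG)+
  also have "\<dots> = sw (\<lambda>x1 x2. sw (\<lambda>a s. sw (\<lambda>r v3. sw (\<lambda>b m. sw (\<lambda>c d. G x1 x2 a b m c d) v3) r) s) v) x"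
    by (intro tsum_cong asc) (intro linsG)+
  also have "\<dots> = sw (\<lambda>x1 x2. sw (\<lambda>a s. sw (\<lambda>b s'. sw (\<lambda>m v3. sw (\<lambda>c d. G x1 x2 a b m c d) v3) s') s) v) x"
    by (intro tsum_cong asc) (intro linsG)+
  finally have 1: "adj (sw F) v x = \<dots>" .
  have "sw (\<lambda>x1 x2. sw (\<lambda>u v3. sw (\<lambda>v1 v2. sw (\<lambda>t r. sw (\<lambda>p q. G x1 x2 v1 p q r v3) t) v2) u) v) x
    = sw (\<lambda>x1 x2. sw (\<lambda>v1 s. sw (\<lambda>v2 v3. sw (\<lambda>t r. sw (\<lambda>p q. G x1 x2 v1 p q r v3) t) v2) s) v) x"
    by (intro tsum_cong asc) (intro linsG)+
  also have "\<dots> = sw (\<lambda>x1 x2. sw (\<lambda>v1 s. sw (\<lambda>v2 v3. sw (\<lambda>p t. sw (\<lambda>q r. G x1 x2 v1 p q r v3) t) v2) s) v) x"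
    by (intro tsum_cong asc) (intro linsG)+
  also have "\<dots> = sw (\<lambda>x1 x2. sw (\<lambda>v1 s. sw (\<lambda>p s'. sw (\<lambda>t v3. sw (\<lambda>q r. G x1 x2 v1 p q r v3) t) s') s) v) x"
    by (intro tsum_cong asc) (intro linsG)+
  also have "\<dots> = sw (\<lambda>x1 x2. sw (\<lambda>v1 s. sw (\<lambda>p s'. sw (\<lambda>q s''. sw (\<lambda>r v3. G x1 x2 v1 p q r v3) s'') s') s) v) x"
    by (intro tsum_cong asc) (intro linsG)+
  finally show ?thesis using 1 by (simp add: G_def)
qed

lemma DD_alg: "k_algebra DD"
proof (rule k_algebraI)
  show "lin (scl DD) (scl DD) (\<lambda>x. x \<bullet>\<^bsub>DD\<^esub> y)" "lin (scl DD) (scl DD) (\<lambda>x. y \<bullet>\<^bsub>DD\<^esub> x)" for y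
    unfolding DD_simps by (intro linsD)+
  fix d d' d''
  note lins' = lins td_lin
  show "d \<bullet>\<^bsub>DD\<^esub> d' \<bullet>\<^bsub>DD\<^esub> d'' = d \<bullet>\<^bsub>DD\<^esub> (d' \<bullet>\<^bsub>DD\<^esub> d'')"
  proof (rule td_ext)
    fix x
    \<comment> \<open>Acting by v on the operator of d d' gives the formula of
      \<open>td_mult\<close> with v acting on the operator of d' instead. Associativity then reduces
      to coassociativity in the argument x.\<close>
    have K: "adj (td (d \<bullet>\<^bsub>DD\<^esub> d')) v x = sw (\<lambda>x1 x2. adj (td d) (adj (td d') v x2) x1) x" for v x
    proof -
      have "adj (td (d \<bullet>\<^bsub>DD\<^esub> d')) v x = adj (sw (\<lambda>z1 z2. adj (td d) (td d' z2) z1)) v x" by (simp only: td_mult)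
      also have "\<dots> = sw (\<lambda>x1 x2. sw (\<lambda>u v3. sw (\<lambda>v1 v2. sw (\<lambda>t r. sw (\<lambda>p q. q \<diamondop>
           adj (td d) (td d' (S v1 \<diamondop> x2 \<diamondop> v3)) (S p \<diamondop> x1 \<diamondop> r)) t) v2) u) v) x"
        by (rule adj_sw) (intro lins')+
      also have "\<dots> = sw (\<lambda>x1 x2. sw (\<lambda>u v3. sw (\<lambda>v1 v2. adj (td d) (v2 \<diamondop> td d' (S v1 \<diamondop> x2 \<diamondop> v3)) x1) u) v) x"
        by (subst adj_mult, intro lins') (rule refl)
      also have "\<dots> = sw (\<lambda>x1 x2. adj (td d) (adj (td d') v x2) x1) x"
      proof (intro tsum_cong)
        fix x1 x2
        have "lin sE sE (\<lambda>q. adj (td d) q x1)" by (intro lins')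
        note l = lin_tsum[OF this]
        show "sw (\<lambda>u v3. sw (\<lambda>v1 v2. adj (td d) (v2 \<diamondop> td d' (S v1 \<diamondop> x2 \<diamondop> v3)) x1) u) v = adj (td d) (adj (td d') v x2) x1"
          by (simp only: l)
      qed
      finally show ?thesis .
    qed
    have "td (d \<bullet>\<^bsub>DD\<^esub> d' \<bullet>\<^bsub>DD\<^esub> d'') x = sw (\<lambda>u x3. sw (\<lambda>x1 x2. adj (td d) (adj (td d') (td d'' x3) x2) x1) u) x"
      by (simp only: td_mult[of "d \<bullet>\<^bsub>DD\<^esub> d'"] K)
    also have "\<dots> = sw (\<lambda>x1 u. sw (\<lambda>x2 x3. adj (td d) (adj (td d') (td d'' x3) x2) x1) u) x"
      by (rule sw_assoc[where t = sE]) (intro lins')+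
    also have "\<dots> = sw (\<lambda>x1 u. adj (td d) (sw (\<lambda>x2 x3. adj (td d') (td d'' x3) x2) u) x1) x"
    proof (intro tsum_cong)
      fix x1 u
      have "lin sE sE (\<lambda>q. adj (td d) q x1)" by (intro lins')
      note l = lin_tsum[OF this]
      show "sw (\<lambda>x2 x3. adj (td d) (adj (td d') (td d'' x3) x2) x1) u = adj (td d) (sw (\<lambda>x2 x3. adj (td d') (td d'' x3) x2) u) x1"
        by (simp only: l)
    qed
    also have "\<dots> = td (d \<bullet>\<^bsub>DD\<^esub> (d' \<bullet>\<^bsub>DD\<^esub> d'')) x"
      by (simp only: td_mult)
    finally show "td (d \<bullet>\<^bsub>DD\<^esub> d' \<bullet>\<^bsub>DD\<^esub> d'') x = td (d \<bullet>\<^bsub>DD\<^esub> (d' \<bullet>\<^bsub>DD\<^esub> d'')) x" .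
  qed
next
  fix d
  note lins' = lins td_lin
  show "\<u>\<^bsub>DD\<^esub> \<bullet>\<^bsub>DD\<^esub> d = d"
  proof (rule td_ext)
    fix x
    have 1: "adj (td (dp oE oED)) v x = sE (eps x) v" for v x
    proof -
      have "adj (td (dp oE oED)) v x = sw (\<lambda>u v3. sE (eps v3) (sw (\<lambda>v1 v2. sE (eps v1) (sE (eps x) v2)) u)) v"
        by (simp add: td_dp ev_dual_one eps_mult eps_S lin_scl[OF k_algebraD(6)[OF algE lin_ident[OF vsE]]] mE_one
           vs_scale_scale[OF vsE] ac_simps flip: tsum_scale[OF vsE])
      also have "\<dots> = sw (\<lambda>u v3. sE (eps v3) (sE (eps x) u)) v"
        by (subst sw_eps_left, intro lins) (rule refl)
      also have "\<dots> = sE (eps x) v" by (rule sw_eps_right) (intro lins)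
      finally show ?thesis .
    qed
    show "td (\<u>\<^bsub>DD\<^esub> \<bullet>\<^bsub>DD\<^esub> d) x = td d x"
      by (simp add: td_mult 1) (rule sw_eps_left, intro lins')
  qed
  show "d \<bullet>\<^bsub>DD\<^esub> \<u>\<^bsub>DD\<^esub> = d"
  proof (rule td_ext)
    fix x
    have "adj (td d) (sE c oE) x = sE c (td d x)" for c x
    proof -
      have "lin sE sE (\<lambda>q. adj (td d) q x)" by (intro lins')
      from lin_scl[OF this] show ?thesis using adj_one[OF td_lin[OF lin_ident[OF vsE]]] by simp
    qed
    then show "td (d \<bullet>\<^bsub>DD\<^esub> \<u>\<^bsub>DD\<^esub>) x = td d x"
      by (simp add: td_mult td_dp ev_dual_one) (rule sw_eps_right, intro lins')
  qed
qed

section \<open>Coproduct, antipode and R-matrix of the double in Sweedler form\<close>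

lemma tsum_DD_cop:
  assumes 1: "\<And>y. lin (fscl sE) t (\<lambda>x. \<Phi> x y)" and 2: "\<And>x. lin (fscl sE) t (\<lambda>y. \<Phi> x y)"
  shows "tsum DD \<Phi> (cop DD d) = tsum ED (\<lambda>w \<xi>. sw (\<lambda>w1 w2. tsum ED (\<lambda>\<xi>1 \<xi>2. \<Phi> (dp w1 \<xi>1) (dp w2 \<xi>2)) (cop ED \<xi>)) w) d"
proof -
  \<comment> \<open>The record \<open>double E\<close> is built on top of
    \<open>double_alg E\<close>, and its coproduct is written with the tensors of the latter. As
    \<open>tens\<close> reads only \<open>scl\<close> and \<open>bas\<close>, which the two records
    share, nothing changes.\<close>
  have t: "tens (double_alg E) (double_alg E) = tens DD DD"
    by (simp add: tens_def coord_def double_def Let_def fun_eq_iff)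
  have L: "lin (fscl (fscl sE)) t (tsum DD \<Phi>)"
    by (rule lin_tsum_arg[OF lin_ident[OF vs_fscl[OF vs_DD]] vs_DD 1])
  have c: "cop DD d = tsum ED (\<lambda>w \<xi>. sw (\<lambda>w1 w2. tsum ED (\<lambda>\<xi>1 \<xi>2. tens DD DD (dp w1 \<xi>1) (dp w2 \<xi>2)) (cop ED \<xi>)) w) d"
    unfolding t[symmetric] by (simp add: double_def Let_def)
  have p: "tsum DD \<Phi> (tens DD DD x y) = \<Phi> x y" for x y
    by (rule tsum_tens'[OF DD_based, where t = t]) (simp_all add: 1 2)
  show ?thesis unfolding c by (simp only: lin_tsum[OF L] p)
qed

lemma tsum_DD_cop_dp:
  assumes 1: "\<And>y. lin (fscl sE) t (\<lambda>x. \<Phi> x y)" and 2: "\<And>x. lin (fscl sE) t (\<lambda>y. \<Phi> x y)"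
  shows "tsum DD \<Phi> (cop DD (dp w \<xi>)) = sw (\<lambda>w1 w2. tsum ED (\<lambda>\<xi>1 \<xi>2. \<Phi> (dp w1 \<xi>1) (dp w2 \<xi>2)) (cop ED \<xi>)) w"
proof -
  have c: "lin (fscl (*)) (fscl (fscl (*))) (cop ED)"
    unfolding dual_def bialg.simps hopf.simps by (rule lin_fun) (auto intro!: linsd vs_fscl vs_field)
  show ?thesis
    unfolding tsum_DD_cop[OF 1 2]
    by (rule D_tsum_dp[where t = t])
       (intro lin_tsum_fun lin_tsum_arg[OF c] vs_fscl vs_field lin_sw lins dp_lin_left dp_lin_right lin_comp[OF 1] lin_comp[OF 2] lin_ident)+
qed

lemma the_inv_S_lin: "lin sE sE (the_inv S)"
proof -
  have "the_inv S (x + y) = the_inv S x + the_inv S y \<and> the_inv S (sE c x) = sE c (the_inv S x)" for x y c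
  proof -
    obtain a where a: "x = S a" using S_bij by (rule bij_pointE)
    obtain b where b: "y = S b" using S_bij by (rule bij_pointE)
    show ?thesis by (simp add: a b flip: lin_plus[OF S_lin] lin_scl[OF S_lin])
  qed
  then show ?thesis by (simp add: lin_def vsE)
qed

lemma dual_anti_lin: "lin (fscl (*)) (fscl (*)) (anti ED)"
  unfolding dual_def hopf.simps by (intro linsd)

lemma DD_anti_eq: "anti DD d = tsum ED (\<lambda>w \<xi>. dp oE (anti ED \<xi>) \<bullet>\<^bsub>DD\<^esub> dp (the_inv S w) oED) d"
proof -
  have m: "\<And>d d'. d \<bullet>\<^bsub>double_alg E\<^esub> d' = d \<bullet>\<^bsub>DD\<^esub> d'" by (simp add: double_def Let_def)
  show ?thesis unfolding m[symmetric] by (simp add: double_def Let_def)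
qed

lemma DD_anti_lin: "lin s (fscl sE) f \<Longrightarrow> lin s (fscl sE) (\<lambda>z. anti DD (f z))"
  unfolding DD_anti_eq by (rule lin_tsum_arg[OF _ vsE], assumption) (intro linsD lin_comp[OF the_inv_S_lin])

text \<open>The antipode of w \<xi> is a product with the functional in front, which the exchange
  relation brings back to the order w \<xi>. The argument is given as S(v) so that the inverse
  antipode cancels; since S is onto, all elements of E are reached.\<close>

lemma DD_anti: "anti DD (dp (S v) \<xi>) = sw (\<lambda>u v3. sw (\<lambda>v1 v2. dp v2 (to_dual E (\<lambda>x. ev' \<xi> (S (S v1 \<diamondop> x \<diamondop> v3))))) u) v"
proof -
  have "anti DD (dp (S v) \<xi>) = dp oE (anti ED \<xi>) \<bullet>\<^bsub>DD\<^esub> dp v oED"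
    unfolding DD_anti_eq
    by (subst D_tsum_dp[where t = "fscl sE"])
       (intro linsD lin_comp[OF the_inv_S_lin] lin_comp[OF dual_anti_lin] | simp)+
  also have "\<dots> = sw (\<lambda>u v3. sw (\<lambda>v1 v2. dp v2 (to_dual E (\<lambda>x. ev' \<xi> (S (S v1 \<diamondop> x \<diamondop> v3))))) u) v"
    by (simp add: DD_mult_dp ev_dual_anti mE_one k_algebraD(4)[OF dual_alg])
  finally show ?thesis .
qed

lemma tsum_double_R:
  assumes 1: "\<And>y. lin (fscl sE) t (\<lambda>x. \<Phi> x y)" and 2: "\<And>x. lin (fscl sE) t (\<lambda>y. \<Phi> x y)"
  shows "tsum DD \<Phi> (double_R E) = (\<Sum>j\<in>UNIV. \<Phi> (dp (bas E j) oED) (dp oE (bas ED j)))"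
proof -
  have L: "lin (fscl (fscl sE)) t (tsum DD \<Phi>)"
    by (rule lin_tsum_arg[OF lin_ident[OF vs_fscl[OF vs_DD]] vs_DD 1])
  have p: "tsum DD \<Phi> (tens DD DD x y) = \<Phi> x y" for x y
    by (rule tsum_tens'[OF DD_based, where t = t]) (simp_all add: 1 2)
  show ?thesis by (simp add: double_R_def lin_setsum[OF L] p)
qed

lemma tsum_dual2_to_double2:
  assumes 1: "\<And>y. lin (fscl sE) t (\<lambda>x. \<Phi> x y)" and 2: "\<And>x. lin (fscl sE) t (\<lambda>y. \<Phi> x y)"
  shows "tsum DD \<Phi> (dual2_to_double2 E J) = tsum ED (\<lambda>\<xi> \<eta>. \<Phi> (dp oE \<xi>) (dp oE \<eta>)) J"
proof -
  have L: "lin (fscl (fscl sE)) t (tsum DD \<Phi>)"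
    by (rule lin_tsum_arg[OF lin_ident[OF vs_fscl[OF vs_DD]] vs_DD 1])
  have p: "tsum DD \<Phi> (tens DD DD x y) = \<Phi> x y" for x y
    by (rule tsum_tens'[OF DD_based, where t = t]) (simp_all add: 1 2)
  show ?thesis by (simp add: dual2_to_double2_def lin_tsum[OF L] p)
qed

lemma dp_oE_mult: "dp oE \<xi> \<bullet>\<^bsub>DD\<^esub> dp oE \<eta> = dp oE (\<xi> \<bullet>\<^bsub>ED\<^esub> \<eta>)"
proof -
  have "to_dual E (ev' \<xi>) = \<xi>" by (rule ev_ext) (simp add: ev_to_dual ev_lin)
  then show ?thesis
    by (subst DD_mult_dp, subst sw_one[where t = "fscl sE"], (intro linsD)+, subst sw_one[where t = "fscl sE"], (intro linsD)+)
       (simp add: S_one one_mE mE_one)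
qed

end

section \<open>The smash product\<close>

locale smash_alg = hopf_alg E for E :: "('k::field, 'e::ab_group_add, 'i::finite) hopf" +
  fixes A :: "('k, 'a::ab_group_add) kalg" and act :: "'e \<Rightarrow> 'a \<Rightarrow> 'a"
  assumes modalg: "module_algebra E A act"
begin

abbreviation sA where "sA \<equiv> scl A"
abbreviation mA (infixl "\<cdot>" 70) where "x \<cdot> y \<equiv> x \<bullet>\<^bsub>A\<^esub> y"
abbreviation BB where "BB \<equiv> smash E A act"
abbreviation sB where "sB \<equiv> fscl sA"
abbreviation mB (infixl "\<odot>" 70) where "x \<odot> y \<equiv> x \<bullet>\<^bsub>BB\<^esub> y"
abbreviation pt where "pt \<equiv> tens A E"
abbreviation iA where "iA a \<equiv> pt a oE"
abbreviation iE where "iE w \<equiv> pt \<u>\<^bsub>A\<^esub> w"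

lemma algA: "k_algebra A" and act_lin: "lin sA sA (act w)" and act_lin_left: "lin sE sA (\<lambda>w. act w a)"
  and act_mult: "act (w \<diamondop> v) a = act w (act v a)" and act_one: "act oE a = a"
  and act_prod: "act w (a \<cdot> b) = sw (\<lambda>w1 w2. act w1 a \<cdot> act w2 b) w"
  and act_unt: "act w \<u>\<^bsub>A\<^esub> = sA (eps w) \<u>\<^bsub>A\<^esub>"
  using modalg by (auto simp: module_algebra_def)

lemmas vsA = k_algebraD(1)[OF algA]

lemma vsB: "vector_space sB" by (rule vs_fscl[OF vsA])

lemma pt_lin_left: "lin s sA f \<Longrightarrow> lin s sB (\<lambda>z. pt (f z) w)"
  by (rule lin_tens_left[OF vsA])

lemma pt_lin_right: "lin s sE f \<Longrightarrow> lin s sB (\<lambda>z. pt a (f z))"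
  by (rule lin_tens_right[OF based vsA])

lemma B_tsum_pt:
  assumes "\<And>w. lin sA t (\<lambda>a. \<phi> a w)" "\<And>a. lin sE t (\<phi> a)"
  shows "tsum E \<phi> (pt a w) = \<phi> a w"
  by (rule tsum_tens'[OF based]) (use assms in auto)

lemma B_ext:
  assumes "lin sB t F" "lin sB t G" "\<And>a w. F (pt a w) = G (pt a w)" shows "F b = G b"
  using tensor_ext[OF based vsA assms(1,2)] assms(3) by blast

lemma BB_simps [simp]: "scl BB = sB" "\<u>\<^bsub>BB\<^esub> = pt \<u>\<^bsub>A\<^esub> oE"
  by (simp_all add: smash_def)

lemmas lins_AE = linsd lin_ident[OF vsA] k_algebraD(5)[OF algA] k_algebraD(6)[OF algA]
  lin_comp[OF act_lin] lin_comp[OF act_lin_left] lin_scale[where t = sA] lin_scale_vec[OF vsA]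
  pt_lin_left pt_lin_right lin_ident[OF vsB] lin_scale[where t = sB] lin_scale_vec[OF vsB]

lemma mB_def: "s \<odot> t = tsum E (\<lambda>a w. tsum E (\<lambda>b v. sw (\<lambda>w1 w2. pt (a \<cdot> act w1 b) (w2 \<diamondop> v)) w) t) s"
  by (simp add: smash_def)

lemma mB_lin:
  shows "lin s sB f \<Longrightarrow> lin s sB (\<lambda>z. f z \<odot> d)" and "lin s sB f \<Longrightarrow> lin s sB (\<lambda>z. d \<odot> f z)"
  unfolding mB_def
  by (rule lin_tsum_arg[OF _ vsA], assumption, intro lin_tsum_fun lins_AE)
     (rule lin_tsum_fun, rule lin_tsum_arg[OF _ vsA], assumption, intro lin_tsum_fun lins_AE)

lemmas linsB = lins_AE mB_lin

lemma mB_pt: "pt a w \<odot> pt b v = sw (\<lambda>w1 w2. pt (a \<cdot> act w1 b) (w2 \<diamondop> v)) w"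
  unfolding mB_def
  by (subst B_tsum_pt[where t = sB], (intro linsB)+, subst B_tsum_pt[where t = sB], (intro linsB)+) (rule refl)

lemma iA_pt: "iA a \<odot> pt b v = pt (a \<cdot> b) v"
  unfolding mB_pt by (subst sw_one[where t = sB], (intro linsB)+) (simp add: act_one one_mE)

lemma pt_iE: "pt a w \<odot> iE v = pt a (w \<diamondop> v)"
proof -
  have "pt a w \<odot> iE v = sw (\<lambda>w1 w2. sB (eps w1) (pt a (w2 \<diamondop> v))) w"
    by (simp add: mB_pt act_unt lin_scl[OF k_algebraD(6)[OF algA lin_ident[OF vsA]]] k_algebraD(4)[OF algA]
      lin_scl[OF pt_lin_left[OF lin_ident[OF vsA]]])
  also have "\<dots> = pt a (w \<diamondop> v)" by (rule sw_eps_left) (intro linsB)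
  finally show ?thesis .
qed

lemma BB_alg: "k_algebra BB"
proof (rule k_algebraI)
  show "lin (scl BB) (scl BB) (\<lambda>x. x \<odot> y)" "lin (scl BB) (scl BB) (\<lambda>x. y \<odot> x)" for y
    unfolding BB_simps by (intro linsB)+
  fix x y z
  show "x \<odot> y \<odot> z = x \<odot> (y \<odot> z)"
  proof (rule B_ext[where t = sB and b = x])
    show "lin sB sB (\<lambda>x. x \<odot> y \<odot> z)" "lin sB sB (\<lambda>x. x \<odot> (y \<odot> z))" by (intro linsB)+
    fix a w show "pt a w \<odot> y \<odot> z = pt a w \<odot> (y \<odot> z)"
    proof (rule B_ext[where t = sB and b = y])
      show "lin sB sB (\<lambda>y. pt a w \<odot> y \<odot> z)" "lin sB sB (\<lambda>y. pt a w \<odot> (y \<odot> z))" by (intro linsB)+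
      fix b v show "pt a w \<odot> pt b v \<odot> z = pt a w \<odot> (pt b v \<odot> z)"
      proof (rule B_ext[where t = sB and b = z])
        show "lin sB sB (\<lambda>z. pt a w \<odot> pt b v \<odot> z)" "lin sB sB (\<lambda>z. pt a w \<odot> (pt b v \<odot> z))" by (intro linsB)+
        fix c u
        have l: "lin sB sB (\<lambda>x. x \<odot> pt c u)" "lin sB sB (\<lambda>x. pt a w \<odot> x)" by (intro linsB)+
        have l2: "lin sA sB (\<lambda>x. pt (a \<cdot> x) r)" for r by (intro linsB)
        have "pt a w \<odot> pt b v \<odot> pt c u = sw (\<lambda>w1 w2. sw (\<lambda>x y. pt (a \<cdot> act w1 b \<cdot> act x c) (y \<diamondop> u)) (w2 \<diamondop> v)) w"
          by (simp add: mB_pt lin_tsum[OF l(1)])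
        also have "\<dots> = sw (\<lambda>w1 w2. sw (\<lambda>p q. sw (\<lambda>v1 v2. pt (a \<cdot> act w1 b \<cdot> act (p \<diamondop> v1) c) (q \<diamondop> v2 \<diamondop> u)) v) w2) w"
          by (intro tsum_cong sw_mult[where t = sB]) (intro linsB)+
        also have "\<dots> = sw (\<lambda>w1 w2. sw (\<lambda>v1 v2. sw (\<lambda>p q. pt (a \<cdot> act w1 b \<cdot> act (p \<diamondop> v1) c) (q \<diamondop> v2 \<diamondop> u)) w2) v) w"
          by (intro tsum_cong tsum_swap)
        also have "\<dots> = sw (\<lambda>v1 v2. sw (\<lambda>w1 w2. sw (\<lambda>p q. pt (a \<cdot> act w1 b \<cdot> act (p \<diamondop> v1) c) (q \<diamondop> v2 \<diamondop> u)) w2) w) v"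
          by (rule tsum_swap)
        also have "\<dots> = sw (\<lambda>v1 v2. sw (\<lambda>w' q. sw (\<lambda>w1 p. pt (a \<cdot> act w1 b \<cdot> act (p \<diamondop> v1) c) (q \<diamondop> v2 \<diamondop> u)) w') w) v"
          by (intro tsum_cong sw_assoc[where t = sB, symmetric]) (intro linsB)+
        also have "\<dots> = pt a w \<odot> (pt b v \<odot> pt c u)"
          by (simp add: mB_pt lin_tsum[OF l(2)] act_prod act_mult lin_tsum[OF l2] k_algebraD(2)[OF algA] mE_assoc)
        finally show "pt a w \<odot> pt b v \<odot> pt c u = pt a w \<odot> (pt b v \<odot> pt c u)" .
      qed
    qed
  qed
next
  fix x
  show "\<u>\<^bsub>BB\<^esub> \<odot> x = x"
    unfolding BB_simps by (rule B_ext[where t = sB and b = x], (intro linsB)+) (simp add: iA_pt k_algebraD(3)[OF algA])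
  show "x \<odot> \<u>\<^bsub>BB\<^esub> = x"
    unfolding BB_simps by (rule B_ext[where t = sB and b = x], (intro linsB)+) (simp add: pt_iE mE_one)
qed

lemmas mB_assoc = k_algebraD(2)[OF BB_alg]
lemma mB_one: "x \<odot> pt \<u>\<^bsub>A\<^esub> oE = x" and one_mB: "pt \<u>\<^bsub>A\<^esub> oE \<odot> x = x"
  using k_algebraD(3,4)[OF BB_alg, of x] by simp_all

lemma iA_iE: "iA a \<odot> iE w = pt a w" by (simp add: pt_iE one_mE)
lemma iA_mult: "iA a \<odot> iA b = iA (a \<cdot> b)" by (simp add: iA_pt)
lemma iE_mult: "iE v \<odot> iE w = iE (v \<diamondop> w)" by (simp add: pt_iE)
lemma iE_iA: "iE w \<odot> iA a = sw (\<lambda>w1 w2. pt (act w1 a) w2) w"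
  by (simp add: mB_pt mE_one k_algebraD(3)[OF algA])

lemma iE_pt: "iE v \<odot> pt a w = sw (\<lambda>v1 v2. pt (act v1 a) (v2 \<diamondop> w)) v"
  by (simp add: mB_pt k_algebraD(3)[OF algA])

text \<open>Inside B the action of E on A is inner, w a = (w1 a) w2, and the second leg is removed
  by its antipode.\<close>

lemma iA_act: "iA (act w a) = sw (\<lambda>w1 w2. iE w1 \<odot> iA a \<odot> iE (S w2)) w"
proof -
  have l: "lin sB sB (\<lambda>x. x \<odot> iE v)" for v by (intro linsB)
  have "sw (\<lambda>w1 w2. iE w1 \<odot> iA a \<odot> iE (S w2)) w = sw (\<lambda>u z. sw (\<lambda>x y. pt (act x a) (y \<diamondop> S z)) u) w"
    by (simp add: iE_iA lin_tsum[OF l] pt_iE)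
  also have "\<dots> = sw (\<lambda>x u. sw (\<lambda>y z. pt (act x a) (y \<diamondop> S z)) u) w"
    by (rule sw_assoc[where t = sB]) (intro linsB)+
  also have "\<dots> = pt (act w a) oE"
    by (rule sw_S_right_right[where t = sB]) (intro linsB)+
  finally show ?thesis ..
qed

text \<open>
  The action \<open>b \<mapsto> b\<^sub>0 \<phi>(b\<^sub>1)\<close> of a functional \<open>\<phi>\<close> on \<open>B\<close>.
\<close>

definition hit :: "('e \<Rightarrow> 'k) \<Rightarrow> ('i \<Rightarrow> 'a) \<Rightarrow> 'i \<Rightarrow> 'a" where
  "hit \<phi> b = tsum E (\<lambda>a w. sw (\<lambda>w1 w2. sB (\<phi> w2) (pt a w1)) w) b"

lemma hit_lin: "lin s sB f \<Longrightarrow> lin s sB (\<lambda>z. hit \<phi> (f z))"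
  unfolding hit_def by (rule lin_tsum_arg[OF _ vsA], assumption) (intro linsB)

lemma hit_lin_fun: "(\<And>w. lin s (*) (\<lambda>z. \<phi> z w)) \<Longrightarrow> lin s sB (\<lambda>z. hit (\<phi> z) b)"
  unfolding hit_def by (intro linsB)

lemmas linsh = linsB hit_lin hit_lin_fun

lemma hit_pt:
  assumes "lin sE (*) \<phi>" shows "hit \<phi> (pt a w) = sw (\<lambda>w1 w2. sB (\<phi> w2) (pt a w1)) w"
  unfolding hit_def by (rule B_tsum_pt[where t = sB]) (intro linsB lin_comp[OF assms])+

text \<open>The coaction of B touches only the factor in E, so A is coinvariant and functionals act
  A-linearly on either side (see also \<open>hit_iA_right\<close>). This is why they commute with
  the Hochschild faces.\<close>

lemma hit_iA_left:
  assumes "lin sE (*) \<phi>" shows "hit \<phi> (iA a \<odot> b) = iA a \<odot> hit \<phi> b"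
proof (rule B_ext[where t = sB and b = b])
  show "lin sB sB (\<lambda>b. hit \<phi> (iA a \<odot> b))" "lin sB sB (\<lambda>b. iA a \<odot> hit \<phi> b)" by (intro linsh)+
  fix c w
  have l: "lin sB sB (\<lambda>x. iA a \<odot> x)" by (intro linsB)
  show "hit \<phi> (iA a \<odot> pt c w) = iA a \<odot> hit \<phi> (pt c w)"
    by (simp add: iA_pt hit_pt[OF assms] lin_tsum[OF l] lin_scl[OF l])
qed

lemma hit_iA_right:
  assumes "lin sE (*) \<phi>" shows "hit \<phi> (b \<odot> iA a) = hit \<phi> b \<odot> iA a"
proof (rule B_ext[where t = sB and b = b])
  note lins' = linsh lin_comp[OF assms]
  show "lin sB sB (\<lambda>b. hit \<phi> (b \<odot> iA a))" "lin sB sB (\<lambda>b. hit \<phi> b \<odot> iA a)" by (intro linsh)+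
  fix c w
  have l: "lin sB sB (\<lambda>x. x \<odot> iA a)" "lin sB sB (\<lambda>x. hit \<phi> x)" by (intro linsh)+
  have "hit \<phi> (pt c w \<odot> iA a) = sw (\<lambda>x u. sw (\<lambda>y z. sB (\<phi> z) (pt (c \<cdot> act x a) y)) u) w"
    by (simp add: mB_pt mE_one lin_tsum[OF l(2)] hit_pt[OF assms])
  also have "\<dots> = sw (\<lambda>u z. sw (\<lambda>x y. sB (\<phi> z) (pt (c \<cdot> act x a) y)) u) w"
    by (rule sw_assoc[where t = sB, symmetric]) (intro lins')+
  also have "\<dots> = hit \<phi> (pt c w) \<odot> iA a"
    by (simp add: mB_pt mE_one hit_pt[OF assms] lin_tsum[OF l(1)] lin_scl[OF l(1)] tsum_scale[OF vsB])
  finally show "hit \<phi> (pt c w \<odot> iA a) = hit \<phi> (pt c w) \<odot> iA a" .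
qed

text \<open>The coaction is multiplicative, so the coaction leg of a product b v is that of b times
  v2. The functional is therefore translated by v2; \<open>hit_iE_left\<close> is the mirror
  image.\<close>

lemma hit_iE_right:
  assumes "lin sE (*) \<phi>" shows "hit \<phi> (b \<odot> iE v) = sw (\<lambda>v1 v2. hit (\<lambda>u. \<phi> (u \<diamondop> v2)) b \<odot> iE v1) v"
proof (rule B_ext[where t = sB and b = b])
  note lins' = linsh lin_comp[OF assms]
  show "lin sB sB (\<lambda>b. hit \<phi> (b \<odot> iE v))" "lin sB sB (\<lambda>b. sw (\<lambda>v1 v2. hit (\<lambda>u. \<phi> (u \<diamondop> v2)) b \<odot> iE v1) v)" by (intro lins')+
  fix c w
  have l: "lin sB sB (\<lambda>x. x \<odot> iE v1)" for v1 by (intro linsh)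
  have p: "lin sE (*) (\<lambda>u. \<phi> (u \<diamondop> v2))" for v2 by (intro lins')
  have "hit \<phi> (pt c w \<odot> iE v) = sw (\<lambda>w1 w2. sw (\<lambda>v1 v2. sB (\<phi> (w2 \<diamondop> v2)) (pt c (w1 \<diamondop> v1))) v) w"
    unfolding pt_iE hit_pt[OF assms] by (rule sw_mult[where t = sB]) (intro lins')+
  also have "\<dots> = sw (\<lambda>v1 v2. sw (\<lambda>w1 w2. sB (\<phi> (w2 \<diamondop> v2)) (pt c (w1 \<diamondop> v1))) w) v" by (rule tsum_swap)
  also have "\<dots> = sw (\<lambda>v1 v2. hit (\<lambda>u. \<phi> (u \<diamondop> v2)) (pt c w) \<odot> iE v1) v"
    by (simp add: hit_pt[OF p] lin_tsum[OF l] lin_scl[OF l] pt_iE)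
  finally show "hit \<phi> (pt c w \<odot> iE v) = sw (\<lambda>v1 v2. hit (\<lambda>u. \<phi> (u \<diamondop> v2)) (pt c w) \<odot> iE v1) v" .
qed

lemma hit_iE_left:
  assumes "lin sE (*) \<phi>" shows "hit \<phi> (iE v \<odot> b) = sw (\<lambda>v1 v2. iE v1 \<odot> hit (\<lambda>u. \<phi> (v2 \<diamondop> u)) b) v"
proof (rule B_ext[where t = sB and b = b])
  note lins' = linsh lin_comp[OF assms]
  show "lin sB sB (\<lambda>b. hit \<phi> (iE v \<odot> b))" "lin sB sB (\<lambda>b. sw (\<lambda>v1 v2. iE v1 \<odot> hit (\<lambda>u. \<phi> (v2 \<diamondop> u)) b) v)" by (intro lins')+
  fix c w
  have l: "lin sB sB (\<lambda>x. iE v1 \<odot> x)" "lin sB sB (\<lambda>x. hit \<phi> x)" for v1 by (intro linsh)+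
  have p: "lin sE (*) (\<lambda>u. \<phi> (v2 \<diamondop> u))" for v2 by (intro lins')
  have "hit \<phi> (iE v \<odot> pt c w) = sw (\<lambda>x r. sw (\<lambda>y z. sB (\<phi> z) (pt (act x c) y)) (r \<diamondop> w)) v"
    by (simp add: iE_pt lin_tsum[OF l(2)] hit_pt[OF assms])
  also have "\<dots> = sw (\<lambda>x r. sw (\<lambda>y z. sw (\<lambda>w1 w2. sB (\<phi> (z \<diamondop> w2)) (pt (act x c) (y \<diamondop> w1))) w) r) v"
    by (intro tsum_cong sw_mult[where t = sB]) (intro lins')+
  also have "\<dots> = sw (\<lambda>r z. sw (\<lambda>x y. sw (\<lambda>w1 w2. sB (\<phi> (z \<diamondop> w2)) (pt (act x c) (y \<diamondop> w1))) w) r) v"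
    by (rule sw_assoc[where t = sB, symmetric]) (intro lins')+
  also have "\<dots> = sw (\<lambda>r z. sw (\<lambda>w1 w2. sw (\<lambda>x y. sB (\<phi> (z \<diamondop> w2)) (pt (act x c) (y \<diamondop> w1))) r) w) v"
    by (intro tsum_cong tsum_swap)
  also have "\<dots> = sw (\<lambda>v1 v2. iE v1 \<odot> hit (\<lambda>u. \<phi> (v2 \<diamondop> u)) (pt c w)) v"
    by (simp add: hit_pt[OF p] lin_tsum[OF l(1)] lin_scl[OF l(1)] iE_pt tsum_scale[OF vsB])
  finally show "hit \<phi> (iE v \<odot> pt c w) = sw (\<lambda>v1 v2. iE v1 \<odot> hit (\<lambda>u. \<phi> (v2 \<diamondop> u)) (pt c w)) v" .
qed

lemma hit_hit:
  assumes 1: "lin sE (*) \<phi>" and 2: "lin sE (*) \<psi>"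
  shows "hit \<phi> (hit \<psi> b) = hit (\<lambda>w. sw (\<lambda>w1 w2. \<phi> w1 * \<psi> w2) w) b"
proof (rule B_ext[where t = sB and b = b])
  note lins' = linsh lin_comp[OF 1] lin_comp[OF 2]
  show "lin sB sB (\<lambda>b. hit \<phi> (hit \<psi> b))" "lin sB sB (\<lambda>b. hit (\<lambda>w. sw (\<lambda>w1 w2. \<phi> w1 * \<psi> w2) w) b)" by (intro lins')+
  fix a w
  have l: "lin sB sB (\<lambda>x. hit \<phi> x)" by (intro linsh)
  have p: "lin sE (*) (\<lambda>w. sw (\<lambda>w1 w2. \<phi> w1 * \<psi> w2) w)" by (intro lins')
  have "hit \<phi> (hit \<psi> (pt a w)) = sw (\<lambda>u z. sw (\<lambda>x y. sB (\<phi> y * \<psi> z) (pt a x)) u) w"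
    by (simp add: hit_pt 1 2 lin_tsum[OF l] lin_scl[OF l] vs_scale_scale[OF vsB] mult.commute flip: tsum_scale[OF vsB])
  also have "\<dots> = sw (\<lambda>x u. sw (\<lambda>y z. sB (\<phi> y * \<psi> z) (pt a x)) u) w"
    by (rule sw_assoc[where t = sB]) (intro lins')+
  also have "\<dots> = hit (\<lambda>w. sw (\<lambda>w1 w2. \<phi> w1 * \<psi> w2) w) (pt a w)"
    by (simp add: hit_pt[OF p]) (simp add: tsum_def vs_sum_scale[OF vsB])
  finally show "hit \<phi> (hit \<psi> (pt a w)) = hit (\<lambda>w. sw (\<lambda>w1 w2. \<phi> w1 * \<psi> w2) w) (pt a w)" .
qed

lemma hit_eps: "hit eps b = b"
proof (rule B_ext[where t = sB and b = b])
  show "lin sB sB (\<lambda>b. hit eps b)" "lin sB sB (\<lambda>b. b)" by (intro linsh)+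
  show "hit eps (pt a w) = pt a w" for a w
    unfolding hit_pt[OF eps_lin] by (rule sw_eps_right) (intro linsh)
qed

text \<open>B is a module algebra over the dual of E: the coaction is an algebra map, and a
  functional evaluated at the product of two coaction legs splits by its coproduct.\<close>

lemma hit_prod: "hit (ev' \<xi>) (b \<odot> c) = tsum ED (\<lambda>\<xi>1 \<xi>2. hit (ev' \<xi>1) b \<odot> hit (ev' \<xi>2) c) (cop ED \<xi>)"
proof (rule B_ext[where t = sB and b = b])
  show "lin sB sB (\<lambda>b. hit (ev' \<xi>) (b \<odot> c))" "lin sB sB (\<lambda>b. tsum ED (\<lambda>\<xi>1 \<xi>2. hit (ev' \<xi>1) b \<odot> hit (ev' \<xi>2) c) (cop ED \<xi>))"
    by (intro linsh)+
  fix a w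
  show "hit (ev' \<xi>) (pt a w \<odot> c) = tsum ED (\<lambda>\<xi>1 \<xi>2. hit (ev' \<xi>1) (pt a w) \<odot> hit (ev' \<xi>2) c) (cop ED \<xi>)"
  proof (rule B_ext[where t = sB and b = c])
    show "lin sB sB (\<lambda>c. hit (ev' \<xi>) (pt a w \<odot> c))" "lin sB sB (\<lambda>c. tsum ED (\<lambda>\<xi>1 \<xi>2. hit (ev' \<xi>1) (pt a w) \<odot> hit (ev' \<xi>2) c) (cop ED \<xi>))"
      by (intro linsh)+
    fix c v
    have l: "lin sB sB (\<lambda>x. hit (ev' \<xi>) x)" "lin sB sB (\<lambda>x. x \<odot> y)" "lin sB sB (\<lambda>x. y \<odot> x)" for \<xi> y by (intro linsh)+
    have "hit (ev' \<xi>) (pt a w \<odot> pt c v) = sw (\<lambda>x r. sw (\<lambda>y z. sB (ev' \<xi> z) (pt (a \<cdot> act x c) y)) (r \<diamondop> v)) w"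
      by (simp add: mB_pt lin_tsum[OF l(1)] hit_pt[OF ev_lin])
    also have "\<dots> = sw (\<lambda>x r. sw (\<lambda>y z. sw (\<lambda>v1 v2. sB (ev' \<xi> (z \<diamondop> v2)) (pt (a \<cdot> act x c) (y \<diamondop> v1))) v) r) w"
      by (intro tsum_cong sw_mult[where t = sB]) (intro linsh)+
    also have "\<dots> = sw (\<lambda>r z. sw (\<lambda>x y. sw (\<lambda>v1 v2. sB (ev' \<xi> (z \<diamondop> v2)) (pt (a \<cdot> act x c) (y \<diamondop> v1))) v) r) w"
      by (rule sw_assoc[where t = sB, symmetric]) (intro linsh)+
    also have "\<dots> = sw (\<lambda>r z. sw (\<lambda>v1 v2. sw (\<lambda>x y. sB (ev' \<xi> (z \<diamondop> v2)) (pt (a \<cdot> act x c) (y \<diamondop> v1))) r) v) w"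
      by (intro tsum_cong tsum_swap)
    also have "\<dots> = sw (\<lambda>r z. sw (\<lambda>v1 v2. sB (ev' \<xi> (z \<diamondop> v2)) (pt a r \<odot> pt c v1)) v) w"
      by (simp add: mB_pt tsum_scale[OF vsB])
    also have "\<dots> = sw (\<lambda>r z. sw (\<lambda>v1 v2. tsum ED (\<lambda>\<xi>1 \<xi>2. sB (ev' \<xi>1 z * ev' \<xi>2 v2) (pt a r \<odot> pt c v1)) (cop ED \<xi>)) v) w"
      by (simp add: tsum_def vs_sum_scale[OF vsB, symmetric] flip: tsum_dual_cop)
    also have "\<dots> = sw (\<lambda>r z. tsum ED (\<lambda>\<xi>1 \<xi>2. sw (\<lambda>v1 v2. sB (ev' \<xi>1 z * ev' \<xi>2 v2) (pt a r \<odot> pt c v1)) v) (cop ED \<xi>)) w"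
      by (intro tsum_cong tsum_swap)
    also have "\<dots> = tsum ED (\<lambda>\<xi>1 \<xi>2. sw (\<lambda>r z. sw (\<lambda>v1 v2. sB (ev' \<xi>1 z * ev' \<xi>2 v2) (pt a r \<odot> pt c v1)) v) w) (cop ED \<xi>)"
      by (rule tsum_swap)
    also have "\<dots> = tsum ED (\<lambda>\<xi>1 \<xi>2. sw (\<lambda>v1 v2. sw (\<lambda>r z. sB (ev' \<xi>2 v2 * ev' \<xi>1 z) (pt a r \<odot> pt c v1)) w) v) (cop ED \<xi>)"
      by (subst mult.commute) (intro tsum_cong tsum_swap)
    also have "\<dots> = tsum ED (\<lambda>\<xi>1 \<xi>2. hit (ev' \<xi>1) (pt a w) \<odot> hit (ev' \<xi>2) (pt c v)) (cop ED \<xi>)"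
      by (simp add: hit_pt[OF ev_lin] lin_tsum[OF l(2)] lin_tsum[OF l(3)] lin_scl[OF l(2)] lin_scl[OF l(3)] vs_scale_scale[OF vsB] flip: tsum_scale[OF vsB])
    finally show "hit (ev' \<xi>) (pt a w \<odot> pt c v) = tsum ED (\<lambda>\<xi>1 \<xi>2. hit (ev' \<xi>1) (pt a w) \<odot> hit (ev' \<xi>2) (pt c v)) (cop ED \<xi>)" .
  qed
qed

end

section \<open>Extension of cochains to the smash product\<close>

text \<open>
  Multilinearity without reference to the number of arguments; it agrees with \<^const>\<open>multilinear\<close> for
  functions vanishing off lists of length \<open>n\<close>, and is inherited by partial applications.
\<close>

definition mlin :: "('k::field \<Rightarrow> 'a::ab_group_add \<Rightarrow> 'a) \<Rightarrow> ('k \<Rightarrow> 'm::ab_group_add \<Rightarrow> 'm) \<Rightarrow> ('a list \<Rightarrow> 'm) \<Rightarrow> bool" where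
  "mlin s t f \<longleftrightarrow> (\<forall>xs ys. lin s t (\<lambda>x. f (xs @ x # ys)))"

lemma mlin_D: "mlin s t f \<Longrightarrow> lin s t (\<lambda>x. f (xs @ x # ys))"
  and mlin_D0: "mlin s t f \<Longrightarrow> lin s t (\<lambda>x. f (x # ys))"
  and mlin_append: "mlin s t f \<Longrightarrow> mlin s t (\<lambda>ys. f (zs @ ys))"
  and mlin_Cons: "mlin s t f \<Longrightarrow> mlin s t (\<lambda>ys. f (z # ys))"
proof -
  assume f: "mlin s t f"
  show "lin s t (\<lambda>x. f (xs @ x # ys))" using f by (simp add: mlin_def)
  show "lin s t (\<lambda>x. f (x # ys))" using f[unfolded mlin_def, rule_format, of "[]"] by simp
  show "mlin s t (\<lambda>ys. f (zs @ ys))" unfolding mlin_def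
    using f[unfolded mlin_def, rule_format, of "zs @ _"] by simp
  show "mlin s t (\<lambda>ys. f (z # ys))" unfolding mlin_def
    using f[unfolded mlin_def, rule_format, of "z # _"] by simp
qed

lemma cochains_iff:
  assumes s: "vector_space (scl A)" and t: "vector_space (scl M)"
  shows "f \<in> cochains A M n \<longleftrightarrow> mlin (scl A) (scl M) f \<and> (\<forall>xs. length xs \<noteq> n \<longrightarrow> f xs = 0)"
proof safe
  assume f: "f \<in> cochains A M n"
  show "mlin (scl A) (scl M) f" unfolding mlin_def
  proof safe
    fix xs ys
    show "lin (scl A) (scl M) (\<lambda>x. f (xs @ x # ys))"
    proof (cases "length xs + length ys + 1 = n")
      case True
      then have "length (xs @ 0 # ys) = n" "length xs < n" by auto
      then show ?thesis using f unfolding cochains_def multilinear_def by fastforce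
    next
      case False
      then have "f (xs @ x # ys) = 0" for x using f by (simp add: cochains_def)
      then show ?thesis by (simp add: lin_const_zero[OF s t])
    qed
  qed
  show "f xs = 0" if "length xs \<noteq> n" for xs using f that by (simp add: cochains_def)
next
  assume "mlin (scl A) (scl M) f" "\<forall>xs. length xs \<noteq> n \<longrightarrow> f xs = 0"
  then show "f \<in> cochains A M n"
    unfolding cochains_def multilinear_def by (auto simp: upd_conv_take_nth_drop mlin_D)
qed

context smash_alg begin

text \<open>
  The value at \<open>b\<^sub>1 \<otimes> \<dots> \<otimes> b\<^sub>n\<close> of the extension of \<open>f\<close>, where \<open>u\<close> is the factor from \<open>E\<close> that has already been moved
  past the arguments to the left: \<open>u (a w) = (u\<^sub>1 \<cdot> a) (u\<^sub>2 w)\<close>.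
\<close>

primrec extn :: "('i \<Rightarrow> 'a) list \<Rightarrow> ('a list \<Rightarrow> 'i \<Rightarrow> 'a) \<Rightarrow> 'e \<Rightarrow> 'i \<Rightarrow> 'a" where
  "extn [] f u = f [] \<odot> iE u"
| "extn (b # bs) f u = tsum E (\<lambda>a w. sw (\<lambda>u1 u2. extn bs (\<lambda>ys. f (act u1 a # ys)) (u2 \<diamondop> w)) u) b"

declare extn.simps(2) [simp del]

abbreviation mlB where "mlB \<equiv> mlin sA sB"

lemma extn_lin_fun: "(\<And>ys. lin s sB (\<lambda>z. \<phi> z ys)) \<Longrightarrow> lin s sB (\<lambda>z. extn bs (\<phi> z) u)"
proof (induction bs arbitrary: \<phi> u)
  case Nil show ?case unfolding extn.simps by (intro linsh Nil)
next
  case (Cons b bs) show ?case unfolding extn.simps by (intro lin_tsum_fun Cons)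
qed

lemma extn_lin_u:
  assumes f: "mlB f" and g: "lin s sE g" shows "lin s sB (\<lambda>z. extn bs f (g z))"
proof (cases bs)
  case Nil show ?thesis unfolding Nil extn.simps by (intro linsh g)
next
  case (Cons b bs') show ?thesis unfolding Cons extn.simps
    by (intro lin_tsum_fun lin_sw[OF g] extn_lin_fun linsh lin_comp[OF mlin_D0[OF f]])
qed

lemma extn_lin_b:
  assumes "mlB f" and g: "lin s sB g" shows "lin s sB (\<lambda>z. extn (cs @ g z # bs) f u)"
  using assms(1)
proof (induction cs arbitrary: f u)
  case Nil then show ?case
    by (simp add: extn.simps(2)) (rule lin_tsum_arg[OF g vsA], intro lin_tsum_fun extn_lin_fun linsh lin_comp[OF mlin_D0[OF Nil]])
next
  case (Cons c cs) then show ?case unfolding append_Cons extn.simps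
    by (intro lin_tsum_fun Cons.IH mlin_Cons)
qed

lemmas extn_lin_b0 = extn_lin_b[where cs = "[]", unfolded append_Nil]

lemma extn_pt:
  assumes f: "mlB f"
  shows "extn (pt a w # bs) f u = sw (\<lambda>u1 u2. extn bs (\<lambda>ys. f (act u1 a # ys)) (u2 \<diamondop> w)) u"
  unfolding extn.simps
  by (rule B_tsum_pt[where t = sB])
     (intro lin_tsum_fun extn_lin_fun linsh lin_comp[OF mlin_D0[OF f]] extn_lin_u mlin_Cons f)+

lemma extn_sum: "extn bs (\<lambda>ys. \<Sum>i\<in>I. \<phi> i ys) u = (\<Sum>i\<in>I. extn bs (\<phi> i) u)"
proof (induction bs arbitrary: \<phi> u)
  case Nil
  have l: "lin sB sB (\<lambda>x. x \<odot> iE u)" by (intro linsh)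
  show ?case by (simp add: lin_setsum[OF l])
next
  case (Cons b bs) then show ?case by (simp add: extn.simps(2) tsum_sum)
qed

lemma extn_tsum: "extn bs (\<lambda>ys. tsum H (\<lambda>x y. \<phi> x y ys) T) u = tsum H (\<lambda>x y. extn bs (\<phi> x y) u) T"
  unfolding tsum_def by (rule extn_sum)

text \<open>The extension rearranges arguments and multiplies the final value by an element of E on
  the right. Hence it commutes with every right E-linear map applied to the values, in particular
  with left multiplications.\<close>

lemma extn_map:
  assumes L: "lin sB sB L" and "\<And>b v. L (b \<odot> iE v) = L b \<odot> iE v"
  shows "extn bs (\<lambda>ys. L (f ys)) u = L (extn bs f u)"
  by (induction bs arbitrary: f u) (simp_all add: extn.simps(2) assms(2) lin_tsum[OF L])

lemma extn_left: "extn bs (\<lambda>ys. b \<odot> f ys) u = b \<odot> extn bs f u"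
  by (rule extn_map) (intro linsh, simp add: mB_assoc)

lemma extn_neg: "extn bs (\<lambda>ys. - f ys) u = - extn bs f u"
  by (rule extn_map) (intro lin_neg linsh, rule lin_uminus[OF mB_lin(1)[OF lin_ident[OF vsB]], symmetric])

lemma extn_add: "extn bs (\<lambda>ys. f ys + g ys) u = extn bs f u + extn bs g u"
proof (induction bs arbitrary: f g u)
  case Nil
  have l: "lin sB sB (\<lambda>x. x \<odot> iE u)" by (intro linsh)
  show ?case by (simp only: extn.simps lin_plus[OF l])
next
  case (Cons b bs) then show ?case by (simp only: extn.simps tsum_add)
qed

lemma extn_zero: "(\<And>ys. length ys = length bs \<Longrightarrow> f ys = 0) \<Longrightarrow> extn bs f u = 0"
proof (induction bs arbitrary: f u)
  case Nil
  have l: "lin sB sB (\<lambda>x. x \<odot> iE u)" by (intro linsh)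
  have "f [] = 0" by (rule Nil) simp
  then show ?case by (simp only: extn.simps lin_zero[OF l])
next
  case (Cons b bs)
  have "extn bs (\<lambda>ys. f (act u1 a # ys)) v = 0" for u1 a v
    by (rule Cons.IH, rule Cons.prems) simp
  then show ?case by (simp only: extn.simps tsum_def sum.neutral_const)
qed

text \<open>The factor u already moved stands immediately to the left of b, so a left factor v of b
  simply joins it.\<close>

lemma extn_iE_left:
  assumes f: "mlB f" shows "extn ((iE v \<odot> b) # bs) f u = extn (b # bs) f (u \<diamondop> v)"
proof (rule B_ext[where t = sB and b = b])
  show "lin sB sB (\<lambda>b. extn ((iE v \<odot> b) # bs) f u)" "lin sB sB (\<lambda>b. extn (b # bs) f (u \<diamondop> v))"
    by (intro extn_lin_b0 f linsh)+
  note lins' = lin_tsum_fun extn_lin_fun linsh lin_comp[OF mlin_D0[OF f]] extn_lin_u mlin_Cons f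
  fix a w
  have l: "lin sB sB (\<lambda>b. extn (b # bs) f u)" by (intro extn_lin_b0 f linsh)
  have "extn ((iE v \<odot> pt a w) # bs) f u = sw (\<lambda>v1 v2. sw (\<lambda>u1 u2. extn bs (\<lambda>ys. f (act (u1 \<diamondop> v1) a # ys)) (u2 \<diamondop> v2 \<diamondop> w)) u) v"
    unfolding iE_pt lin_tsum[OF l] extn_pt[OF f] by (simp only: act_mult mE_assoc)
  also have "\<dots> = sw (\<lambda>u1 u2. sw (\<lambda>v1 v2. extn bs (\<lambda>ys. f (act (u1 \<diamondop> v1) a # ys)) (u2 \<diamondop> v2 \<diamondop> w)) v) u"
    by (rule tsum_swap)
  also have "\<dots> = sw (\<lambda>u1 u2. extn bs (\<lambda>ys. f (act u1 a # ys)) (u2 \<diamondop> w)) (u \<diamondop> v)"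
    by (rule sw_mult[where t = sB, symmetric]) (intro lins')+
  finally show "extn ((iE v \<odot> pt a w) # bs) f u = extn (pt a w # bs) f (u \<diamondop> v)" by (simp only: extn_pt[OF f])
qed

text \<open>The factor w behind a is handed to the next argument, or leaves the extension on the
  right if there is none. Treating both cases in one statement lets a single induction over
  \<open>cs\<close> yield balancedness as well as right E-linearity.\<close>

lemma extn_pt_split:
  assumes "mlB f" shows "extn (cs @ pt a w # bs) f u = extn (cs @ iA a # (case bs of [] \<Rightarrow> [] | c # ds \<Rightarrow> (iE w \<odot> c) # ds)) f u \<odot> (if bs = [] then iE w else iE oE)"
  using assms
proof (induction cs arbitrary: f u)
  case Nil
  have l: "lin sB sB (\<lambda>x. x \<odot> iE w)" by (intro linsh)
  show ?case
    by (cases bs) (simp_all add: extn_pt Nil mB_one mE_one lin_tsum[OF l] mB_assoc iE_mult extn_iE_left mlin_Cons)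
next
  case (Cons c cs)
  have l: "lin sB sB (\<lambda>x. x \<odot> (if bs = [] then iE w else iE oE))" by (intro linsh)
  show ?case unfolding append_Cons extn.simps(2) Cons.IH[OF mlin_Cons[OF Cons.prems]] lin_tsum[OF l] ..
qed

lemma extn_balanced:
  assumes f: "mlB f" shows "extn (cs @ (b \<odot> iE v) # c # ds) f u = extn (cs @ b # (iE v \<odot> c) # ds) f u"
proof (rule B_ext[where t = sB and b = b])
  show "lin sB sB (\<lambda>b. extn (cs @ (b \<odot> iE v) # c # ds) f u)" "lin sB sB (\<lambda>b. extn (cs @ b # (iE v \<odot> c) # ds) f u)"
    by (intro extn_lin_b f linsh)+
  show "extn (cs @ (pt a w \<odot> iE v) # c # ds) f u = extn (cs @ pt a w # (iE v \<odot> c) # ds) f u" for a w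
    unfolding pt_iE extn_pt_split[OF f, of cs a "w \<diamondop> v" "c # ds"] extn_pt_split[OF f, of cs a w "(iE v \<odot> c) # ds"]
    by (simp add: iE_mult flip: mB_assoc)
qed

lemma extn_right:
  assumes f: "mlB f" shows "extn (cs @ [b \<odot> iE v]) f u = extn (cs @ [b]) f u \<odot> iE v"
proof (rule B_ext[where t = sB and b = b])
  show "lin sB sB (\<lambda>b. extn (cs @ [b \<odot> iE v]) f u)" "lin sB sB (\<lambda>b. extn (cs @ [b]) f u \<odot> iE v)"
    by (intro extn_lin_b f linsh)+
  show "extn (cs @ [pt a w \<odot> iE v]) f u = extn (cs @ [pt a w]) f u \<odot> iE v" for a w
    unfolding pt_iE extn_pt_split[OF f, of cs a "w \<diamondop> v" "[]"] extn_pt_split[OF f, of cs a w "[]"]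
    by (simp add: mB_assoc iE_mult)
qed

text \<open>For arguments from A this is F(u x1, x2, ..., xn), where F is the extension of
  \<open>f\<close>; for no arguments it is f() u.\<close>

abbreviation lext where "lext f u xs \<equiv> extn (map (\<lambda>a. iA a) xs) f u"

lemma lext_Cons: "mlB f \<Longrightarrow> lext f u (x # xs) = sw (\<lambda>u1 u2. lext (\<lambda>ys. f (act u1 x # ys)) u2 xs) u"
  by (simp add: extn_pt mE_one)

lemma lext_one: "mlB f \<Longrightarrow> lext f oE xs = f xs"
proof (induction xs arbitrary: f)
  case Nil show ?case by (simp add: mB_one)
next
  case (Cons x xs)
  note lins' = lin_tsum_fun extn_lin_fun linsh lin_comp[OF mlin_D0[OF Cons.prems]] extn_lin_u mlin_Cons Cons.prems
  show ?case unfolding lext_Cons[OF Cons.prems]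
    by (subst sw_one[where t = sB], (intro lins')+) (simp add: Cons.IH[OF mlin_Cons[OF Cons.prems]] act_one)
qed

text \<open>The argument \<open>v\<close> is the copy of E that closes the relative tensor power. It
  can be multiplied on at the end because the extension is right E-linear.\<close>

definition Fext where "Fext f = (\<lambda>bs v. extn bs f oE \<odot> iE v)"

lemma Fext_rel_cochains:
  assumes f: "f \<in> cochains A BB n" shows "Fext f \<in> rel_cochains E A act n"
proof -
  have ml: "mlB f" and z: "\<And>xs. length xs \<noteq> n \<Longrightarrow> f xs = 0"
    using f cochains_iff[of A BB f n] by (auto simp: vsA vsB)
  have z': "length bs \<noteq> n \<Longrightarrow> extn bs f u = 0" for bs u by (rule extn_zero) (simp add: z)
  have l: "lin sB sB (\<lambda>x. x \<odot> iE u)" for u by (intro linsh)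
  show ?thesis unfolding rel_cochains_def Let_def mem_Collect_eq BB_simps
  proof (intro conjI allI impI)
    show "multilinear sB sB n (\<lambda>bs. Fext f bs w)" for w
      unfolding multilinear_def Fext_def by (auto simp: upd_conv_take_nth_drop intro!: linsh extn_lin_b ml)
    show "lin sE sB (Fext f bs)" for bs unfolding Fext_def by (intro linsh)
    show "Fext f bs w = 0" if "length bs \<noteq> n" for bs w using that by (simp add: Fext_def z' lin_zero[OF l])
    show "Fext f (bs[i := bs ! i \<odot> iE v]) w = Fext f (bs[Suc i := iE v \<odot> bs ! Suc i]) w" if "length bs = n" "Suc i < n" for bs i v w
    proof -
      have bs: "bs = take i bs @ bs ! i # bs ! Suc i # drop (Suc (Suc i)) bs"
        using that id_take_nth_drop[of i bs] Cons_nth_drop_Suc[of "Suc i" bs] by simp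
      have 1: "bs[i := x] = take i bs @ x # bs ! Suc i # drop (Suc (Suc i)) bs" for x
        using that upd_conv_take_nth_drop[of i bs x] Cons_nth_drop_Suc[of "Suc i" bs] by simp
      have 2: "bs[Suc i := x] = take i bs @ bs ! i # x # drop (Suc (Suc i)) bs" for x
        using that by (simp add: upd_conv_take_nth_drop take_Suc_conv_app_nth)
      show ?thesis unfolding 1 2 Fext_def extn_balanced[OF ml] ..
    qed
    show "Fext f (bs @ [b \<odot> iE v]) w = Fext f (bs @ [b]) (v \<diamondop> w)" for bs b v w
      by (simp add: Fext_def extn_right[OF ml] mB_assoc iE_mult)
    show "Fext f bs (w \<diamondop> v) = Fext f bs w \<odot> iE v" for bs w v
      by (simp add: Fext_def mB_assoc iE_mult)
  qed
qed

lemma restrict_Fext: "mlB f \<Longrightarrow> restrict_cochain E A (Fext f) = f"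
  by (auto simp: restrict_cochain_def Fext_def mB_one lext_one)

text \<open>In a relative tensor power all factors from E can be pushed to the far right, leaving
  arguments from A. So a relative cochain is known from its restriction, which is therefore
  injective, and the inverse used in \<open>cochain_act\<close> can only be
  \<open>Fext\<close>.\<close>

lemma rel_cochain_determined:
  assumes F: "F \<in> rel_cochains E A act n" shows "F = Fext (restrict_cochain E A F)"
proof -
  define f where "f = restrict_cochain E A F"
  have R: "\<And>w. multilinear sB sB n (\<lambda>bs. F bs w)" "\<And>bs. length bs = n \<Longrightarrow> lin sE sB (F bs)"
    "\<And>bs w. length bs \<noteq> n \<Longrightarrow> F bs w = 0"
    and bal: "\<And>bs i v w. length bs = n \<Longrightarrow> Suc i < n \<Longrightarrow> F (bs[i := bs ! i \<odot> iE v]) w = F (bs[Suc i := iE v \<odot> bs ! Suc i]) w"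
    and bal': "\<And>bs b v w. Suc (length bs) = n \<Longrightarrow> F (bs @ [b \<odot> iE v]) w = F (bs @ [b]) (v \<diamondop> w)"
    and rt: "\<And>bs v w. length bs = n \<Longrightarrow> F bs (w \<diamondop> v) = F bs w \<odot> iE v"
    using F unfolding rel_cochains_def Let_def mem_Collect_eq BB_simps by blast+
  have "(\<lambda>bs. F bs w) \<in> cochains BB BB n" for w
    using R(1,3) by (simp add: cochains_def)
  then have ml: "mlin sB sB (\<lambda>bs. F bs w)" for w using cochains_iff[of BB BB "\<lambda>bs. F bs w" n] by (simp add: vsB)
  have mlf: "mlB f" unfolding mlin_def f_def restrict_cochain_def
    by (simp, intro allI, rule lin_comp[OF mlin_D[OF ml]]) (intro linsh)
  have balanced: "F (cs @ (b \<odot> iE v) # c # ds) w = F (cs @ b # (iE v \<odot> c) # ds) w" for cs b v c ds w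
  proof (cases "length (cs @ b # c # ds) = n")
    case True
    then have "Suc (length cs) < n" by simp
    from bal[OF True this, of v w] show ?thesis by (simp add: nth_append list_update_append)
  next
    case False then show ?thesis using R(3) by simp
  qed
  \<comment> \<open>Here \<open>xs\<close> are the arguments already reduced to A, \<open>u\<close>
    is the factor from E waiting in front of the next argument b, and the induction consumes the
    untouched list \<open>bs\<close>.\<close>
  have key: "length xs + length bs + 1 = n \<Longrightarrow> F (map (\<lambda>a. iA a) xs @ (iE u \<odot> b) # bs) v = extn (b # bs) (\<lambda>ys. f (xs @ ys)) u \<odot> iE v" for xs u b bs v
  proof (induction bs arbitrary: xs u b)
    case Nil
    note mlf' = mlin_append[OF mlf, of xs]
    have n: "Suc (length xs) = n" using Nil by simp
    show ?case
    proof (rule B_ext[where t = sB and b = b])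
      show "lin sB sB (\<lambda>b. F (map (\<lambda>a. iA a) xs @ [iE u \<odot> b]) v)" by (rule lin_comp[OF mlin_D[OF ml]]) (intro linsh)
      show "lin sB sB (\<lambda>b. extn [b] (\<lambda>ys. f (xs @ ys)) u \<odot> iE v)" by (intro linsh extn_lin_b0 mlf')
      fix a w
      have l: "lin sB sB (\<lambda>x. F (map (\<lambda>a. iA a) xs @ [x]) v)" by (rule mlin_D[OF ml])
      have l2: "lin sB sB (\<lambda>x. x \<odot> iE v)" by (intro linsh)
      have "F (map (\<lambda>a. iA a) xs @ [iE u \<odot> pt a w]) v = sw (\<lambda>u1 u2. F (map (\<lambda>a. iA a) xs @ [iA (act u1 a) \<odot> iE (u2 \<diamondop> w)]) v) u"
        by (simp add: iE_pt lin_tsum[OF l] iA_iE)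
      also have "\<dots> = sw (\<lambda>u1 u2. f (xs @ [act u1 a]) \<odot> iE (u2 \<diamondop> w) \<odot> iE v) u"
      proof (rule tsum_cong)
        fix u1 u2
        have "F (map (\<lambda>a. iA a) xs @ [iA (act u1 a) \<odot> iE (u2 \<diamondop> w)]) v = F (map (\<lambda>a. iA a) xs @ [iA (act u1 a)]) (oE \<diamondop> (u2 \<diamondop> w \<diamondop> v))"
          by (subst bal') (simp_all add: n one_mE)
        also have "\<dots> = F (map (\<lambda>a. iA a) (xs @ [act u1 a])) oE \<odot> iE (u2 \<diamondop> w \<diamondop> v)"
          by (subst rt) (use n in simp_all)
        also have "\<dots> = f (xs @ [act u1 a]) \<odot> iE (u2 \<diamondop> w) \<odot> iE v"
          by (simp add: f_def restrict_cochain_def mB_assoc iE_mult)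
        finally show "F (map (\<lambda>a. iA a) xs @ [iA (act u1 a) \<odot> iE (u2 \<diamondop> w)]) v = f (xs @ [act u1 a]) \<odot> iE (u2 \<diamondop> w) \<odot> iE v" .
      qed
      also have "\<dots> = extn [pt a w] (\<lambda>ys. f (xs @ ys)) u \<odot> iE v"
        by (simp add: extn_pt[OF mlf'] lin_tsum[OF l2])
      finally show "F (map (\<lambda>a. iA a) xs @ [iE u \<odot> pt a w]) v = extn [pt a w] (\<lambda>ys. f (xs @ ys)) u \<odot> iE v" .
    qed
  next
    case (Cons c bs)
    note mlf' = mlin_append[OF mlf, of xs]
    show ?case
    proof (rule B_ext[where t = sB and b = b])
      show "lin sB sB (\<lambda>b. F (map (\<lambda>a. iA a) xs @ (iE u \<odot> b) # c # bs) v)" by (rule lin_comp[OF mlin_D[OF ml]]) (intro linsh)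
      show "lin sB sB (\<lambda>b. extn (b # c # bs) (\<lambda>ys. f (xs @ ys)) u \<odot> iE v)" by (intro linsh extn_lin_b0 mlf')
      fix a w
      have l: "lin sB sB (\<lambda>x. F (map (\<lambda>a. iA a) xs @ x # c # bs) v)" by (rule mlin_D[OF ml])
      have l2: "lin sB sB (\<lambda>x. x \<odot> iE v)" by (intro linsh)
      have "F (map (\<lambda>a. iA a) xs @ (iE u \<odot> pt a w) # c # bs) v = sw (\<lambda>u1 u2. F (map (\<lambda>a. iA a) xs @ (iA (act u1 a) \<odot> iE (u2 \<diamondop> w)) # c # bs) v) u"
        by (simp add: iE_pt lin_tsum[OF l] iA_iE)
      also have "\<dots> = sw (\<lambda>u1 u2. F (map (\<lambda>a. iA a) (xs @ [act u1 a]) @ (iE (u2 \<diamondop> w) \<odot> c) # bs) v) u"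
        by (simp add: balanced)
      also have "\<dots> = sw (\<lambda>u1 u2. extn (c # bs) (\<lambda>ys. f (xs @ act u1 a # ys)) (u2 \<diamondop> w) \<odot> iE v) u"
        by (subst Cons.IH) (use Cons.prems in simp_all)
      also have "\<dots> = extn (pt a w # c # bs) (\<lambda>ys. f (xs @ ys)) u \<odot> iE v"
        by (simp add: extn_pt[OF mlf'] lin_tsum[OF l2])
      finally show "F (map (\<lambda>a. iA a) xs @ (iE u \<odot> pt a w) # c # bs) v = extn (pt a w # c # bs) (\<lambda>ys. f (xs @ ys)) u \<odot> iE v" .
    qed
  qed
  have "F bs v = Fext f bs v" for bs v
  proof (cases "length bs = n")
    case False
    have "lin sB sB (\<lambda>x. x \<odot> iE v)" by (intro linsh)
    from False lin_zero[OF this] show ?thesis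
      unfolding Fext_def by (subst extn_zero) (auto simp: R(3) f_def restrict_cochain_def)
  next
    case True
    show ?thesis
    proof (cases bs)
      case Nil
      have "F [] v = F [] (oE \<diamondop> v)" by (simp add: one_mE)
      also have "\<dots> = F [] oE \<odot> iE v" using True Nil by (intro rt) simp
      finally show ?thesis using Nil by (simp add: Fext_def f_def restrict_cochain_def mB_one)
    next
      case (Cons b bs')
      then show ?thesis using key[of "[]" bs' oE b v] True by (simp add: Fext_def one_mB)
    qed
  qed
  then show ?thesis by (auto simp: f_def)
qed

lemma the_inv_restrict:
  assumes f: "f \<in> cochains A BB n"
  shows "the_inv_into (rel_cochains E A act n) (restrict_cochain E A) f = Fext f"
proof (rule the_inv_into_f_eq)
  show "inj_on (restrict_cochain E A) (rel_cochains E A act n)"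
    by (rule inj_onI) (subst rel_cochain_determined, assumption, subst (2) rel_cochain_determined, assumption, simp)
  show "restrict_cochain E A (Fext f) = f"
    using f cochains_iff[of A BB f n] by (auto simp: vsA vsB restrict_Fext)
qed (rule Fext_rel_cochains[OF f])

section \<open>The conjugation action of the double on cochains, made explicit\<close>

abbreviation adB where "adB w b \<equiv> sw (\<lambda>w1 w2. iE (S w1) \<odot> b \<odot> iE w2) w"

lemma coact_hit: "tsum E (\<lambda>m0 m1. sB (ev' \<xi> m1) m0) (tsum E (\<lambda>a w. sw (\<lambda>w1 w2. tens BB E (pt a w1) w2) w) b) = hit (ev' \<xi>) b"
proof -
  have L: "lin (fscl sB) sB (tsum E (\<lambda>m0 m1. sB (ev' \<xi> m1) m0))"
    by (rule lin_tsum_arg[OF lin_ident[OF vs_fscl[OF vsB]] vsB]) (intro linsB)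
  have p: "tsum E (\<lambda>m0 m1. sB (ev' \<xi> m1) m0) (tens BB E b w) = sB (ev' \<xi> w) b" for b w
    by (rule tsum_tens'[OF based, where t = sB]) (unfold BB_simps, (intro linsB)+)
  show ?thesis by (simp add: lin_tsum[OF L] p hit_def)
qed

lemma dact_B_eq: "dact_B E A act d b = tsum ED (\<lambda>w \<xi>. adB w (hit (ev' \<xi>) b)) d"
  by (simp add: dact_B_def Let_def yd_act_def coact_hit)

lemma dact_B_dp: "dact_B E A act (dp w \<xi>) b = adB w (hit (ev' \<xi>) b)"
  unfolding dact_B_eq by (rule D_tsum_dp[where t = sB]) (intro linsh)+

lemma dact_B_lin: "lin s (fscl sE) g \<Longrightarrow> lin s sB (\<lambda>z. dact_B E A act (g z) b)"
  unfolding dact_B_eq by (rule lin_tsum_arg[OF _ vsE], assumption) (intro linsh)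

lemma dact_B_lin_right: "lin s sB g \<Longrightarrow> lin s sB (\<lambda>z. dact_B E A act d (g z))"
  unfolding dact_B_eq by (intro linsh)

lemma dact_E_eq: "dact_E E d v = tsum ED (\<lambda>w \<xi>. sw (\<lambda>w1 w2. S w1 \<diamondop> sw (\<lambda>x y. sE (ev' \<xi> y) x) v \<diamondop> w2) w) d"
  by (simp add: dact_E_def yd_act_def)

lemma dact_E_lin: "lin s (fscl sE) g \<Longrightarrow> lin s sE (\<lambda>z. dact_E E (g z) v)"
  unfolding dact_E_eq by (rule lin_tsum_arg[OF _ vsE], assumption) (intro linsh)

lemma dact_E_dp: "dact_E E (dp w \<xi>) oE = sE (ev' \<xi> oE) (sE (eps w) oE)"
proof -
  have l: "lin sE sE (\<lambda>x. y \<diamondop> x \<diamondop> z)" for y z by (intro linsh)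
  have "dact_E E (dp w \<xi>) oE = sw (\<lambda>w1 w2. S w1 \<diamondop> sw (\<lambda>x y. sE (ev' \<xi> y) x) oE \<diamondop> w2) w"
    unfolding dact_E_eq by (rule D_tsum_dp[where t = sE]) (intro linsh)+
  also have "\<dots> = sw (\<lambda>w1 w2. S w1 \<diamondop> sE (ev' \<xi> oE) oE \<diamondop> w2) w"
  proof -
    have "sw (\<lambda>x y. sE (ev' \<xi> y) x) oE = sE (ev' \<xi> oE) oE"
      by (rule sw_one[where t = sE]) (intro linsh)+
    then show ?thesis by (simp only:)
  qed
  also have "\<dots> = sE (ev' \<xi> oE) (sw (\<lambda>w1 w2. S w1 \<diamondop> w2) w)"
    by (simp add: lin_scl[OF l] mE_one tsum_scale[OF vsE])
  finally show ?thesis using sw_S_left[OF lin_ident[OF vsE], of w] by simp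
qed

lemma hit_iA: assumes "lin sE (*) \<phi>" shows "hit \<phi> (iA x) = sB (\<phi> oE) (iA x)"
  unfolding hit_pt[OF assms] by (rule sw_one[where t = sB]) (intro linsh lin_comp[OF assms])+

lemma adB_iA: "dact_B E A act (dp w \<xi>) (iA x) = sB (ev' \<xi> oE) (adB w (iA x))"
proof -
  have "lin sB sB (\<lambda>b. adB w b)" by (intro linsh)
  from lin_scl[OF this] show ?thesis by (simp add: dact_B_dp hit_iA[OF ev_lin])
qed

lemma DD_cop_lin: "lin (fscl sE) (fscl (fscl sE)) (cop DD)"
proof -
  have t: "tens (double_alg E) (double_alg E) = tens DD DD"
    by (simp add: tens_def coord_def double_def Let_def fun_eq_iff)
  have c: "cop DD = (\<lambda>d. tsum ED (\<lambda>w \<xi>. sw (\<lambda>w1 w2. tsum ED (\<lambda>\<xi>1 \<xi>2. tens DD DD (dp w1 \<xi>1) (dp w2 \<xi>2)) (cop ED \<xi>)) w) d)"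
    unfolding t[symmetric] by (simp add: double_def Let_def)
  have l: "lin s (fscl sE) f \<Longrightarrow> lin s (fscl (fscl sE)) (\<lambda>z. tens DD DD (f z) y)" for s :: "'k \<Rightarrow> 'z::ab_group_add \<Rightarrow> 'z" and f y
    using lin_tens_left[of DD s f DD y] by (simp add: vs_DD)
  show ?thesis
    unfolding c by (intro lin_tsum_arg[OF lin_ident[OF vs_DD] vsE] lin_tsum_fun linsD l)
qed

abbreviation dev where "dev G h bs v \<equiv> diag_eval DD (dact_B E A act) (dact_E E) G h bs v"

lemma dev_lin_fun: "(\<And>bs v. lin s sB (\<lambda>z. \<phi> z bs v)) \<Longrightarrow> lin s sB (\<lambda>z. dev (\<phi> z) h bs v)"
proof (induction bs arbitrary: \<phi> h)
  case Nil then show ?case by simp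
next
  case (Cons b bs) show ?case unfolding diag_eval.simps by (intro lin_tsum_fun Cons)
qed

definition mlin2 :: "(('i \<Rightarrow> 'a) list \<Rightarrow> 'e \<Rightarrow> 'i \<Rightarrow> 'a) \<Rightarrow> bool" where
  "mlin2 G \<longleftrightarrow> (\<forall>v. mlin sB sB (\<lambda>bs. G bs v)) \<and> (\<forall>bs. lin sE sB (G bs))"

lemma mlin2_Cons: "mlin2 G \<Longrightarrow> mlin2 (\<lambda>bs. G (b # bs))"
  unfolding mlin2_def using mlin_Cons[where f = "\<lambda>bs. G bs v" for v] by blast

lemma mlin2_D: "mlin2 G \<Longrightarrow> lin sB sB (\<lambda>b. G (b # bs) v)" "mlin2 G \<Longrightarrow> lin sE sB (\<lambda>v. G bs v)"
  unfolding mlin2_def using mlin_D0[where f = "\<lambda>bs. G bs v"] by blast+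

lemma dev_lin:
  assumes G: "mlin2 G" and g: "lin s (fscl sE) g"
  shows "lin s sB (\<lambda>z. dev G (g z) bs v)"
proof (cases bs)
  case Nil show ?thesis unfolding Nil diag_eval.simps by (intro lin_comp[OF mlin2_D(2)[OF G]] dact_E_lin g)
next
  case (Cons b bs')
  show ?thesis unfolding Cons diag_eval.simps
    by (rule lin_tsum_arg[OF lin_comp[OF DD_cop_lin g] vs_DD])
       (intro dev_lin_fun lin_comp[OF mlin2_D(1)[OF G]] dact_B_lin lin_ident vs_DD)
qed

text \<open>The diagonal action of an element of E alone on arguments from A. The empty case is its
  action on the closing factor 1 of E, where the adjoint action reduces to the counit.\<close>

primrec dgE :: "('a list) \<Rightarrow> (('i \<Rightarrow> 'a) list \<Rightarrow> 'e \<Rightarrow> 'i \<Rightarrow> 'a) \<Rightarrow> 'e \<Rightarrow> 'i \<Rightarrow> 'a" where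
  "dgE [] G w = sB (eps w) (G [] oE)"
| "dgE (x # xs) G w = sw (\<lambda>w1 w2. dgE xs (\<lambda>bs. G (adB w1 (iA x) # bs)) w2) w"

lemma dgE_lin_fun: "(\<And>bs v. lin s sB (\<lambda>z. \<phi> z bs v)) \<Longrightarrow> lin s sB (\<lambda>z. dgE xs (\<phi> z) w)"
proof (induction xs arbitrary: \<phi> w)
  case Nil show ?case unfolding dgE.simps by (intro linsh Nil)
next
  case (Cons x xs) show ?case unfolding dgE.simps by (intro lin_tsum_fun Cons)
qed

lemma dgE_tsum: "dgE xs (\<lambda>bs v. tsum H (\<lambda>x y. \<phi> x y bs v) T) w = tsum H (\<lambda>x y. dgE xs (\<phi> x y) w) T"
proof (induction xs arbitrary: \<phi> w)
  case Nil show ?case by (simp add: tsum_scale[OF vsB])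
next
  case (Cons x xs) show ?case by (simp add: Cons, rule tsum_swap)
qed

text \<open>Functionals act on A and on the unit of E through their value at 1, because both are
  coinvariant. The legs of \<xi> thus multiply up to \<xi>(1), and only the adjoint action of w
  survives.\<close>

lemma dev_dp: "mlin2 G \<Longrightarrow> dev G (dp w \<xi>) (map (\<lambda>a. iA a) xs) oE = sB (ev' \<xi> oE) (dgE xs G w)"
proof (induction xs arbitrary: G w \<xi>)
  case Nil
  then show ?case by (simp add: dact_E_dp lin_scl[OF mlin2_D(2)] vs_scale_scale[OF vsB])
next
  case (Cons x xs)
  note G = Cons.prems
  have D: "lin sB sB (\<lambda>b. dgE xs (\<lambda>bs. G (b # bs)) w)" for w
    by (intro dgE_lin_fun mlin2_D(1)[OF G])
  have "dev G (dp w \<xi>) (map (\<lambda>a. iA a) (x # xs)) oE =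
     sw (\<lambda>w1 w2. tsum ED (\<lambda>\<xi>1 \<xi>2. dev (\<lambda>bs. G (dact_B E A act (dp w1 \<xi>1) (iA x) # bs)) (dp w2 \<xi>2) (map (\<lambda>a. iA a) xs) oE) (cop ED \<xi>)) w"
    unfolding list.map diag_eval.simps
    by (rule tsum_DD_cop_dp[where t = sB])
       (intro dev_lin_fun dev_lin lin_comp[OF mlin2_D(1)[OF G]] dact_B_lin lin_ident vs_DD mlin2_Cons G)+
  also have "\<dots> = sw (\<lambda>w1 w2. tsum ED (\<lambda>\<xi>1 \<xi>2. sB (ev' \<xi>1 oE * ev' \<xi>2 oE) (dgE xs (\<lambda>bs. G (adB w1 (iA x) # bs)) w2)) (cop ED \<xi>)) w"
    by (simp add: Cons.IH[OF mlin2_Cons[OF G]] adB_iA lin_scl[OF D] vs_scale_scale[OF vsB] mult.commute)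
  also have "\<dots> = sw (\<lambda>w1 w2. sB (tsum ED (\<lambda>\<xi>1 \<xi>2. ev' \<xi>1 oE * ev' \<xi>2 oE) (cop ED \<xi>)) (dgE xs (\<lambda>bs. G (adB w1 (iA x) # bs)) w2)) w"
    by (simp add: tsum_def[of ED] vs_sum_scale[OF vsB])
  also have "\<dots> = sB (ev' \<xi> oE) (dgE (x # xs) G w)"
    by (simp add: tsum_dual_cop one_mE tsum_scale[OF vsB])
  finally show ?case .
qed

text \<open>The arguments become S(w1) x1 w2, S(w3) x2 w4, and so on. Each inner pair w2 S(w3) meets
  across a tensor sign and cancels, so one antipode remains at the left end and one leg at the right
  end.\<close>

lemma dgE_extn: "mlB f \<Longrightarrow> dgE xs (\<lambda>bs v. extn bs f u \<odot> iE v) w = sw (\<lambda>w1 w2. lext f (u \<diamondop> S w1) xs \<odot> iE w2) w"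
proof (induction xs arbitrary: f u w)
  case Nil
  have "sw (\<lambda>w1 w2. lext f (u \<diamondop> S w1) [] \<odot> iE w2) w = sw (\<lambda>w1 w2. f [] \<odot> iE (u \<diamondop> (S w1 \<diamondop> w2))) w"
    by (simp add: mB_assoc iE_mult mE_assoc)
  also have "\<dots> = sB (eps w) (f [] \<odot> iE (u \<diamondop> oE))"
    by (rule sw_S_left[where t = sB]) (intro linsh)
  finally show ?case by (simp add: mB_one mE_one)
next
  case (Cons x xs)
  note f = Cons.prems
  note lins' = linsh extn_lin_fun lin_comp[OF mlin_D0[OF f]] extn_lin_u mlin_Cons f
  define \<Theta> where "\<Theta> p m r = sw (\<lambda>z1 z2. lext (\<lambda>ys. f (act z1 x # ys)) (z2 \<diamondop> m) xs \<odot> iE r) (u \<diamondop> S p)" for p m r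
  have T: "lin sE sB (\<lambda>z. \<Theta> z m r)" "lin sE sB (\<lambda>z. \<Theta> p z r)" "lin sE sB (\<lambda>z. \<Theta> p m z)" for p m r
    unfolding \<Theta>_def by (intro lins')+
  note linsT = linsh T[THEN lin_comp]
  have e: "extn (adB w1 (iA x) # bs) f u = sw (\<lambda>p q. sw (\<lambda>z1 z2. extn bs (\<lambda>ys. f (act z1 x # ys)) (z2 \<diamondop> q)) (u \<diamondop> S p)) w1" for bs w1
  proof -
    have l: "lin sB sB (\<lambda>b. extn (b # bs) f u)" by (intro extn_lin_b0 f lin_ident vsB)
    show ?thesis by (simp add: lin_tsum[OF l] mB_assoc extn_iE_left[OF f] iA_iE extn_pt[OF f])
  qed
  have l: "lin sB sB (\<lambda>b. b \<odot> iE v)" for v by (intro linsh)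
  have "dgE (x # xs) (\<lambda>bs v. extn bs f u \<odot> iE v) w
     = sw (\<lambda>w1 w2. sw (\<lambda>p q. sw (\<lambda>z1 z2. dgE xs (\<lambda>bs v. extn bs (\<lambda>ys. f (act z1 x # ys)) (z2 \<diamondop> q) \<odot> iE v) w2) (u \<diamondop> S p)) w1) w"
    by (simp add: e lin_tsum[OF l] dgE_tsum)
  also have "\<dots> = sw (\<lambda>w1 w2. sw (\<lambda>p q. sw (\<lambda>z1 z2. sw (\<lambda>r1 r2. lext (\<lambda>ys. f (act z1 x # ys)) (z2 \<diamondop> q \<diamondop> S r1) xs \<odot> iE r2) w2) (u \<diamondop> S p)) w1) w"
    by (simp add: Cons.IH[OF mlin_Cons[OF f]])
  also have "\<dots> = sw (\<lambda>w1 w2. sw (\<lambda>p q. sw (\<lambda>r1 r2. \<Theta> p (q \<diamondop> S r1) r2) w2) w1) w"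
    unfolding \<Theta>_def mE_assoc by (intro tsum_cong tsum_swap)
  also have "\<dots> = sw (\<lambda>p t. sw (\<lambda>q w2. sw (\<lambda>r1 r2. \<Theta> p (q \<diamondop> S r1) r2) w2) t) w"
    by (rule sw_assoc[where t = sB]) (intro linsT)+
  also have "\<dots> = sw (\<lambda>p t. \<Theta> p oE t) w"
    by (intro tsum_cong sw_S_right_left[where t = sB]) (intro linsT)+
  also have "\<dots> = sw (\<lambda>w1 w2. lext f (u \<diamondop> S w1) (x # xs) \<odot> iE w2) w"
    by (simp only: \<Theta>_def mE_one lext_Cons[OF f] lin_tsum[OF l])
  finally show ?case .
qed

text \<open>Arguments from A carry no coaction, but the extension leaves a factor of E on the right
  of the value. The last leg of that factor enters the functional.\<close>

lemma hit_lext: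
  assumes \<phi>: "lin sE (*) \<phi>"
  shows "mlB f \<Longrightarrow> hit \<phi> (lext f u xs) = sw (\<lambda>u1 u2. lext (\<lambda>ys. hit (\<lambda>y. \<phi> (y \<diamondop> u2)) (f ys)) u1 xs) u"
proof (induction xs arbitrary: f u)
  case Nil show ?case by (simp add: hit_iE_right[OF \<phi>])
next
  case (Cons x xs)
  note f = Cons.prems
  note lins' = linsh extn_lin_fun lin_comp[OF mlin_D0[OF f]] extn_lin_u mlin_Cons f lin_comp[OF \<phi>]
  have l: "lin sB sB (\<lambda>b. hit \<phi> b)" by (intro linsh)
  have m: "mlB (\<lambda>ys. hit (\<lambda>y. \<phi> (y \<diamondop> u2)) (f ys))" for u2
    using f unfolding mlin_def by (auto intro!: hit_lin)
  have "hit \<phi> (lext f u (x # xs)) = sw (\<lambda>z1 r. sw (\<lambda>u1 u2. lext (\<lambda>ys. hit (\<lambda>y. \<phi> (y \<diamondop> u2)) (f (act z1 x # ys))) u1 xs) r) u"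
    by (simp only: lext_Cons[OF f] lin_tsum[OF l] Cons.IH[OF mlin_Cons[OF f]])
  also have "\<dots> = sw (\<lambda>r u2. sw (\<lambda>z1 u1. lext (\<lambda>ys. hit (\<lambda>y. \<phi> (y \<diamondop> u2)) (f (act z1 x # ys))) u1 xs) r) u"
    by (rule sw_assoc[where t = sB, symmetric]) (intro lins' mlin_Cons[OF m])+
  also have "\<dots> = sw (\<lambda>u1 u2. lext (\<lambda>ys. hit (\<lambda>y. \<phi> (y \<diamondop> u2)) (f ys)) u1 (x # xs)) u"
    by (simp only: lext_Cons[OF m])
  finally show ?case .
qed

definition ract :: "'e \<Rightarrow> ('a list \<Rightarrow> 'i \<Rightarrow> 'a) \<Rightarrow> 'a list \<Rightarrow> 'i \<Rightarrow> 'a" where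
  "ract w f = (\<lambda>xs. sw (\<lambda>w1 w2. iE (S w1) \<odot> lext f w2 xs) w)"

definition dact :: "('i \<Rightarrow> 'e) \<Rightarrow> ('a list \<Rightarrow> 'i \<Rightarrow> 'a) \<Rightarrow> 'a list \<Rightarrow> 'i \<Rightarrow> 'a" where
  "dact d f = (\<lambda>xs. tsum ED (\<lambda>w \<xi>. ract w (\<lambda>ys. hit (ev' \<xi>) (f ys)) xs) d)"

lemma mlB_hit: "mlB f \<Longrightarrow> mlB (\<lambda>ys. hit \<phi> (f ys))"
  unfolding mlin_def by (auto intro!: hit_lin)

lemma ract_lin:
  assumes "mlB f" "lin s sE g" shows "lin s sB (\<lambda>z. ract (g z) f xs)"
  unfolding ract_def by (intro linsh extn_lin_u assms)

lemma ract_lin_fun: "(\<And>ys. lin s sB (\<lambda>z. \<phi> z ys)) \<Longrightarrow> lin s sB (\<lambda>z. ract w (\<phi> z) xs)"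
  unfolding ract_def by (intro linsh extn_lin_fun)

lemma dact_dp: assumes f: "mlB f" shows "dact (dp w \<xi>) f = ract w (\<lambda>ys. hit (ev' \<xi>) (f ys))"
  unfolding dact_def by (rule HOL.ext, rule D_tsum_dp[where t = sB]) (intro ract_lin ract_lin_fun mlB_hit f linsh)+

lemma dact_lin:
  assumes f: "mlB f" and g: "lin s (fscl sE) g" shows "lin s sB (\<lambda>z. dact (g z) f xs)"
  unfolding dact_def by (rule lin_tsum_arg[OF g vsE]) (intro ract_lin mlB_hit f lin_ident vsE)

lemma dact_lin_fun: "(\<And>ys. lin s sB (\<lambda>z. \<phi> z ys)) \<Longrightarrow> lin s sB (\<lambda>z. dact d (\<phi> z) xs)"
  unfolding dact_def by (intro lin_tsum_fun ract_lin_fun hit_lin)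

lemma mlin2_Fext: assumes "mlB f" shows "mlin2 (Fext f)"
  unfolding mlin2_def mlin_def Fext_def by (auto intro!: linsh extn_lin_b assms)

lemma cochain_act_dp:
  assumes f: "f \<in> cochains A BB n"
  shows "cochain_act E A act n (dp (S t) \<xi>) f = ract (S t) (\<lambda>ys. hit (ev' \<xi>) (f ys))"
proof
  fix as
  have ml: "mlB f" using f cochains_iff[of A BB f n] by (auto simp: vsA vsB)
  note m2 = mlin2_Fext[OF ml]
  note lin0 = linsh extn_lin_fun lin_comp[OF mlin_D0[OF ml]] extn_lin_u ml mlB_hit
  let ?Q = "\<lambda>v. sw (\<lambda>a b. lext f (S a) as \<odot> iE b) v"
  \<comment> \<open>All slots for elements of E are kept separate, with \<open>m\<close> reserved
    for b2 S(v3), so that coassociativity can regroup the legs before anything cancels.\<close>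
  define H where "H v1 a b1 m t2 = adB (S t2) (hit (\<lambda>y. ev' \<xi> (y \<diamondop> (m \<diamondop> S (S v1)))) (lext f (S a) as) \<odot> iE b1)" for v1 a b1 m t2
  have lH: "lin sE sB (\<lambda>z. H z a b1 m t2)" "lin sE sB (\<lambda>z. H v1 z b1 m t2)" "lin sE sB (\<lambda>z. H v1 a z m t2)"
     "lin sE sB (\<lambda>z. H v1 a b1 z t2)" "lin sE sB (\<lambda>z. H v1 a b1 m z)" for v1 a b1 m t2
    unfolding H_def by (intro lin0)+
  note linH = linsh lH[THEN lin_comp]
  have dev: "dev (Fext f) (anti DD (dp (S t1) \<xi>2)) (map (\<lambda>a. iA a) as) oE
     = sw (\<lambda>u v3. sw (\<lambda>v1 v2. sB (ev' \<xi>2 (S v3 \<diamondop> S (S v1))) (?Q v2)) u) t1" for t1 \<xi>2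
  proof -
    have l: "lin (fscl sE) sB (\<lambda>h. dev (Fext f) h (map (\<lambda>a. iA a) as) oE)"
      by (intro dev_lin m2 lin_ident vs_DD)
    have l1: "lin sE (*) (\<lambda>x. ev' \<xi>2 (S (S v1 \<diamondop> x \<diamondop> v3)))" for v1 v3 by (intro linsh)
    have d: "dgE as (Fext f) w = ?Q w" for w
      unfolding Fext_def using dgE_extn[OF ml, of as oE w] by (simp add: one_mE)
    show ?thesis
      by (simp add: DD_anti lin_tsum[OF l] dev_dp[OF m2] d ev_to_dual[OF l1]) (simp add: mE_one S_mult mE_assoc S_one)
  qed
  \<comment> \<open>One leg of \<xi> acts outside through the coaction, the other inside as a
    scalar. The rule \<xi>1(y) \<xi>2(z) = \<xi>(yz) joins them into a single functional.\<close>
  have dual: "tsum ED (\<lambda>\<xi>1 \<xi>2. adB w (hit (ev' \<xi>1) (sw (\<lambda>u v3. sw (\<lambda>v1 v2. sB (ev' \<xi>2 (Z v1 v3)) (?Q v2)) u) t1))) (cop ED \<xi>)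
     = adB w (sw (\<lambda>u v3. sw (\<lambda>v1 v2. hit (\<lambda>y. ev' \<xi> (y \<diamondop> Z v1 v3)) (?Q v2)) u) t1)" for w t1 Z
  proof -
    have la: "lin sB sB (\<lambda>b. adB w b)" by (intro linsh)
    have lh: "lin sB sB (\<lambda>b. hit \<phi> b)" for \<phi> by (intro linsh)
    have h: "hit (\<lambda>y. ev' \<xi> (y \<diamondop> z)) b = tsum ED (\<lambda>\<xi>1 \<xi>2. sB (ev' \<xi>2 z) (hit (ev' \<xi>1) b)) (cop ED \<xi>)" for z b
    proof -
      have "hit (\<lambda>y. ev' \<xi> (y \<diamondop> z)) b = tsum E (\<lambda>a w. sw (\<lambda>w1 w2. tsum ED (\<lambda>\<xi>1 \<xi>2. sB (ev' \<xi>2 z) (sB (ev' \<xi>1 w2) (pt a w1))) (cop ED \<xi>)) w) b"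
        unfolding hit_def by (simp add: vs_scale_scale[OF vsB] mult.commute flip: tsum_dual_cop) (simp add: tsum_def vs_sum_scale[OF vsB])
      also have "\<dots> = tsum E (\<lambda>a w. tsum ED (\<lambda>\<xi>1 \<xi>2. sw (\<lambda>w1 w2. sB (ev' \<xi>2 z) (sB (ev' \<xi>1 w2) (pt a w1))) w) (cop ED \<xi>)) b"
        by (intro tsum_cong tsum_swap)
      also have "\<dots> = tsum ED (\<lambda>\<xi>1 \<xi>2. tsum E (\<lambda>a w. sw (\<lambda>w1 w2. sB (ev' \<xi>2 z) (sB (ev' \<xi>1 w2) (pt a w1))) w) b) (cop ED \<xi>)"
        by (rule tsum_swap)
      finally show ?thesis by (simp add: hit_def tsum_scale[OF vsB])
    qed
    have "adB w (sw (\<lambda>u v3. sw (\<lambda>v1 v2. hit (\<lambda>y. ev' \<xi> (y \<diamondop> Z v1 v3)) (?Q v2)) u) t1)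
       = sw (\<lambda>u v3. sw (\<lambda>v1 v2. tsum ED (\<lambda>\<xi>1 \<xi>2. sB (ev' \<xi>2 (Z v1 v3)) (adB w (hit (ev' \<xi>1) (?Q v2)))) (cop ED \<xi>)) u) t1"
      by (simp only: h lin_tsum[OF la] lin_scl[OF la])
    also have "\<dots> = sw (\<lambda>u v3. tsum ED (\<lambda>\<xi>1 \<xi>2. sw (\<lambda>v1 v2. sB (ev' \<xi>2 (Z v1 v3)) (adB w (hit (ev' \<xi>1) (?Q v2)))) u) (cop ED \<xi>)) t1"
      by (intro tsum_cong tsum_swap)
    also have "\<dots> = tsum ED (\<lambda>\<xi>1 \<xi>2. sw (\<lambda>u v3. sw (\<lambda>v1 v2. sB (ev' \<xi>2 (Z v1 v3)) (adB w (hit (ev' \<xi>1) (?Q v2)))) u) t1) (cop ED \<xi>)"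
      by (rule tsum_swap)
    also have "\<dots> = tsum ED (\<lambda>\<xi>1 \<xi>2. adB w (hit (ev' \<xi>1) (sw (\<lambda>u v3. sw (\<lambda>v1 v2. sB (ev' \<xi>2 (Z v1 v3)) (?Q v2)) u) t1))) (cop ED \<xi>)"
      by (simp only: lin_tsum[OF la] lin_scl[OF la] lin_tsum[OF lh] lin_scl[OF lh])
    finally show ?thesis ..
  qed
  have ladB: "lin sB sB (\<lambda>b. adB w b)" for w by (intro linsh)
  have "cochain_act E A act n (dp (S t) \<xi>) f as
     = sw (\<lambda>w1 w2. tsum ED (\<lambda>\<xi>1 \<xi>2. dact_B E A act (dp w1 \<xi>1) (dev (Fext f) (anti DD (dp w2 \<xi>2)) (map (\<lambda>a. iA a) as) oE)) (cop ED \<xi>)) (S t)"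
    unfolding cochain_act_def the_inv_restrict[OF f] restrict_cochain_def rel_act_def
    by (rule tsum_DD_cop_dp[where t = sB]) (intro dact_B_lin dact_B_lin_right dev_lin m2 DD_anti_lin lin_ident vs_DD)+
  also have "\<dots> = sw (\<lambda>t1 t2. tsum ED (\<lambda>\<xi>1 \<xi>2. dact_B E A act (dp (S t2) \<xi>1) (dev (Fext f) (anti DD (dp (S t1) \<xi>2)) (map (\<lambda>a. iA a) as) oE)) (cop ED \<xi>)) t"
    by (rule sw_S[where t = sB]) (intro lin_tsum_fun dact_B_lin dact_B_lin_right dev_lin m2 DD_anti_lin linsD)+
  also have "\<dots> = sw (\<lambda>t1 t2. adB (S t2) (sw (\<lambda>u v3. sw (\<lambda>v1 v2. hit (\<lambda>y. ev' \<xi> (y \<diamondop> (S v3 \<diamondop> S (S v1)))) (?Q v2)) u) t1)) t"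
    unfolding dev dact_B_dp dual ..
  also have "\<dots> = sw (\<lambda>t1 t2. sw (\<lambda>u v3. sw (\<lambda>v1 v2. sw (\<lambda>a b. sw (\<lambda>b1 b2. H v1 a b1 (b2 \<diamondop> S v3) t2) b) v2) u) t1) t"
  proof -
    have l: "lin sE (*) (\<lambda>y. ev' \<xi> (y \<diamondop> z))" for z by (intro linsh)
    have lh: "lin sB sB (\<lambda>b. hit \<phi> b)" for \<phi> by (intro linsh)
    show ?thesis unfolding H_def by (simp only: lin_tsum[OF lh] hit_iE_right[OF l] lin_tsum[OF ladB] mE_assoc)
  qed
  also have "\<dots> = sw (\<lambda>t1 t2. sw (\<lambda>v1 r. sw (\<lambda>v2 v3. sw (\<lambda>a b. sw (\<lambda>b1 b2. H v1 a b1 (b2 \<diamondop> S v3) t2) b) v2) r) t1) t"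
    by (rule tsum_cong, rule sw_assoc[where t = sB]) (intro linH)+
  also have "\<dots> = sw (\<lambda>t1 t2. sw (\<lambda>v1 r. sw (\<lambda>a r'. sw (\<lambda>b v3. sw (\<lambda>b1 b2. H v1 a b1 (b2 \<diamondop> S v3) t2) b) r') r) t1) t"
    by (rule tsum_cong, rule tsum_cong, rule sw_assoc[where t = sB]) (intro linH)+
  also have "\<dots> = sw (\<lambda>t1 t2. sw (\<lambda>v1 r. sw (\<lambda>a r'. sw (\<lambda>b1 r''. sw (\<lambda>b2 v3. H v1 a b1 (b2 \<diamondop> S v3) t2) r'') r') r) t1) t"
    by (rule tsum_cong, rule tsum_cong, rule tsum_cong, rule sw_assoc[where t = sB]) (intro linH)+
  also have "\<dots> = sw (\<lambda>t1 t2. sw (\<lambda>v1 r. sw (\<lambda>a r'. H v1 a r' oE t2) r) t1) t"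
    by (rule tsum_cong, rule tsum_cong, rule tsum_cong, rule sw_S_right_right[where t = sB]) (intro linH)+
  finally have 1: "cochain_act E A act n (dp (S t) \<xi>) f as = \<dots>" .
  let ?K = "\<lambda>m z. lext (\<lambda>ys. hit (\<lambda>y. ev' \<xi> (y \<diamondop> m)) (f ys)) z as"
  have lK: "lin sE sB (\<lambda>z. ?K z x)" "lin sE sB (\<lambda>z. ?K m z)" for x m by (intro lin0)+
  note linK = linsh lK[THEN lin_comp]
  let ?g = "\<lambda>ys. hit (ev' \<xi>) (f ys)"
  have hK: "hit (\<lambda>y. ev' \<xi> (y \<diamondop> (oE \<diamondop> S (S v1)))) (lext f (S a) as) = sw (\<lambda>a1 a2. ?K (S (S v1 \<diamondop> a1)) (S a2)) a" for v1 a
  proof -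
    have l: "lin sE (*) (\<lambda>y. ev' \<xi> (y \<diamondop> S (S v1)))" by (intro linsh)
    have "hit (\<lambda>y. ev' \<xi> (y \<diamondop> (oE \<diamondop> S (S v1)))) (lext f (S a) as) = sw (\<lambda>u1 u2. ?K (u2 \<diamondop> S (S v1)) u1) (S a)"
      by (simp only: one_mE hit_lext[OF l ml] mE_assoc)
    also have "\<dots> = sw (\<lambda>a1 a2. ?K (S a1 \<diamondop> S (S v1)) (S a2)) a"
      by (rule sw_S[where t = sB]) (intro linK)+
    finally show ?thesis by (simp only: S_mult)
  qed
  have lr: "lin sB sB (\<lambda>b. b \<odot> iE v)" for v by (intro linsh)
  note 1
  also have "sw (\<lambda>t1 t2. sw (\<lambda>v1 r. sw (\<lambda>a r'. H v1 a r' oE t2) r) t1) t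
     = sw (\<lambda>t1 t2. sw (\<lambda>v1 r. sw (\<lambda>a r'. sw (\<lambda>a1 a2. adB (S t2) (?K (S (S v1 \<diamondop> a1)) (S a2) \<odot> iE r')) a) r) t1) t"
    unfolding H_def by (simp only: hK lin_tsum[OF lr] lin_tsum[OF ladB])
  also have "\<dots> = sw (\<lambda>t1 t2. sw (\<lambda>v1 r. sw (\<lambda>a1 s. sw (\<lambda>a2 r'. adB (S t2) (?K (S (S v1 \<diamondop> a1)) (S a2) \<odot> iE r')) s) r) t1) t"
    by (rule tsum_cong, rule tsum_cong, rule sw_assoc[where t = sB]) (intro linK)+
  also have "\<dots> = sw (\<lambda>t1 t2. sw (\<lambda>a2 r'. adB (S t2) (?K (S oE) (S a2) \<odot> iE r')) t1) t"
    by (rule tsum_cong, rule sw_S_left_left[where t = sB]) (intro linK)+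
  also have "\<dots> = sw (\<lambda>t1 t2. sw (\<lambda>a2 r'. adB (S t2) (lext ?g (S a2) as \<odot> iE r')) t1) t"
    by (simp only: S_one mE_one)
  also have "\<dots> = sw (\<lambda>t1 t2. sw (\<lambda>a r. sw (\<lambda>p q. iE (S (S q)) \<odot> lext ?g (S a) as \<odot> iE (r \<diamondop> S p)) t2) t1) t"
    by (subst sw_S[where t = sB], (intro linsh)+) (simp only: mB_assoc iE_mult)
  also have "\<dots> = sw (\<lambda>a s. sw (\<lambda>r t2. sw (\<lambda>p q. iE (S (S q)) \<odot> lext ?g (S a) as \<odot> iE (r \<diamondop> S p)) t2) s) t"
    by (rule sw_assoc[where t = sB]) (intro lin0)+
  also have "\<dots> = sw (\<lambda>a s. iE (S (S s)) \<odot> lext ?g (S a) as \<odot> iE oE) t"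
    by (rule tsum_cong, rule sw_S_right_left[where t = sB]) (intro lin0)+
  also have "\<dots> = ract (S t) ?g as"
    unfolding ract_def by (subst sw_S[where t = sB], (intro lin0)+) (simp only: mB_one)
  finally show "cochain_act E A act n (dp (S t) \<xi>) f as = ract (S t) ?g as" .
qed

text \<open>Both sides are linear in the element of the double, and surjectivity of the antipode
  brings every pure element w \<xi> into the form S(t) \<xi> treated before.\<close>

lemma cochain_act_eq:
  assumes f: "f \<in> cochains A BB n" shows "cochain_act E A act n d f = dact d f"
proof
  fix as
  have ml: "mlB f" using f cochains_iff[of A BB f n] by (auto simp: vsA vsB)
  show "cochain_act E A act n d f as = dact d f as"
  proof (rule D_ext[where t = sB and d = d])
    show "lin (fscl sE) sB (\<lambda>d. cochain_act E A act n d f as)"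
      unfolding cochain_act_def the_inv_restrict[OF f] restrict_cochain_def rel_act_def
      by (rule lin_tsum_arg[OF DD_cop_lin vs_DD]) (intro dact_B_lin lin_ident vs_DD)
    show "lin (fscl sE) sB (\<lambda>d. dact d f as)" by (intro dact_lin ml lin_ident vs_DD)
    fix w \<xi>
    obtain t where t: "w = S t" using S_bij by (rule bij_pointE)
    show "cochain_act E A act n (dp w \<xi>) f as = dact (dp w \<xi>) f as"
      unfolding t cochain_act_dp[OF f] dact_dp[OF ml] ..
  qed
qed

end

text \<open>The sign (-1)^n as a parity test, meaningful in any additive group and accessible to
  case analysis.\<close>

abbreviation pm :: "nat \<Rightarrow> 'm::ab_group_add \<Rightarrow> 'm" where "pm n x \<equiv> (if even n then x else - x)"

lemma pm_scale: "vector_space s \<Longrightarrow> s ((- 1) ^ n) x = pm n x"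
  by (simp add: vs_scale_one vs_neg)

section \<open>Hochschild cochains and the cup product\<close>

text \<open>
  The differential is \<open>HL + HR\<close>: \<open>HL\<close> is the first face and \<open>HR\<close> the alternating sum of the others. Unlike the
  differential, \<open>HR\<close> needs no degree and is recursive in the list of arguments.
\<close>

definition HL :: "('k, 'm::ab_group_add, 'z) kalg_scheme \<Rightarrow> ('a \<Rightarrow> 'm) \<Rightarrow> ('a list \<Rightarrow> 'm) \<Rightarrow> 'a list \<Rightarrow> 'm" where
  "HL M \<iota> f xs = (case xs of [] \<Rightarrow> 0 | x # ys \<Rightarrow> \<iota> x \<bullet>\<^bsub>M\<^esub> f ys)"

lemma HL_simps [simp]: "HL M \<iota> f [] = 0" "HL M \<iota> f (x # ys) = \<iota> x \<bullet>\<^bsub>M\<^esub> f ys"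
  by (simp_all add: HL_def)

fun HR :: "('k, 'a, 'y) kalg_scheme \<Rightarrow> ('k, 'm::ab_group_add, 'z) kalg_scheme \<Rightarrow> ('a \<Rightarrow> 'm) \<Rightarrow> ('a list \<Rightarrow> 'm) \<Rightarrow> 'a list \<Rightarrow> 'm" where
  "HR A M \<iota> f [] = 0"
| "HR A M \<iota> f [x] = - (f [] \<bullet>\<^bsub>M\<^esub> \<iota> x)"
| "HR A M \<iota> f (x # y # ys) = - f ((x \<bullet>\<^bsub>A\<^esub> y) # ys) - HR A M \<iota> (\<lambda>zs. f (x # zs)) (y # ys)"

lemma HR_cong: "(\<And>zs. Suc (length zs) = length xs \<Longrightarrow> f zs = g zs) \<Longrightarrow> HR A M \<iota> f xs = HR A M \<iota> g xs"
proof (induction A M \<iota> f xs arbitrary: g rule: HR.induct)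
  case (3 A M \<iota> f x y ys)
  have "HR A M \<iota> (\<lambda>zs. f (x # zs)) (y # ys) = HR A M \<iota> (\<lambda>zs. g (x # zs)) (y # ys)"
    by (rule 3(1)) (simp add: 3(2))
  then show ?case using 3(2)[of "(x \<bullet>\<^bsub>A\<^esub> y) # ys"] by simp
qed auto

lemma HR_map:
  assumes "\<And>b c. L (b + c) = L b + L c" "\<And>b x. L (b \<bullet>\<^bsub>M\<^esub> \<iota> x) = L b \<bullet>\<^bsub>M'\<^esub> \<iota>' x"
  shows "HR A M' \<iota>' (\<lambda>zs. L (f zs)) xs = L (HR A M \<iota> f xs)"
proof -
  have z: "L 0 = 0" using assms(1)[of 0 0] by simp
  have n: "L (- b) = - L b" for b using assms(1)[of b "- b"] z by (simp add: eq_neg_iff_add_eq_0 add.commute)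
  have d: "L (b - c) = L b - L c" for b c using assms(1)[of b "- c"] n by simp
  show ?thesis by (induction xs arbitrary: f rule: induct_list012) (simp_all add: z n d assms)
qed

lemma HR_map_list:
  assumes "\<And>x y. \<iota> (x \<bullet>\<^bsub>A\<^esub> y) = \<iota> x \<bullet>\<^bsub>M\<^esub> \<iota> y"
  shows "HR A M \<iota> (\<lambda>zs. F (map \<iota> zs)) xs = HR M M (\<lambda>b. b) F (map \<iota> xs)"
proof (induction xs arbitrary: F rule: induct_list012)
  case (3 x y xs) show ?case using 3(2)[of "\<lambda>zs. F (\<iota> x # zs)"] by (simp add: assms)
qed simp_all

locale hoch_alg =
  fixes A :: "('k::field, 'a::ab_group_add) kalg" and M :: "('k, 'm::ab_group_add) kalg" and \<iota> :: "'a \<Rightarrow> 'm"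
  assumes algA: "k_algebra A" and algM: "k_algebra M" and iota_lin: "lin (scl A) (scl M) \<iota>"
    and iota_mult: "\<iota> (x \<bullet>\<^bsub>A\<^esub> y) = \<iota> x \<bullet>\<^bsub>M\<^esub> \<iota> y"
begin

abbreviation sA where "sA \<equiv> scl A"
abbreviation sM where "sM \<equiv> scl M"
abbreviation mM (infixl "\<odot>" 70) where "x \<odot> y \<equiv> x \<bullet>\<^bsub>M\<^esub> y"
abbreviation L where "L \<equiv> HL M \<iota>"
abbreviation R where "R \<equiv> HR A M \<iota>"
abbreviation C where "C n \<equiv> cochains A M n"
abbreviation d where "d \<equiv> hoch_diff A M \<iota>"
abbreviation cp where "cp \<equiv> cup M"

lemmas vsA = k_algebraD(1)[OF algA] and vsM = k_algebraD(1)[OF algM]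
lemmas mM_assoc = k_algebraD(2)[OF algM]

lemma mM_lin: "lin sM sM (\<lambda>x. x \<odot> y)" "lin sM sM (\<lambda>x. y \<odot> x)"
  by (rule k_algebraD(5)[OF algM lin_ident[OF vsM]], rule k_algebraD(6)[OF algM lin_ident[OF vsM]])

lemmas mM_simps = lin_plus[OF mM_lin(1)] lin_plus[OF mM_lin(2)] lin_zero[OF mM_lin(1)] lin_zero[OF mM_lin(2)]
  lin_uminus[OF mM_lin(1)] lin_uminus[OF mM_lin(2)] lin_minus[OF mM_lin(1)] lin_minus[OF mM_lin(2)]

lemma C_iff: "f \<in> C n \<longleftrightarrow> mlin sA sM f \<and> (\<forall>xs. length xs \<noteq> n \<longrightarrow> f xs = 0)"
  by (rule cochains_iff[OF vsA vsM])

lemmas linsM = lin_ident[OF vsA] lin_ident[OF vsM] k_algebraD(5)[OF algM] k_algebraD(6)[OF algM]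
  k_algebraD(5)[OF algA] k_algebraD(6)[OF algA] lin_comp[OF iota_lin] lin_neg lin_diff lin_add

lemma R_lin_fun: "(\<And>zs. lin s sM (\<lambda>z. \<phi> z zs)) \<Longrightarrow> lin s sM (\<lambda>z. R (\<phi> z) xs)"
proof (induction xs arbitrary: \<phi> rule: induct_list012)
  case 1 show ?case by (simp add: lin_const_zero[OF lin_vs1[OF 1] vsM])
next
  case (2 x) show ?case unfolding HR.simps by (intro linsM 2)
next
  case (3 x y zs) show ?case unfolding HR.simps by (intro linsM 3)
qed

lemma mlin_R: assumes "mlin sA sM f" shows "mlin sA sM (R f)"
  unfolding mlin_def
proof safe
  fix xs ys
  have nil: "mlin sA sM f \<Longrightarrow> lin sA sM (\<lambda>x. R f (x # ys))" for f ys
    by (cases ys) (simp_all, (intro linsM R_lin_fun lin_comp[OF mlin_D0] | assumption)+)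
  show "lin sA sM (\<lambda>x. R f (xs @ x # ys))" using assms
  proof (induction xs arbitrary: f rule: induct_list012)
    case 1 then show ?case by (simp add: nil)
  next
    case (2 a)
    show ?case by simp (intro linsM lin_comp[OF mlin_D0[OF 2]] nil mlin_Cons 2)
  next
    case (3 a b xs)
    have "lin sA sM (\<lambda>x. f ((a \<bullet>\<^bsub>A\<^esub> b) # xs @ x # ys))" using mlin_D[OF 3(3), of "(a \<bullet>\<^bsub>A\<^esub> b) # xs" ys] by simp
    moreover have "lin sA sM (\<lambda>x. R (\<lambda>zs. f (a # zs)) (b # xs @ x # ys))"
      using 3(2)[OF mlin_Cons[OF 3(3)]] by simp
    ultimately show ?case by simp (intro linsM)
  qed
qed

lemma mlin_L: assumes "mlin sA sM f" shows "mlin sA sM (L f)"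
  unfolding mlin_def
proof safe
  fix xs ys
  show "lin sA sM (\<lambda>x. L f (xs @ x # ys))"
    by (cases xs) (simp_all, (intro linsM lin_comp[OF mlin_D[OF assms]])+)
qed

lemma R_sum_formula: "length xs = Suc n \<Longrightarrow> R f xs =
   (\<Sum>i<n. sM ((- 1) ^ Suc i) (f (take i xs @ [xs ! i \<bullet>\<^bsub>A\<^esub> xs ! Suc i] @ drop (i + 2) xs)))
   + sM ((- 1) ^ Suc n) (f (butlast xs) \<odot> \<iota> (last xs))"
proof (induction n arbitrary: xs f)
  case 0
  then obtain x where "xs = [x]" by (auto simp: length_Suc_conv)
  then show ?case by (simp add: vs_neg[OF vsM] vs_scale_one[OF vsM])
next
  case (Suc n)
  then obtain x y ys where xs: "xs = x # y # ys" by (auto simp: length_Suc_conv)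
  have "R f xs = - f ((x \<bullet>\<^bsub>A\<^esub> y) # ys) - R (\<lambda>zs. f (x # zs)) (y # ys)" by (simp add: xs)
  also have "R (\<lambda>zs. f (x # zs)) (y # ys) = (\<Sum>i<n. sM ((- 1) ^ Suc i) (f (x # take i (y # ys) @ [(y # ys) ! i \<bullet>\<^bsub>A\<^esub> (y # ys) ! Suc i] @ drop (i + 2) (y # ys))))
    + sM ((- 1) ^ Suc n) (f (x # butlast (y # ys)) \<odot> \<iota> (last (y # ys)))"
    using Suc.prems xs by (subst Suc.IH) simp_all
  finally show ?case
    by (simp add: xs sum.lessThan_Suc_shift vs_neg[OF vsM] vs_scale_one[OF vsM] sum_negf algebra_simps del: sum.lessThan_Suc)
qed

text \<open>The two parts do not know the degree. On lists of length other than n + 1 they only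
  evaluate \<open>f\<close> off length n, where a cochain vanishes, in agreement with the
  differential.\<close>

lemma d_eq: assumes f: "f \<in> C n" shows "d n f = (\<lambda>xs. L f xs + R f xs)"
proof
  fix xs
  show "d n f xs = L f xs + R f xs"
  proof (cases "length xs = Suc n")
    case True
    then obtain x ys where xs: "xs = x # ys" by (cases xs) auto
    show ?thesis using True R_sum_formula[OF True, of f] by (simp add: hoch_diff_def xs)
  next
    case False
    have f0: "f zs = 0" if "Suc (length zs) = length xs" for zs using False f that by (auto simp: C_iff)
    have "R f xs = R (\<lambda>_. 0) xs" by (rule HR_cong) (rule f0)
    also have "\<dots> = 0" using HR_map[where L = "\<lambda>_. 0" and f = "\<lambda>_. 0" and M' = M and M = M and \<iota>' = \<iota> and \<iota> = \<iota>] by (simp add: mM_simps)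
    finally have "R f xs = 0" .
    moreover have "L f xs = 0" by (cases xs) (auto simp: f0 mM_simps)
    ultimately show ?thesis using False by (simp add: hoch_diff_def)
  qed
qed

lemma d_C: assumes f: "f \<in> C n" shows "d n f \<in> C (Suc n)"
  unfolding C_iff
proof (intro conjI allI impI)
  have "mlin sA sM f" using f by (simp add: C_iff)
  from mlin_L[OF this] mlin_R[OF this] show "mlin sA sM (d n f)"
    unfolding d_eq[OF f] mlin_def by (auto intro: lin_add)
  show "length xs \<noteq> Suc n \<Longrightarrow> d n f xs = 0" for xs by (simp add: hoch_diff_def)
qed

lemma R_add: "R (\<lambda>zs. f zs + g zs) xs = R f xs + R g xs"
  by (induction xs arbitrary: f g rule: induct_list012) (simp_all add: mM_simps)

lemma R_left: "R (\<lambda>zs. b \<odot> f zs) xs = b \<odot> R f xs"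
  by (rule HR_map) (simp_all add: mM_simps mM_assoc)

lemma R_neg: "R (\<lambda>zs. - f zs) xs = - R f xs"
  by (rule HR_map) (simp_all add: mM_simps)

lemma R_diff: "R (\<lambda>zs. f zs - g zs) xs = R f xs - R g xs"
  using R_add[of f "\<lambda>zs. - g zs" xs] by (simp add: R_neg)

text \<open>Peeling off the first argument x, the induction hypothesis for f(x, -) handles the faces
  that leave x alone, and associativity of A cancels the two ways of merging the first three
  arguments. Two arguments need that \<open>\<iota>\<close> is multiplicative.\<close>

lemma R_R: "R (R f) xs = 0"
proof (induction xs arbitrary: f rule: length_induct)
  case (1 xs)
  consider "xs = []" | x where "xs = [x]" | x y where "xs = [x, y]" | x y z zs where "xs = x # y # z # zs"
    by (metis neq_Nil_conv)
  then show ?case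
  proof cases
    case 4
    have c: "R (\<lambda>ws. R f (x # ws)) (y # z # zs) = - R f (x # (y \<bullet>\<^bsub>A\<^esub> z) # zs)
        - R (\<lambda>ws. - f ((x \<bullet>\<^bsub>A\<^esub> y) # ws) - R (\<lambda>zs. f (x # zs)) (y # ws)) (z # zs)"
      by simp
    have "length (y # z # zs) < length xs" by (simp add: 4)
    from 1[rule_format, OF this] have "R (R (\<lambda>zs. f (x # zs))) (y # z # zs) = 0" .
    then have "- R (\<lambda>zs. f (x # zs)) ((y \<bullet>\<^bsub>A\<^esub> z) # zs) - R (\<lambda>ws. R (\<lambda>zs. f (x # zs)) (y # ws)) (z # zs) = 0"
      by (simp only: HR.simps)
    then have ih: "- R (\<lambda>zs. f (x # zs)) ((y \<bullet>\<^bsub>A\<^esub> z) # zs) = R (\<lambda>ws. R (\<lambda>zs. f (x # zs)) (y # ws)) (z # zs)"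
      by (simp only: right_minus_eq)
    show ?thesis unfolding 4 HR.simps(3)[of A M \<iota> "R f"] c R_diff R_neg ih[symmetric] HR.simps(3)[of A M \<iota> f] k_algebraD(2)[OF algA] by simp
  qed (simp_all add: mM_simps iota_mult mM_assoc)
qed

lemma d_d: assumes f: "f \<in> C n" shows "d (Suc n) (d n f) = 0"
proof
  fix xs
  let ?g = "\<lambda>xs. L f xs + R f xs"
  have "L ?g xs + R ?g xs = 0"
  proof (cases xs)
    case (Cons x ys)
    show ?thesis
    proof (cases ys)
      case (Cons y zs)
      have "R ?g xs = R (L f) xs" by (simp add: R_add R_R)
      then show ?thesis by (simp add: Cons \<open>xs = x # ys\<close> mM_simps iota_mult mM_assoc R_left)
    qed (simp add: Cons mM_simps)
  qed simp
  moreover have "d (Suc n) (d n f) xs = L (d n f) xs + R (d n f) xs" by (simp only: d_eq[OF d_C[OF f]])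
  ultimately show "d (Suc n) (d n f) xs = 0 xs" by (simp only: d_eq[OF f] zero_fun_apply)
qed

text \<open>The faces are divided at the end of the block evaluated by g. The last face of R g,
  right multiplication by \<iota> z, does not occur on the left-hand side; the term H (g ys \<odot>
  \<iota> z) zs removes it. H is kept general because the rule serves both cup products and
  insertions.\<close>

lemma R_split:
  assumes H: "\<And>b c zs. H (b + c) zs = H b zs + H c zs"
  shows "R (\<lambda>ws. H (g (take (length ys) ws)) (drop (length ys) ws)) (ys @ z # zs)
    = H (R g (ys @ [z])) zs + pm (length ys) (H (g ys \<odot> \<iota> z) zs + R (H (g ys)) (z # zs))"
proof -
  have H0: "H 0 zs = 0" for zs using H[of 0 0] by simp
  have Hn: "H (- b) zs = - H b zs" for b zs using H[of b "- b"] H0 by (simp add: eq_neg_iff_add_eq_0 add.commute)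
  have Hd: "H (b - c) zs = H b zs - H c zs" for b c zs using H[of b "- c"] Hn by simp
  show ?thesis
  proof (induction ys arbitrary: g)
    case Nil show ?case by (simp add: Hn)
  next
    case (Cons y ys)
    obtain w ws where w: "ys @ [z] = w # ws" by (cases ys) auto
    obtain ws' where w': "ys @ z # zs = w # ws'" "ws' = ws @ zs" using w by (metis append_Cons append_assoc append_Nil)
    have t: "take (length ys) ws' = ws" "drop (length ys) ws' = zs"
      using arg_cong[OF w, of length] w'(2) by simp_all
    have "R (\<lambda>ws. H (g (take (length (y # ys)) ws)) (drop (length (y # ys)) ws)) ((y # ys) @ z # zs)
      = - H (g ((y \<bullet>\<^bsub>A\<^esub> w) # ws)) zs - R (\<lambda>ws. H (g (y # take (length ys) ws)) (drop (length ys) ws)) (ys @ z # zs)"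
      by (simp add: w'(1) t)
    also have "R (\<lambda>ws. H (g (y # take (length ys) ws)) (drop (length ys) ws)) (ys @ z # zs)
      = H (R (\<lambda>ws. g (y # ws)) (ys @ [z])) zs + pm (length ys) (H (g (y # ys) \<odot> \<iota> z) zs + R (H (g (y # ys))) (z # zs))"
      by (rule Cons.IH)
    finally show ?case by (simp add: w Hd Hn)
  qed
qed

lemma cup_eq: assumes f: "f \<in> C m" and g: "g \<in> C n"
  shows "cp m n f g = (\<lambda>xs. f (take m xs) \<odot> g (drop m xs))"
proof
  fix xs
  show "cp m n f g xs = f (take m xs) \<odot> g (drop m xs)"
  proof (cases "length xs = m + n")
    case False
    then have "length (take m xs) \<noteq> m \<or> length (drop m xs) \<noteq> n" by auto
    then have "f (take m xs) = 0 \<or> g (drop m xs) = 0" using f g by (auto simp: C_iff)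
    then show ?thesis using False by (auto simp: cup_def mM_simps)
  qed (simp add: cup_def)
qed

lemma mlin_cup: assumes m: "mlin sA sM f" "mlin sA sM g" shows "mlin sA sM (\<lambda>ws. f (take m ws) \<odot> g (drop m ws))"
  unfolding mlin_def
proof safe
  fix xs ys
  show "lin sA sM (\<lambda>x. f (take m (xs @ x # ys)) \<odot> g (drop m (xs @ x # ys)))"
    by (cases "m - length xs") (simp_all, (intro linsM lin_comp[OF mlin_D[OF m(1)]] lin_comp[OF mlin_D[OF m(2)]])+)
qed

lemma cup_C: assumes f: "f \<in> C m" and g: "g \<in> C n" shows "cp m n f g \<in> C (m + n)"
  unfolding C_iff
proof (intro conjI allI impI)
  show "mlin sA sM (cp m n f g)" unfolding cup_eq[OF f g] by (rule mlin_cup) (use f g in \<open>auto simp: C_iff\<close>)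
qed (simp add: cup_def)

text \<open>The Leibniz rule is \<open>R_split\<close> for H b ws = b \<odot> g ws: the correction f
  ys \<odot> \<iota> z \<odot> g zs is precisely the first face of g.\<close>

lemma d_cup: assumes f: "f \<in> C m" and g: "g \<in> C n"
  shows "d (m + n) (cp m n f g) = cp (Suc m) n (d m f) g + pm m (cp m (Suc n) f (d n g))"
proof
  fix xs
  show "d (m + n) (cp m n f g) xs = (cp (Suc m) n (d m f) g + pm m (cp m (Suc n) f (d n g))) xs"
  proof (cases "length xs = Suc (m + n)")
    case False then show ?thesis by (simp add: hoch_diff_def cup_def)
  next
    case True
    then have "m < length xs" by simp
    then obtain ys z zs where xs: "xs = ys @ z # zs" and m: "m = length ys"
      by (metis id_take_nth_drop length_take min.absorb4)
    have HL: "L (\<lambda>xs. f (take m xs) \<odot> g (drop m xs)) xs = L f (ys @ [z]) \<odot> g zs"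
      by (cases ys) (simp_all add: xs m mM_assoc)
    have HR: "R (\<lambda>xs. f (take m xs) \<odot> g (drop m xs)) xs = R f (ys @ [z]) \<odot> g zs + pm m (f ys \<odot> \<iota> z \<odot> g zs + f ys \<odot> R g (z # zs))"
      using R_split[of "\<lambda>b ws. b \<odot> g ws" f ys z zs] by (simp add: xs m mM_simps R_left)
    have "d (m + n) (cp m n f g) xs = L f (ys @ [z]) \<odot> g zs + (R f (ys @ [z]) \<odot> g zs + pm m (f ys \<odot> \<iota> z \<odot> g zs + f ys \<odot> R g (z # zs)))"
      unfolding d_eq[OF cup_C[OF f g]] unfolding cup_eq[OF f g] HL HR ..
    also have "\<dots> = d m f (ys @ [z]) \<odot> g zs + pm m (f ys \<odot> d n g (z # zs))"
      by (simp add: d_eq[OF f] d_eq[OF g] mM_simps mM_assoc)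
    also have "\<dots> = (cp (Suc m) n (d m f) g + pm m (cp m (Suc n) f (d n g))) xs"
      unfolding cup_eq[OF d_C[OF f] g] plus_fun_apply by (simp add: cup_eq[OF f d_C[OF g], unfolded m] xs m)
    finally show ?thesis .
  qed
qed

section \<open>Cohomology groups, and the reduction of the graded statement to cochains\<close>

definition Z where "Z n = {f \<in> C n. d n f = 0}"
abbreviation Bd where "Bd \<equiv> coboundaries A M \<iota>"
abbreviation CZ where "CZ \<equiv> cocycles A M \<iota>"
abbreviation cls where "cls \<equiv> hoch_class A M \<iota>"
abbreviation sF where "sF \<equiv> fscl sM"
abbreviation G where "G n \<equiv> CZ n Mod Bd n"

lemma vsF: "vector_space sF" by (rule vs_fscl[OF vsM])

lemma C_zero: "0 \<in> C n" and C_add: "f \<in> C n \<Longrightarrow> g \<in> C n \<Longrightarrow> f + g \<in> C n"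
  and C_scale: "f \<in> C n \<Longrightarrow> sF c f \<in> C n" and C_neg: "f \<in> C n \<Longrightarrow> - f \<in> C n"
  unfolding C_iff mlin_def fscl_def
  by (auto intro!: lin_const_zero vsA vsM lin_add lin_scale lin_neg simp: vs_zero[OF vsM])

lemma d_add: "f \<in> C n \<Longrightarrow> g \<in> C n \<Longrightarrow> d n (f + g) = d n f + d n g"
proof -
  assume f: "f \<in> C n" and g: "g \<in> C n"
  have "L (f + g) xs + R (f + g) xs = L f xs + R f xs + (L g xs + R g xs)" for xs
    using R_add[of f g xs] by (cases xs) (simp_all add: plus_fun_def mM_simps)
  then show ?thesis unfolding d_eq[OF f] d_eq[OF g] d_eq[OF C_add[OF f g]] by (simp add: fun_eq_iff)
qed

lemma d_scale: "f \<in> C n \<Longrightarrow> d n (sF c f) = sF c (d n f)"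
proof -
  assume f: "f \<in> C n"
  have "R (\<lambda>zs. sM c (f zs)) xs = sM c (R f xs)" for xs
    by (rule HR_map) (simp_all add: vs_scale_add[OF vsM] lin_scl[OF mM_lin(1)])
  then have "L (sF c f) xs + R (sF c f) xs = sM c (L f xs + R f xs)" for xs
    by (cases xs) (simp_all add: fscl_def lin_scl[OF mM_lin(2)] vs_scale_add[OF vsM] vs_zero[OF vsM])
  then show ?thesis unfolding d_eq[OF f] d_eq[OF C_scale[OF f]] by (simp add: fun_eq_iff fscl_def)
qed

lemma d_zero: "d n 0 = 0"
  using d_add[OF C_zero C_zero, of n] by simp

lemma C_minus: "f \<in> C n \<Longrightarrow> g \<in> C n \<Longrightarrow> f - g \<in> C n"
  using C_add[OF _ C_neg] by fastforce

lemma d_neg: "f \<in> C n \<Longrightarrow> d n (- f) = - d n f"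
  using d_add[of f n "- f"] C_neg[of f n] d_zero[of n] by (simp add: eq_neg_iff_add_eq_0 add.commute)

lemma Z_add: "f \<in> Z n \<Longrightarrow> g \<in> Z n \<Longrightarrow> f + g \<in> Z n" and Z_zero: "0 \<in> Z n"
  and Z_neg: "f \<in> Z n \<Longrightarrow> - f \<in> Z n" and Z_scale: "f \<in> Z n \<Longrightarrow> sF c f \<in> Z n"
  by (simp_all add: Z_def C_add d_add C_zero d_zero C_neg d_neg C_scale d_scale vs_zero[OF vsF])

lemma Z_C: "f \<in> Z n \<Longrightarrow> f \<in> C n" and Z_d: "f \<in> Z n \<Longrightarrow> d n f = 0"
  by (simp_all add: Z_def)

lemma Bd_Z: "b \<in> Bd n \<Longrightarrow> b \<in> Z n"
  using Z_zero by (cases n) (auto simp: Z_def d_C d_d)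

lemma Bd_zero: "0 \<in> Bd n"
  by (cases n) (auto intro!: image_eqI[where x = 0] simp: d_zero C_zero)

lemma Bd_add: "b \<in> Bd n \<Longrightarrow> c \<in> Bd n \<Longrightarrow> b + c \<in> Bd n"
proof (cases n)
  case (Suc k)
  assume "b \<in> Bd n" "c \<in> Bd n"
  then obtain f g where "f \<in> C k" "g \<in> C k" "b = d k f" "c = d k g" using Suc by auto
  then show ?thesis using Suc C_add by (auto intro!: image_eqI[where x = "f + g"] simp: d_add)
qed simp

lemma Bd_scale: "b \<in> Bd n \<Longrightarrow> sF c b \<in> Bd n"
  by (cases n) (auto simp: vs_zero[OF vsF] d_scale[symmetric] intro: C_scale)

lemma Bd_neg: "b \<in> Bd n \<Longrightarrow> - b \<in> Bd n"
  using Bd_scale[of b n "- 1"] by (simp add: vs_neg[OF vsF] vs_scale_one[OF vsF])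

lemma Bd_minus: "b \<in> Bd n \<Longrightarrow> c \<in> Bd n \<Longrightarrow> b - c \<in> Bd n"
  using Bd_add[OF _ Bd_neg] by fastforce

lemma Bd_sum: "(\<And>i. i \<in> I \<Longrightarrow> f i \<in> Bd n) \<Longrightarrow> sum f I \<in> Bd n"
  by (induction I rule: infinite_finite_induct) (auto intro: Bd_zero Bd_add)

lemma Z_sum: "(\<And>i. i \<in> I \<Longrightarrow> f i \<in> Z n) \<Longrightarrow> sum f I \<in> Z n"
  by (induction I rule: infinite_finite_induct) (auto intro: Z_zero Z_add)

lemma CZ_simps [simp]: "carrier (CZ n) = Z n" "x \<otimes>\<^bsub>CZ n\<^esub> y = x + y" "\<one>\<^bsub>CZ n\<^esub> = 0"
  by (simp_all add: cocycles_def Z_def)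

lemma CZ_group: "comm_group (CZ n)"
proof (rule comm_groupI)
  fix f assume "f \<in> carrier (CZ n)"
  then show "\<exists>g\<in>carrier (CZ n). g \<otimes>\<^bsub>CZ n\<^esub> f = \<one>\<^bsub>CZ n\<^esub>"
    by (intro bexI[of _ "- f"]) (use Z_neg in auto)
qed (use Z_add Z_zero in \<open>auto simp: add.assoc add.commute\<close>)

lemma CZ_inv: "f \<in> Z n \<Longrightarrow> inv\<^bsub>CZ n\<^esub> f = - f"
proof -
  assume f: "f \<in> Z n"
  interpret comm_group "CZ n" by (rule CZ_group)
  show ?thesis by (rule inv_equality) (use f Z_neg in auto)
qed

lemma Bd_subgroup: "subgroup (Bd n) (CZ n)"
proof (rule subgroup.intro)
  show "inv\<^bsub>CZ n\<^esub> b \<in> Bd n" if "b \<in> Bd n" for b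
    unfolding CZ_inv[OF Bd_Z[OF that]] by (rule Bd_neg[OF that])
qed (use Bd_Z in \<open>auto simp: Bd_zero Bd_add\<close>)

lemma Bd_normal: "Bd n \<lhd> CZ n"
proof -
  interpret comm_group "CZ n" by (rule CZ_group)
  show ?thesis by (rule subgroup_imp_normal[OF Bd_subgroup])
qed

lemma G_group: "comm_group (G n)"
proof -
  interpret comm_group "CZ n" by (rule CZ_group)
  show ?thesis by (rule abelian_FactGroup[OF Bd_subgroup])
qed

lemma cls_mem: "g \<in> cls n f \<longleftrightarrow> g - f \<in> Bd n"
proof -
  have "g \<in> cls n f \<longleftrightarrow> (\<exists>b\<in>Bd n. g = b + f)" by (auto simp: hoch_class_def r_coset_def)
  also have "\<dots> \<longleftrightarrow> g - f \<in> Bd n" by (auto intro!: bexI[of _ "g - f"])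
  finally show ?thesis .
qed

lemma cls_eq: assumes "f - g \<in> Bd n" shows "cls n f = cls n g"
proof -
  have "h - f \<in> Bd n \<longleftrightarrow> h - g \<in> Bd n" for h
    using Bd_add[OF _ assms, of "h - f"] Bd_minus[OF _ assms, of "h - g"] by auto
  then show ?thesis by (auto simp: cls_mem)
qed

lemma cls_Z: "f \<in> Z n \<Longrightarrow> g \<in> cls n f \<Longrightarrow> g \<in> Z n"
  using Z_add[of "g - f" n f] Bd_Z[of "g - f" n] by (auto simp: cls_mem)

lemma G_carrier: "carrier (G n) = cls n ` Z n"
  by (auto simp: FactGroup_def RCOSETS_def hoch_class_def)

lemma G_mult: "f \<in> Z n \<Longrightarrow> g \<in> Z n \<Longrightarrow> cls n f \<otimes>\<^bsub>G n\<^esub> cls n g = cls n (f + g)"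
  using normal.rcos_sum[OF Bd_normal, of f n g] by (simp add: FactGroup_def hoch_class_def)

lemma G_one: "\<one>\<^bsub>G n\<^esub> = cls n 0"
  using Bd_minus[OF _ Bd_zero] by (auto simp: FactGroup_def cls_mem)

lemma G_finprod: "finite I \<Longrightarrow> (\<And>i. f i \<in> Z n) \<Longrightarrow> finprod (G n) (\<lambda>i. cls n (f i)) I = cls n (\<Sum>i\<in>I. f i)"
proof (induction I rule: finite_induct)
  case empty
  interpret comm_group "G n" by (rule G_group)
  show ?case by (simp only: finprod_empty G_one sum.empty)
next
  case (insert i I)
  interpret comm_group "G n" by (rule G_group)
  have "finprod (G n) (\<lambda>i. cls n (f i)) (insert i I) = cls n (f i) \<otimes>\<^bsub>G n\<^esub> finprod (G n) (\<lambda>i. cls n (f i)) I"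
    by (rule finprod_insert) (use insert G_carrier in auto)
  also have "\<dots> = cls n (f i + (\<Sum>i\<in>I. f i))"
    unfolding insert.IH[OF insert.prems] by (rule G_mult[OF insert.prems Z_sum[OF insert.prems]])
  finally show ?case by (simp only: sum.insert[OF insert.hyps])
qed

text \<open>Operations on cohomology are unions over representatives. Independence of the
  representative turns such a union into one value, so that computation on classes becomes
  computation on cocycles.\<close>

lemma UN_cls: "f \<in> Z n \<Longrightarrow> (\<And>g. g \<in> Z n \<Longrightarrow> g - f \<in> Bd n \<Longrightarrow> \<phi> g = Y) \<Longrightarrow> (\<Union>g\<in>cls n f. \<phi> g) = Y"
proof -
  assume f: "f \<in> Z n" and \<phi>: "\<And>g. g \<in> Z n \<Longrightarrow> g - f \<in> Bd n \<Longrightarrow> \<phi> g = Y"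
  have "f \<in> cls n f" by (simp add: cls_mem Bd_zero)
  moreover have "\<phi> g = Y" if "g \<in> cls n f" for g
    using \<phi> cls_Z[OF f that] that by (simp add: cls_mem)
  ultimately show ?thesis by auto
qed

lemma cup_add_left: "cp m n (f + f') g = cp m n f g + cp m n f' g"
  and cup_add_right: "cp m n f (g + g') = cp m n f g + cp m n f g'"
  and cup_scale_left: "cp m n (sF c f) g = sF c (cp m n f g)"
  and cup_scale_right: "cp m n f (sF c g) = sF c (cp m n f g)"
  and cup_zero: "cp m n 0 g = 0" "cp m n f 0 = 0"
  by (auto simp: cup_def fun_eq_iff mM_simps fscl_def lin_scl[OF mM_lin(1)] lin_scl[OF mM_lin(2)] vs_zero[OF vsM])

lemma cup_minus_left: "cp m n (f - f') g = cp m n f g - cp m n f' g"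
  and cup_minus_right: "cp m n f (g - g') = cp m n f g - cp m n f g'"
  by (auto simp: cup_def fun_eq_iff mM_simps)

lemma cup_Z: "f \<in> Z m \<Longrightarrow> g \<in> Z n \<Longrightarrow> cp m n f g \<in> Z (m + n)"
  by (simp add: Z_def cup_C d_cup cup_zero)

lemma cup_Bd_left: "b \<in> Bd m \<Longrightarrow> g \<in> Z n \<Longrightarrow> cp m n b g \<in> Bd (m + n)"
proof (cases m)
  case (Suc k)
  assume "b \<in> Bd m" and g: "g \<in> Z n"
  then obtain f where f: "f \<in> C k" "b = d k f" using Suc by auto
  have "cp m n b g = d (k + n) (cp k n f g)" using d_cup[OF f(1) Z_C[OF g]] f(2) Suc by (simp add: cup_zero Z_d[OF g])
  then show ?thesis using Suc f(1) Z_C[OF g] by (auto intro!: imageI cup_C)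
qed (simp add: cup_zero Bd_zero)

lemma cup_Bd_right: "f \<in> Z m \<Longrightarrow> b \<in> Bd n \<Longrightarrow> cp m n f b \<in> Bd (m + n)"
proof (cases n)
  case (Suc k)
  assume f: "f \<in> Z m" and "b \<in> Bd n"
  then obtain g where g: "g \<in> C k" "b = d k g" using Suc by auto
  have "d (m + k) (cp m k f g) = pm m (cp m n f b)" using d_cup[OF Z_C[OF f] g(1)] g Suc by (simp add: cup_zero Z_d[OF f])
  moreover have "d (m + k) (cp m k f g) \<in> Bd (m + n)" using Suc Z_C[OF f] g(1) by (auto intro!: imageI cup_C)
  ultimately show ?thesis using Bd_neg[of "- cp m n f b" "m + n"] by (auto split: if_splits)
qed (simp add: cup_zero Bd_zero)

lemma cup_cls: assumes f: "f \<in> Z m" "f' \<in> Z m" "f' - f \<in> Bd m" and g: "g \<in> Z n" "g' \<in> Z n" "g' - g \<in> Bd n"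
  shows "cls (m + n) (cp m n f' g') = cls (m + n) (cp m n f g)"
proof (rule cls_eq)
  have "cp m n f' g' - cp m n f g = cp m n (f' - f) g' + cp m n f (g' - g)"
    by (simp add: cup_minus_left cup_minus_right)
  also have "\<dots> \<in> Bd (m + n)" using cup_Bd_left[OF f(3) g(2)] cup_Bd_right[OF f(1) g(3)] by (rule Bd_add)
  finally show "cp m n f' g' - cp m n f g \<in> Bd (m + n)" .
qed

definition cunit where "cunit = (\<lambda>xs::'a list. if xs = [] then \<u>\<^bsub>M\<^esub> else 0)"

lemma cunit_Z: "cunit \<in> Z 0"
proof -
  have C: "cunit \<in> C 0" by (simp add: C_iff cunit_def mlin_def lin_const_zero[OF vsA vsM])
  have "d 0 cunit xs = 0" for xs
  proof (cases "length xs = Suc 0")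
    case True
    then obtain x where "xs = [x]" by (auto simp: length_Suc_conv)
    then show ?thesis unfolding d_eq[OF C] by (simp add: cunit_def k_algebraD(3,4)[OF algM])
  qed (simp add: hoch_diff_def)
  then show ?thesis using C unfolding Z_def by (simp add: fun_eq_iff)
qed

text \<open>Everything required of the graded algebra is reduced to identities of cochains. The
  module algebra laws hold strictly, and the braiding alone is demanded only up to a coboundary, for
  cocycles. The Hopf data and the action are parameters, so that the untwisted and the twisted case
  are both instances.\<close>

lemma HH_braided_commutative:
  fixes H :: "('k, 'h::ab_group_add, 'j::finite, 'z) bialg_scheme" and cact :: "nat \<Rightarrow> 'h \<Rightarrow> ('a list \<Rightarrow> 'm) \<Rightarrow> 'a list \<Rightarrow> 'm"
    and \<R> :: "'j \<Rightarrow> 'h"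
  assumes aC: "\<And>n h f. f \<in> C n \<Longrightarrow> cact n h f \<in> C n"
    and aadd: "\<And>n h f g. f \<in> C n \<Longrightarrow> g \<in> C n \<Longrightarrow> cact n h (f + g) = cact n h f + cact n h g"
    and ascl: "\<And>n h c f. f \<in> C n \<Longrightarrow> cact n h (sF c f) = sF c (cact n h f)"
    and aladd: "\<And>n h h' f. f \<in> C n \<Longrightarrow> cact n (h + h') f = cact n h f + cact n h' f"
    and alscl: "\<And>n h c f. f \<in> C n \<Longrightarrow> cact n (scl H c h) f = sF c (cact n h f)"
    and amul: "\<And>n h h' f. f \<in> C n \<Longrightarrow> cact n (h \<bullet>\<^bsub>H\<^esub> h') f = cact n h (cact n h' f)"
    and aone: "\<And>n f. f \<in> C n \<Longrightarrow> cact n \<u>\<^bsub>H\<^esub> f = f"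
    and ad: "\<And>n h f. f \<in> C n \<Longrightarrow> d n (cact n h f) = cact (Suc n) h (d n f)"
    and acup: "\<And>m n h f g. f \<in> C m \<Longrightarrow> g \<in> C n \<Longrightarrow>
       cact (m + n) h (cp m n f g) = tsum H (\<lambda>h1 h2. cp m n (cact m h1 f) (cact n h2 g)) (cop H h)"
    and aunit: "\<And>h. cact 0 h cunit = sF (cou H h) cunit"
    and braid: "\<And>m n f g. f \<in> Z m \<Longrightarrow> g \<in> Z n \<Longrightarrow>
       cp m n f g - sF ((- 1) ^ (m * n)) (tsum H (\<lambda>r r'. cp n m (cact n r' g) (cact m r f)) \<R>) \<in> Bd (m + n)"
  shows "braided_commutative H \<R> (HH A M \<iota> cact)"
proof -
  let ?\<Omega> = "HH A M \<iota> cact"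
  \<comment> \<open>An action commuting with d preserves cocycles and, by \<open>aB\<close> below,
    coboundaries; hence it descends to classes.\<close>
  have aZ: "cact n h f \<in> Z n" if "f \<in> Z n" for n h f
  proof -
    have "cact (Suc n) h 0 = 0" using aadd[OF C_zero C_zero, of "Suc n" h] by simp
    then show ?thesis using aC[OF Z_C[OF that]] ad[OF Z_C[OF that]] Z_d[OF that] by (simp add: Z_def)
  qed
  have amin: "cact n h (f - g) = cact n h f - cact n h g" if "f \<in> C n" "g \<in> C n" for n h f g
    using aadd[OF C_minus[OF that] that(2), of h] by (simp add: eq_diff_eq)
  have aB: "cact n h b \<in> Bd n" if b: "b \<in> Bd n" for n h b
  proof (cases n)
    case 0
    have "cact 0 h 0 = 0" using aadd[OF C_zero C_zero, of 0 h] by simp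
    then show ?thesis using b 0 by simp
  next
    case (Suc k)
    then obtain g where g: "g \<in> C k" "b = d k g" using b Suc by auto
    then show ?thesis using Suc aC[OF g(1)] by (auto simp: ad[symmetric])
  qed
  have gr: "gr ?\<Omega> n = G n" for n by (simp add: HH_def Let_def)
  have gscl: "gscl ?\<Omega> n c (cls n f) = cls n (sF c f)" if f: "f \<in> Z n" for n c and f :: "'a list \<Rightarrow> 'm"
  proof -
    have "(\<Union>g\<in>cls n f. cls n (sF c g)) = cls n (sF c f)"
    proof (rule UN_cls[OF f], rule cls_eq)
      fix g assume "g - f \<in> Bd n"
      then have "sF c (g - f) \<in> Bd n" by (rule Bd_scale)
      then show "sF c g - sF c f \<in> Bd n" by (simp add: lin_minus[OF lin_scale[OF lin_ident[OF vsF]]])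
    qed
    then show ?thesis by (simp add: HH_def Let_def fscl_def)
  qed
  have gact: "gact ?\<Omega> n h (cls n f) = cls n (cact n h f)" if f: "f \<in> Z n" for n h f
  proof -
    have "(\<Union>g\<in>cls n f. cls n (cact n h g)) = cls n (cact n h f)"
    proof (rule UN_cls[OF f], rule cls_eq)
      fix g assume g: "g \<in> Z n" "g - f \<in> Bd n"
      then show "cact n h g - cact n h f \<in> Bd n" using aB[of "g - f" n h] amin[OF Z_C[OF g(1)] Z_C[OF f]] by simp
    qed
    then show ?thesis by (simp add: HH_def Let_def)
  qed
  have gmul: "gmul ?\<Omega> m n (cls m f) (cls n g) = cls (m + n) (cp m n f g)" if f: "f \<in> Z m" and g: "g \<in> Z n" for m n f g
  proof -
    have "(\<Union>f'\<in>cls m f. \<Union>g'\<in>cls n g. cls (m + n) (cp m n f' g')) = cls (m + n) (cp m n f g)"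
      by (rule UN_cls[OF f], rule UN_cls[OF g], rule cup_cls) (use f g in auto)
    then show ?thesis by (simp add: HH_def Let_def)
  qed
  have gunt: "gunt ?\<Omega> = cls 0 cunit" by (simp add: HH_def Let_def cunit_def)
  have sum_cls: "gr_tsum H ?\<Omega> n (\<lambda>h h'. cls n (\<phi> h h')) t = cls n (tsum H \<phi> t)" if "\<And>h h'. \<phi> h h' \<in> Z n" for n \<phi> t
    unfolding gr_tsum_def tsum_def gr by (rule G_finprod) (use that in auto)
  have mlt: "cls n f \<otimes>\<^bsub>gr ?\<Omega> n\<^esub> cls n g = cls n (f + g)" if "f \<in> Z n" "g \<in> Z n" for n f g
    unfolding gr by (rule G_mult[OF that])
  have car: "carrier (gr ?\<Omega> n) = cls n ` Z n" for n unfolding gr by (rule G_carrier)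
  have lin: "gr_linear ?\<Omega> m n \<phi>" if "\<And>f. f \<in> Z m \<Longrightarrow> \<phi> (cls m f) = cls n (\<psi> f)" "\<And>f. f \<in> Z m \<Longrightarrow> \<psi> f \<in> Z n"
    "\<And>f g. f \<in> Z m \<Longrightarrow> g \<in> Z m \<Longrightarrow> \<psi> (f + g) = \<psi> f + \<psi> g" "\<And>c f. f \<in> Z m \<Longrightarrow> \<psi> (sF c f) = sF c (\<psi> f)" for m n \<phi> \<psi>
    unfolding gr_linear_def hom_def using that
    by (auto simp: car mlt gscl Z_add Z_scale)
  have sp: "gr_space ?\<Omega>" unfolding gr_space_def
  proof (intro allI conjI ballI)
    show "comm_group (gr ?\<Omega> n)" for n unfolding gr by (rule G_group)
    show "gscl ?\<Omega> n c \<in> hom (gr ?\<Omega> n) (gr ?\<Omega> n)" for n c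
      using lin[of n "gscl ?\<Omega> n c" n "sF c"] by (simp add: gr_linear_def gscl Z_scale vs_scale_add[OF vsF] vs_scale_scale[OF vsF] mult.commute)
    fix n x assume "x \<in> carrier (gr ?\<Omega> n)"
    then obtain f where x: "x = cls n f" "f \<in> Z n" by (auto simp: car)
    show "gscl ?\<Omega> n 1 x = x" by (simp add: x gscl vs_scale_one[OF vsF])
    show "gscl ?\<Omega> n (c * c') x = gscl ?\<Omega> n c (gscl ?\<Omega> n c' x)" for c c'
      by (simp add: x gscl Z_scale vs_scale_scale[OF vsF])
    show "gscl ?\<Omega> n (c + c') x = gscl ?\<Omega> n c x \<otimes>\<^bsub>gr ?\<Omega> n\<^esub> gscl ?\<Omega> n c' x" for c c'
      by (simp only: x gscl Z_scale mlt vs_add_scale[OF vsF])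
  qed
  have alg: "gr_algebra ?\<Omega>" unfolding gr_algebra_def
  proof (intro allI conjI ballI)
    show "gr_space ?\<Omega>" by (rule sp)
    show "gr_linear ?\<Omega> n (m + n) (gmul ?\<Omega> m n x)" if X: "x \<in> carrier (gr ?\<Omega> m)" for m n x
    proof -
      from X obtain f where x: "x = cls m f" "f \<in> Z m" by (auto simp: car)
      show ?thesis by (rule lin[of n _ "m + n" "cp m n f"]) (simp_all add: x gmul cup_Z cup_add_right cup_scale_right)
    qed
    show "gr_linear ?\<Omega> m (m + n) (\<lambda>x. gmul ?\<Omega> m n x y)" if X: "y \<in> carrier (gr ?\<Omega> n)" for m n y
    proof -
      from X obtain f where y: "y = cls n f" "f \<in> Z n" by (auto simp: car)
      show ?thesis by (rule lin[of m _ "m + n" "\<lambda>g. cp m n g f"]) (simp_all add: y gmul cup_Z cup_add_left cup_scale_left)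
    qed
    show "gmul ?\<Omega> (l + m) n (gmul ?\<Omega> l m x y) z = gmul ?\<Omega> l (m + n) x (gmul ?\<Omega> m n y z)"
      if X: "x \<in> carrier (gr ?\<Omega> l)" "y \<in> carrier (gr ?\<Omega> m)" "z \<in> carrier (gr ?\<Omega> n)" for l m n x y z
    proof -
      from X obtain f g h where x: "x = cls l f" "f \<in> Z l" "y = cls m g" "g \<in> Z m" "z = cls n h" "h \<in> Z n" by (auto simp: car)
      have "cp (l + m) n (cp l m f g) h = cp l (m + n) f (cp m n g h)"
        by (auto simp: cup_def fun_eq_iff mM_assoc take_drop drop_drop add.commute min_absorb1 add.left_commute mM_simps)
      then show ?thesis using cup_Z[OF x(2,4)] cup_Z[OF x(4,6)] by (simp add: x gmul add.assoc)
    qed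
    show "gunt ?\<Omega> \<in> carrier (gr ?\<Omega> 0)" by (simp add: gunt car cunit_Z)
    fix n x assume "x \<in> carrier (gr ?\<Omega> n)"
    then obtain f where x: "x = cls n f" "f \<in> Z n" by (auto simp: car)
    have f0: "length xs \<noteq> n \<Longrightarrow> f xs = 0" for xs using Z_C[OF x(2)] by (simp add: C_iff)
    have "cp 0 n cunit f = f" "cp n 0 f cunit = f"
      by (auto simp: cup_def cunit_def fun_eq_iff f0 k_algebraD(3,4)[OF algM])
    then show "gmul ?\<Omega> 0 n (gunt ?\<Omega>) x = x" "gmul ?\<Omega> n 0 x (gunt ?\<Omega>) = x"
      using gmul[OF cunit_Z x(2)] gmul[OF x(2) cunit_Z] by (simp_all add: x(1) gunt)
  qed
  have mod: "gr_module_algebra H ?\<Omega>" unfolding gr_module_algebra_def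
  proof (intro allI conjI ballI)
    show "gr_algebra ?\<Omega>" by (rule alg)
    show "gr_linear ?\<Omega> n n (gact ?\<Omega> n h)" for n h
      by (rule lin[of n _ n "cact n h"]) (simp_all add: gact aZ aadd ascl Z_C)
    show "gact ?\<Omega> 0 h (gunt ?\<Omega>) = gscl ?\<Omega> 0 (cou H h) (gunt ?\<Omega>)" for h
      by (simp add: gunt gact cunit_Z aunit gscl)
    show "gact ?\<Omega> (m + n) h (gmul ?\<Omega> m n x y) =
        gr_tsum H ?\<Omega> (m + n) (\<lambda>h1 h2. gmul ?\<Omega> m n (gact ?\<Omega> m h1 x) (gact ?\<Omega> n h2 y)) (cop H h)"
      if X: "x \<in> carrier (gr ?\<Omega> m)" "y \<in> carrier (gr ?\<Omega> n)" for h m n x y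
    proof -
      from X obtain f g where x: "x = cls m f" "f \<in> Z m" "y = cls n g" "g \<in> Z n" by (auto simp: car)
      show ?thesis
        by (simp add: x gmul gact cup_Z aZ acup[OF Z_C[OF x(2)] Z_C[OF x(4)]] sum_cls)
    qed
  next
    fix n x assume "x \<in> carrier (gr ?\<Omega> n)"
    then obtain f where x: "x = cls n f" "f \<in> Z n" by (auto simp: car)
    note fC = Z_C[OF x(2)]
    show "gact ?\<Omega> n (h + h') x = gact ?\<Omega> n h x \<otimes>\<^bsub>gr ?\<Omega> n\<^esub> gact ?\<Omega> n h' x" for h h'
      by (simp only: x gact mlt aZ aladd[OF fC])
    show "gact ?\<Omega> n (scl H c h) x = gscl ?\<Omega> n c (gact ?\<Omega> n h x)" for c h
      by (simp only: x gact gscl aZ alscl[OF fC])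
    show "gact ?\<Omega> n (h \<bullet>\<^bsub>H\<^esub> h') x = gact ?\<Omega> n h (gact ?\<Omega> n h' x)" for h h'
      by (simp only: x gact aZ amul[OF fC])
    show "gact ?\<Omega> n \<u>\<^bsub>H\<^esub> x = x" by (simp only: x gact aone[OF fC])
  qed
  show ?thesis unfolding braided_commutative_def
  proof (intro conjI allI ballI)
    show "gr_module_algebra H ?\<Omega>" by (rule mod)
    fix m n x y assume "x \<in> carrier (gr ?\<Omega> m)" "y \<in> carrier (gr ?\<Omega> n)"
    then obtain f g where x: "x = cls m f" "f \<in> Z m" "y = cls n g" "g \<in> Z n" by (auto simp: car)
    let ?\<phi> = "\<lambda>r r'. cp n m (cact n r' g) (cact m r f)"
    have Z: "?\<phi> r r' \<in> Z (m + n)" for r r' using cup_Z[OF aZ[OF x(4)] aZ[OF x(2)]] by (simp add: add.commute)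
    have mul: "gmul ?\<Omega> n m (gact ?\<Omega> n r' y) (gact ?\<Omega> m r x) = cls (m + n) (?\<phi> r r')" for r r'
      using gmul[OF aZ[OF x(4)] aZ[OF x(2)]] x by (simp add: gact add.commute)
    have "tsum H ?\<phi> \<R> \<in> Z (m + n)" unfolding tsum_def by (rule Z_sum) (rule Z)
    then show "gmul ?\<Omega> m n x y = gscl ?\<Omega> (m + n) ((- 1) ^ (m * n))
          (gr_tsum H ?\<Omega> (m + n) (\<lambda>r r'. gmul ?\<Omega> n m (gact ?\<Omega> n r' y) (gact ?\<Omega> m r x)) \<R>)"
      unfolding mul sum_cls[OF Z] by (simp only: gscl x(1,3) gmul[OF x(2,4)] cls_eq[OF braid[OF x(2,4)]])
  qed
qed

lemma R_zero: "R (\<lambda>zs. 0) xs = 0"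
  by (induction xs rule: induct_list012) (simp_all add: mM_simps)

lemma R_sum: "R (\<lambda>zs. \<Sum>i\<in>I. \<phi> i zs) xs = (\<Sum>i\<in>I. R (\<phi> i) xs)"
  by (induction I rule: infinite_finite_induct) (simp_all add: R_zero R_add)

lemma R_tsum: "R (\<lambda>zs. tsum H (\<lambda>x y. \<phi> x y zs) T) xs = tsum H (\<lambda>x y. R (\<phi> x y) xs) T"
  unfolding tsum_def by (rule R_sum)

section \<open>Gerstenhaber's homotopy\<close>

abbreviation RM where "RM \<equiv> HR M M (\<lambda>b. b)"

text \<open>
  \<open>Ins n g i F\<close> inserts the \<open>n\<close>-cochain \<open>g\<close> at place \<open>i\<close> of \<open>F\<close>; \<open>Zs n g i F\<close> is \<open>(-1)\<^sup>i\<close> times the part of the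
  alternating sum of faces of \<open>F\<close> that starts at the place of \<open>g\<close>.
\<close>

primrec Ins :: "nat \<Rightarrow> ('a list \<Rightarrow> 'm) \<Rightarrow> nat \<Rightarrow> ('m list \<Rightarrow> 'm) \<Rightarrow> 'a list \<Rightarrow> 'm" where
  "Ins n g 0 F xs = F (g (take n xs) # map \<iota> (drop n xs))"
| "Ins n g (Suc i) F xs = (case xs of [] \<Rightarrow> 0 | x # ys \<Rightarrow> Ins n g i (\<lambda>cs. F (\<iota> x # cs)) ys)"

primrec Zs :: "nat \<Rightarrow> ('a list \<Rightarrow> 'm) \<Rightarrow> nat \<Rightarrow> ('m list \<Rightarrow> 'm) \<Rightarrow> 'a list \<Rightarrow> 'm" where
  "Zs n g 0 F xs = RM F (g (take n xs) # map \<iota> (drop n xs))"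
| "Zs n g (Suc i) F xs = (case xs of [] \<Rightarrow> 0 | x # ys \<Rightarrow> - Zs n g i (\<lambda>cs. F (\<iota> x # cs)) ys)"

lemma Ins_map: "L' 0 = 0 \<Longrightarrow> Ins n g i (\<lambda>cs. L' (F cs)) xs = L' (Ins n g i F xs)"
  by (induction i arbitrary: F xs) (auto split: list.split)

lemma Ins_neg_diff: "Ins n g i (\<lambda>cs. - F cs - F' cs) xs = - Ins n g i F xs - Ins n g i F' xs"
  by (induction i arbitrary: F F' xs) (auto split: list.split)

lemma Ins_lin_fun: "(\<And>zs. lin s sM (\<lambda>z. \<phi> z zs)) \<Longrightarrow> lin s sM (\<lambda>z. Ins n g i (\<phi> z) xs)"
proof (induction i arbitrary: \<phi> xs)
  case 0 then show ?case by simp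
next
  case (Suc i) then show ?case
    by (cases xs) (simp_all add: lin_const_zero[OF lin_vs1[OF Suc(2)] vsM])
qed

lemma mlin_Ins:
  assumes g: "mlin sA sM g" shows "mlin sM sM F \<Longrightarrow> mlin sA sM (Ins n g i F)"
proof (induction i arbitrary: F)
  case (0 F)
  show ?case unfolding mlin_def
  proof safe
    fix xs ys
    show "lin sA sM (\<lambda>x. Ins n g 0 F (xs @ x # ys))"
    proof (cases "n \<le> length xs")
      case True
      then show ?thesis using lin_comp[OF mlin_D[OF 0, of "g (take n xs) # map \<iota> (drop n xs)" "map \<iota> ys"] iota_lin]
        by simp
    next
      case False
      then obtain k where k: "n - length xs = Suc k" by (cases "n - length xs") auto
      show ?thesis using False lin_comp[OF mlin_D0[OF 0, of "map \<iota> (drop k ys)"] mlin_D[OF g, of xs "take k ys"]]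
        by (simp add: k)
    qed
  qed
next
  case (Suc i F)
  show ?case unfolding mlin_def
  proof safe
    fix xs ys
    show "lin sA sM (\<lambda>x. Ins n g (Suc i) F (xs @ x # ys))"
    proof (cases xs)
      case Nil
      then show ?thesis by (simp add: Ins_lin_fun lin_comp[OF mlin_D0[OF Suc.prems] iota_lin])
    next
      case (Cons z zs)
      then show ?thesis using mlin_D[OF Suc.IH[OF mlin_Cons[OF Suc.prems]]] by simp
    qed
  qed
qed

text \<open>The faces of an insertion lie to the left of g, inside it, or to its right. Those on the
  left are faces of F with g one place later. Those inside collapse, by the cocycle condition, to
  one product \<iota> x \<odot> g, which is the face joining g to its left neighbour. Those on the
  right are shifted by the n arguments of g, whence the sign. The two \<open>Zs\<close> terms
  correct the full sum \<open>RM F\<close> accordingly.\<close>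

lemma R_Ins:
  assumes g: "g \<in> Z n"
  shows "mlin sM sM F \<Longrightarrow> i + n < length xs \<Longrightarrow>
    R (Ins n g i F) xs = Ins n g (Suc i) (RM F) xs - Zs n g (Suc i) F xs - pm n (Zs n g i F xs)"
proof (induction i arbitrary: F xs)
  case (0 F xs)
  obtain ys z zs where xs: "xs = ys @ z # zs" and n: "n = length ys"
    using 0(2) by (metis add_0 id_take_nth_drop length_take min.absorb4)
  obtain x ws where x: "ys @ [z] = x # ws" by (cases ys) auto
  have xs': "xs = x # ws @ zs" using x xs by (metis append_Cons append_assoc append_Nil)
  have t: "length ws = n" using arg_cong[OF x, of length] n by simp
  have add: "F ((b + c) # bs) = F (b # bs) + F (c # bs)" for b c bs
    using lin_plus[OF mlin_D0[OF 0(1)]] .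
  have neg: "F ((- b) # bs) = - F (b # bs)" for b bs
    using lin_uminus[OF mlin_D0[OF 0(1)]] .
  \<comment> \<open>For a cocycle the faces inside its block sum to minus the first face; this is
    where dg = 0 enters.\<close>
  have "L g (x # ws) + R g (x # ws) = 0"
    using Z_d[OF g] d_eq[OF Z_C[OF g]] by (metis zero_fun_apply)
  then have Rg: "R g (ys @ [z]) = - (\<iota> x \<odot> g ws)" by (simp add: x eq_neg_iff_add_eq_0 add.commute)
  have I0: "Ins n g 0 F = (\<lambda>ws. F (g (take (length ys) ws) # map \<iota> (drop (length ys) ws)))"
    by (auto simp: n)
  have "R (Ins n g 0 F) xs = R (\<lambda>ws. F (g (take (length ys) ws) # map \<iota> (drop (length ys) ws))) (ys @ z # zs)"
    by (simp only: I0 xs)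
  also have "\<dots> = F (R g (ys @ [z]) # map \<iota> zs) + pm n (F ((g ys \<odot> \<iota> z) # map \<iota> zs) + R (\<lambda>zs. F (g ys # map \<iota> zs)) (z # zs))"
    by (subst R_split[where H = "\<lambda>b zs. F (b # map \<iota> zs)"]) (simp_all add: add n)
  also have "R (\<lambda>zs. F (g ys # map \<iota> zs)) (z # zs) = RM (\<lambda>cs. F (g ys # cs)) (\<iota> z # map \<iota> zs)"
    using HR_map_list[where F = "\<lambda>cs. F (g ys # cs)" and xs = "z # zs" and A = A and M = M and \<iota> = \<iota>] by (simp add: iota_mult)
  also have "F (R g (ys @ [z]) # map \<iota> zs) = - F ((\<iota> x \<odot> g ws) # map \<iota> zs)" by (simp add: Rg neg)
  finally have 1: "R (Ins n g 0 F) xs = - F ((\<iota> x \<odot> g ws) # map \<iota> zs)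
      + pm n (F ((g ys \<odot> \<iota> z) # map \<iota> zs) + RM (\<lambda>cs. F (g ys # cs)) (\<iota> z # map \<iota> zs))" .
  have 2: "Ins n g (Suc 0) (RM F) xs - Zs n g (Suc 0) F xs = - F ((\<iota> x \<odot> g ws) # map \<iota> zs)"
    by (simp add: xs' t)
  have 3: "Zs n g 0 F xs = - (F ((g ys \<odot> \<iota> z) # map \<iota> zs) + RM (\<lambda>cs. F (g ys # cs)) (\<iota> z # map \<iota> zs))"
    by (simp add: xs n)
  show ?case unfolding 1 2 3 by simp
next
  case (Suc i F xs)
  obtain x y ys where xs: "xs = x # y # ys" using Suc.prems(2)
    by (cases xs; cases "tl xs"; auto)
  note ih = Suc.IH[OF mlin_Cons[OF Suc.prems(1)], of "y # ys" "\<iota> x"]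
  show ?case using ih Suc.prems(2) by (simp add: xs iota_mult Ins_neg_diff)
qed

text \<open>With g in the last place, the only face starting there is the final right multiplication
  by the value of g.\<close>

lemma Zs_full: "length xs = m + n \<Longrightarrow> Zs n g m F xs = - pm m (F (map \<iota> (take m xs)) \<odot> g (drop m xs))"
proof (induction m arbitrary: F xs)
  case 0 then show ?case by simp
next
  case (Suc m F xs)
  from Suc.prems obtain x ys where xs: "xs = x # ys" "length ys = m + n" by (cases xs) auto
  show ?case by (simp add: xs(1) Suc.IH[OF xs(2)])
qed

lemma sum_pm: "(\<Sum>i\<in>I. pm k (f i)) = pm k (\<Sum>i\<in>I. f i)"
  by (simp add: sum_negf)

lemma lin_pm: "lin s t f \<Longrightarrow> lin s t (\<lambda>x. pm k (f x))"
  by (cases "even k") (simp_all add: lin_neg)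

lemma LR_pm: "L (\<lambda>xs. pm k (f xs)) xs + R (\<lambda>xs. pm k (f xs)) xs = pm k (L f xs + R f xs)"
  by (cases "even k"; cases xs) (simp_all add: R_neg mM_simps)

text \<open>The hypotheses on F' say that F is a cocycle: F' is its first face, as far as \<iota>
  reaches, and minus the sum of its other faces. The homotopy is the alternating sum of insertions
  of g at all m places of F. Its differential telescopes; the end i = m gives F followed by g, the
  end i = 0 gives g inserted into F'.\<close>

lemma homotopy:
  assumes g: "g \<in> Z n" and F: "mlin sM sM F" and F': "\<And>x cs. F' (\<iota> x # cs) = \<iota> x \<odot> F cs" "\<And>bs. F' bs = - RM F bs"
  shows "(\<lambda>xs. if length xs = m + n then F (map \<iota> (take m xs)) \<odot> g (drop m xs)
      - pm (m * n) (F' (g (take n xs) # map \<iota> (drop n xs))) else 0) \<in> Bd (m + n)"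
proof -
  let ?I = "\<lambda>i xs. pm (i * Suc n) (Ins n g i F xs)"
  let ?h = "\<lambda>xs. \<Sum>i<m. ?I i xs"
  let ?T = "\<lambda>i xs. pm (i * Suc n) (Zs n g i F xs)"
  let ?X = "\<lambda>xs. F (map \<iota> (take m xs)) \<odot> g (drop m xs) - pm (m * n) (F' (g (take n xs) # map \<iota> (drop n xs)))"
  have F'2: "F' = (\<lambda>bs. - RM F bs)" using F'(2) by blast
  \<comment> \<open>The first face of the insertion at place i is the insertion of g into F' at
    place i + 1, which cancels the main term of \<open>R_Ins\<close>. The sign (-1)^(i(n+1)) turns
    the remaining two terms into a difference of consecutive values of \<open>?T\<close>.\<close>
  have step: "L (?I i) xs + R (?I i) xs = pm n (?T (Suc i) xs - ?T i xs)" if len: "i + n < length xs" for i xs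
  proof -
    obtain x ys where xs: "xs = x # ys" using len by (cases xs) auto
    have l: "Ins n g (Suc i) F' xs = \<iota> x \<odot> Ins n g i F ys"
      by (simp add: xs F'(1) Ins_map[of "\<lambda>b. \<iota> x \<odot> b"] mM_simps)
    have neg: "Ins n g (Suc i) F' xs = - Ins n g (Suc i) (RM F) xs"
      unfolding F'2 by (rule Ins_map) simp
    have "L (Ins n g i F) xs = \<iota> x \<odot> Ins n g i F ys" by (simp add: xs)
    then have "L (Ins n g i F) xs = - Ins n g (Suc i) (RM F) xs" by (simp only: l[symmetric] neg)
    then have "L (Ins n g i F) xs + R (Ins n g i F) xs = - Zs n g (Suc i) F xs - pm n (Zs n g i F xs)"
      unfolding R_Ins[OF g F len] by simp
    then have "pm (i * Suc n) (L (Ins n g i F) xs + R (Ins n g i F) xs) = pm (i * Suc n) (- Zs n g (Suc i) F xs - pm n (Zs n g i F xs))"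
      by simp
    moreover have "L (?I i) xs + R (?I i) xs = pm (i * Suc n) (L (Ins n g i F) xs + R (Ins n g i F) xs)"
      by (rule LR_pm)
    moreover have "pm (i * Suc n) (- Zs n g (Suc i) F xs - pm n (Zs n g i F xs)) = pm n (?T (Suc i) xs - ?T i xs)"
      by (auto simp del: Zs.simps)
    ultimately show ?thesis by simp
  qed
  have LRh: "L ?h xs + R ?h xs = pm n (?T m xs - ?T 0 xs)" if len: "length xs = m + n" for xs
  proof -
    have "L ?h xs = (\<Sum>i<m. L (?I i) xs)"
      by (cases xs) (simp_all add: lin_setsum[OF mM_lin(2)] del: mult_Suc_right)
    then have "L ?h xs + R ?h xs = (\<Sum>i<m. L (?I i) xs + R (?I i) xs)" by (simp only: R_sum sum.distrib)
    also have "\<dots> = (\<Sum>i<m. pm n (?T (Suc i) xs - ?T i xs))" by (rule sum.cong, simp, rule step) (simp add: len)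
    also have "\<dots> = pm n (\<Sum>i<m. ?T (Suc i) xs - ?T i xs)" by (rule sum_pm)
    finally show ?thesis unfolding sum_lessThan_telescope[of "\<lambda>i. ?T i xs" m] .
  qed
  have X: "L ?h xs + R ?h xs = - pm (m * n + n) (?X xs)" if "length xs = m + n" for xs
    unfolding LRh[OF that] Zs_full[OF that] by (auto simp: F'(2))
  show ?thesis
  proof (cases m)
    \<comment> \<open>Without places for insertion the telescoping sum is empty, so the difference
      itself is zero and no cochain of degree n - 1 has to be found.\<close>
    case 0
    have LR0: "L (\<lambda>xs. 0) xs + R (\<lambda>xs. 0) xs = 0" for xs
      by (cases xs) (simp_all add: R_zero mM_simps)
    have "?X xs = 0" if "length xs = m + n" for xs using X[OF that] LR0[of xs] 0 by (auto split: if_splits)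
    then have "(\<lambda>xs. if length xs = m + n then ?X xs else 0) = 0" by auto
    then show ?thesis using Bd_zero by (simp only:)
  next
    case (Suc m')
    define k where "k = m' + n"
    \<comment> \<open>The insertions are cut off to lists of length m + n - 1, as a cochain must
      vanish elsewhere, and the global sign is the one that makes the coboundary equal to
      \<open>?X\<close>.\<close>
    define h' where "h' = (\<lambda>xs. if length xs = k then - pm (m * n + n) (?h xs) else 0)"
    have hC: "h' \<in> C k" unfolding C_iff
    proof (intro conjI allI impI)
      have l: "lin sA sM (\<lambda>x. ?h (xs @ x # ys))" for xs ys
        by (rule lin_sum, rule lin_pm, rule mlin_D, rule mlin_Ins[OF _ F]) (use Z_C[OF g] in \<open>simp add: C_iff\<close>)
      show "mlin sA sM h'" unfolding mlin_def h'_def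
      proof safe
        fix xs ys
        show "lin sA sM (\<lambda>x. if length (xs @ x # ys) = k then - pm (m * n + n) (?h (xs @ x # ys)) else 0)"
        proof (cases "Suc (length xs + length ys) = k")
          case True
          have "lin sA sM (\<lambda>x. - pm (m * n + n) (?h (xs @ x # ys)))" by (intro lin_neg lin_pm l)
          then show ?thesis using True by (simp del: sum.lessThan_Suc mult_Suc_right)
        next
          case False then show ?thesis using lin_const_zero[OF vsA vsM] by simp
        qed
      qed
    qed (simp add: h'_def)
    have "d k h' xs = (if length xs = m + n then ?X xs else 0)" for xs
    proof (cases "length xs = m + n")
      case False then show ?thesis using Suc by (simp add: hoch_diff_def k_def)
    next
      case True
      then obtain x ys where xs: "xs = x # ys" "length ys = k" using Suc by (auto simp: length_Suc_conv k_def)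
      have "R h' xs = R (\<lambda>zs. - pm (m * n + n) (?h zs)) xs"
        by (rule HR_cong) (use xs in \<open>simp add: h'_def\<close>)
      also have "\<dots> = - pm (m * n + n) (R ?h xs)" by (simp add: R_neg)
      also have "L h' xs = - pm (m * n + n) (L ?h xs)" by (simp add: xs h'_def mM_simps)
      ultimately have "d k h' xs = - pm (m * n + n) (L ?h xs + R ?h xs)" unfolding d_eq[OF hC] by simp
      also have "\<dots> = ?X xs" unfolding X[OF True] by simp
      finally show ?thesis using True by simp
    qed
    then have "(\<lambda>xs. if length xs = m + n then ?X xs else 0) = d k h'" by auto
    also have "\<dots> \<in> Bd (m + n)" using Suc hC by (simp add: k_def)
    finally show ?thesis .
  qed
qed

end

context smash_alg begin

section \<open>Braided commutativity\<close>

lemma hoch_AB: "hoch_alg A BB (\<lambda>a. iA a)"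
proof (rule hoch_alg.intro)
  show "k_algebra A" by (rule algA)
  show "k_algebra BB" by (rule BB_alg)
  show "lin (scl A) (scl BB) (\<lambda>a. iA a)" unfolding BB_simps by (intro linsB)
  show "iA (x \<cdot> y) = iA x \<odot> iA y" for x y by (simp add: iA_mult)
qed

lemma hoch_BB: "hoch_alg BB BB (\<lambda>b. b)"
  by (rule hoch_alg.intro) (simp_all add: BB_alg vsB lin_ident)

end

sublocale smash_alg \<subseteq> h: hoch_alg A "smash E A act" "\<lambda>a. tens A E a \<u>\<^bsub>E\<^esub>"
  by (rule hoch_AB)

context smash_alg begin

abbreviation LA where "LA \<equiv> HL BB (\<lambda>a. iA a)"
abbreviation RA where "RA \<equiv> HR A BB (\<lambda>a. iA a)"
abbreviation RB where "RB \<equiv> HR BB BB (\<lambda>b. b)"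
abbreviation CB where "CB n \<equiv> cochains A BB n"

lemma CB_iff: "f \<in> CB n \<longleftrightarrow> mlB f \<and> (\<forall>xs. length xs \<noteq> n \<longrightarrow> f xs = 0)"
  using cochains_iff[of A BB f n] by (simp add: vsA vsB)

lemma mlB_RA: "mlB f \<Longrightarrow> mlB (RA f)" and mlB_LA: "mlB f \<Longrightarrow> mlB (LA f)"
  using h.mlin_R[of f] h.mlin_L[of f] by simp_all

lemma RB_tsum: "RB (\<lambda>zs. tsum H (\<lambda>x y. \<phi> x y zs) T) xs = tsum H (\<lambda>x y. RB (\<phi> x y) xs) T"
  by (rule hoch_alg.R_tsum[OF hoch_BB])

section \<open>Extension and the faces of the differential\<close>

lemma extn_cong: "(\<And>ys. length ys = length bs \<Longrightarrow> f ys = g ys) \<Longrightarrow> extn bs f u = extn bs g u"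
proof (induction bs arbitrary: f g u)
  case Nil then show ?case by simp
next
  case (Cons b bs)
  have "extn bs (\<lambda>ys. f (act u1 a # ys)) v = extn bs (\<lambda>ys. g (act u1 a # ys)) v" for u1 a v
    by (rule Cons.IH, rule Cons.prems) simp
  then show ?case by (simp only: extn.simps)
qed

text \<open>Multiplying b and c in B and then extending agrees with extending first and multiplying
  in A: moving u past a product distributes its legs over the factors, which is the module algebra
  law. The functions \<open>hd\<close> and \<open>tl\<close> single out the argument of A that
  receives the left factor.\<close>

lemma extn_merge:
  assumes f: "mlB f"
  shows "tsum E (\<lambda>a w. sw (\<lambda>u1 u2. extn (c # bs) (\<lambda>ys. f ((act u1 a \<cdot> hd ys) # tl ys)) (u2 \<diamondop> w)) u) b = extn ((b \<odot> c) # bs) f u"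
proof (rule B_ext[where t = sB and b = b])
  note lins' = lin_tsum_fun extn_lin_fun linsh lin_comp[OF mlin_D0[OF f]] extn_lin_u mlin_Cons f
  show "lin sB sB (\<lambda>b. extn ((b \<odot> c) # bs) f u)" by (intro extn_lin_b0 f linsh)
  show "lin sB sB (\<lambda>b. tsum E (\<lambda>a w. sw (\<lambda>u1 u2. extn (c # bs) (\<lambda>ys. f ((act u1 a \<cdot> hd ys) # tl ys)) (u2 \<diamondop> w)) u) b)"
    by (rule lin_tsum_arg[OF lin_ident[OF vsB] vsA]) (intro lins')
  fix a w
  let ?G = "\<lambda>c. sw (\<lambda>u1 u2. tsum E (\<lambda>a' w'. sw (\<lambda>v1 v2. extn bs (\<lambda>ys. f ((act u1 a \<cdot> act v1 a') # ys)) (v2 \<diamondop> w')) (u2 \<diamondop> w)) c) u"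
  have "tsum E (\<lambda>a w. sw (\<lambda>u1 u2. extn (c # bs) (\<lambda>ys. f ((act u1 a \<cdot> hd ys) # tl ys)) (u2 \<diamondop> w)) u) (pt a w)
     = sw (\<lambda>u1 u2. extn (c # bs) (\<lambda>ys. f ((act u1 a \<cdot> hd ys) # tl ys)) (u2 \<diamondop> w)) u"
    unfolding extn.simps by (rule B_tsum_pt[where t = sB]) (simp, intro lins')+
  also have "\<dots> = ?G c" by (simp add: extn.simps)
  also have "?G c = extn ((pt a w \<odot> c) # bs) f u"
  proof (rule B_ext[where t = sB and b = c])
    show "lin sB sB (\<lambda>c. extn ((pt a w \<odot> c) # bs) f u)" by (intro extn_lin_b0 f linsh)
    show "lin sB sB ?G" by (intro lin_tsum_fun lin_tsum_arg[OF lin_ident[OF vsB] vsA] lins')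
    fix c w'
    have l: "lin sB sB (\<lambda>b. extn (b # bs) f u)" by (intro extn_lin_b0 f lin_ident vsB)
    have lf: "lin sA sB (\<lambda>x. extn bs (\<lambda>ys. f (x # ys)) v)" for v by (intro lins')
    have "?G (pt c w') = sw (\<lambda>u1 u2. sw (\<lambda>v1 v2. extn bs (\<lambda>ys. f ((act u1 a \<cdot> act v1 c) # ys)) (v2 \<diamondop> w')) (u2 \<diamondop> w)) u"
      by (rule tsum_cong, rule B_tsum_pt[where t = sB]) (intro lins')+
    also have "\<dots> = sw (\<lambda>u1 u2. sw (\<lambda>p q. sw (\<lambda>w1 w2. extn bs (\<lambda>ys. f ((act u1 a \<cdot> act (p \<diamondop> w1) c) # ys)) (q \<diamondop> w2 \<diamondop> w')) w) u2) u"
      by (rule tsum_cong, rule sw_mult[where t = sB]) (intro lins')+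
    also have "\<dots> = sw (\<lambda>r q. sw (\<lambda>u1 p. sw (\<lambda>w1 w2. extn bs (\<lambda>ys. f ((act u1 a \<cdot> act (p \<diamondop> w1) c) # ys)) (q \<diamondop> w2 \<diamondop> w')) w) r) u"
      by (rule sw_assoc[where t = sB, symmetric]) (intro lins')+
    also have "\<dots> = sw (\<lambda>r q. sw (\<lambda>w1 w2. sw (\<lambda>u1 p. extn bs (\<lambda>ys. f ((act u1 a \<cdot> act (p \<diamondop> w1) c) # ys)) (q \<diamondop> w2 \<diamondop> w')) r) w) u"
      by (rule tsum_cong, rule tsum_swap)
    also have "\<dots> = sw (\<lambda>w1 w2. sw (\<lambda>r q. sw (\<lambda>u1 p. extn bs (\<lambda>ys. f ((act u1 a \<cdot> act (p \<diamondop> w1) c) # ys)) (q \<diamondop> w2 \<diamondop> w')) r) u) w"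
      by (rule tsum_swap)
    also have "\<dots> = extn ((pt a w \<odot> pt c w') # bs) f u"
      by (simp only: mB_pt lin_tsum[OF l] extn_pt[OF f] act_prod lin_tsum[OF lf] act_mult mE_assoc)
    finally show "?G (pt c w') = extn ((pt a w \<odot> pt c w') # bs) f u" .
  qed
  finally show "tsum E (\<lambda>a w. sw (\<lambda>u1 u2. extn (c # bs) (\<lambda>ys. f ((act u1 a \<cdot> hd ys) # tl ys)) (u2 \<diamondop> w)) u) (pt a w)
     = extn ((pt a w \<odot> c) # bs) f u" .
qed

text \<open>Inner faces are carried over by \<open>extn_merge\<close>. The last one is carried over
  since u b, rewritten with its A-part in front, is again multiplied onto the value from the
  right.\<close>

lemma extn_RA: "mlB f \<Longrightarrow> extn bs (RA f) u = RB (\<lambda>cs. extn cs f u) bs"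
proof (induction bs arbitrary: f u rule: induct_list012)
  case 1
  have "lin sB sB (\<lambda>b. b \<odot> iE u)" by (intro linsh)
  from lin_zero[OF this] show ?case by simp
next
  case (2 b)
  note lins' = extn_lin_b0 mlB_RA[OF 2] linsh
  show ?case
  proof (rule B_ext[where t = sB and b = b])
    show "lin sB sB (\<lambda>b. extn [b] (RA f) u)" by (intro lins')
    show "lin sB sB (\<lambda>b. RB (\<lambda>cs. extn cs f u) [b])" unfolding HR.simps extn.simps by (intro lins' lin_neg)
    fix a w
    have l: "lin sB sB (\<lambda>b. f [] \<odot> iE u \<odot> b)" "lin sB sB (\<lambda>b. f [] \<odot> b)" "lin sB sB (\<lambda>b. b \<odot> iE w)" for w by (intro linsh)+
    have "extn [pt a w] (RA f) u = sw (\<lambda>u1 u2. - (f [] \<odot> iA (act u1 a) \<odot> iE (u2 \<diamondop> w))) u"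
      by (simp add: extn_pt[OF mlB_RA[OF 2]] lin_uminus[OF l(3)])
    also have "\<dots> = - (f [] \<odot> (iE u \<odot> pt a w))"
      by (simp add: iE_pt lin_tsum[OF l(2)] tsum_neg mB_assoc iA_iE)
    finally show "extn [pt a w] (RA f) u = RB (\<lambda>cs. extn cs f u) [pt a w]" by (simp add: mB_assoc)
  qed
next
  case (3 b c bs)
  note f = 3(3)
  have e: "extn (c # bs) (\<lambda>ys. RA f (x # ys)) v = - extn (c # bs) (\<lambda>ys. f ((x \<cdot> hd ys) # tl ys)) v - RB (\<lambda>cs. extn cs (\<lambda>ys. f (x # ys)) v) (c # bs)" for x v
  proof -
    have "extn (c # bs) (\<lambda>ys. RA f (x # ys)) v = extn (c # bs) (\<lambda>ys. - f ((x \<cdot> hd ys) # tl ys) + (- RA (\<lambda>ys. f (x # ys)) ys)) v"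
    proof (rule extn_cong)
      fix ys :: "'a list" assume "length ys = length (c # bs)"
      then obtain y zs where "ys = y # zs" by (cases ys) auto
      then show "RA f (x # ys) = - f ((x \<cdot> hd ys) # tl ys) + (- RA (\<lambda>ys. f (x # ys)) ys)" by simp
    qed
    also have "\<dots> = - extn (c # bs) (\<lambda>ys. f ((x \<cdot> hd ys) # tl ys)) v + (- extn (c # bs) (RA (\<lambda>ys. f (x # ys))) v)"
      by (simp only: extn_add extn_neg)
    also have "extn (c # bs) (RA (\<lambda>ys. f (x # ys))) v = RB (\<lambda>cs. extn cs (\<lambda>ys. f (x # ys)) v) (c # bs)"
      by (rule 3(2)[OF mlin_Cons[OF f]])
    finally show ?thesis by (simp only: add_uminus_conv_diff)
  qed
  have "extn (b # c # bs) (RA f) u = tsum E (\<lambda>a w. sw (\<lambda>u1 u2. extn (c # bs) (\<lambda>ys. RA f (act u1 a # ys)) (u2 \<diamondop> w)) u) b"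
    by (simp only: extn.simps(2)[of b])
  also have "\<dots> = - tsum E (\<lambda>a w. sw (\<lambda>u1 u2. extn (c # bs) (\<lambda>ys. f ((act u1 a \<cdot> hd ys) # tl ys)) (u2 \<diamondop> w)) u) b
    - tsum E (\<lambda>a w. sw (\<lambda>u1 u2. RB (\<lambda>cs. extn cs (\<lambda>ys. f (act u1 a # ys)) (u2 \<diamondop> w)) (c # bs)) u) b"
    unfolding e by (simp add: tsum_def sum_subtractf sum_negf)
  also have "\<dots> = - extn ((b \<odot> c) # bs) f u - RB (\<lambda>cs. extn (b # cs) f u) (c # bs)"
    by (simp only: extn_merge[OF f] extn.simps(2)[of b] RB_tsum)
  also have "\<dots> = RB (\<lambda>cs. extn cs f u) (b # c # bs)" by simp
  finally show ?case .
qed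

lemma lext_RA: "mlB f \<Longrightarrow> lext (RA f) u xs = RA (\<lambda>ys. lext f u ys) xs"
  unfolding extn_RA using HR_map_list[of "\<lambda>a. iA a" A BB "\<lambda>cs. extn cs f u" xs] by (simp add: iA_mult)

section \<open>The double acts on cochains compatibly with faces, products and cup products\<close>

lemma ract_tsum: "ract w (\<lambda>ys. tsum H (\<lambda>x y. \<phi> x y ys) T) xs = tsum H (\<lambda>x y. ract w (\<phi> x y) xs) T"
proof -
  have l: "lin sB sB (\<lambda>b. c \<odot> b)" for c by (intro linsh)
  show ?thesis unfolding ract_def by (simp add: extn_tsum lin_tsum[OF l], rule tsum_swap)
qed

lemma ract_RA: "mlB f \<Longrightarrow> ract w (RA f) xs = RA (ract w f) xs"
  unfolding ract_def by (simp add: lext_RA h.R_tsum h.R_left)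

text \<open>The first argument has to pass the antipode in front. Since the action is inner in B,
  S(w1) (w2 x) is S(w1) w2 x S(w3), and the first pair cancels; so x comes to the front and an
  antipode remains behind it.\<close>

lemma ract_LA: assumes f: "mlB f" shows "ract w (LA f) xs = LA (ract w f) xs"
proof (cases xs)
  case Nil
  have "lin sB sB (\<lambda>b. c \<odot> b)" "lin sB sB (\<lambda>b. b \<odot> c)" for c by (intro linsh)+
  from lin_zero[OF this(1)] lin_zero[OF this(2)] show ?thesis by (simp add: Nil ract_def tsum_def)
next
  case xs: (Cons x xs)
  note lins' = lin_tsum_fun extn_lin_fun linsh lin_comp[OF mlin_D0[OF f]] extn_lin_u mlin_Cons f
  have l: "lin sB sB (\<lambda>b. c \<odot> b)" "lin sB sB (\<lambda>b. b \<odot> c)" for c by (intro linsh)+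
  have "ract w (LA f) (x # xs) = sw (\<lambda>w1 r. sw (\<lambda>p q. sw (\<lambda>p1 p2. iE (S w1 \<diamondop> p1) \<odot> iA x \<odot> iE (S p2) \<odot> lext f q xs) p) r) w"
    unfolding ract_def lext_Cons[OF mlB_LA[OF f]] HL_simps extn_left
    by (simp only: iA_act lin_tsum[OF l(1)] lin_tsum[OF l(2)] mB_assoc iE_mult[symmetric])
  also have "\<dots> = sw (\<lambda>w1 r. sw (\<lambda>p1 s. sw (\<lambda>p2 q. iE (S w1 \<diamondop> p1) \<odot> iA x \<odot> iE (S p2) \<odot> lext f q xs) s) r) w"
    by (rule tsum_cong, rule sw_assoc[where t = sB]) (intro lins')+
  also have "\<dots> = sw (\<lambda>p2 q. iE oE \<odot> iA x \<odot> iE (S p2) \<odot> lext f q xs) w"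
    by (rule sw_S_left_left[where t = sB]) (intro lins')+
  also have "\<dots> = LA (ract w f) (x # xs)"
    unfolding ract_def HL_simps by (simp only: lin_tsum[OF l(1)] one_mB mB_assoc)
  finally show ?thesis by (simp only: xs)
qed

lemma hit_LA: "lin sE (*) \<phi> \<Longrightarrow> hit \<phi> (LA f xs) = LA (\<lambda>ys. hit \<phi> (f ys)) xs"
  by (cases xs) (simp_all add: hit_iA_left lin_zero[OF hit_lin[OF lin_ident[OF vsB]]])

lemma hit_RA: "lin sE (*) \<phi> \<Longrightarrow> hit \<phi> (RA f xs) = RA (\<lambda>ys. hit \<phi> (f ys)) xs"
  by (rule HR_map[where L = "hit \<phi>", symmetric]) (rule lin_plus[OF hit_lin[OF lin_ident[OF vsB]]], rule hit_iA_right)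

lemma dact_LA: assumes f: "mlB f" shows "dact d (LA f) xs = LA (dact d f) xs"
proof -
  have l: "lin sB sB (\<lambda>b. c \<odot> b)" for c by (intro linsh)
  have "dact d (LA f) xs = tsum ED (\<lambda>w \<xi>. LA (ract w (\<lambda>ys. hit (ev' \<xi>) (f ys))) xs) d"
    unfolding dact_def by (simp add: hit_LA[OF ev_lin] ract_LA mlB_hit f)
  also have "\<dots> = LA (dact d f) xs"
    by (cases xs) (simp_all add: dact_def lin_tsum[OF l] tsum_def[of _ "\<lambda>w \<xi>. 0"])
  finally show ?thesis .
qed

lemma dact_RA: assumes f: "mlB f" shows "dact d (RA f) xs = RA (dact d f) xs"
  unfolding dact_def by (simp add: hit_RA[OF ev_lin] ract_RA mlB_hit f h.R_tsum)

lemma ract_C: assumes f: "f \<in> CB n" shows "ract w f \<in> CB n"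
  unfolding CB_iff
proof (intro conjI allI impI)
  have ml: "mlB f" using f by (simp add: CB_iff)
  show "mlB (ract w f)" unfolding mlin_def ract_def
    by (simp, intro allI lin_tsum_fun linsh extn_lin_b ml)
  fix xs :: "'a list" assume "length xs \<noteq> n"
  then have "lext f u xs = 0" for u by (intro extn_zero) (use f in \<open>simp add: CB_iff\<close>)
  moreover have "lin sB sB (\<lambda>b. c \<odot> b)" for c by (intro linsh)
  note lin_zero[OF this]
  ultimately show "ract w f xs = 0" by (simp only: ract_def tsum_def sum.neutral_const)
qed

lemma hit_C: "f \<in> CB n \<Longrightarrow> (\<lambda>ys. hit \<phi> (f ys)) \<in> CB n"
  unfolding CB_iff by (simp add: mlB_hit lin_zero[OF hit_lin[OF lin_ident[OF vsB]]])

lemma dact_C: assumes f: "f \<in> CB n" shows "dact d f \<in> CB n"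
  unfolding CB_iff
proof (intro conjI allI impI)
  have *: "ract w (\<lambda>ys. hit \<phi> (f ys)) \<in> CB n" for w \<phi> by (intro ract_C hit_C f)
  then have ml: "mlB (ract w (\<lambda>ys. hit \<phi> (f ys)))" for w \<phi> by (simp add: CB_iff)
  show "mlB (dact d f)" unfolding mlin_def dact_def by (intro allI lin_tsum_fun mlin_D[OF ml])
  show "dact d f xs = 0" if "length xs \<noteq> n" for xs
    using * that unfolding dact_def tsum_def CB_iff by (intro sum.neutral) blast
qed

lemma lext_mult: "mlB f \<Longrightarrow> lext (\<lambda>ys. lext f w ys) v xs = lext f (w \<diamondop> v) xs"
proof (induction xs arbitrary: f w v)
  case Nil show ?case by (simp add: mB_assoc iE_mult)
next
  case (Cons x xs)
  note f = Cons.prems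
  note lins' = lin_tsum_fun extn_lin_fun linsh lin_comp[OF mlin_D0[OF f]] extn_lin_u mlin_Cons f
  have m: "mlB (\<lambda>ys. lext f w ys)" unfolding mlin_def by (simp, intro allI extn_lin_b f linsh)
  have "lext (\<lambda>ys. lext f w ys) v (x # xs) = sw (\<lambda>v1 v2. sw (\<lambda>w1 w2. lext (\<lambda>ys. f (act (w1 \<diamondop> v1) x # ys)) (w2 \<diamondop> v2) xs) w) v"
    unfolding lext_Cons[OF m] unfolding lext_Cons[OF f] extn_tsum by (simp only: Cons.IH[OF mlin_Cons[OF f]] act_mult)
  also have "\<dots> = sw (\<lambda>w1 w2. sw (\<lambda>v1 v2. lext (\<lambda>ys. f (act (w1 \<diamondop> v1) x # ys)) (w2 \<diamondop> v2) xs) v) w"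
    by (rule tsum_swap)
  also have "\<dots> = sw (\<lambda>w1 w2. lext (\<lambda>ys. f (act w1 x # ys)) w2 xs) (w \<diamondop> v)"
    by (rule sw_mult[where t = sB, symmetric]) (intro lins')+
  finally show ?case by (simp only: lext_Cons[OF f])
qed

text \<open>The order is reversed: E acts on cochains from the right, in accordance with the double
  containing the opposite of E.\<close>

lemma ract_mult: assumes f: "mlB f" shows "ract v (ract w f) xs = ract (w \<diamondop> v) f xs"
proof -
  note lins' = linsh extn_lin_u f
  have l: "lin sB sB (\<lambda>b. c \<odot> b)" for c by (intro linsh)
  have "ract v (ract w f) xs = sw (\<lambda>v1 v2. sw (\<lambda>w1 w2. iE (S (w1 \<diamondop> v1)) \<odot> lext f (w2 \<diamondop> v2) xs) w) v"
    unfolding ract_def by (simp add: extn_tsum extn_left lext_mult[OF f] lin_tsum[OF l] S_mult mB_assoc flip: iE_mult)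
  also have "\<dots> = sw (\<lambda>w1 w2. sw (\<lambda>v1 v2. iE (S (w1 \<diamondop> v1)) \<odot> lext f (w2 \<diamondop> v2) xs) v) w" by (rule tsum_swap)
  also have "\<dots> = ract (w \<diamondop> v) f xs" unfolding ract_def
    by (rule sw_mult[where t = sB, symmetric]) (intro lins')+
  finally show ?thesis .
qed

lemma ract_one: assumes f: "mlB f" shows "ract oE f xs = f xs"
  unfolding ract_def
  by (subst sw_one[where t = sB], (intro linsh extn_lin_u f)+) (simp add: S_one one_mB lext_one[OF f])

text \<open>This is the Yetter-Drinfeld condition for cochains. The leg S(v1) comes from the
  antipode factor in front of the value, the leg v3 from the factor the extension leaves behind it.
  It matches the exchange relation in the product of the double.\<close>

lemma hit_ract:
  assumes \<phi>: "lin sE (*) \<phi>" and g: "mlB g"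
  shows "hit \<phi> (ract v g xs) = sw (\<lambda>u v3. sw (\<lambda>v1 v2. ract v2 (\<lambda>ys. hit (\<lambda>y. \<phi> (S v1 \<diamondop> y \<diamondop> v3)) (g ys)) xs) u) v"
proof -
  define \<Theta> where "\<Theta> a b r s = iE (S b) \<odot> lext (\<lambda>ys. hit (\<lambda>y. \<phi> (S a \<diamondop> y \<diamondop> s)) (g ys)) r xs" for a b r s
  note lins' = linsh extn_lin_fun extn_lin_u g mlB_hit lin_comp[OF \<phi>]
  have T: "lin sE sB (\<lambda>z. \<Theta> z b r s)" "lin sE sB (\<lambda>z. \<Theta> a z r s)" "lin sE sB (\<lambda>z. \<Theta> a b z s)" "lin sE sB (\<lambda>z. \<Theta> a b r z)" for a b r s
    unfolding \<Theta>_def by (intro lins')+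
  note linsT = linsh T[THEN lin_comp]
  have l: "lin sB sB (\<lambda>b. hit \<phi> b)" "lin sB sB (\<lambda>b. c \<odot> b)" for c by (intro linsh)+
  have p: "lin sE (*) (\<lambda>y. \<phi> (q \<diamondop> y))" for q by (intro lins')
  have "hit \<phi> (ract v g xs) = sw (\<lambda>v1 v2. sw (\<lambda>p q. iE p \<odot> hit (\<lambda>u. \<phi> (q \<diamondop> u)) (lext g v2 xs)) (S v1)) v"
    by (simp add: ract_def lin_tsum[OF l(1)] hit_iE_left[OF \<phi>])
  also have "\<dots> = sw (\<lambda>v1 v2. sw (\<lambda>a b. iE (S b) \<odot> hit (\<lambda>u. \<phi> (S a \<diamondop> u)) (lext g v2 xs)) v1) v"
    by (rule tsum_cong, rule sw_S[where t = sB]) (intro lins')+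
  also have "\<dots> = sw (\<lambda>v1 v2. sw (\<lambda>a b. sw (\<lambda>r s. \<Theta> a b r s) v2) v1) v"
    by (simp only: hit_lext[OF p g] lin_tsum[OF l(2)] \<Theta>_def mE_assoc)
  also have "\<dots> = sw (\<lambda>a t. sw (\<lambda>b v2. sw (\<lambda>r s. \<Theta> a b r s) v2) t) v"
    by (rule sw_assoc[where t = sB]) (intro linsT)+
  also have "\<dots> = sw (\<lambda>a t. sw (\<lambda>m s. sw (\<lambda>b r. \<Theta> a b r s) m) t) v"
    by (rule tsum_cong, rule sw_assoc[where t = sB, symmetric]) (intro linsT)+
  also have "\<dots> = sw (\<lambda>u s. sw (\<lambda>a m. sw (\<lambda>b r. \<Theta> a b r s) m) u) v"
    by (rule sw_assoc[where t = sB, symmetric]) (intro linsT)+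
  finally show ?thesis by (simp only: ract_def \<Theta>_def)
qed

lemma mlB_ract: assumes f: "mlB f" shows "mlB (ract w f)"
  unfolding mlin_def ract_def by (simp, intro allI lin_tsum_fun linsh extn_lin_b f)

lemma mlB_dact: assumes f: "mlB f" shows "mlB (dact d f)"
  unfolding mlin_def dact_def by (intro allI lin_tsum_fun mlin_D[OF mlB_ract[OF mlB_hit[OF f]]])

lemma dact_mult: assumes f: "mlB f" shows "dact (d \<bullet>\<^bsub>DD\<^esub> d') f xs = dact d (dact d' f) xs"
proof (rule D_ext[where t = sB and d = d])
  show "lin (fscl sE) sB (\<lambda>d. dact (d \<bullet>\<^bsub>DD\<^esub> d') f xs)" "lin (fscl sE) sB (\<lambda>d. dact d (dact d' f) xs)"
    by (intro dact_lin mlB_dact f linsD)+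
  fix w \<xi>
  show "dact (dp w \<xi> \<bullet>\<^bsub>DD\<^esub> d') f xs = dact (dp w \<xi>) (dact d' f) xs"
  proof (rule D_ext[where t = sB and d = d'])
    show "lin (fscl sE) sB (\<lambda>d'. dact (dp w \<xi> \<bullet>\<^bsub>DD\<^esub> d') f xs)" "lin (fscl sE) sB (\<lambda>d'. dact (dp w \<xi>) (dact d' f) xs)"
      by (intro dact_lin dact_lin_fun f linsD)+
    fix v \<eta>
    let ?g = "\<lambda>ys. hit (ev' \<eta>) (f ys)"
    have g: "mlB ?g" by (rule mlB_hit[OF f])
    have l: "lin (fscl sE) sB (\<lambda>d. dact d f xs)" by (intro dact_lin f lin_ident vs_DD)
    have h: "hit (ev' (to_dual E \<phi> \<bullet>\<^bsub>ED\<^esub> \<eta>)) b = hit \<phi> (hit (ev' \<eta>) b)" if \<phi>: "lin sE (*) \<phi>" for \<phi> b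
    proof -
      have "ev' (to_dual E \<phi> \<bullet>\<^bsub>ED\<^esub> \<eta>) = (\<lambda>w. sw (\<lambda>w1 w2. \<phi> w1 * ev' \<eta> w2) w)"
        by (rule HOL.ext) (simp add: ev_dual_mult ev_to_dual[OF \<phi>])
      then show ?thesis by (simp add: hit_hit[OF \<phi> ev_lin])
    qed
    have p: "lin sE (*) (\<lambda>x. ev' \<xi> (S v1 \<diamondop> x \<diamondop> v3))" for v1 v3 by (intro linsd)
    have "dact (dp w \<xi> \<bullet>\<^bsub>DD\<^esub> dp v \<eta>) f xs = sw (\<lambda>u v3. sw (\<lambda>v1 v2. ract (v2 \<diamondop> w) (\<lambda>ys. hit (\<lambda>x. ev' \<xi> (S v1 \<diamondop> x \<diamondop> v3)) (?g ys)) xs) u) v"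
      by (simp add: DD_mult_dp lin_tsum[OF l] dact_dp[OF f] h[OF p])
    also have "\<dots> = ract w (\<lambda>ys. hit (ev' \<xi>) (ract v ?g ys)) xs"
      by (simp add: hit_ract[OF ev_lin g] ract_tsum ract_mult[OF mlB_hit[OF g], symmetric])
    also have "\<dots> = dact (dp w \<xi>) (dact (dp v \<eta>) f) xs"
      by (simp only: dact_dp[OF f] dact_dp[OF mlB_ract[OF g]])
    finally show "dact (dp w \<xi> \<bullet>\<^bsub>DD\<^esub> dp v \<eta>) f xs = dact (dp w \<xi>) (dact (dp v \<eta>) f) xs" .
  qed
qed

lemma hit_oED: "hit (ev' oED) b = b"
proof -
  have "ev' oED = eps" by (rule HOL.ext) (rule ev_dual_one)
  then show ?thesis by (simp add: hit_eps)
qed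

lemma dact_one: "mlB f \<Longrightarrow> dact (dp oE oED) f xs = f xs"
  by (simp add: dact_dp hit_oED ract_one)

text \<open>On a cup product, w has to travel past the arguments of f and go on to those of g. But
  \<open>lext f w1 xs\<close> also leaves a leg of w on the right of its value; the inserted S(p)
  takes it off again.\<close>

lemma lext_cup:
  assumes g: "mlB g"
  shows "mlB f \<Longrightarrow> lext (\<lambda>ws. f (take (length xs) ws) \<odot> g (drop (length xs) ws)) w (xs @ ys)
    = sw (\<lambda>w1 r. sw (\<lambda>p q. lext f w1 xs \<odot> iE (S p) \<odot> lext g q ys) r) w"
proof (induction xs arbitrary: f w)
  case Nil
  have "sw (\<lambda>w1 r. sw (\<lambda>p q. lext f w1 [] \<odot> iE (S p) \<odot> lext g q ys) r) w
      = sw (\<lambda>w1 r. sw (\<lambda>p q. f [] \<odot> iE (w1 \<diamondop> S p) \<odot> lext g q ys) r) w"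
    by (simp add: mB_assoc flip: iE_mult)
  also have "\<dots> = f [] \<odot> iE oE \<odot> lext g w ys"
    by (rule sw_S_right_left[where t = sB]) (intro linsh extn_lin_u g)+
  finally show ?case by (simp add: extn_left mB_one)
next
  case (Cons x xs)
  note f = Cons.prems
  note lins' = lin_tsum_fun extn_lin_fun linsh lin_comp[OF mlin_D0[OF f]] extn_lin_u mlin_Cons f g
  have l: "lin sB sB (\<lambda>b. b \<odot> c)" for c by (intro linsh)
  have "lext (\<lambda>ws. f (take (length (x # xs)) ws) \<odot> g (drop (length (x # xs)) ws)) w ((x # xs) @ ys)
    = sw (\<lambda>z r. lext (\<lambda>ws. f (act z x # take (length xs) ws) \<odot> g (drop (length xs) ws)) r (xs @ ys)) w"
    unfolding append_Cons by (subst lext_Cons) (use h.mlin_cup[of f g] f g in simp_all)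
  also have "\<dots> = sw (\<lambda>z r. sw (\<lambda>w1 s. sw (\<lambda>p q. lext (\<lambda>ys. f (act z x # ys)) w1 xs \<odot> iE (S p) \<odot> lext g q ys) s) r) w"
    by (simp only: Cons.IH[OF mlin_Cons[OF f]])
  also have "\<dots> = sw (\<lambda>r s. sw (\<lambda>z w1. sw (\<lambda>p q. lext (\<lambda>ys. f (act z x # ys)) w1 xs \<odot> iE (S p) \<odot> lext g q ys) s) r) w"
    by (rule sw_assoc[where t = sB, symmetric]) (intro lins')+
  also have "\<dots> = sw (\<lambda>w1 r. sw (\<lambda>p q. lext f w1 (x # xs) \<odot> iE (S p) \<odot> lext g q ys) r) w"
    by (simp only: lext_Cons[OF f] lin_tsum[OF l]) (rule tsum_cong, rule tsum_swap)
  finally show ?case .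
qed

text \<open>The antipode that \<open>lext_cup\<close> puts between the two values is the one with
  which the action on the second cochain begins.\<close>

lemma ract_cup:
  assumes f: "mlB f" and g: "mlB g" and m: "m \<le> length zs"
  shows "ract w (\<lambda>ws. f (take m ws) \<odot> g (drop m ws)) zs = sw (\<lambda>w1 w2. ract w1 f (take m zs) \<odot> ract w2 g (drop m zs)) w"
proof -
  define xs ys where "xs = take m zs" and "ys = drop m zs"
  have zs: "zs = xs @ ys" and len: "m = length xs" using m by (simp_all add: xs_def ys_def)
  note lins' = linsh extn_lin_u f g
  have l: "lin sB sB (\<lambda>b. b \<odot> c)" "lin sB sB (\<lambda>b. c \<odot> b)" for c by (intro linsh)+
  have "ract w (\<lambda>ws. f (take m ws) \<odot> g (drop m ws)) zs
     = sw (\<lambda>w0 r. sw (\<lambda>w1 s. sw (\<lambda>p q. iE (S w0) \<odot> lext f w1 xs \<odot> (iE (S p) \<odot> lext g q ys)) s) r) w"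
    unfolding ract_def zs len lext_cup[OF g f] by (simp add: lin_tsum[OF l(2)] mB_assoc)
  also have "\<dots> = sw (\<lambda>r s. sw (\<lambda>w0 w1. sw (\<lambda>p q. iE (S w0) \<odot> lext f w1 xs \<odot> (iE (S p) \<odot> lext g q ys)) s) r) w"
    by (rule sw_assoc[where t = sB, symmetric]) (intro lins')+
  also have "\<dots> = sw (\<lambda>w1 w2. ract w1 f xs \<odot> ract w2 g ys) w"
    unfolding ract_def by (simp only: lin_tsum[OF l(1)] lin_tsum[OF l(2)]) (rule tsum_cong, rule tsum_swap)
  finally show ?thesis by (simp only: xs_def ys_def)
qed

lemma tsum_apply: "tsum H \<phi> T xs = tsum H (\<lambda>x y. \<phi> x y xs) T"
  by (simp add: tsum_def sum_fun_apply)

lemma dact_cup: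
  assumes f: "f \<in> CB m" and g: "g \<in> CB n"
  shows "dact d (cup BB m n f g) = tsum DD (\<lambda>d1 d2. cup BB m n (dact d1 f) (dact d2 g)) (cop DD d)"
proof
  fix zs
  have ml: "mlB f" "mlB g" using f g by (auto simp: CB_iff)
  have l: "lin s sB F \<Longrightarrow> lin s sB (\<lambda>z. F z \<odot> c)" "lin s sB F \<Longrightarrow> lin s sB (\<lambda>z. c \<odot> F z)"
    for s :: "'k \<Rightarrow> 'z::ab_group_add \<Rightarrow> 'z" and F c by (intro mB_lin, assumption)+
  show "dact d (cup BB m n f g) zs = tsum DD (\<lambda>d1 d2. cup BB m n (dact d1 f) (dact d2 g)) (cop DD d) zs"
  proof (cases "length zs = m + n")
    case False
    then show ?thesis using dact_C[OF h.cup_C[OF f g], of d]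
      by (simp add: tsum_apply CB_iff) (simp add: cup_def tsum_def)
  next
    case True
    then have m: "m \<le> length zs" by simp
    have "tsum DD (\<lambda>d1 d2. cup BB m n (dact d1 f) (dact d2 g)) (cop DD d) zs
      = tsum DD (\<lambda>d1 d2. dact d1 f (take m zs) \<odot> dact d2 g (drop m zs)) (cop DD d)"
      using True by (simp add: tsum_apply cup_def)
    also have "\<dots> = tsum ED (\<lambda>w \<xi>. sw (\<lambda>w1 w2. tsum ED (\<lambda>\<xi>1 \<xi>2. dact (dp w1 \<xi>1) f (take m zs) \<odot> dact (dp w2 \<xi>2) g (drop m zs)) (cop ED \<xi>)) w) d"
      by (rule tsum_DD_cop[where t = sB]) (intro l dact_lin ml lin_ident vs_DD)+
    also have "\<dots> = tsum ED (\<lambda>w \<xi>. tsum ED (\<lambda>\<xi>1 \<xi>2. sw (\<lambda>w1 w2. ract w1 (\<lambda>ys. hit (ev' \<xi>1) (f ys)) (take m zs) \<odot> ract w2 (\<lambda>ys. hit (ev' \<xi>2) (g ys)) (drop m zs)) w) (cop ED \<xi>)) d"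
      by (simp only: dact_dp ml) (rule tsum_cong, rule tsum_swap)
    also have "\<dots> = tsum ED (\<lambda>w \<xi>. tsum ED (\<lambda>\<xi>1 \<xi>2. ract w (\<lambda>ws. hit (ev' \<xi>1) (f (take m ws)) \<odot> hit (ev' \<xi>2) (g (drop m ws))) zs) (cop ED \<xi>)) d"
      by (simp only: ract_cup[OF mlB_hit[OF ml(1)] mlB_hit[OF ml(2)] m])
    also have "\<dots> = dact d (cup BB m n f g) zs"
      unfolding dact_def h.cup_eq[OF f g] by (simp only: hit_prod ract_tsum)
    finally show ?thesis ..
  qed
qed

lemma dact_cunit: "dact d h.cunit = fscl sB (cou DD d) h.cunit"
proof
  fix xs
  have c: "cou DD d = tsum ED (\<lambda>w \<xi>. eps w * ev' \<xi> oE) d" by (simp add: double_def Let_def dual_cou)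
  show "dact d h.cunit xs = fscl sB (cou DD d) h.cunit xs"
  proof (cases "xs = []")
    case False
    have "dact d h.cunit \<in> CB 0" by (rule dact_C) (use h.cunit_Z h.Z_C in blast)
    then show ?thesis using False by (simp add: CB_iff fscl_def[of sB] h.cunit_def vs_zero[OF vsB])
  next
    case True
    have "ract w (\<lambda>ys. hit (ev' \<xi>) (h.cunit ys)) [] = sB (eps w * ev' \<xi> oE) (iA \<u>\<^bsub>A\<^esub>)" for w \<xi>
    proof -
      have l: "lin sB sB (\<lambda>b. b \<odot> c)" "lin sB sB (\<lambda>b. c \<odot> b)" for c by (intro linsh)+
      have "ract w (\<lambda>ys. hit (ev' \<xi>) (h.cunit ys)) [] = sw (\<lambda>w1 w2. sB (ev' \<xi> oE) (iE (S w1 \<diamondop> w2))) w"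
        by (simp add: ract_def h.cunit_def hit_iA[OF ev_lin] lin_scl[OF l(1)] lin_scl[OF l(2)] iE_mult one_mE)
      also have "\<dots> = sB (eps w) (sB (ev' \<xi> oE) (iE oE))"
        by (rule sw_S_left) (intro linsh)
      finally show ?thesis by (simp add: vs_scale_scale[OF vsB])
    qed
    then show ?thesis by (simp add: True dact_def c h.cunit_def fscl_def[of sB] tsum_def vs_sum_scale[OF vsB])
  qed
qed

text \<open>This is the map into whose first slot the values of a second cochain will be inserted.
  Obtaining it as the extension of the first face of f lets the cocycle condition for f be extended
  along with it.\<close>

lemma extn_LA: assumes f: "mlB f" shows "extn (b # bs) (LA f) oE = tsum E (\<lambda>a w. iA a \<odot> extn bs f w) b"
proof (rule B_ext[where t = sB and b = b])
  note lins' = linsh extn_lin_u extn_lin_b0 mlB_LA f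
  show "lin sB sB (\<lambda>b. extn (b # bs) (LA f) oE)" by (intro lins')
  show "lin sB sB (\<lambda>b. tsum E (\<lambda>a w. iA a \<odot> extn bs f w) b)" by (intro lin_tsum_arg[OF lin_ident[OF vsB] vsA] lins')
  fix a w
  have "extn (pt a w # bs) (LA f) oE = sw (\<lambda>u1 u2. iA (act u1 a) \<odot> extn bs f (u2 \<diamondop> w)) oE"
    by (simp add: extn_pt[OF mlB_LA[OF f]] extn_left)
  also have "\<dots> = iA a \<odot> extn bs f w"
    by (subst sw_one[where t = sB], (intro lins')+) (simp add: act_one one_mE)
  also have "\<dots> = tsum E (\<lambda>a w. iA a \<odot> extn bs f w) (pt a w)"
    by (rule B_tsum_pt[where t = sB, symmetric]) (intro lins')+
  finally show "extn (pt a w # bs) (LA f) oE = tsum E (\<lambda>a w. iA a \<odot> extn bs f w) (pt a w)" .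
qed

text \<open>Summing over dual bases substitutes the coaction leg of b for the basis vector, so the
  sum is b0 (b1 acting on f)(x). For b = a w this reads a w1 S(w2) F(w3 x1, ...), and the antipode
  cancels.\<close>

lemma braid_eval:
  assumes f: "mlB f"
  shows "(\<Sum>j\<in>UNIV. hit (ev' (bas ED j)) b \<odot> ract (bas E j) f xs) = extn (b # map (\<lambda>a. iA a) xs) (LA f) oE"
proof (rule B_ext[where t = sB and b = b])
  note lins' = linsh extn_lin_u extn_lin_b0 mlB_LA f ract_lin
  show "lin sB sB (\<lambda>b. extn (b # map (\<lambda>a. iA a) xs) (LA f) oE)" by (intro lins')
  show "lin sB sB (\<lambda>b. \<Sum>j\<in>UNIV. hit (ev' (bas ED j)) b \<odot> ract (bas E j) f xs)" by (intro lin_sum lins')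
  fix a w
  have l: "lin sB sB (\<lambda>b. b \<odot> c)" "lin sB sB (\<lambda>b. c \<odot> b)" for c by (intro linsh)+
  have "(\<Sum>j\<in>UNIV. hit (ev' (bas ED j)) (pt a w) \<odot> ract (bas E j) f xs)
    = sw (\<lambda>w1 w2. \<Sum>j\<in>UNIV. sB (cf j w2) (pt a w1 \<odot> ract (bas E j) f xs)) w"
    by (simp add: hit_pt[OF ev_lin] ev_dual_bas lin_tsum[OF l(1)] lin_scl[OF l(1)] tsum_sum)
  also have "\<dots> = sw (\<lambda>w1 w2. pt a w1 \<odot> ract w2 f xs) w"
    by (rule tsum_cong, rule expand) (intro lins')
  also have "\<dots> = sw (\<lambda>w1 r. sw (\<lambda>p q. pt a (w1 \<diamondop> S p) \<odot> lext f q xs) r) w"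
    unfolding ract_def by (simp only: lin_tsum[OF l(2)] mB_assoc[symmetric] pt_iE)
  also have "\<dots> = iA a \<odot> lext f w xs"
    by (rule sw_S_right_left[where t = sB]) (intro lins')+
  also have "\<dots> = extn (pt a w # map (\<lambda>a. iA a) xs) (LA f) oE"
    unfolding extn_LA[OF f] by (rule B_tsum_pt[where t = sB, symmetric]) (intro lins')+
  finally show "(\<Sum>j\<in>UNIV. hit (ev' (bas ED j)) (pt a w) \<odot> ract (bas E j) f xs) = extn (pt a w # map (\<lambda>a. iA a) xs) (LA f) oE" .
qed

lemma braid:
  assumes f: "f \<in> h.Z m" and g: "g \<in> h.Z n"
  shows "cup BB m n f g - fscl sB ((- 1) ^ (m * n)) (tsum DD (\<lambda>r r'. cup BB n m (dact r' g) (dact r f)) (double_R E)) \<in> h.Bd (m + n)"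
proof -
  have ml: "mlB f" "mlB g" and C: "f \<in> CB m" "g \<in> CB n" using h.Z_C[OF f] h.Z_C[OF g] by (auto simp: CB_iff)
  let ?F = "\<lambda>bs. extn bs f oE" and ?F' = "\<lambda>bs. extn bs (LA f) oE"
  have F: "mlin (scl BB) (scl BB) ?F" unfolding mlin_def by (simp, intro allI extn_lin_b ml linsh)
  have F1: "?F' (iA x # cs) = iA x \<odot> ?F cs" for x cs
    unfolding extn_LA[OF ml(1)] by (rule B_tsum_pt[where t = sB]) (intro linsh extn_lin_u ml)+
  \<comment> \<open>The cocycle identity of f, first face plus remaining faces equal to zero, after
    extension to B. The cocycle property of g is used only inside the homotopy.\<close>
  have F2: "?F' bs = - RB ?F bs" for bs
  proof -
    have "LA f ys + RA f ys = 0" for ys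
      using h.Z_d[OF f] h.d_eq[OF C(1)] by (metis zero_fun_apply)
    then have "extn bs (\<lambda>ys. LA f ys + RA f ys) oE = 0" by (intro extn_zero)
    then show ?thesis by (simp add: extn_add extn_RA[OF ml(1)] eq_neg_iff_add_eq_0)
  qed
  have "cup BB m n f g - fscl sB ((- 1) ^ (m * n)) (tsum DD (\<lambda>r r'. cup BB n m (dact r' g) (dact r f)) (double_R E))
    = (\<lambda>xs. if length xs = m + n then ?F (map (\<lambda>a. iA a) (take m xs)) \<odot> g (drop m xs)
      - pm (m * n) (?F' (g (take n xs) # map (\<lambda>a. iA a) (drop n xs))) else 0)" (is "?X = ?Y")
  proof
    fix xs
    show "?X xs = ?Y xs"
    proof (cases "length xs = m + n")
      case False
      then show ?thesis by (simp add: tsum_apply fscl_def[of sB]) (simp add: cup_def tsum_def vs_zero[OF vsB])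
    next
      case True
      have lm: "lin s sB G \<Longrightarrow> lin s sB (\<lambda>z. G z \<odot> c)" "lin s sB G \<Longrightarrow> lin s sB (\<lambda>z. c \<odot> G z)"
        for s :: "'k \<Rightarrow> 'z::ab_group_add \<Rightarrow> 'z" and G c by (intro mB_lin, assumption)+
      have "tsum DD (\<lambda>r r'. cup BB n m (dact r' g) (dact r f)) (double_R E) xs
         = tsum DD (\<lambda>r r'. dact r' g (take n xs) \<odot> dact r f (drop n xs)) (double_R E)"
        using True by (simp add: tsum_apply cup_def)
      also have "\<dots> = (\<Sum>j\<in>UNIV. dact (dp oE (bas ED j)) g (take n xs) \<odot> dact (dp (bas E j) oED) f (drop n xs))"
        by (rule tsum_double_R[where t = sB]) (intro lm dact_lin ml lin_ident vs_DD)+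
      also have "\<dots> = ?F' (g (take n xs) # map (\<lambda>a. iA a) (drop n xs))"
        by (simp only: dact_dp ml hit_oED ract_one mlB_hit braid_eval)
      finally show ?thesis using True
        by (simp add: fscl_def[of sB] lext_one[OF ml(1)] pm_scale[OF vsB]) (simp add: cup_def)
    qed
  qed
  also have "\<dots> \<in> h.Bd (m + n)" by (rule h.homotopy[OF g F F1 F2])
  finally show ?thesis .
qed

lemma dact_add: "dact d (f + g) = dact d f + dact d g" and dact_scale: "dact d (fscl sB c f) = fscl sB c (dact d f)"
  and dact_add_left: "mlB f \<Longrightarrow> dact (d + d') f = dact d f + dact d' f"
  and dact_scale_left: "mlB f \<Longrightarrow> dact (fscl sE c d) f = fscl sB c (dact d f)"
proof -
  have l: "lin (fscl sB) sB (\<lambda>f. dact d f xs)" for xs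
    by (rule dact_lin_fun, rule lin_fun_apply[OF vsB], rule lin_ident, rule vs_fscl, rule vsB)
  show "dact d (f + g) = dact d f + dact d g" using lin_plus[OF l] by (auto simp: fun_eq_iff)
  show "dact d (fscl sB c f) = fscl sB c (dact d f)"
  proof
    show "dact d (fscl sB c f) xs = fscl sB c (dact d f) xs" for xs
      using lin_scl[OF l[of xs], of c f] by (simp only: fscl_def[of sB c "dact d f"])
  qed
  assume f: "mlB f"
  have l: "lin (fscl sE) sB (\<lambda>d. dact d f xs)" for xs by (intro dact_lin f lin_ident vs_DD)
  show "dact (d + d') f = dact d f + dact d' f" using lin_plus[OF l] by (auto simp: fun_eq_iff)
  show "dact (fscl sE c d) f = fscl sB c (dact d f)"
  proof
    show "dact (fscl sE c d) f xs = fscl sB c (dact d f) xs" for xs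
      using lin_scl[OF l[of xs], of c d] by (simp only: fscl_def[of sB c "dact d f"])
  qed
qed

lemma d_dact: assumes f: "f \<in> CB n" shows "h.d n (dact x f) = dact x (h.d n f)"
proof
  fix xs
  have ml: "mlB f" using f by (simp add: CB_iff)
  have "dact x (\<lambda>ys. LA f ys + RA f ys) xs = dact x (LA f) xs + dact x (RA f) xs"
    using fun_cong[OF dact_add[of x "LA f" "RA f"], of xs] unfolding plus_fun_def[of "LA f" "RA f"] plus_fun_apply .
  then show "h.d n (dact x f) xs = dact x (h.d n f) xs"
    unfolding h.d_eq[OF f] h.d_eq[OF dact_C[OF f]] by (simp only: dact_LA[OF ml] dact_RA[OF ml])
qed

end

section \<open>Twists\<close>

text \<open>By bilinearity only pure tensors have to be compared. The rule is applied to the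
  embedding of the dual's tensor square into that of the double and to the flip.\<close>

lemma talg_hom:
  fixes V :: "('k::field, 'v::ab_group_add, 'y) kalg_scheme"
    and H :: "('k, 'h::ab_group_add, 'i::finite, 'z) based_alg_scheme"
  assumes H: "is_based H" "k_algebra H" and V: "k_algebra V" and X: "k_algebra X"
    and F: "lin (fscl (scl V)) (scl X) F"
    and m: "\<And>v h v' h'. F (tens V H (v \<bullet>\<^bsub>V\<^esub> v') (h \<bullet>\<^bsub>H\<^esub> h')) = F (tens V H v h) \<bullet>\<^bsub>X\<^esub> F (tens V H v' h')"
  shows "F (s \<bullet>\<^bsub>talg V H\<^esub> t) = F s \<bullet>\<^bsub>X\<^esub> F t"
proof (rule tensor_ext[where t = s, OF H(1) k_algebraD(1)[OF V]])
  note rules = lin_comp[OF F] talg_lin[OF H V] k_algebraD(5)[OF X] k_algebraD(6)[OF X] lin_ident vs_fscl k_algebraD(1)[OF V]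
  show "lin (fscl (scl V)) (scl X) (\<lambda>s. F (s \<bullet>\<^bsub>talg V H\<^esub> t))" "lin (fscl (scl V)) (scl X) (\<lambda>s. F s \<bullet>\<^bsub>X\<^esub> F t)"
    by (intro rules)+
  fix v h
  show "F (tens V H v h \<bullet>\<^bsub>talg V H\<^esub> t) = F (tens V H v h) \<bullet>\<^bsub>X\<^esub> F t"
  proof (rule tensor_ext[where t = t, OF H(1) k_algebraD(1)[OF V]])
    show "lin (fscl (scl V)) (scl X) (\<lambda>t. F (tens V H v h \<bullet>\<^bsub>talg V H\<^esub> t))" "lin (fscl (scl V)) (scl X) (\<lambda>t. F (tens V H v h) \<bullet>\<^bsub>X\<^esub> F t)"
      by (intro rules)+
    show "F (tens V H v h \<bullet>\<^bsub>talg V H\<^esub> tens V H v' h') = F (tens V H v h) \<bullet>\<^bsub>X\<^esub> F (tens V H v' h')" for v' h'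
      by (simp add: talg_pure[OF H V] m)
  qed
qed

locale hopf_twist = hopf_alg E for E :: "('k::field, 'e::ab_group_add, 'i::finite) hopf" +
  fixes J :: "'i \<Rightarrow> 'i \<Rightarrow> 'k"
  assumes twist: "invertible_twist (dual E) J"
begin

abbreviation JD where "JD \<equiv> dual2_to_double2 E J"
abbreviation DD2 where "DD2 \<equiv> talg DD DD"
abbreviation JI where "JI \<equiv> inverse_in DD2 JD"

lemma DD2_alg: "k_algebra DD2" by (rule k_algebra_talg[OF DD_based DD_alg DD_alg])

lemma vs_dual': "vector_space (fscl ((*) :: 'k \<Rightarrow> 'k \<Rightarrow> 'k))" by (rule vs_fscl[OF vs_field])

lemma d2d_lin: "lin (fscl (fscl (*))) (fscl (fscl sE)) (dual2_to_double2 E)"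
proof -
  have "lin s (fscl sE) f \<Longrightarrow> lin s (fscl (fscl sE)) (\<lambda>z. tens DD DD (f z) y)"
    for s :: "'k \<Rightarrow> 'z::ab_group_add \<Rightarrow> 'z" and f y
    using lin_tens_left[of DD s f DD y] by (simp add: vs_DD)
  note t = this
  show ?thesis unfolding dual2_to_double2_def
    by (rule lin_tsum_arg[OF lin_ident[OF vs_fscl[OF vs_dual']] vs_dual']) (intro t dp_lin_right lin_ident vs_dual')
qed

lemma d2d_pure: "dual2_to_double2 E (tens ED ED \<xi> \<eta>) = tens DD DD (dp oE \<xi>) (dp oE \<eta>)"
proof -
  have l: "lin (fscl (*)) (fscl (fscl sE)) (\<lambda>\<xi>. tens DD DD (dp oE \<xi>) y)" "lin (fscl (*)) (fscl (fscl sE)) (\<lambda>\<xi>. tens DD DD y (dp oE \<xi>))" for y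
    using lin_tens_left[of DD "fscl (*)" "\<lambda>\<xi>. dp oE \<xi>" DD y] lin_tens_right[OF DD_based, of DD "fscl (*)" "\<lambda>\<xi>. dp oE \<xi>" y]
      dp_lin_right[OF lin_ident[OF vs_dual']] by (simp_all add: vs_DD)
  show ?thesis unfolding dual2_to_double2_def
    by (rule tsum_tens'[OF dual_based, where t = "fscl (fscl sE)"]) (simp_all add: l)
qed

lemma d2d_mult: "dual2_to_double2 E (s \<bullet>\<^bsub>talg ED ED\<^esub> t) = dual2_to_double2 E s \<bullet>\<^bsub>DD2\<^esub> dual2_to_double2 E t"
  by (rule talg_hom[OF dual_based dual_alg dual_alg DD2_alg])
     (simp_all add: d2d_lin d2d_pure dp_oE_mult[symmetric] talg_pure[OF DD_based DD_alg DD_alg])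

lemma flip_pure: "flip DD (tens DD DD x y) = tens DD DD y x"
  unfolding flip_def
  by (rule tsum_tens'[OF DD_based, where t = "fscl (fscl sE)"])
     (use lin_tens_left[of DD "fscl sE" "\<lambda>x. x" DD] lin_tens_right[OF DD_based, of DD "fscl sE" "\<lambda>x. x"] in \<open>simp_all add: vs_DD lin_ident\<close>)

lemma flip_lin: "lin (fscl (fscl sE)) (fscl (fscl sE)) (flip DD)"
  unfolding flip_def
  by (rule lin_tsum_arg[OF lin_ident[OF vs_fscl[OF vs_DD]] vs_DD])
     (use lin_tens_right[OF DD_based, of DD "fscl sE" "\<lambda>x. x"] in \<open>simp add: vs_DD lin_ident\<close>)

lemma flip_mult: "flip DD (s \<bullet>\<^bsub>DD2\<^esub> t) = flip DD s \<bullet>\<^bsub>DD2\<^esub> flip DD t"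
  by (rule talg_hom[OF DD_based DD_alg DD_alg DD2_alg])
     (simp_all add: flip_lin flip_pure talg_pure[OF DD_based DD_alg DD_alg])

lemma tsum_flip:
  assumes "\<And>y. lin (fscl sE) t (\<lambda>x. \<Theta> x y)" "\<And>x. lin (fscl sE) t (\<lambda>y. \<Theta> x y)"
  shows "tsum DD \<Theta> (flip DD T) = tsum DD (\<lambda>x y. \<Theta> y x) T"
proof -
  have L: "lin (fscl (fscl sE)) t (tsum DD \<Theta>)"
    by (rule lin_tsum_arg[OF lin_ident[OF vs_fscl[OF vs_DD]] vs_DD assms(1)])
  have p: "tsum DD \<Theta> (tens DD DD x y) = \<Theta> x y" for x y
    by (rule tsum_tens'[OF DD_based, where t = t]) (simp_all add: assms)
  show ?thesis by (simp add: flip_def lin_tsum[OF L] p)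
qed

text \<open>\<open>inverse_in\<close> is a description and needs a witness: the inverse of J in the
  tensor square of the dual is carried over by the embedding and by the flip, both of which are
  unital and multiplicative.\<close>

lemma twist_inverses: "JD \<bullet>\<^bsub>DD2\<^esub> JI = \<u>\<^bsub>DD2\<^esub>" "flip DD JD \<bullet>\<^bsub>DD2\<^esub> inverse_in DD2 (flip DD JD) = \<u>\<^bsub>DD2\<^esub>"
proof -
  obtain K where K: "J \<bullet>\<^bsub>talg ED ED\<^esub> K = \<u>\<^bsub>talg ED ED\<^esub>" "K \<bullet>\<^bsub>talg ED ED\<^esub> J = \<u>\<^bsub>talg ED ED\<^esub>"
    using twist by (auto simp: invertible_twist_def is_inverse_def)
  have u: "dual2_to_double2 E \<u>\<^bsub>talg ED ED\<^esub> = \<u>\<^bsub>DD2\<^esub>" by (simp add: d2d_pure)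
  have i: "is_inverse DD2 JD (dual2_to_double2 E K)"
    unfolding is_inverse_def d2d_mult[symmetric] K u by simp
  then have f: "is_inverse DD2 (flip DD JD) (flip DD (dual2_to_double2 E K))"
    unfolding is_inverse_def flip_mult[symmetric] by (simp add: flip_pure)
  show "JD \<bullet>\<^bsub>DD2\<^esub> JI = \<u>\<^bsub>DD2\<^esub>" "flip DD JD \<bullet>\<^bsub>DD2\<^esub> inverse_in DD2 (flip DD JD) = \<u>\<^bsub>DD2\<^esub>"
    using i f inverse_in_unique[OF DD2_alg i] inverse_in_unique[OF DD2_alg f] by (simp_all add: is_inverse_def)
qed

lemma tsum_DD2_mult:
  assumes "\<And>y. lin (fscl sE) t (\<lambda>x. \<Phi> x y)" "\<And>x. lin (fscl sE) t (\<lambda>y. \<Phi> x y)"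
  shows "tsum DD \<Phi> (x \<bullet>\<^bsub>DD2\<^esub> y) = tsum DD (\<lambda>v h. tsum DD (\<lambda>v' h'. \<Phi> (v \<bullet>\<^bsub>DD\<^esub> v') (h \<bullet>\<^bsub>DD\<^esub> h')) y) x"
  by (rule tsum_talg_mult[OF DD_based, where t = t]) (simp_all add: assms)

lemma twist_cop: "cop (twist_bialg DD JD) h = JI \<bullet>\<^bsub>DD2\<^esub> cop DD h \<bullet>\<^bsub>DD2\<^esub> JD"
  by (simp add: twist_bialg_def)

lemma twist_tsum: "tsum (twist_bialg DD JD) = tsum DD"
  by (simp add: tsum_def twist_bialg_def fun_eq_iff)

text \<open>
  The definitions of \<open>\<Delta>\<^sup>J\<close> and \<open>R\<^sup>J\<close> are only used in this form, without inverses.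
\<close>

lemma twist_cop_mult: "JD \<bullet>\<^bsub>DD2\<^esub> cop (twist_bialg DD JD) h = cop DD h \<bullet>\<^bsub>DD2\<^esub> JD"
  unfolding twist_cop by (simp only: k_algebraD(2)[OF DD2_alg, symmetric] twist_inverses k_algebraD(3)[OF DD2_alg])

lemma twist_R_mult: "flip DD JD \<bullet>\<^bsub>DD2\<^esub> twist_R DD JD X = X \<bullet>\<^bsub>DD2\<^esub> JD"
  unfolding twist_R_def by (simp only: k_algebraD(2)[OF DD2_alg, symmetric] twist_inverses k_algebraD(3)[OF DD2_alg])

lemma twist_counit:
  assumes "lin (fscl (*)) t G"
  shows "tsum ED (\<lambda>\<xi> \<eta>. t (ev' \<xi> oE) (G \<eta>)) J = G oED" "tsum ED (\<lambda>\<xi> \<eta>. t (ev' \<eta> oE) (G \<xi>)) J = G oED"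
proof -
  have "tsum ED (\<lambda>x y. fscl (*) (ev' x oE) y) J = oED" "tsum ED (\<lambda>x y. fscl (*) (ev' y oE) x) J = oED"
    using twist by (simp_all add: invertible_twist_def dual_cou)
  then show "tsum ED (\<lambda>\<xi> \<eta>. t (ev' \<xi> oE) (G \<eta>)) J = G oED" "tsum ED (\<lambda>\<xi> \<eta>. t (ev' \<eta> oE) (G \<xi>)) J = G oED"
    using lin_tsum[OF assms, of ED "\<lambda>x y. fscl (*) (ev' x oE) y" J] lin_tsum[OF assms, of ED "\<lambda>x y. fscl (*) (ev' y oE) x" J]
    by (simp_all add: lin_scl[OF assms])
qed

text \<open>The cocycle identity lives in a triple tensor product; pairing it with an arbitrary
  trilinear map gives the shape in which it meets threefold products in B.\<close>

lemma twist_cocycle: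
  assumes 1: "\<And>y z. lin (fscl (*)) t (\<lambda>x. \<Phi> x y z)" and 2: "\<And>x z. lin (fscl (*)) t (\<lambda>y. \<Phi> x y z)"
    and 3: "\<And>x y. lin (fscl (*)) t (\<lambda>z. \<Phi> x y z)"
  shows "tsum ED (\<lambda>\<xi> \<eta>. tsum ED (\<lambda>\<xi>1 \<xi>2. tsum ED (\<lambda>\<mu> \<nu>. \<Phi> (\<xi>1 \<bullet>\<^bsub>ED\<^esub> \<mu>) (\<xi>2 \<bullet>\<^bsub>ED\<^esub> \<nu>) \<eta>) J) (cop ED \<xi>)) J
    = tsum ED (\<lambda>\<xi> \<eta>. tsum ED (\<lambda>\<eta>1 \<eta>2. tsum ED (\<lambda>\<mu> \<nu>. \<Phi> \<xi> (\<eta>1 \<bullet>\<^bsub>ED\<^esub> \<mu>) (\<eta>2 \<bullet>\<^bsub>ED\<^esub> \<nu>)) J) (cop ED \<eta>)) J"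
proof -
  let ?V = "talg ED ED"
  let ?\<Phi>' = "\<lambda>t z. tsum ED (\<lambda>x y. \<Phi> x y z) t"
  let ?\<Psi> = "\<lambda>x y z. tsum ED (\<lambda>x' y'. \<Phi> (x \<bullet>\<^bsub>ED\<^esub> x') (y \<bullet>\<^bsub>ED\<^esub> y') z) J"
  let ?\<Psi>2 = "\<lambda>p q z. tsum ED (\<lambda>x y. \<Phi> p (q \<bullet>\<^bsub>ED\<^esub> x) (z \<bullet>\<^bsub>ED\<^esub> y)) J"
  let ?J23 = "tsum ED (\<lambda>x y. tens ?V ED (tens ED ED oED x) y) J"
  note vs = vs_dual'
  note mlin = k_algebraD(5)[OF dual_alg, simplified] k_algebraD(6)[OF dual_alg, simplified] lin_ident[OF vs]
  note linP = lin_comp[OF 1] lin_comp[OF 2] lin_comp[OF 3] mlin lin_tsum_fun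
  have P1: "lin (fscl (fscl (*))) t (\<lambda>u. ?\<Phi>' u z)" for z
    by (rule lin_tsum_arg[OF lin_ident[OF vs_fscl[OF vs]] vs 1])
  have P2: "lin (fscl (*)) t (\<lambda>z. ?\<Phi>' u z)" for u by (intro linP)
  have V: "k_algebra ?V" by (rule k_algebra_talg[OF dual_based dual_alg dual_alg])
  have mV: "lin (fscl (fscl (*))) t (\<lambda>x. ?\<Phi>' (y \<bullet>\<^bsub>?V\<^esub> x) z)" for y z
    using lin_comp[OF P1 k_algebraD(6)[OF V, simplified, OF lin_ident[OF vs_fscl[OF vs]]]] .
  have e: "?\<Phi>' (s \<bullet>\<^bsub>?V\<^esub> s') z = tsum ED (\<lambda>x y. tsum ED (\<lambda>x' y'. \<Phi> (x \<bullet>\<^bsub>ED\<^esub> x') (y \<bullet>\<^bsub>ED\<^esub> y') z) s') s" for s s' z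
    by (rule tsum_talg_mult[OF dual_based, where t = t]) (simp_all add: 1 2)
  have p: "tsum ED (\<lambda>t' z'. ?\<Phi>' (s \<bullet>\<^bsub>?V\<^esub> t') (z \<bullet>\<^bsub>ED\<^esub> z')) (tens ?V ED s' z') = ?\<Phi>' (s \<bullet>\<^bsub>?V\<^esub> s') (z \<bullet>\<^bsub>ED\<^esub> z')" for s z s' z'
    by (rule tsum_tens'[OF dual_based, where t = t]) (simp add: mV, simp, intro linP)
  have q: "tsum ED (\<lambda>x' y'. \<Phi> (a \<bullet>\<^bsub>ED\<^esub> x') (b \<bullet>\<^bsub>ED\<^esub> y') c) (tens ED ED x y) = \<Phi> (a \<bullet>\<^bsub>ED\<^esub> x) (b \<bullet>\<^bsub>ED\<^esub> y) c" for a b c x y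
    by (rule tsum_tens'[OF dual_based, where t = t]) (simp, intro linP, simp, intro linP)
  have L: "lin (fscl (fscl (fscl (*)))) t (tsum ED (\<lambda>t' z'. ?\<Phi>' (s \<bullet>\<^bsub>?V\<^esub> t') (z \<bullet>\<^bsub>ED\<^esub> z')))" for s z
    by (rule lin_tsum_arg[OF lin_ident[OF vs_fscl[OF vs_fscl[OF vs]]] vs_fscl[OF vs] mV])
  have M: "tsum ED ?\<Phi>' (u \<bullet>\<^bsub>talg ?V ED\<^esub> u') = tsum ED (\<lambda>s z. tsum ED (\<lambda>s' z'. ?\<Phi>' (s \<bullet>\<^bsub>?V\<^esub> s') (z \<bullet>\<^bsub>ED\<^esub> z')) u') u" for u u'
    by (rule tsum_talg_mult[OF dual_based, where t = t]) (simp_all add: P1 P2)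
  have "tsum ED ?\<Phi>' (cop_l ED J \<bullet>\<^bsub>talg ?V ED\<^esub> tens ?V ED J oED) = tsum ED (\<lambda>u z. tsum ED (\<lambda>x y. ?\<Psi> x y z) u) (cop_l ED J)"
    unfolding M unfolding p unfolding e k_algebraD(4)[OF dual_alg] ..
  also have "\<dots> = tsum ED (\<lambda>u z. tsum ED (\<lambda>x y. ?\<Psi> x y z) (cop ED u)) J"
    by (rule tsum_cop_l[OF dual_based, where t = t]) (simp, intro linP)+
  finally have l: "tsum ED ?\<Phi>' (cop_l ED J \<bullet>\<^bsub>talg ?V ED\<^esub> tens ?V ED J oED) = \<dots>" .
  have "tsum ED ?\<Phi>' (cop_r ED J \<bullet>\<^bsub>talg ?V ED\<^esub> ?J23) = tsum ED (\<lambda>u z. tsum ED (\<lambda>x y. tsum ED (\<lambda>p q. \<Phi> (p \<bullet>\<^bsub>ED\<^esub> oED) (q \<bullet>\<^bsub>ED\<^esub> x) (z \<bullet>\<^bsub>ED\<^esub> y)) u) J) (cop_r ED J)"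
    unfolding M unfolding lin_tsum[OF L] unfolding p unfolding e q ..
  also have "\<dots> = tsum ED (\<lambda>u z. tsum ED (\<lambda>p q. ?\<Psi>2 p q z) u) (cop_r ED J)"
    by (simp only: k_algebraD(4)[OF dual_alg]) (rule tsum_cong, rule tsum_swap)
  also have "\<dots> = tsum ED (\<lambda>x u. tsum ED (\<lambda>y z. ?\<Psi>2 x y z) (cop ED u)) J"
    by (rule tsum_cop_r[OF dual_based, where t = t]) (simp, intro linP)+
  finally have r: "tsum ED ?\<Phi>' (cop_r ED J \<bullet>\<^bsub>talg ?V ED\<^esub> ?J23) = \<dots>" .
  have "cop_l ED J \<bullet>\<^bsub>talg ?V ED\<^esub> tens ?V ED J oED = cop_r ED J \<bullet>\<^bsub>talg ?V ED\<^esub> ?J23"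
    using twist by (simp add: invertible_twist_def)
  then show ?thesis using l r by simp
qed

end

section \<open>The untwisted case: the explicit action satisfies all conditions on cochains\<close>

context smash_alg begin

lemma C_mlB: "f \<in> CB n \<Longrightarrow> mlB f" by (simp add: CB_iff)

context
  fixes f n assumes f: "f \<in> CB n"
begin

lemma cochain_act_C: "cochain_act E A act n h f \<in> CB n"
  unfolding cochain_act_eq[OF f] by (rule dact_C[OF f])

lemma cochain_act_add:
  "g \<in> CB n \<Longrightarrow> cochain_act E A act n h (f + g) = cochain_act E A act n h f + cochain_act E A act n h g"
  by (simp only: cochain_act_eq f h.C_add dact_add)

lemma cochain_act_scale: "cochain_act E A act n h (fscl sB c f) = fscl sB c (cochain_act E A act n h f)"
  using h.C_scale[OF f, of c] by (simp only: cochain_act_eq f BB_simps dact_scale)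

lemma cochain_act_add_left: "cochain_act E A act n (h + h') f = cochain_act E A act n h f + cochain_act E A act n h' f"
  unfolding cochain_act_eq[OF f] by (rule dact_add_left[OF C_mlB[OF f]])

lemma cochain_act_scale_left: "cochain_act E A act n (scl DD c h) f = fscl sB c (cochain_act E A act n h f)"
  unfolding cochain_act_eq[OF f] DD_simps by (rule dact_scale_left[OF C_mlB[OF f]])

lemma cochain_act_mult: "cochain_act E A act n (h \<bullet>\<^bsub>DD\<^esub> h') f = cochain_act E A act n h (cochain_act E A act n h' f)"
  unfolding cochain_act_eq[OF f] cochain_act_eq[OF dact_C[OF f]] by (rule HOL.ext) (rule dact_mult[OF C_mlB[OF f]])

lemma cochain_act_one: "cochain_act E A act n \<u>\<^bsub>DD\<^esub> f = f"
  unfolding cochain_act_eq[OF f] DD_simps by (rule HOL.ext) (rule dact_one[OF C_mlB[OF f]])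

lemma d_cochain_act: "h.d n (cochain_act E A act n h f) = cochain_act E A act (Suc n) h (h.d n f)"
  unfolding cochain_act_eq[OF f] cochain_act_eq[OF h.d_C[OF f]] by (rule d_dact[OF f])

end

lemma cochain_act_cunit: "cochain_act E A act 0 h h.cunit = fscl sB (cou DD h) h.cunit"
  unfolding cochain_act_eq[OF h.Z_C[OF h.cunit_Z]] by (rule dact_cunit)

lemma HH_smash_braided: "braided_commutative DD (double_R E) (HH_smash E A act)"
  unfolding HH_smash_def
proof (rule h.HH_braided_commutative, unfold BB_simps(1))
  note cl = cochain_act_eq
  fix m n h f g
  assume f: "f \<in> CB m" and g: "g \<in> CB n"
  show "cochain_act E A act (m + n) h (h.cp m n f g) =
     tsum DD (\<lambda>h1 h2. h.cp m n (cochain_act E A act m h1 f) (cochain_act E A act n h2 g)) (cop DD h)"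
    unfolding cl[OF f] cl[OF g] cl[OF h.cup_C[OF f g]] by (rule dact_cup[OF f g])
next
  fix m n f g
  assume f: "f \<in> h.Z m" and g: "g \<in> h.Z n"
  note cl = cochain_act_eq[OF h.Z_C[OF f]] cochain_act_eq[OF h.Z_C[OF g]]
  show "h.cp m n f g - fscl sB ((- 1) ^ (m * n)) (tsum DD (\<lambda>r r'. h.cp n m (cochain_act E A act n r' g) (cochain_act E A act m r f)) (double_R E)) \<in> h.Bd (m + n)"
    unfolding cl by (rule braid[OF f g])
qed (rule cochain_act_C cochain_act_add cochain_act_scale cochain_act_add_left cochain_act_scale_left cochain_act_mult
    cochain_act_one d_cochain_act cochain_act_cunit; assumption)+

end

section \<open>The twisted smash product and its cohomology\<close>

locale smash_twist = smash_alg E A act + hopf_twist E J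
  for E :: "('k::field, 'e::ab_group_add, 'i::finite) hopf" and A :: "('k, 'a::ab_group_add) kalg"
    and act :: "'e \<Rightarrow> 'a \<Rightarrow> 'a" and J :: "'i \<Rightarrow> 'i \<Rightarrow> 'k"
begin

abbreviation BJ where "BJ \<equiv> twist_alg DD JD (dact_B E A act) BB"

lemma BJ_simps: "scl BJ = sB" "\<u>\<^bsub>BJ\<^esub> = \<u>\<^bsub>BB\<^esub>"
  by (simp_all add: twist_alg_def)

lemma dact_B_dual: "dact_B E A act (dp oE \<xi>) b = hit (ev' \<xi>) b"
  unfolding dact_B_dp by (subst sw_one[where t = sB], (intro linsh)+) (simp add: S_one one_mB mB_one)

lemma BJ_mult: "b \<bullet>\<^bsub>BJ\<^esub> b' = tsum ED (\<lambda>\<xi> \<eta>. hit (ev' \<xi>) b \<odot> hit (ev' \<eta>) b') J"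
proof -
  have "b \<bullet>\<^bsub>BJ\<^esub> b' = tsum DD (\<lambda>x y. dact_B E A act x b \<odot> dact_B E A act y b') JD"
    by (simp add: twist_alg_def)
  also have "\<dots> = tsum ED (\<lambda>\<xi> \<eta>. dact_B E A act (dp oE \<xi>) b \<odot> dact_B E A act (dp oE \<eta>) b') J"
    by (rule tsum_dual2_to_double2[where t = sB]) (intro linsh dact_B_lin lin_ident vs_DD)+
  finally show ?thesis unfolding dact_B_dual .
qed

lemma hit_hit_dual: "hit (ev' \<xi>) (hit (ev' \<mu>) b) = hit (ev' (\<xi> \<bullet>\<^bsub>ED\<^esub> \<mu>)) b"
proof -
  have "ev' (\<xi> \<bullet>\<^bsub>ED\<^esub> \<mu>) = (\<lambda>w. sw (\<lambda>w1 w2. ev' \<xi> w1 * ev' \<mu> w2) w)" by (rule HOL.ext) (rule ev_dual_mult)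
  then show ?thesis by (simp only: hit_hit ev_lin lin_ident)
qed

text \<open>A leg of J acting on the coinvariant algebra A acts by its counit, and normalization of
  J leaves the unit in the other leg. Products with A are therefore untouched by the twist, and so
  is the differential.\<close>

lemma iA_BJ: "iA a \<bullet>\<^bsub>BJ\<^esub> b = iA a \<odot> b" and BJ_iA: "b \<bullet>\<^bsub>BJ\<^esub> iA a = b \<odot> iA a"
proof -
  have "lin (fscl (*)) sB (\<lambda>\<xi>. iA a \<odot> hit (ev' \<xi>) b)" "lin (fscl (*)) sB (\<lambda>\<xi>. hit (ev' \<xi>) b \<odot> iA a)"
    by (intro linsh)+
  note t = twist_counit(1)[OF this(1)] twist_counit(2)[OF this(2)]
  have s: "sB c x \<odot> y = sB c (x \<odot> y)" "y \<odot> sB c x = sB c (y \<odot> x)" for c x y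
    by (rule lin_scl[OF mB_lin(1)[OF lin_ident[OF vsB]]], rule lin_scl[OF mB_lin(2)[OF lin_ident[OF vsB]]])
  show "iA a \<bullet>\<^bsub>BJ\<^esub> b = iA a \<odot> b" "b \<bullet>\<^bsub>BJ\<^esub> iA a = b \<odot> iA a"
    unfolding BJ_mult hit_iA[OF ev_lin] s t hit_oED by (rule refl)+
qed

lemma BJ_alg: "k_algebra BJ"
proof (rule k_algebraI)
  show "lin (scl BJ) (scl BJ) (\<lambda>x. x \<bullet>\<^bsub>BJ\<^esub> y)" "lin (scl BJ) (scl BJ) (\<lambda>x. y \<bullet>\<^bsub>BJ\<^esub> x)" for y
    unfolding BJ_mult BJ_simps by (intro linsh)+
  show "\<u>\<^bsub>BJ\<^esub> \<bullet>\<^bsub>BJ\<^esub> x = x" "x \<bullet>\<^bsub>BJ\<^esub> \<u>\<^bsub>BJ\<^esub> = x" for x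
    unfolding BJ_simps BB_simps iA_BJ BJ_iA one_mB mB_one by (rule refl)+
  fix x y z
  let ?\<Phi> = "\<lambda>\<xi> \<eta> \<zeta>. hit (ev' \<xi>) x \<odot> hit (ev' \<eta>) y \<odot> hit (ev' \<zeta>) z"
  have h: "hit (ev' \<xi>) (tsum ED \<psi> J) = tsum ED (\<lambda>a b. hit (ev' \<xi>) (\<psi> a b)) J" for \<xi> \<psi>
    by (rule lin_tsum[OF hit_lin[OF lin_ident[OF vsB]]])
  have m: "tsum ED \<psi> T \<odot> c = tsum ED (\<lambda>a b. \<psi> a b \<odot> c) T" "c \<odot> tsum ED \<psi> T = tsum ED (\<lambda>a b. c \<odot> \<psi> a b) T" for \<psi> T c
    by (rule lin_tsum[OF mB_lin(1)[OF lin_ident[OF vsB]]], rule lin_tsum[OF mB_lin(2)[OF lin_ident[OF vsB]]])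
  have "x \<bullet>\<^bsub>BJ\<^esub> y \<bullet>\<^bsub>BJ\<^esub> z = tsum ED (\<lambda>\<xi> \<eta>. tsum ED (\<lambda>\<mu> \<nu>. tsum ED (\<lambda>\<xi>1 \<xi>2. ?\<Phi> (\<xi>1 \<bullet>\<^bsub>ED\<^esub> \<mu>) (\<xi>2 \<bullet>\<^bsub>ED\<^esub> \<nu>) \<eta>) (cop ED \<xi>)) J) J"
    unfolding BJ_mult h hit_prod hit_hit_dual m by (rule refl)
  also have "\<dots> = tsum ED (\<lambda>\<xi> \<eta>. tsum ED (\<lambda>\<xi>1 \<xi>2. tsum ED (\<lambda>\<mu> \<nu>. ?\<Phi> (\<xi>1 \<bullet>\<^bsub>ED\<^esub> \<mu>) (\<xi>2 \<bullet>\<^bsub>ED\<^esub> \<nu>) \<eta>) J) (cop ED \<xi>)) J"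
    by (rule tsum_cong, rule tsum_swap)
  \<comment> \<open>Letting \<xi> act on the product of x and y split it by its coproduct, which
    produced the left side of the cocycle identity; its right side is what \<eta> gives on the
    product of y and z.\<close>
  also have "\<dots> = tsum ED (\<lambda>\<xi> \<eta>. tsum ED (\<lambda>\<eta>1 \<eta>2. tsum ED (\<lambda>\<mu> \<nu>. ?\<Phi> \<xi> (\<eta>1 \<bullet>\<^bsub>ED\<^esub> \<mu>) (\<eta>2 \<bullet>\<^bsub>ED\<^esub> \<nu>)) J) (cop ED \<eta>)) J"
    by (rule twist_cocycle[where t = sB]) (intro linsh)+
  also have "\<dots> = tsum ED (\<lambda>\<xi> \<eta>. tsum ED (\<lambda>\<mu> \<nu>. tsum ED (\<lambda>\<eta>1 \<eta>2. ?\<Phi> \<xi> (\<eta>1 \<bullet>\<^bsub>ED\<^esub> \<mu>) (\<eta>2 \<bullet>\<^bsub>ED\<^esub> \<nu>)) (cop ED \<eta>)) J) J"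
    by (rule tsum_cong, rule tsum_swap)
  also have "\<dots> = x \<bullet>\<^bsub>BJ\<^esub> (y \<bullet>\<^bsub>BJ\<^esub> z)"
    unfolding BJ_mult h hit_prod hit_hit_dual m mB_assoc by (rule refl)
  finally show "x \<bullet>\<^bsub>BJ\<^esub> y \<bullet>\<^bsub>BJ\<^esub> z = x \<bullet>\<^bsub>BJ\<^esub> (y \<bullet>\<^bsub>BJ\<^esub> z)" .
qed

lemma cochains_BJ: "cochains A BJ n = CB n" by (simp add: cochains_def BJ_simps)

lemma hoch_diff_BJ: "hoch_diff A BJ (\<lambda>a. iA a) n f = h.d n f"
  unfolding hoch_diff_def iA_BJ BJ_iA BJ_simps BB_simps ..

lemma coboundaries_BJ: "coboundaries A BJ (\<lambda>a. iA a) n = h.Bd n"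
  by (cases n) (simp_all add: hoch_diff_BJ cochains_BJ)

lemma hoch_BJ: "hoch_alg A BJ (\<lambda>a. iA a)"
proof (rule hoch_alg.intro[OF algA BJ_alg])
  show "lin sA (scl BJ) (\<lambda>a. iA a)" unfolding BJ_simps by (intro linsB)
  show "iA (x \<cdot> y) = iA x \<bullet>\<^bsub>BJ\<^esub> iA y" for x y by (simp add: iA_BJ iA_mult)
qed

lemma dact_lin_fscl:
  assumes "mlB f" "lin s (fscl sE) g" shows "lin s (fscl sB) (\<lambda>z. dact (g z) f)"
  by (rule lin_fun[OF _ vsB dact_lin[OF assms]]) (use assms(2) in \<open>simp add: lin_def\<close>)

lemma cup_lin:
  assumes "lin s (fscl sB) g"
  shows "lin s (fscl sB) (\<lambda>z. cup BB m n (g z) c)" "lin s (fscl sB) (\<lambda>z. cup BB m n c (g z))"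
proof -
  have vs: "vector_space s" using assms by (simp add: lin_def)
  have "lin s sB (\<lambda>z. cup BB m n (g z) c xs)" "lin s sB (\<lambda>z. cup BB m n c (g z) xs)" for xs
    by (cases "length xs = m + n"; simp add: cup_def lin_const_zero[OF vs vsB]; intro mB_lin lin_fun_apply[OF vsB assms])+
  then show "lin s (fscl sB) (\<lambda>z. cup BB m n (g z) c)" "lin s (fscl sB) (\<lambda>z. cup BB m n c (g z))"
    by (auto intro!: lin_fun[OF vs vsB])
qed

text \<open>Functionals act on a cochain through its values alone, so twisting the product of two
  values amounts to acting with the legs of J on the two cochains.\<close>

lemma cup_BJ:
  assumes f: "mlB f" and g: "mlB g"
  shows "cup BJ m n f g = tsum DD (\<lambda>x y. cup BB m n (dact x f) (dact y g)) JD"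
proof
  fix xs
  have d: "dact (dp oE \<xi>) f xs = hit (ev' \<xi>) (f xs)" if "mlB f" for \<xi> f xs
    unfolding dact_dp[OF that] by (rule ract_one[OF mlB_hit[OF that]])
  have "tsum DD (\<lambda>x y. cup BB m n (dact x f) (dact y g)) JD = tsum ED (\<lambda>\<xi> \<eta>. cup BB m n (dact (dp oE \<xi>) f) (dact (dp oE \<eta>) g)) J"
    by (rule tsum_dual2_to_double2[where t = "fscl sB"]) (intro cup_lin dact_lin_fscl f g lin_ident vs_DD)+
  moreover have "tsum ED (\<lambda>\<xi> \<eta>. cup BB m n (dact (dp oE \<xi>) f) (dact (dp oE \<eta>) g)) J xs = cup BJ m n f g xs"
    by (rule trans[OF tsum_apply]) (cases "length xs = m + n"; simp only: cup_def if_True if_False BJ_mult d f g tsum_def sum.neutral_const simp_thms)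
  ultimately show "cup BJ m n f g xs = tsum DD (\<lambda>x y. cup BB m n (dact x f) (dact y g)) JD xs" by (simp only:)
qed

lemma dact_Z: assumes f: "f \<in> h.Z n" shows "dact x f \<in> h.Z n"
proof -
  have "dact x 0 = 0" using dact_add[of x 0 0] by simp
  then show ?thesis using d_dact[OF h.Z_C[OF f], of x] dact_C[OF h.Z_C[OF f], of x] h.Z_d[OF f]
    unfolding h.Z_def by simp
qed

text \<open>The element h acts on the legs of J through \<Delta>(h) J, which equals J times the
  twisted coproduct of h. Absorbing J into the product of B_J leaves the twisted coproduct on the
  cochains.\<close>

lemma dact_cup_BJ:
  assumes f: "f \<in> CB m" and g: "g \<in> CB n"
  shows "dact h (cup BJ m n f g) = tsum DD (\<lambda>h1 h2. cup BJ m n (dact h1 f) (dact h2 g)) (cop (twist_bialg DD JD) h)"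
proof -
  let ?\<Phi> = "\<lambda>x y. cup BB m n (dact x f) (dact y g)"
  note ml = C_mlB[OF f] C_mlB[OF g]
  have D: "dact (x \<bullet>\<^bsub>DD\<^esub> y) f = dact x (dact y f)" if "mlB f" for x y f by (rule HOL.ext) (rule dact_mult[OF that])
  have l: "lin (fscl sB) (fscl sB) (\<lambda>f. dact h f)" for h
    unfolding lin_def by (simp only: dact_add dact_scale vs_fscl[OF vsB]) simp
  have 1: "lin (fscl sE) (fscl sB) (\<lambda>x. ?\<Phi> x y)" and 2: "lin (fscl sE) (fscl sB) (\<lambda>y. ?\<Phi> x y)" for x y
    by (intro cup_lin dact_lin_fscl ml lin_ident vs_DD)+
  have "dact h (cup BJ m n f g) = tsum DD (\<lambda>x y. tsum DD (\<lambda>h1 h2. ?\<Phi> (h1 \<bullet>\<^bsub>DD\<^esub> x) (h2 \<bullet>\<^bsub>DD\<^esub> y)) (cop DD h)) JD"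
    unfolding cup_BJ[OF ml] lin_tsum[OF l] dact_cup[OF dact_C[OF f] dact_C[OF g]] D[OF ml(1)] D[OF ml(2)] by (rule refl)
  also have "\<dots> = tsum DD ?\<Phi> (cop DD h \<bullet>\<^bsub>DD2\<^esub> JD)"
    unfolding tsum_DD2_mult[OF 1 2] by (rule tsum_swap)
  also have "\<dots> = tsum DD (\<lambda>h1 h2. tsum DD (\<lambda>x y. ?\<Phi> (x \<bullet>\<^bsub>DD\<^esub> h1) (y \<bullet>\<^bsub>DD\<^esub> h2)) JD) (cop (twist_bialg DD JD) h)"
    unfolding twist_cop_mult[symmetric] tsum_DD2_mult[OF 1 2] by (rule tsum_swap)
  also have "\<dots> = tsum DD (\<lambda>h1 h2. cup BJ m n (dact h1 f) (dact h2 g)) (cop (twist_bialg DD JD) h)"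
    unfolding cup_BJ[OF mlB_dact[OF ml(1)] mlB_dact[OF ml(2)]] D[OF ml(1)] D[OF ml(2)] by (rule refl)
  finally show ?thesis .
qed

lemma braid_BJ:
  assumes f: "f \<in> h.Z m" and g: "g \<in> h.Z n"
  shows "cup BJ m n f g - fscl sB ((- 1) ^ (m * n))
    (tsum DD (\<lambda>r r'. cup BJ n m (dact r' g) (dact r f)) (twist_R DD JD (double_R E))) \<in> h.Bd (m + n)"
proof -
  let ?s = "fscl sB ((- 1) ^ (m * n))" and ?R = "double_R E"
  let ?\<Psi> = "\<lambda>r r'. cup BB n m (dact r' g) (dact r f)"
  let ?b = "\<lambda>x y. tsum DD (\<lambda>r r'. cup BB n m (dact r' (dact y g)) (dact r (dact x f))) ?R"
  note ml = C_mlB[OF h.Z_C[OF f]] C_mlB[OF h.Z_C[OF g]]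
  have D: "dact (x \<bullet>\<^bsub>DD\<^esub> y) f = dact x (dact y f)" if "mlB f" for x y f by (rule HOL.ext) (rule dact_mult[OF that])
  have 1: "lin (fscl sE) (fscl sB) (\<lambda>x. ?\<Psi> x y)" and 2: "lin (fscl sE) (fscl sB) (\<lambda>y. ?\<Psi> x y)" for x y
    by (intro cup_lin dact_lin_fscl ml lin_ident vs_DD)+
  have 3: "lin (fscl sE) (fscl sB) (\<lambda>y. ?\<Psi> (y \<bullet>\<^bsub>DD\<^esub> r) x)" "lin (fscl sE) (fscl sB) (\<lambda>x. ?\<Psi> y (x \<bullet>\<^bsub>DD\<^esub> r))" for r x y
    by (intro cup_lin dact_lin_fscl ml DD_mult_lin lin_ident vs_DD)+
  have "tsum DD (\<lambda>r r'. cup BJ n m (dact r' g) (dact r f)) (twist_R DD JD ?R)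
      = tsum DD (\<lambda>r r'. tsum DD (\<lambda>x y. ?\<Psi> (y \<bullet>\<^bsub>DD\<^esub> r) (x \<bullet>\<^bsub>DD\<^esub> r')) JD) (twist_R DD JD ?R)"
    unfolding cup_BJ[OF mlB_dact[OF ml(2)] mlB_dact[OF ml(1)]] D[OF ml(1)] D[OF ml(2)] by (rule refl)
  \<comment> \<open>In the braided product g stands in front, so the first leg of J falls on g and
    the second on f, whereas the first leg of R acts on f. Flipping J aligns the legs.\<close>
  also have "\<dots> = tsum DD (\<lambda>r r'. tsum DD (\<lambda>y x. ?\<Psi> (y \<bullet>\<^bsub>DD\<^esub> r) (x \<bullet>\<^bsub>DD\<^esub> r')) (flip DD JD)) (twist_R DD JD ?R)"
    by (rule tsum_cong, rule tsum_flip[where t = "fscl sB", symmetric]) (rule 3)+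
  also have "\<dots> = tsum DD ?\<Psi> (flip DD JD \<bullet>\<^bsub>DD2\<^esub> twist_R DD JD ?R)"
    unfolding tsum_DD2_mult[OF 1 2] by (rule tsum_swap)
  also have "\<dots> = tsum DD ?b JD"
    unfolding twist_R_mult tsum_DD2_mult[OF 1 2] D[OF ml(1)] D[OF ml(2)] by (rule tsum_swap)
  finally have "cup BJ m n f g - ?s (tsum DD (\<lambda>r r'. cup BJ n m (dact r' g) (dact r f)) (twist_R DD JD ?R))
     = tsum DD (\<lambda>x y. cup BB m n (dact x f) (dact y g)) JD - ?s (tsum DD ?b JD)"
    by (simp only: cup_BJ[OF ml])
  also have "\<dots> = tsum DD (\<lambda>x y. cup BB m n (dact x f) (dact y g) - ?s (?b x y)) JD"
    by (simp only: tsum_scale[OF vs_fscl[OF vsB], symmetric]) (simp only: tsum_def sum_subtractf)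
  \<comment> \<open>For every basis term of J both cochains are still cocycles, the untwisted
    relation applies to them, and coboundaries are closed under sums.\<close>
  also have "\<dots> \<in> h.Bd (m + n)"
    unfolding tsum_def[of DD _ JD] by (rule h.Bd_sum) (rule braid[OF dact_Z[OF f] dact_Z[OF g]])
  finally show ?thesis .
qed

lemma HH_twisted_smash_braided:
  "braided_commutative (twist_bialg DD JD) (twist_R DD JD (double_R E)) (HH_twisted_smash E A act J)"
proof -
  interpret j: hoch_alg A BJ "\<lambda>a. iA a" by (rule hoch_BJ)
  have Z: "j.Z n = h.Z n" for n by (simp add: j.Z_def h.Z_def cochains_BJ hoch_diff_BJ)
  have u: "j.cunit = h.cunit" unfolding j.cunit_def h.cunit_def BJ_simps ..
  have b: "scl (twist_bialg DD JD) = scl DD" "mul (twist_bialg DD JD) = mul DD" "\<u>\<^bsub>twist_bialg DD JD\<^esub> = \<u>\<^bsub>DD\<^esub>" "cou (twist_bialg DD JD) = cou DD"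
    by (simp_all add: twist_bialg_def)
  show ?thesis unfolding HH_twisted_smash_def
  proof (rule j.HH_braided_commutative, unfold BJ_simps cochains_BJ hoch_diff_BJ coboundaries_BJ Z u b twist_tsum)
    fix m n h f g
    assume f: "f \<in> CB m" and g: "g \<in> CB n"
    have "cup BJ m n f g \<in> CB (m + n)" using j.cup_C[of f m g n] f g by (simp add: cochains_BJ)
    note cl = cochain_act_eq[OF this] cochain_act_eq[OF f] cochain_act_eq[OF g]
    show "cochain_act E A act (m + n) h (cup BJ m n f g) =
      tsum DD (\<lambda>h1 h2. cup BJ m n (cochain_act E A act m h1 f) (cochain_act E A act n h2 g)) (cop (twist_bialg DD JD) h)"
      unfolding cl by (rule dact_cup_BJ[OF f g])
  next
    fix m n f g
    assume f: "f \<in> h.Z m" and g: "g \<in> h.Z n"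
    note cl = cochain_act_eq[OF h.Z_C[OF f]] cochain_act_eq[OF h.Z_C[OF g]]
    show "cup BJ m n f g - fscl sB ((- 1) ^ (m * n)) (tsum DD (\<lambda>r r'. cup BJ n m (cochain_act E A act n r' g) (cochain_act E A act m r f)) (twist_R DD JD (double_R E))) \<in> h.Bd (m + n)"
      unfolding cl by (rule braid_BJ[OF f g])
  qed (rule cochain_act_C cochain_act_add cochain_act_scale cochain_act_add_left cochain_act_scale_left cochain_act_mult
    cochain_act_one d_cochain_act cochain_act_cunit; assumption)+
qed

end

theorem corollary5p13:
  fixes E :: "('k::field, 'e::ab_group_add, 'i::finite) hopf"
    and A :: "('k, 'a::ab_group_add) kalg"
    and act :: "'e \<Rightarrow> 'a \<Rightarrow> 'a"
  assumes "hopf_algebra E" and "module_algebra E A act"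
  shows "braided_commutative (double E) (double_R E) (HH_smash E A act) \<and>
    (\<forall>J. invertible_twist (dual E) J \<longrightarrow>
       braided_commutative
         (twist_bialg (double E) (dual2_to_double2 E J))
         (twist_R (double E) (dual2_to_double2 E J) (double_R E))
         (HH_twisted_smash E A act J))"
proof (intro conjI allI impI)
  interpret smash_alg E A act by unfold_locales (use assms in auto)
  show "braided_commutative (double E) (double_R E) (HH_smash E A act)" by (rule HH_smash_braided)
  fix J
  assume "invertible_twist (dual E) J"
  then interpret smash_twist E A act J by unfold_locales
  show "braided_commutative (twist_bialg (double E) (dual2_to_double2 E J))
      (twist_R (double E) (dual2_to_double2 E J) (double_R E)) (HH_twisted_smash E A act J)"
    by (rule HH_twisted_smash_braided)
qed

end
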